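(* Let $u\in L^2_a(\mu,H)$, define $$L=\exp\left(\int_0^1(R_s(X)\dot{u}_s,dB_s)-\tfrac12\int_0^1|R_s(X)\dot{u}_s|^2ds\right)$$ and assume that $E_\mu[L]=1$. Then $$E_\mu[L\mid\mathcal F_1(X)]=1$$ $\mu$-almost surely. In particular, if $u$ is $\mathcal F_1(X)$-measurable, then $$E\left[\exp\left(\int_0^1(R_s(X)\dot{u}_s,dB_s)\right)\Big|\,\mathcal F_1(X)\right]=\exp\left(\tfrac12\int_0^1|R_s(X)\dot{u}_s|^2ds\right),$$ hence under the conditional probability $\mu^X$ defined by $\mu^X(\cdot)=\mu(\cdot\mid\mathcal F_1(X))$, the random variable $\int_0^1(R_s(X)\dot{u}_s,dB_s)$ is Gaussian with mean zero and variance $|\mathbb R(X)u|_H^2$. In particular, the process $$N_t=\int_0^tR_s(X)\,dB_s$$ is an additive (i.e. with independent increments) Gaussian martingale under the conditional probability $\mu^X$.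
   Context: $B=(B_t)_{t\in[0,1]}$ is an $\mathbb R^d$-valued Brownian motion under the probability $\mu$, and $H=\{h=\int_0^\cdot\dot h(s)ds:\dot h\in L^2([0,1],\mathbb R^d)\}$ with $|h|_H=\|\dot h\|_{L^2}$. $X=(X_t)_{t\in[0,1]}$ is an $\mathbb R^n$-valued solution of the (not necessarily Markovian) stochastic differential equation $dX_t=b(t,X)dt+\sigma(t,X)dB_t$, $X_0=x$, where $\sigma:[0,1]\times C([0,1],\mathbb R^n)\to L(\mathbb R^d,\mathbb R^n)$ and $b:[0,1]\times C([0,1],\mathbb R^n)\to\mathbb R^n$ are measurable, adapted to the natural filtration of $C([0,1],\mathbb R^n)$ and of linear growth, and weak uniqueness holds for the equation. $(\mathcal F_t(X))$ is the filtration of $X$. $P_s(X)$ is a measurable version of the orthogonal projection from $\mathbb R^d$ onto $\sigma(s,X)^\star(\mathbb R^n)$, $R_s(X)=I_{\mathbb R^d}-P_s(X)$, and $(\mathbb R(X)h)(t)=\int_0^tR_s(X)\dot h(s)ds$. $L^2_a(\mu,H)$ is the space of square-integrable $H$-valued $u=\int_0^\cdot\dot u_sds$ with $\dot u$ adapted to the Brownian filtration. *)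

theory Defs
  imports "HOL-Probability.Probability"
begin

text \<open>
  Time runs through \<open>{0..1}\<close>. Processes are indexed by \<^typ>\<open>real\<close>, and only their values on
  \<open>{0..1}\<close> matter. Linear maps between Euclidean spaces are matrices.
\<close>

section \<open>Path space and natural filtrations\<close>

text \<open>
  \<open>C([0,1])\<close>, realised by functions that are \<open>undefined\<close> outside \<open>{0..1}\<close>. Its cylinder
  \<open>\<sigma>\<close>-algebra is the Borel \<open>\<sigma>\<close>-algebra of the uniform norm.
\<close>

definition path_space :: "(real \<Rightarrow> 'e::topological_space) measure" where
  "path_space = restrict_space (\<Pi>\<^sub>M t\<in>{0..1}. borel) {w. continuous_on {0..1} w}"

definition path_of :: "(real \<Rightarrow> 'a \<Rightarrow> 'e) \<Rightarrow> 'a \<Rightarrow> real \<Rightarrow> 'e" where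
  "path_of X \<omega> = (\<lambda>t\<in>{0..1}. X t \<omega>)"

definition natural_filtration ::
    "'a measure \<Rightarrow> (real \<Rightarrow> 'a \<Rightarrow> 'e::topological_space) \<Rightarrow> real \<Rightarrow> 'a measure" where
  "natural_filtration M X t =
     vimage_algebra (space M) (\<lambda>\<omega>. \<lambda>s\<in>{0..t}. X s \<omega>) (\<Pi>\<^sub>M s\<in>{0..t}. borel)"

definition path_filtration :: "real \<Rightarrow> (real \<Rightarrow> 'e::topological_space) measure" where
  "path_filtration = natural_filtration path_space (\<lambda>s w. w s)"

definition filtration_of :: "'a measure \<Rightarrow> (real \<Rightarrow> 'a measure) \<Rightarrow> bool" where
  "filtration_of M F \<longleftrightarrow> filtration (space M) F \<and> (\<forall>t. sets (F t) \<subseteq> sets M)"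

definition augmented :: "'a measure \<Rightarrow> (real \<Rightarrow> 'a measure) \<Rightarrow> real \<Rightarrow> 'a measure" where
  "augmented M F t = sigma (space M) (sets (F t) \<union> null_sets M)"

section \<open>Brownian motion\<close>

definition brownian_motion ::
    "'a measure \<Rightarrow> (real \<Rightarrow> 'a measure) \<Rightarrow> (real \<Rightarrow> 'a \<Rightarrow> real^'d) \<Rightarrow> bool" where
  "brownian_motion M F B \<longleftrightarrow>
     prob_space M \<and> filtration_of M F \<and>
     (\<forall>t\<in>{0..1}. B t \<in> borel_measurable (F t)) \<and>
     (AE \<omega> in M. B 0 \<omega> = 0) \<and>
     (AE \<omega> in M. continuous_on {0..1} (\<lambda>t. B t \<omega>)) \<and>
     (\<forall>s t. 0 \<le> s \<and> s < t \<and> t \<le> 1 \<longrightarrow>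
        prob_space.indep_set M (sets (F s))
          {(\<lambda>\<omega>. B t \<omega> - B s \<omega>) -` A \<inter> space M | A. A \<in> sets borel} \<and>
        distr M borel (\<lambda>\<omega>. B t \<omega> - B s \<omega>) =
          density lborel (\<lambda>y. ennreal (\<Prod>i\<in>UNIV. normal_density 0 (sqrt (t - s)) (y $ i))))"

section \<open>Stochastic integrals\<close>

text \<open>
  A simple process is \<open>\<Sum>i<k. \<xi> i \<cdot> 1\<^bsub>(\<tau> i, \<tau> (i+1)]\<^esub>\<close> with \<open>\<xi> i\<close> bounded and \<open>F (\<tau> i)\<close>-measurable.
\<close>

definition simple_process ::
    "'a measure \<Rightarrow> (real \<Rightarrow> 'a measure) \<Rightarrow> nat \<Rightarrow> (nat \<Rightarrow> real) \<Rightarrow> (nat \<Rightarrow> 'a \<Rightarrow> real^'d) \<Rightarrow> bool" where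
  "simple_process M F k \<tau> \<xi> \<longleftrightarrow>
     (\<forall>i<k. 0 \<le> \<tau> i \<and> \<tau> i \<le> \<tau> (Suc i) \<and> \<tau> (Suc i) \<le> 1 \<and>
        \<xi> i \<in> borel_measurable (F (\<tau> i)) \<and> bounded (\<xi> i ` space M))"

definition simple_value ::
    "nat \<Rightarrow> (nat \<Rightarrow> real) \<Rightarrow> (nat \<Rightarrow> 'a \<Rightarrow> real^'d) \<Rightarrow> real \<Rightarrow> 'a \<Rightarrow> real^'d" where
  "simple_value k \<tau> \<xi> s \<omega> = (\<Sum>i<k. indicator {\<tau> i<..\<tau> (Suc i)} s *\<^sub>R \<xi> i \<omega>)"

definition simple_integral ::
    "(real \<Rightarrow> 'a \<Rightarrow> real^'d) \<Rightarrow> nat \<Rightarrow> (nat \<Rightarrow> real) \<Rightarrow> (nat \<Rightarrow> 'a \<Rightarrow> real^'d) \<Rightarrow> real \<Rightarrow> 'a \<Rightarrow> real" where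
  "simple_integral B k \<tau> \<xi> t \<omega> =
     (\<Sum>i<k. \<xi> i \<omega> \<bullet> (B (min (\<tau> (Suc i)) t) \<omega> - B (min (\<tau> i) t) \<omega>))"

definition null_in_prob :: "'a measure \<Rightarrow> (nat \<Rightarrow> 'a \<Rightarrow> ennreal) \<Rightarrow> bool" where
  "null_in_prob M D \<longleftrightarrow>
     (\<forall>\<epsilon>>0. (\<lambda>n. measure M {\<omega> \<in> space M. ennreal \<epsilon> < D n \<omega>}) \<longlonglongrightarrow> 0)"

text \<open>
  \<open>ito_integral M F B H Z\<close>: the process \<open>Z\<close> is a continuous version of \<open>\<integral>\<^sub>0\<^sup>t (H\<^sub>s, dB\<^sub>s)\<close>. It is
  determined up to indistinguishability. No adaptedness of \<open>H\<close> is required separately: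
  approximability by simple processes forces \<open>H\<close> to agree \<open>ds \<times> dM\<close>-a.e. with an adapted process,
  and forces \<open>\<integral>\<^sub>0\<^sup>1 |H\<^sub>s|\<^sup>2 ds < \<infinity>\<close> almost surely.
\<close>

definition ito_integral ::
    "'a measure \<Rightarrow> (real \<Rightarrow> 'a measure) \<Rightarrow> (real \<Rightarrow> 'a \<Rightarrow> real^'d) \<Rightarrow>
     (real \<Rightarrow> 'a \<Rightarrow> real^'d) \<Rightarrow> (real \<Rightarrow> 'a \<Rightarrow> real) \<Rightarrow> bool" where
  "ito_integral M F B H Z \<longleftrightarrow>
     (\<lambda>(s, \<omega>). H s \<omega>) \<in> borel_measurable (restrict_space borel {0..1} \<Otimes>\<^sub>M M) \<and>
     (\<forall>t\<in>{0..1}. Z t \<in> borel_measurable M) \<and>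
     (\<forall>\<omega>\<in>space M. continuous_on {0..1} (\<lambda>t. Z t \<omega>)) \<and>
     (\<exists>k \<tau> \<xi>.
        (\<forall>n. simple_process M F (k n) (\<tau> n) (\<xi> n)) \<and>
        null_in_prob M (\<lambda>n \<omega>. \<integral>\<^sup>+s\<in>{0..1}.
          ennreal ((norm (simple_value (k n) (\<tau> n) (\<xi> n) s \<omega> - H s \<omega>))\<^sup>2) \<partial>lborel) \<and>
        (\<forall>t\<in>{0..1}. null_in_prob M
          (\<lambda>n \<omega>. ennreal \<bar>simple_integral B (k n) (\<tau> n) (\<xi> n) t \<omega> - Z t \<omega>\<bar>)))"

definition ito_integral_matrix ::
    "'a measure \<Rightarrow> (real \<Rightarrow> 'a measure) \<Rightarrow> (real \<Rightarrow> 'a \<Rightarrow> real^'d) \<Rightarrow>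
     (real \<Rightarrow> 'a \<Rightarrow> real^'d^'m) \<Rightarrow> (real \<Rightarrow> 'a \<Rightarrow> real^'m) \<Rightarrow> bool" where
  "ito_integral_matrix M F B H Z \<longleftrightarrow>
     (\<forall>i. ito_integral M F B (\<lambda>s \<omega>. H s \<omega> $ i) (\<lambda>t \<omega>. Z t \<omega> $ i))"

section \<open>The stochastic differential equation\<close>

definition sde_coefficients ::
    "(real \<Rightarrow> (real \<Rightarrow> real^'n) \<Rightarrow> real^'n) \<Rightarrow> (real \<Rightarrow> (real \<Rightarrow> real^'n) \<Rightarrow> real^'d^'n) \<Rightarrow> bool" where
  "sde_coefficients b \<sigma> \<longleftrightarrow>
     (\<lambda>(t, w). b t w) \<in> borel_measurable (restrict_space borel {0..1} \<Otimes>\<^sub>M path_space) \<and>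
     (\<lambda>(t, w). \<sigma> t w) \<in> borel_measurable (restrict_space borel {0..1} \<Otimes>\<^sub>M path_space) \<and>
     (\<forall>t\<in>{0..1}. b t \<in> borel_measurable (path_filtration t) \<and>
                \<sigma> t \<in> borel_measurable (path_filtration t)) \<and>
     (\<exists>K. \<forall>t\<in>{0..1}. \<forall>w\<in>space path_space.
        norm (b t w) + norm (\<sigma> t w) \<le> K * (1 + (SUP s\<in>{0..t}. norm (w s))))"

definition sde_solution ::
    "'a measure \<Rightarrow> (real \<Rightarrow> 'a measure) \<Rightarrow> (real \<Rightarrow> 'a \<Rightarrow> real^'d) \<Rightarrow> (real \<Rightarrow> 'a \<Rightarrow> real^'n) \<Rightarrow>
     real^'n \<Rightarrow> (real \<Rightarrow> (real \<Rightarrow> real^'n) \<Rightarrow> real^'n) \<Rightarrow>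
     (real \<Rightarrow> (real \<Rightarrow> real^'n) \<Rightarrow> real^'d^'n) \<Rightarrow> bool" where
  "sde_solution M F B X x b \<sigma> \<longleftrightarrow>
     brownian_motion M F B \<and>
     (\<forall>t\<in>{0..1}. X t \<in> borel_measurable (F t)) \<and>
     (\<forall>\<omega>\<in>space M. continuous_on {0..1} (\<lambda>t. X t \<omega>)) \<and>
     (AE \<omega> in M. X 0 \<omega> = x) \<and>
     (\<exists>Z. ito_integral_matrix M F B (\<lambda>s \<omega>. \<sigma> s (path_of X \<omega>)) Z \<and>
        (\<forall>t\<in>{0..1}. AE \<omega> in M.
           X t \<omega> = x + (LINT s:{0..t}|lborel. b s (path_of X \<omega>)) + Z t \<omega>))"

text \<open>
  Uniqueness in law. Solutions range over all measures, filtrations and Brownian motions on the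
  type \<^typ>\<open>'a\<close>; HOL cannot quantify over the type itself. As the law of \<open>(B, X)\<close> lives
  on a space of cardinality \<open>2\<^bsup>\<aleph>\<^sub>0\<^esup>\<close>, every solution has a copy, with the same law of \<open>X\<close>, on any type
  of at least that cardinality. In any case the condition is implied by uniqueness among
  solutions on arbitrary probability spaces.
\<close>

definition weak_uniqueness ::
    "'a itself \<Rightarrow> real^'n \<Rightarrow> (real \<Rightarrow> (real \<Rightarrow> real^'n) \<Rightarrow> real^'n) \<Rightarrow>
     (real \<Rightarrow> (real \<Rightarrow> real^'n) \<Rightarrow> real^'d^'n) \<Rightarrow> bool" where
  "weak_uniqueness (_ :: 'a itself) x b \<sigma> \<longleftrightarrow>
     (\<forall>(M1 :: 'a measure) F1 B1 X1 (M2 :: 'a measure) F2 B2 X2.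
        sde_solution M1 F1 B1 X1 x b \<sigma> \<and> sde_solution M2 F2 B2 X2 x b \<sigma> \<longrightarrow>
        distr M1 path_space (path_of X1) = distr M2 path_space (path_of X2))"

section \<open>Projections and Cameron--Martin space\<close>

definition is_orthogonal_projection :: "(real^'d) set \<Rightarrow> real^'d^'d \<Rightarrow> bool" where
  "is_orthogonal_projection S Q \<longleftrightarrow>
     (\<forall>v. Q *v v \<in> S \<and> (\<forall>w\<in>S. orthogonal (v - Q *v v) w))"

definition projection_version ::
    "'a measure \<Rightarrow> (real \<Rightarrow> 'a \<Rightarrow> real^'n) \<Rightarrow> (real \<Rightarrow> (real \<Rightarrow> real^'n) \<Rightarrow> real^'d^'n) \<Rightarrow>
     (real \<Rightarrow> (real \<Rightarrow> real^'n) \<Rightarrow> real^'d^'d) \<Rightarrow> bool" where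
  "projection_version M X \<sigma> P \<longleftrightarrow>
     (\<lambda>(s, w). P s w) \<in> borel_measurable (restrict_space borel {0..1} \<Otimes>\<^sub>M path_space) \<and>
     (AE \<omega> in M. AE s in lborel. s \<in> {0..1} \<longrightarrow>
        is_orthogonal_projection
          (range (\<lambda>y. transpose (\<sigma> s (path_of X \<omega>)) *v y)) (P s (path_of X \<omega>)))"

definition coprojection ::
    "(real \<Rightarrow> (real \<Rightarrow> real^'n) \<Rightarrow> real^'d^'d) \<Rightarrow> (real \<Rightarrow> 'a \<Rightarrow> real^'n) \<Rightarrow>
     real \<Rightarrow> 'a \<Rightarrow> real^'d^'d" where
  "coprojection P X s \<omega> = mat 1 - P s (path_of X \<omega>)"

text \<open>
  An element \<open>h\<close> of the Cameron--Martin space \<open>H\<close> is represented by its density; the path itself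
  and \<open>|h|\<^sub>H\<^sup>2\<close> are recovered as follows.
\<close>

definition cm_path :: "(real \<Rightarrow> real^'d) \<Rightarrow> real \<Rightarrow> real^'d" where
  "cm_path h' t = (LINT s:{0..t}|lborel. h' s)"

definition cm_norm_sq :: "(real \<Rightarrow> real^'d) \<Rightarrow> real" where
  "cm_norm_sq h' = (LINT s:{0..1}|lborel. (norm (h' s))\<^sup>2)"

definition L2_adapted ::
    "'a measure \<Rightarrow> (real \<Rightarrow> 'a measure) \<Rightarrow> (real \<Rightarrow> 'a \<Rightarrow> real^'d) \<Rightarrow> bool" where
  "L2_adapted M F u' \<longleftrightarrow>
     (\<lambda>(s, \<omega>). u' s \<omega>) \<in> borel_measurable (restrict_space borel {0..1} \<Otimes>\<^sub>M M) \<and>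
     (\<forall>s\<in>{0..1}. u' s \<in> borel_measurable (F s)) \<and>
     (\<integral>\<^sup>+\<omega>. (\<integral>\<^sup>+s\<in>{0..1}. ennreal ((norm (u' s \<omega>))\<^sup>2) \<partial>lborel) \<partial>M) < \<infinity>"

text \<open>
  Measurability of the \<open>H\<close>-valued random variable \<open>u\<close>, an almost-sure equivalence class, with
  respect to \<open>G\<close>. The Borel \<open>\<sigma>\<close>-algebra of the separable space \<open>H\<close> is generated by the evaluations.
\<close>

definition cm_measurable :: "'a measure \<Rightarrow> 'a measure \<Rightarrow> (real \<Rightarrow> 'a \<Rightarrow> real^'d) \<Rightarrow> bool" where
  "cm_measurable M G u' \<longleftrightarrow>
     (\<forall>t\<in>{0..1}. \<exists>v\<in>borel_measurable G. AE \<omega> in M. cm_path (\<lambda>s. u' s \<omega>) t = v \<omega>)"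

section \<open>Conditional probability given a sub-\<open>\<sigma>\<close>-algebra\<close>

text \<open>
  Notions under the conditional probability \<open>\<mu>(\<cdot> | G)\<close> are the usual ones, with probabilities and
  expectations replaced by conditional ones, identities holding almost surely.
\<close>

definition cond_prob_of :: "'a measure \<Rightarrow> 'a measure \<Rightarrow> 'a set \<Rightarrow> 'a \<Rightarrow> real" where
  "cond_prob_of M G A = real_cond_exp M G (indicator A)"

text \<open>The normal law with mean \<open>m\<close> and variance \<open>v \<ge> 0\<close>, a point mass if \<open>v = 0\<close>.\<close>

definition gaussian_law :: "real \<Rightarrow> real \<Rightarrow> real measure" where
  "gaussian_law m v =
     distr (density lborel (\<lambda>y. ennreal (std_normal_density y))) borel (\<lambda>y. m + sqrt v * y)"

definition cond_gaussian ::
    "'a measure \<Rightarrow> 'a measure \<Rightarrow> ('a \<Rightarrow> real) \<Rightarrow> ('a \<Rightarrow> real) \<Rightarrow> ('a \<Rightarrow> real) \<Rightarrow> bool" where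
  "cond_gaussian M G Y m v \<longleftrightarrow>
     (AE \<omega> in M. 0 \<le> v \<omega>) \<and>
     (\<forall>A\<in>sets borel. AE \<omega> in M.
        cond_prob_of M G (Y -` A \<inter> space M) \<omega> = measure (gaussian_law (m \<omega>) (v \<omega>)) A)"

definition cond_gaussian_process ::
    "'a measure \<Rightarrow> 'a measure \<Rightarrow> (real \<Rightarrow> 'a \<Rightarrow> real^'d) \<Rightarrow> bool" where
  "cond_gaussian_process M G N \<longleftrightarrow>
     (\<forall>(k::nat) t a. (\<forall>j<k. t j \<in> {0..1}) \<longrightarrow>
        (\<exists>m\<in>borel_measurable G. \<exists>v\<in>borel_measurable G.
           cond_gaussian M G (\<lambda>\<omega>. \<Sum>j<k. a j \<bullet> N (t j) \<omega>) m v))"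

definition cond_indep_increments ::
    "'a measure \<Rightarrow> 'a measure \<Rightarrow> (real \<Rightarrow> 'a \<Rightarrow> real^'d) \<Rightarrow> bool" where
  "cond_indep_increments M G N \<longleftrightarrow>
     (\<forall>(k::nat) t A.
        (\<forall>i\<le>k. t i \<in> {0..1}) \<and> (\<forall>i<k. t i \<le> t (Suc i) \<and> A i \<in> sets borel) \<longrightarrow>
        (AE \<omega> in M.
           cond_prob_of M G {\<omega> \<in> space M. \<forall>i<k. N (t (Suc i)) \<omega> - N (t i) \<omega> \<in> A i} \<omega> =
           (\<Prod>i<k. cond_prob_of M G {\<omega> \<in> space M. N (t (Suc i)) \<omega> - N (t i) \<omega> \<in> A i} \<omega>)))"

definition cond_martingale ::
    "'a measure \<Rightarrow> 'a measure \<Rightarrow> (real \<Rightarrow> 'a measure) \<Rightarrow> (real \<Rightarrow> 'a \<Rightarrow> real^'d) \<Rightarrow> bool" where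
  "cond_martingale M G F N \<longleftrightarrow>
     (\<forall>t\<in>{0..1}. N t \<in> borel_measurable (F t)) \<and>
     (\<forall>t\<in>{0..1}. AE \<omega> in M. nn_cond_exp M G (\<lambda>\<omega>. ennreal (norm (N t \<omega>))) \<omega> < \<infinity>) \<and>
     (\<forall>s t A i. 0 \<le> s \<and> s \<le> t \<and> t \<le> 1 \<and> A \<in> sets (F s) \<longrightarrow>
        (AE \<omega> in M. real_cond_exp M G (\<lambda>\<omega>. indicator A \<omega> * N t \<omega> $ i) \<omega> =
                   real_cond_exp M G (\<lambda>\<omega>. indicator A \<omega> * N s \<omega> $ i) \<omega>))"

end

theory Submission
  imports Defs "HOL-Complex_Analysis.Conformal_Mappings"
begin

text \<open>
  Write \<open>H = R u\<close>. Under the measure with density \<open>L\<close> the process \<open>B - \<integral>H ds\<close> is a Brownian motion, and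
  since \<open>\<sigma> R = 0\<close> it drives the same equation with the same solution \<open>X\<close>. Weak uniqueness shows that
  the change of measure leaves the law of \<open>X\<close> unchanged, which says that \<open>E[L | F\<^sub>1(X)] = 1\<close>.
  For step processes Girsanov's theorem is an explicit Gaussian computation; it passes to the limit
  because densities of mean one that converge in probability converge in mean.

  If \<open>u\<close> is bounded and \<open>F\<^sub>1(X)\<close>-measurable, the conditional exponential moments of the integral of
  \<open>\<lambda> R u\<close> are thus those of a Gaussian variable for every real \<open>\<lambda>\<close>, and analytic continuation to
  imaginary \<open>\<lambda>\<close> gives the conditional characteristic function; truncation removes the boundedness.
  Replacing \<open>u\<close> by \<open>1\<^sub>A 1\<^bsub>(s,t]\<^esub> u\<close> with \<open>A \<in> F\<^sub>s\<close> shows that increments of \<open>N\<close> are conditionally independent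
  of the past.
\<close>

text \<open>The stochastic integral is given only as a limit in probability of integrals of simple
  processes, so the exponential takes over the role of the Ito isometry: step exponentials have mean
  one, Fatou's lemma bounds the mean of their limits by one, and Chebyshev's inequality turns this
  into convergence in probability of integrals whose integrands converge in mean square. The
  assumption \<open>E[L] = 1\<close> concerns \<open>u\<close> alone, while the Gaussian law needs
  the exponential of \<open>r R u\<close> for every real \<open>r\<close>. This is why boundedness
  is imposed first: a bounded integrand has exponential mean one for all its multiples. Radial
  truncation multiplies by scalars and so stays in the kernel of \<open>\<sigma>\<close>. Limits of
  adapted variables are controlled only up to null sets, hence the work takes place in the augmented
  filtration. Measurability of \<open>u\<close> as a random element of \<open>H\<close> says nothing
  about single times, so a density jointly measurable in time and in \<open>X\<close> has to be
  produced before \<open>|R u|^2\<close> can serve as a weight measurable for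
  \<open>X\<close>.\<close>

lemma borel_measurable_cis [measurable (raw)]:
  "f \<in> borel_measurable M \<Longrightarrow> (\<lambda>x. cis (f x)) \<in> borel_measurable M"
  unfolding cis_conv_exp by measurable

lemma integrable_mult_bounded:
  fixes f :: "'a \<Rightarrow> 'b::{real_normed_algebra, banach, second_countable_topology}"
  assumes "integrable M f" "g \<in> borel_measurable M" "\<And>x. x \<in> space M \<Longrightarrow> norm (g x) \<le> K"
  shows "integrable M (\<lambda>x. f x * g x)" "integrable M (\<lambda>x. g x * f x)"
proof -
  have *: "norm (f x) * norm (g x) \<le> norm (K *\<^sub>R f x)" if "x \<in> space M" for x
  proof -
    have "norm (f x) * norm (g x) \<le> norm (f x) * \<bar>K\<bar>"
      using assms(3)[OF that] by (intro mult_left_mono) auto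
    then show ?thesis by (simp add: mult.commute)
  qed
  have *: "norm (f x * g x) \<le> norm (K *\<^sub>R f x)" "norm (g x * f x) \<le> norm (K *\<^sub>R f x)" if "x \<in> space M" for x
    using *[OF that] norm_mult_ineq[of "f x" "g x"] norm_mult_ineq[of "g x" "f x"] by (auto simp: mult.commute)
  have i: "integrable M (\<lambda>x. K *\<^sub>R f x)" using assms(1) by simp
  show "integrable M (\<lambda>x. f x * g x)" "integrable M (\<lambda>x. g x * f x)"
    using assms(2) borel_measurable_integrable[OF assms(1)] *
    by (auto intro!: Bochner_Integration.integrable_bound[OF i] AE_I2 simp del: norm_scaleR)
qed

lemma integrable_mult_cis:
  fixes w :: "'a \<Rightarrow> real"
  assumes "integrable M w" "f \<in> borel_measurable M"
  shows "integrable M (\<lambda>x. of_real (w x) * cis (f x))"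
  by (rule integrable_mult_bounded(1)[where K=1]) (use assms in auto)

section \<open>Characteristic functions of finite measures\<close>

lemma char_eq_cis: "char M t = (\<integral>x. cis (t * x) \<partial>M)"
  by (simp add: char_def cis_conv_exp)

text \<open>Levy's uniqueness theorem speaks of probability laws. The value at \<open>t = 0\<close>
  shows that both measures have the same mass \<open>m\<close>, so both are divided by
  \<open>m\<close>, compared, and multiplied by \<open>m\<close> again; mass zero is treated
  separately.\<close>

lemma measure_eqI_char_real:
  fixes \<mu> \<nu> :: "real measure"
  assumes "finite_measure \<mu>" "finite_measure \<nu>"
    and [measurable_cong, simp]: "sets \<mu> = sets borel" "sets \<nu> = sets borel"
    and eq: "\<And>t. (\<integral>y. cis (t * y) \<partial>\<mu>) = (\<integral>y. cis (t * y) \<partial>\<nu>)"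
  shows "\<mu> = \<nu>"
proof -
  interpret \<mu>: finite_measure \<mu> by fact
  interpret \<nu>: finite_measure \<nu> by fact
  have sp: "space \<mu> = UNIV" "space \<nu> = UNIV"
    using sets_eq_imp_space_eq[of \<mu> borel] sets_eq_imp_space_eq[of \<nu> borel] by auto
  define m where "m = measure \<mu> UNIV"
  have m': "measure \<nu> UNIV = m" using eq[of 0] by (simp add: m_def sp)
  show ?thesis
  proof (cases "m = 0")
    case True
    have "emeasure \<mu> A = 0" "emeasure \<nu> A = 0" for A
      using True m' emeasure_space[of \<mu> A] emeasure_space[of \<nu> A]
      by (auto simp: \<mu>.emeasure_eq_measure \<nu>.emeasure_eq_measure sp m_def)
    then show ?thesis by (intro measure_eqI) auto
  next
    case False
    then have mpos: "m > 0" using zero_less_measure_iff m_def by fastforce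
    have d: "real_distribution (density \<kappa> (\<lambda>_. ennreal (1/m)))"
      if "finite_measure \<kappa>" "sets \<kappa> = sets borel" "measure \<kappa> UNIV = m" for \<kappa>
    proof -
      interpret \<kappa>: finite_measure \<kappa> by fact
      have sp: "space \<kappa> = UNIV" using sets_eq_imp_space_eq[OF that(2)] by simp
      have "prob_space (density \<kappa> (\<lambda>_. ennreal (1/m)))"
        using mpos that
        by (intro prob_spaceI) (simp add: emeasure_density \<kappa>.emeasure_eq_measure sp
              ennreal_mult[symmetric])
      then show ?thesis
        using that by (simp add: real_distribution_def real_distribution_axioms_def)
    qed
    have "density \<mu> (\<lambda>_. ennreal (1/m)) = density \<nu> (\<lambda>_. ennreal (1/m))"
    proof (rule Levy_uniqueness)
      show "char (density \<mu> (\<lambda>_. ennreal (1 / m))) = char (density \<nu> (\<lambda>_. ennreal (1 / m)))"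
        using mpos by (auto simp: char_eq_cis fun_eq_iff integral_density eq)
    qed (use d assms m' m_def in auto)
    then have "density (density \<mu> (\<lambda>_. ennreal (1/m))) (\<lambda>_. ennreal m) =
        density (density \<nu> (\<lambda>_. ennreal (1/m))) (\<lambda>_. ennreal m)" by simp
    then show ?thesis
      using mpos by (simp add: density_density_eq ennreal_mult[symmetric] density_1)
  qed
qed

lemma finite_measure_distr_density:
  assumes "integrable N v" "\<And>x. x \<in> space N \<Longrightarrow> 0 \<le> v x" "Z \<in> borel_measurable N"
  shows "finite_measure (distr (density N (\<lambda>x. ennreal (v x))) borel Z)"
proof -
  have [measurable]: "v \<in> borel_measurable N" "Z \<in> borel_measurable N" using assms by auto
  have "(\<integral>\<^sup>+x. ennreal (v x) \<partial>N) < \<infinity>"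
    using assms by (auto simp: nn_integral_eq_integral)
  then show ?thesis
    by (intro finite_measureI) (auto simp: emeasure_distr emeasure_density cong: nn_integral_cong)
qed

text \<open>The uniqueness principle is kept as a hypothesis because it is instantiated in two ways:
  by the real case inside the proof for Euclidean spaces, and afterwards by the Euclidean
  case.\<close>

lemma weighted_distr_eqI:
  fixes Y :: "'a \<Rightarrow> 'c::euclidean_space" and Y' :: "'b \<Rightarrow> 'c"
  assumes uniq: "\<And>\<mu> \<nu> :: 'c measure. finite_measure \<mu> \<Longrightarrow> finite_measure \<nu> \<Longrightarrow> sets \<mu> = sets borel \<Longrightarrow>
      sets \<nu> = sets borel \<Longrightarrow> (\<And>l. (\<integral>y. cis (l \<bullet> y) \<partial>\<mu>) = (\<integral>y. cis (l \<bullet> y) \<partial>\<nu>)) \<Longrightarrow> \<mu> = \<nu>"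
    and w: "integrable M w" "\<And>x. x \<in> space M \<Longrightarrow> 0 \<le> w x"
    and w': "integrable M' w'" "\<And>x. x \<in> space M' \<Longrightarrow> 0 \<le> w' x"
    and Y [measurable]: "Y \<in> borel_measurable M" "Y' \<in> borel_measurable M'"
    and eq: "\<And>l. (\<integral>x. of_real (w x) * cis (l \<bullet> Y x) \<partial>M) = (\<integral>x. of_real (w' x) * cis (l \<bullet> Y' x) \<partial>M')"
  shows "distr (density M (\<lambda>x. ennreal (w x))) borel Y = distr (density M' (\<lambda>x. ennreal (w' x))) borel Y'"
proof (rule uniq)
  have [measurable]: "w \<in> borel_measurable M" "w' \<in> borel_measurable M'" using w w' by auto
  show "finite_measure (distr (density M (\<lambda>x. ennreal (w x))) borel Y)" "finite_measure (distr (density M' w') borel Y')"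
    using w w' Y by (auto intro!: finite_measure_distr_density)
  show "(\<integral>y. cis (l \<bullet> y) \<partial>distr (density M (\<lambda>x. ennreal (w x))) borel Y) = (\<integral>y. cis (l \<bullet> y) \<partial>distr (density M' w') borel Y')" for l
    using w w' eq[of l] by (simp add: integral_distr integral_density scaleR_conv_of_real)
qed auto

lemma integral_eqI_distr_density:
  fixes f :: "'c::topological_space \<Rightarrow> real"
  assumes "distr (density M (\<lambda>x. ennreal (w x))) borel Y = distr (density M' (\<lambda>x. ennreal (w' x))) borel Y'"
    and w: "integrable M w" "\<And>x. x \<in> space M \<Longrightarrow> 0 \<le> w x"
    and w': "integrable M' w'" "\<And>x. x \<in> space M' \<Longrightarrow> 0 \<le> w' x"
    and [measurable]: "Y \<in> borel_measurable M" "Y' \<in> borel_measurable M'" "f \<in> borel_measurable borel"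
  shows "(\<integral>x. w x * f (Y x) \<partial>M) = (\<integral>x. w' x * f (Y' x) \<partial>M')"
proof -
  have [measurable]: "w \<in> borel_measurable M" "w' \<in> borel_measurable M'" using w w' by auto
  have "(\<integral>x. w x * f (Y x) \<partial>M) = (\<integral>y. f y \<partial>distr (density M (\<lambda>x. ennreal (w x))) borel Y)"
    using w by (subst integral_distr) (simp_all add: integral_density)
  also have "\<dots> = (\<integral>x. w' x * f (Y' x) \<partial>M')"
    unfolding assms(1) using w' by (subst integral_distr) (simp_all add: integral_density)
  finally show ?thesis .
qed

text \<open>
  Coordinates are treated one at a time by the real case. The nonnegative weights \<open>1\<close>,
  \<open>1 + cos (l \<bullet> y)\<close> and \<open>1 + sin (l \<bullet> y)\<close> span the exponentials in the remaining coordinates.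
\<close>

lemma measure_eqI_char:
  fixes \<mu> \<nu> :: "'c::euclidean_space measure"
  assumes "finite_measure \<mu>" "finite_measure \<nu>"
    and [measurable_cong, simp]: "sets \<mu> = sets borel" "sets \<nu> = sets borel"
    and eq: "\<And>l. (\<integral>y. cis (l \<bullet> y) \<partial>\<mu>) = (\<integral>y. cis (l \<bullet> y) \<partial>\<nu>)"
  shows "\<mu> = \<nu>"
proof -
  interpret \<mu>: finite_measure \<mu> by fact
  interpret \<nu>: finite_measure \<nu> by fact
  have sp: "space \<mu> = UNIV" "space \<nu> = UNIV"
    using sets_eq_imp_space_eq[of \<mu> borel] sets_eq_imp_space_eq[of \<nu> borel] by auto
  \<comment> \<open>Coordinates in \<open>J\<close> are confined to the sets \<open>C j\<close>, the
    others are still tested by exponentials. \<open>J = {}\<close> is the hypothesis;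
    \<open>J = Basis\<close> with frequency 0 measures a box.\<close>
  define ind :: "'c set \<Rightarrow> ('c \<Rightarrow> real set) \<Rightarrow> 'c \<Rightarrow> real"
    where "ind J C y = (\<Prod>j\<in>J. indicator (C j) (y \<bullet> j))" for J C y
  have ind01: "0 \<le> ind J C y" "ind J C y \<le> 1" for J C y
    unfolding ind_def by (auto intro!: prod_nonneg prod_le_1)
  have ind_abs: "\<bar>ind J C y\<bar> \<le> 1" for J C y using ind01[of J C y] by simp
  have main: "(\<integral>y. of_real (ind J C y) * cis (l \<bullet> y) \<partial>\<mu>) = (\<integral>y. of_real (ind J C y) * cis (l \<bullet> y) \<partial>\<nu>)"
    if "J \<subseteq> Basis" "\<And>j. j \<in> J \<Longrightarrow> C j \<in> sets borel" for J C l
    using finite_subset[OF that(1) finite_Basis] that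
  proof (induction J arbitrary: l rule: finite_induct)
    case empty
    show ?case using eq by (simp add: ind_def)
  next
    case (insert i J)
    then have IH: "(\<integral>y. of_real (ind J C y) * cis (l \<bullet> y) \<partial>\<mu>) = (\<integral>y. of_real (ind J C y) * cis (l \<bullet> y) \<partial>\<nu>)" for l
      by auto
    have [measurable]: "ind J C \<in> borel_measurable borel"
      unfolding ind_def using insert.prems by (intro borel_measurable_prod) auto
    have [measurable]: "C i \<in> sets borel" using insert.prems by auto
    note b = \<mu>.integrable_const_bound[where B=1] \<nu>.integrable_const_bound[where B=1]
    \<comment> \<open>The real case applies along the single coordinate
      \<open>y \<bullet> i\<close>, with a nonnegative weight that may depend on all of
      \<open>y\<close>. The bound 2 is that of \<open>1 + cos\<close> and makes \<open>w\<close>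
      integrable.\<close>
    have step: "(\<integral>y. w y * indicator (C i) (y \<bullet> i) \<partial>\<mu>) = (\<integral>y. w y * indicator (C i) (y \<bullet> i) \<partial>\<nu>)"
      if [measurable]: "w \<in> borel_measurable borel" and w: "\<And>y. 0 \<le> w y" "\<And>y. w y \<le> 2"
        and e: "\<And>t. (\<integral>y. of_real (w y) * cis (t * (y \<bullet> i)) \<partial>\<mu>) = (\<integral>y. of_real (w y) * cis (t * (y \<bullet> i)) \<partial>\<nu>)" for w
    proof (rule integral_eqI_distr_density[where f="indicator (C i)" and Y="\<lambda>y. y \<bullet> i" and Y'="\<lambda>y. y \<bullet> i"])
      show iw: "integrable \<mu> w" "integrable \<nu> w"
        using w by (auto intro!: \<mu>.integrable_const_bound[where B=2] \<nu>.integrable_const_bound[where B=2])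
      show "distr (density \<mu> (\<lambda>x. ennreal (w x))) borel (\<lambda>y. y \<bullet> i) =
            distr (density \<nu> (\<lambda>x. ennreal (w x))) borel (\<lambda>y. y \<bullet> i)"
        using iw w e by (intro weighted_distr_eqI measure_eqI_char_real) auto
    qed (use w in auto)
    have icis: "integrable \<mu> (\<lambda>y. of_real (ind J C y) * cis (l \<bullet> y))" "integrable \<nu> (\<lambda>y. of_real (ind J C y) * cis (l \<bullet> y))" for l
      using ind01 by (auto intro!: b simp: norm_mult)
    have [measurable]: "ind (insert i J) C \<in> borel_measurable borel"
      unfolding ind_def using insert.prems by (intro borel_measurable_prod) auto
    have iI: "integrable \<mu> (\<lambda>y. complex_of_real (ind (insert i J) C y) * cis (l \<bullet> y))"
         "integrable \<nu> (\<lambda>y. complex_of_real (ind (insert i J) C y) * cis (l \<bullet> y))"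
      using ind01 by (auto intro!: b simp: norm_mult)
    have w0: "(\<integral>y. ind J C y * indicator (C i) (y \<bullet> i) \<partial>\<mu>) = (\<integral>y. ind J C y * indicator (C i) (y \<bullet> i) \<partial>\<nu>)"
    proof (rule step)
      fix t
      have *: "t * (y \<bullet> i) = (t *\<^sub>R i) \<bullet> y" for y by (simp add: inner_commute)
      show "(\<integral>y. of_real (ind J C y) * cis (t * (y \<bullet> i)) \<partial>\<mu>) = (\<integral>y. of_real (ind J C y) * cis (t * (y \<bullet> i)) \<partial>\<nu>)"
        unfolding * by (rule IH)
    qed (auto intro: ind01 order_trans[OF ind01(2)])
    have lin: "(\<integral>y. of_real (ind J C y) * cis (l1 \<bullet> y) + k * (of_real (ind J C y) * cis (l2 \<bullet> y)) +
           k' * (of_real (ind J C y) * cis (l3 \<bullet> y)) \<partial>\<mu>) =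
         (\<integral>y. of_real (ind J C y) * cis (l1 \<bullet> y) + k * (of_real (ind J C y) * cis (l2 \<bullet> y)) +
           k' * (of_real (ind J C y) * cis (l3 \<bullet> y)) \<partial>\<nu>)" for l1 l2 l3 k k'
      by (simp add: icis IH)
    \<comment> \<open>The phase \<open>c\<close> covers the cosine (\<open>c = 0\<close>) and the
      sine (\<open>c = - pi/2\<close>) together. Written by exponentials, the weight splits into
      three terms to which the induction hypothesis applies.\<close>
    have trig: "(\<integral>y. ind J C y * (1 + cos (l \<bullet> y + c)) * indicator (C i) (y \<bullet> i) \<partial>\<mu>) =
                (\<integral>y. ind J C y * (1 + cos (l \<bullet> y + c)) * indicator (C i) (y \<bullet> i) \<partial>\<nu>)" for c
    proof (rule step)
      fix t
      have *: "of_real (ind J C y * (1 + cos (l \<bullet> y + c))) * cis (t * (y \<bullet> i)) =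
         of_real (ind J C y) * cis ((t *\<^sub>R i) \<bullet> y) +
         cis c / 2 * (of_real (ind J C y) * cis ((t *\<^sub>R i + l) \<bullet> y)) +
         cis (- c) / 2 * (of_real (ind J C y) * cis ((t *\<^sub>R i - l) \<bullet> y))" for y
      proof -
        have h1: "complex_of_real (cos (l \<bullet> y + c)) = (cis c * cis (l \<bullet> y) + cis (-c) * cis (-(l \<bullet> y))) / 2"
          by (simp add: cis_mult complex_eq_iff algebra_simps cos_add sin_add cos_diff sin_diff)
        have h2: "cis ((t *\<^sub>R i + l) \<bullet> y) = cis (t * (y \<bullet> i)) * cis (l \<bullet> y)"
                 "cis ((t *\<^sub>R i - l) \<bullet> y) = cis (t * (y \<bullet> i)) * cis (-(l \<bullet> y))"
                 "cis ((t *\<^sub>R i) \<bullet> y) = cis (t * (y \<bullet> i))"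
          by (simp_all add: cis_mult inner_add_left inner_diff_left inner_commute[of i y])
        show ?thesis unfolding of_real_mult of_real_add h1 h2 by (simp add: algebra_simps add_divide_distrib)
      qed
      show "(\<integral>y. of_real (ind J C y * (1 + cos (l \<bullet> y + c))) * cis (t * (y \<bullet> i)) \<partial>\<mu>) =
            (\<integral>y. of_real (ind J C y * (1 + cos (l \<bullet> y + c))) * cis (t * (y \<bullet> i)) \<partial>\<nu>)"
        unfolding * by (rule lin)
    next
      fix y
      have "0 \<le> 1 + cos (l \<bullet> y + c)" "1 + cos (l \<bullet> y + c) \<le> 2"
        using cos_ge_minus_one[of "l \<bullet> y + c"] cos_le_one[of "l \<bullet> y + c"] by linarith+
      then show "0 \<le> ind J C y * (1 + cos (l \<bullet> y + c))" "ind J C y * (1 + cos (l \<bullet> y + c)) \<le> 2"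
        using ind01[of J C y] mult_mono[of "ind J C y" 1 "1 + cos (l \<bullet> y + c)" 2] by auto
    qed auto
    \<comment> \<open>Subtracting \<open>w0\<close> removes the constant 1 that made the weight
      nonnegative.\<close>
    have cosE: "(\<integral>y. ind (insert i J) C y * cos (l \<bullet> y + c) \<partial>\<mu>) = (\<integral>y. ind (insert i J) C y * cos (l \<bullet> y + c) \<partial>\<nu>)" for c
    proof -
      have r: "ind J C y * (1 + cos (l \<bullet> y + c)) * indicator (C i) (y \<bullet> i) =
         ind (insert i J) C y * cos (l \<bullet> y + c) + ind J C y * indicator (C i) (y \<bullet> i)" for y
        using insert.hyps by (simp add: ind_def algebra_simps)
      have abs1: "\<bar>x * z\<bar> \<le> 1" if "0 \<le> x" "x \<le> 1" "\<bar>z\<bar> \<le> 1" for x z :: real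
        using that by (simp add: abs_mult mult_le_one)
      have i1: "integrable \<mu> (\<lambda>y. ind (insert i J) C y * cos (l \<bullet> y + c))" "integrable \<nu> (\<lambda>y. ind (insert i J) C y * cos (l \<bullet> y + c))"
        by (auto intro!: b AE_I2 abs1 ind01 simp: indicator_def ind_abs)
      have i2: "integrable \<mu> (\<lambda>y. ind J C y * indicator (C i) (y \<bullet> i))" "integrable \<nu> (\<lambda>y. ind J C y * indicator (C i) (y \<bullet> i))"
        by (auto intro!: b AE_I2 abs1 ind01 simp: indicator_def ind_abs)
      show ?thesis
        using trig[of c] w0 unfolding r by (simp add: i1 i2)
    qed
    have ce: "(\<integral>y. of_real (ind (insert i J) C y) * cis (l \<bullet> y) \<partial>\<kappa>) =
        Complex (\<integral>y. ind (insert i J) C y * cos (l \<bullet> y + 0) \<partial>\<kappa>) (\<integral>y. ind (insert i J) C y * cos (l \<bullet> y + (- pi/2)) \<partial>\<kappa>)"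
      if "integrable \<kappa> (\<lambda>y. of_real (ind (insert i J) C y) * cis (l \<bullet> y))" for \<kappa>
    proof -
      have "(\<integral>y. ind (insert i J) C y * cos (l \<bullet> y + (- pi/2)) \<partial>\<kappa>) = (\<integral>y. ind (insert i J) C y * sin (l \<bullet> y) \<partial>\<kappa>)"
        by (simp add: cos_diff)
      then show ?thesis
        using integral_Re[OF that] integral_Im[OF that] by (simp add: complex_eq_iff)
    qed
    show ?case unfolding ce[OF iI(1)] ce[OF iI(2)] cosE ..
  qed
  let ?E = "range (\<lambda>(a, b). box a b::'c set)"
  show ?thesis
  proof (rule measure_eqI_generator_eq)
    show "Int_stable ?E" by (auto simp: Int_stable_def box_Int_box)
    show "?E \<subseteq> Pow UNIV" "sets \<mu> = sigma_sets UNIV ?E" "sets \<nu> = sigma_sets UNIV ?E"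
      by (simp_all add: borel_eq_box)
    let ?A = "\<lambda>n::nat. box (- (real n *\<^sub>R One)) (real n *\<^sub>R One) :: 'c set"
    show "range ?A \<subseteq> ?E" "(\<Union>i. ?A i) = UNIV" unfolding UN_box_eq_UNIV by auto
    show "emeasure \<mu> (?A i) \<noteq> \<infinity>" for i by auto
    fix X assume "X \<in> ?E"
    then obtain a b where X: "X = box a b" by auto
    have e: "ind Basis (\<lambda>i. {a \<bullet> i<..<b \<bullet> i}) y = indicator X y" for y
      unfolding ind_def X by (auto simp: indicator_def box_def prod.If_cases Ball_def intro!: prod.neutral)
    have "(\<integral>y. complex_of_real (indicator X y) \<partial>\<mu>) = (\<integral>y. complex_of_real (indicator X y) \<partial>\<nu>)"
      using main[of Basis "\<lambda>i. {a \<bullet> i<..<b \<bullet> i}" 0] by (simp add: e)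
    then have "measure \<mu> X = measure \<nu> X" by (simp add: X sp)
    then show "emeasure \<mu> X = emeasure \<nu> X" by (simp add: \<mu>.emeasure_eq_measure \<nu>.emeasure_eq_measure)
  qed
qed

text \<open>The tool by which laws are identified below. The weight carries a density or the
  indicator of a conditioning event, so tilted and conditional laws are compared through Fourier
  transforms, without regular conditional distributions.\<close>

lemma integral_eqI_char:
  fixes Y :: "'a \<Rightarrow> 'c::euclidean_space" and Y' :: "'b \<Rightarrow> 'c" and f :: "'c \<Rightarrow> real"
  assumes w: "integrable M w" "\<And>x. x \<in> space M \<Longrightarrow> 0 \<le> w x"
    and w': "integrable M' w'" "\<And>x. x \<in> space M' \<Longrightarrow> 0 \<le> w' x"
    and Y: "Y \<in> borel_measurable M" "Y' \<in> borel_measurable M'" and f: "f \<in> borel_measurable borel"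
    and eq: "\<And>l. (\<integral>x. of_real (w x) * cis (l \<bullet> Y x) \<partial>M) = (\<integral>x. of_real (w' x) * cis (l \<bullet> Y' x) \<partial>M')"
  shows "(\<integral>x. w x * f (Y x) \<partial>M) = (\<integral>x. w' x * f (Y' x) \<partial>M')"
  by (rule integral_eqI_distr_density[OF weighted_distr_eqI[OF measure_eqI_char]]) (use assms in auto)

section \<open>Gaussian vectors\<close>

definition gauss :: "real \<Rightarrow> (real^'d) measure" where
  "gauss \<delta> = density lborel (\<lambda>y. ennreal (\<Prod>i\<in>UNIV. normal_density 0 (sqrt \<delta>) (y $ i)))"

lemma sets_gauss [measurable_cong, simp]: "sets (gauss \<delta>) = sets borel"
  and space_gauss [simp]: "space (gauss \<delta>) = UNIV"
  by (auto simp: gauss_def)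

lemma lborel_prod_integral:
  fixes f :: "'c::euclidean_space \<Rightarrow> real \<Rightarrow> complex"
  assumes "\<And>b. b \<in> Basis \<Longrightarrow> integrable lborel (f b)"
  shows "integrable lborel (\<lambda>y. \<Prod>b\<in>Basis. f b (y \<bullet> b))"
    and "(\<integral>y. (\<Prod>b\<in>Basis. f b (y \<bullet> b)) \<partial>lborel) = (\<Prod>b\<in>Basis. \<integral>u. f b u \<partial>lborel)"
proof -
  interpret product_sigma_finite "\<lambda>_::'c. lborel :: real measure" by standard
  have [measurable]: "f b \<in> borel_measurable borel" if "b \<in> Basis" for b
    using borel_measurable_integrable[OF assms[OF that]] by simp
  have m: "(\<lambda>y. \<Prod>b\<in>Basis. f b (y \<bullet> b)) \<in> borel_measurable borel" by measurable
  have c: "(\<Prod>b\<in>Basis. f b ((\<Sum>b\<in>Basis. g b *\<^sub>R b) \<bullet> b)) = (\<Prod>b\<in>Basis. f b (g b))" for g :: "'c \<Rightarrow> real"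
    by (intro prod.cong refl) simp
  show "integrable lborel (\<lambda>y. \<Prod>b\<in>Basis. f b (y \<bullet> b))"
    unfolding lborel_eq[where 'a='c] using m product_integrable_prod[OF finite_Basis, of f] assms
    by (subst integrable_distr_eq) (simp_all add: c)
  show "(\<integral>y. (\<Prod>b\<in>Basis. f b (y \<bullet> b)) \<partial>lborel) = (\<Prod>b\<in>Basis. \<integral>u. f b u \<partial>lborel)"
    unfolding lborel_eq[where 'a='c] using m product_integral_prod[OF finite_Basis, of f] assms
    by (subst integral_distr) (simp_all add: c)
qed

lemma bij_axis_Basis: "bij_betw (\<lambda>i. axis i (1::real)) (UNIV :: 'd::finite set) Basis"
  by (auto simp: bij_betw_def inj_on_def axis_eq_axis Basis_vec_def)

lemma lborel_vec_prod_integral: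
  fixes f :: "'d::finite \<Rightarrow> real \<Rightarrow> complex"
  assumes "\<And>i. integrable lborel (f i)"
  shows "integrable lborel (\<lambda>y::real^'d. \<Prod>i\<in>UNIV. f i (y $ i))"
    and "(LINT y::real^'d|lborel. (\<Prod>i\<in>UNIV. f i (y $ i))) = (\<Prod>i\<in>UNIV. \<integral>u. f i u \<partial>lborel)"
proof -
  define h where "h b = f (inv_into UNIV (\<lambda>i. axis i (1::real)) b)" for b :: "real^'d"
  have h: "h (axis i 1) = f i" for i
    by (simp add: h_def inv_into_f_f[OF bij_betw_imp_inj_on[OF bij_axis_Basis]])
  have ih: "integrable lborel (h b)" for b using assms by (simp add: h_def)
  have e: "(\<Prod>b\<in>Basis. h b (y \<bullet> b)) = (\<Prod>i\<in>UNIV. f i (y $ i))" for y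
    by (subst prod.reindex_bij_betw[OF bij_axis_Basis, symmetric]) (simp add: h inner_axis)
  have e2: "(\<Prod>b\<in>Basis. \<integral>u. h b u \<partial>lborel) = (\<Prod>i\<in>UNIV. \<integral>u. f i u \<partial>lborel)"
    by (subst prod.reindex_bij_betw[OF bij_axis_Basis, symmetric]) (simp add: h)
  show "integrable lborel (\<lambda>y::real^'d. \<Prod>i\<in>UNIV. f i (y $ i))"
    using lborel_prod_integral(1)[of h, OF ih] by (simp add: e)
  show "(LINT y::real^'d|lborel. (\<Prod>i\<in>UNIV. f i (y $ i))) = (\<Prod>i\<in>UNIV. \<integral>u. f i u \<partial>lborel)"
    using lborel_prod_integral(2)[of h, OF ih] by (simp add: e e2)
qed

text \<open>Completing the square: the factor \<open>exp (c * u - c\<^sup>2 * \<delta> / 2)\<close>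
  moves the mean from 0 to \<open>c * \<delta>\<close>, and the phase
  \<open>- \<delta> * (l * c)\<close> centres the variable again. What remains is the characteristic
  function of a centred normal variable of variance \<open>\<delta>\<close>.\<close>

lemma normal_tilt_1d:
  fixes \<delta> c l :: real
  assumes "\<delta> > 0"
  defines "f \<equiv> \<lambda>u. complex_of_real (normal_density 0 (sqrt \<delta>) u * exp (c * u - c\<^sup>2 * \<delta> / 2)) * cis (l * u - \<delta> * (l * c))"
  shows "integrable lborel f" "(\<integral>u. f u \<partial>lborel) = of_real (exp (- (l\<^sup>2 * \<delta> / 2)))"
proof -
  have f: "f u = of_real (normal_density (c * \<delta>) (sqrt \<delta>) u) * cis (l * (u - c * \<delta>))" for u
  proof -
    have "-(u - 0)\<^sup>2 / (2 * \<delta>) + (c * u - c\<^sup>2 * \<delta> / 2) = -(u - c * \<delta>)\<^sup>2 / (2 * \<delta>)"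
      using assms(1) by (simp add: field_simps power2_eq_square)
    then have "exp (-(u - c * \<delta>)\<^sup>2 / (2 * \<delta>)) = exp (-(u - 0)\<^sup>2 / (2 * \<delta>)) * exp (c * u - c\<^sup>2 * \<delta> / 2)"
      by (metis exp_add)
    then have p1: "normal_density 0 (sqrt \<delta>) u * exp (c * u - c\<^sup>2 * \<delta> / 2) = normal_density (c * \<delta>) (sqrt \<delta>) u"
      using assms(1) by (simp add: normal_density_def)
    have p2: "l * u - \<delta> * (l * c) = l * (u - c * \<delta>)" by (simp add: algebra_simps)
    show ?thesis unfolding f_def p1 p2 ..
  qed
  have "integrable lborel (normal_density (c * \<delta>) (sqrt \<delta>))"
    using assms(1) by (intro integrable_normal_density) simp
  then show "integrable lborel f"
    unfolding f[abs_def] by (rule integrable_mult_cis) simp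
  have g: "sqrt \<delta> * normal_density (c * \<delta>) (sqrt \<delta>) (c * \<delta> + sqrt \<delta> * x) = std_normal_density x" for x
    using assms(1) by (simp add: normal_density_def real_sqrt_mult power_mult_distrib)
  have fx: "of_real (sqrt \<delta>) * f (c * \<delta> + sqrt \<delta> * x) = of_real (std_normal_density x) * cis ((l * sqrt \<delta>) * x)" for x
    unfolding f g[symmetric] of_real_mult by (simp add: mult.assoc)
  have "(\<integral>u. f u \<partial>lborel) = of_real (sqrt \<delta>) * (\<integral>x. f (c * \<delta> + sqrt \<delta> * x) \<partial>lborel)"
    using assms(1) by (subst lborel_integral_real_affine[where c="sqrt \<delta>" and t="c * \<delta>"])
      (simp_all add: scaleR_conv_of_real)
  also have "\<dots> = (\<integral>x. of_real (std_normal_density x) * cis ((l * sqrt \<delta>) * x) \<partial>lborel)"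
    unfolding fx[symmetric] by (rule integral_mult_right_zero[symmetric])
  also have "\<dots> = char std_normal_distribution (l * sqrt \<delta>)"
    by (simp add: char_eq_cis integral_density scaleR_conv_of_real)
  also have "\<dots> = of_real (exp (- (l\<^sup>2 * \<delta> / 2)))"
    using assms(1) by (simp add: char_std_normal_distribution power_mult_distrib)
  finally show "(\<integral>u. f u \<partial>lborel) = of_real (exp (- (l\<^sup>2 * \<delta> / 2)))" .
qed

section \<open>Exponential tilting of Gaussian increments\<close>

text \<open>One time step of length \<open>\<delta>\<close>: the Girsanov density for the drift
  \<open>\<xi>\<close>, times the Fourier exponential of the increment corrected by that drift,
  divided by the mean of this exponential under the tilted law. The total mean is then 1 for all
  \<open>\<xi>\<close> and \<open>l\<close>.\<close>

definition tilt :: "real \<Rightarrow> real^'d \<Rightarrow> real^'d \<Rightarrow> real^'d \<Rightarrow> complex" where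
  "tilt \<delta> \<xi> l y = of_real (exp (\<xi> \<bullet> y - (norm \<xi>)\<^sup>2 * \<delta> / 2 + (norm l)\<^sup>2 * \<delta> / 2)) * cis (l \<bullet> y - \<delta> * (l \<bullet> \<xi>))"

lemma measurable_tilt [measurable (raw)]:
  assumes [measurable]: "f \<in> borel_measurable N" "g \<in> borel_measurable N"
  shows "(\<lambda>x. tilt \<delta> (f x) l (g x)) \<in> borel_measurable N"
  unfolding tilt_def by measurable

lemma norm_tilt: "norm (tilt \<delta> \<xi> l y) = exp (\<xi> \<bullet> y - (norm \<xi>)\<^sup>2 * \<delta> / 2) * exp ((norm l)\<^sup>2 * \<delta> / 2)"
  by (simp add: tilt_def norm_mult exp_add)

text \<open>All exponents are sums over the coordinates, so the integral is a product of
  one-dimensional ones. Their values multiply to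
  \<open>exp (- ((norm l)\<^sup>2 * \<delta> / 2))\<close>, which the normalising term of
  \<open>tilt\<close> cancels.\<close>

lemma tilt_gauss:
  fixes \<xi> l :: "real^'d"
  assumes "\<delta> > 0"
  shows "integrable (gauss \<delta>) (tilt \<delta> \<xi> l)" "(\<integral>y. tilt \<delta> \<xi> l y \<partial>gauss \<delta>) = 1"
proof -
  define f where "f i u = complex_of_real (normal_density 0 (sqrt \<delta>) u * exp (\<xi>$i * u - (\<xi>$i)\<^sup>2 * \<delta> / 2)) * cis (l$i * u - \<delta> * (l$i * \<xi>$i))" for i u
  note f = normal_tilt_1d[OF assms, of "\<xi>$i" "l$i" for i, folded f_def]
  have n: "(norm z)\<^sup>2 = (\<Sum>i\<in>UNIV. (z$i)\<^sup>2)" for z :: "real^'d"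
    by (simp add: norm_vec_def L2_set_def sum_nonneg)
  have cp: "cis (sum a S) = (\<Prod>i\<in>S. cis (a i))" if "finite S" for a :: "'d \<Rightarrow> real" and S
    using that by (induction rule: finite_induct) (auto simp: cis_mult[symmetric])
  have e: "complex_of_real (\<Prod>i\<in>UNIV. normal_density 0 (sqrt \<delta>) (y $ i)) * tilt \<delta> \<xi> l y =
      of_real (exp ((norm l)\<^sup>2 * \<delta> / 2)) * (\<Prod>i\<in>UNIV. f i (y $ i))" for y
  proof -
    have "\<xi> \<bullet> y - (norm \<xi>)\<^sup>2 * \<delta> / 2 = (\<Sum>i\<in>UNIV. \<xi>$i * y$i - (\<xi>$i)\<^sup>2 * \<delta> / 2)"
      by (simp add: inner_vec_def n sum_subtractf sum_distrib_right sum_divide_distrib)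
    moreover have "l \<bullet> y - \<delta> * (l \<bullet> \<xi>) = (\<Sum>i\<in>UNIV. l$i * y$i - \<delta> * (l$i * \<xi>$i))"
      by (simp add: inner_vec_def sum_subtractf sum_distrib_left)
    ultimately show ?thesis
      by (simp add: tilt_def f_def exp_add exp_sum cp prod.distrib)
  qed
  have m [measurable]: "tilt \<delta> \<xi> l \<in> borel_measurable borel" by measurable
  have p: "0 \<le> (\<Prod>i\<in>UNIV. normal_density 0 (sqrt \<delta>) (y $ i))" for y :: "real^'d"
    by (intro prod_nonneg) auto
  have [measurable]: "(\<lambda>y::real^'d. \<Prod>i\<in>UNIV. normal_density 0 (sqrt \<delta>) (y $ i)) \<in> borel_measurable borel"
    by measurable
  show "integrable (gauss \<delta>) (tilt \<delta> \<xi> l)"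
    unfolding gauss_def using p lborel_vec_prod_integral(1)[of f, OF f(1)]
    by (subst integrable_density) (auto simp: scaleR_conv_of_real e simp del: of_real_prod)
  have "(\<Prod>i\<in>UNIV. \<integral>u. f i u \<partial>lborel) = of_real (exp (- ((norm l)\<^sup>2 * \<delta> / 2)))"
    by (simp add: f(2) n exp_sum[symmetric] sum_negf sum_distrib_right sum_divide_distrib flip: of_real_prod)
  then show "(\<integral>y. tilt \<delta> \<xi> l y \<partial>gauss \<delta>) = 1"
    unfolding gauss_def using p lborel_vec_prod_integral(2)[of f, OF f(1)]
    by (subst integral_density)
       (auto simp: scaleR_conv_of_real e exp_minus simp del: of_real_prod)
qed

text \<open>With \<open>\<xi> = 0\<close> and \<open>l = 0\<close> the tilt is constantly 1, so the
  total mass is read off from its integral.\<close>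

lemma prob_space_gauss:
  assumes "\<delta> > 0"
  shows "prob_space (gauss \<delta> :: (real^'d) measure)"
proof -
  have i: "integrable (gauss \<delta> :: (real^'d) measure) (\<lambda>_. 1::complex)" "(\<integral>y. (1::complex) \<partial>(gauss \<delta> :: (real^'d) measure)) = 1"
    using tilt_gauss[OF assms, of "0::real^'d" 0] by (simp_all add: tilt_def[abs_def])
  have fin: "emeasure (gauss \<delta> :: (real^'d) measure) UNIV < \<infinity>"
    using integrable_iff_bounded[THEN iffD1, OF i(1)] by simp
  have "measure (gauss \<delta> :: (real^'d) measure) UNIV = 1"
    using i(2) by (simp add: scaleR_conv_of_real del: of_real_mult)
  then show ?thesis
    using fin by (intro prob_spaceI) (simp add: emeasure_eq_ennreal_measure less_top)
qed

text \<open>The conditional expectation of the tilt given \<open>Fa\<close> is 1. Since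
  \<open>\<xi>\<close> and \<open>W\<close> are \<open>Fa\<close>-measurable and
  \<open>\<Delta>\<close> is independent of \<open>Fa\<close>, Fubini's theorem allows integrating
  over the Gaussian increment with the rest frozen.\<close>

lemma (in prob_space) tilt_increment_expectation:
  fixes \<Delta> \<xi> :: "'a \<Rightarrow> real^'d" and W :: "'a \<Rightarrow> complex"
  assumes sub: "subalgebra M Fa" and \<Delta> [measurable]: "\<Delta> \<in> borel_measurable M"
    and ind: "indep_set (sets Fa) {\<Delta> -` A \<inter> space M | A. A \<in> sets borel}"
    and law: "distr M borel \<Delta> = gauss \<delta>" and \<delta>: "\<delta> > 0"
    and \<xi> [measurable]: "\<xi> \<in> borel_measurable Fa"
    and W: "W \<in> borel_measurable Fa" "integrable M W"
  shows "integrable M (\<lambda>\<omega>. W \<omega> * tilt \<delta> (\<xi> \<omega>) l (\<Delta> \<omega>))"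
    and "(\<integral>\<omega>. W \<omega> * tilt \<delta> (\<xi> \<omega>) l (\<Delta> \<omega>) \<partial>M) = (\<integral>\<omega>. W \<omega> \<partial>M)"
proof -
  note [measurable] = W(1)
  let ?R = "restr_to_subalg M Fa" and ?g = "gauss \<delta> :: (real^'d) measure"
  have setsR [measurable_cong]: "sets ?R = sets Fa" and spR: "space ?R = space M"
    using sub by (auto simp: sets_restr_to_subalg space_restr_to_subalg)
  interpret R: prob_space ?R using sub by (rule prob_space_restr_to_subalg) unfold_locales
  interpret g: prob_space ?g by (rule prob_space_gauss[OF \<delta>])
  interpret P: pair_sigma_finite ?R ?g ..
  have idm [measurable]: "(\<lambda>\<omega>. \<omega>) \<in> M \<rightarrow>\<^sub>M ?R"
    using sub by (auto simp: measurable_def spR setsR subalgebra_def sets.Int_space_eq2 dest: sets.sets_into_space)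
  have mp [measurable]: "(\<lambda>\<omega>. (\<omega>, \<Delta> \<omega>)) \<in> M \<rightarrow>\<^sub>M ?R \<Otimes>\<^sub>M ?g" by measurable
  \<comment> \<open>Independence as a product law: the pair consists of the outcome, seen through
    \<open>Fa\<close>, and the increment.\<close>
  have joint: "?R \<Otimes>\<^sub>M ?g = distr M (?R \<Otimes>\<^sub>M ?g) (\<lambda>\<omega>. (\<omega>, \<Delta> \<omega>))"
  proof (rule pair_measure_eqI)
    fix A C assume A: "A \<in> sets ?R" and C: "C \<in> sets ?g"
    have AM: "A \<in> sets M" "A \<in> sets Fa" using A sub by (auto simp: setsR subalgebra_def)
    have "(\<lambda>\<omega>. (\<omega>, \<Delta> \<omega>)) -` (A \<times> C) \<inter> space M = A \<inter> (\<Delta> -` C \<inter> space M)"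
      using sets.sets_into_space[OF AM(1)] by auto
    moreover have "prob (A \<inter> (\<Delta> -` C \<inter> space M)) = prob A * prob (\<Delta> -` C \<inter> space M)"
      using C by (intro indep_setD[OF ind AM(2)]) auto
    moreover have "prob (\<Delta> -` C \<inter> space M) = measure ?g C"
      using C by (simp add: law[symmetric] measure_distr)
    ultimately show "emeasure ?R A * emeasure ?g C = emeasure (distr M (?R \<Otimes>\<^sub>M ?g) (\<lambda>\<omega>. (\<omega>, \<Delta> \<omega>))) (A \<times> C)"
      using A C AM sub by (simp add: emeasure_distr emeasure_restr_to_subalg emeasure_eq_measure g.emeasure_eq_measure
         ennreal_mult[symmetric])
  qed (auto intro: R.sigma_finite_measure g.sigma_finite_measure)
  let ?k = "\<lambda>(\<omega>, y). W \<omega> * tilt \<delta> (\<xi> \<omega>) l y"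
  have km [measurable]: "?k \<in> borel_measurable (?R \<Otimes>\<^sub>M ?g)" by measurable
  have WR: "integrable ?R W" using W sub by (simp add: integrable_in_subalg)
  \<comment> \<open>The modulus of the tilt has the same mean for every \<open>x\<close>, so
    integrability of \<open>W\<close> is enough for Fubini's theorem, however large
    \<open>\<xi>\<close> may be.\<close>
  have nt: "(\<integral>y. norm (tilt \<delta> x l y) \<partial>?g) = exp ((norm l)\<^sup>2 * \<delta> / 2)" for x :: "real^'d"
  proof -
    have "(\<integral>y. complex_of_real (exp (x \<bullet> y - (norm x)\<^sup>2 * \<delta> / 2)) \<partial>?g) = 1"
      using tilt_gauss(2)[OF \<delta>, of x 0] by (simp add: tilt_def)
    then have "(\<integral>y. exp (x \<bullet> y - (norm x)\<^sup>2 * \<delta> / 2) \<partial>?g) = 1"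
      by (metis integral_complex_of_real of_real_eq_1_iff)
    then show ?thesis by (simp add: norm_tilt)
  qed
  have ki: "integrable (?R \<Otimes>\<^sub>M ?g) ?k"
  proof (rule P.Fubini_integrable[OF km])
    show "integrable ?R (\<lambda>x. \<integral>y. norm (?k (x, y)) \<partial>?g)"
      using WR by (simp add: norm_mult nt)
    show "AE x in ?R. integrable ?g (\<lambda>y. ?k (x, y))"
      using tilt_gauss(1)[OF \<delta>] by (auto intro!: AE_I2 integrable_mult_right)
  qed
  then show "integrable M (\<lambda>\<omega>. W \<omega> * tilt \<delta> (\<xi> \<omega>) l (\<Delta> \<omega>))"
    by (subst (asm) joint) (simp add: integrable_distr_eq)
  have "(\<integral>\<omega>. W \<omega> * tilt \<delta> (\<xi> \<omega>) l (\<Delta> \<omega>) \<partial>M) = (\<integral>x. ?k x \<partial>(?R \<Otimes>\<^sub>M ?g))"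
    by (subst joint) (simp add: integral_distr)
  also have "\<dots> = (\<integral>\<omega>. \<integral>y. ?k (\<omega>, y) \<partial>?g \<partial>?R)"
    using P.integral_fst'[OF ki] by simp
  also have "\<dots> = (\<integral>\<omega>. W \<omega> \<partial>?R)" by (simp add: tilt_gauss(2)[OF \<delta>])
  also have "\<dots> = (\<integral>\<omega>. W \<omega> \<partial>M)" using W sub by (simp add: integral_subalgebra2)
  finally show "(\<integral>\<omega>. W \<omega> * tilt \<delta> (\<xi> \<omega>) l (\<Delta> \<omega>) \<partial>M) = (\<integral>\<omega>. W \<omega> \<partial>M)" .
qed

section \<open>Step processes\<close>

abbreviation unit_lborel :: "real measure" where
  "unit_lborel \<equiv> restrict_space lborel {0..1}"

lemma prob_space_unit_lborel: "prob_space unit_lborel"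
  by (rule prob_spaceI) (simp add: emeasure_restrict_space space_restrict_space)

interpretation unit_lborel: prob_space unit_lborel
  by (rule prob_space_unit_lborel)

lemma space_unit_lborel [simp]: "space unit_lborel = {0..1}"
  by (simp add: space_restrict_space)

lemma sets_unit_lborel [measurable_cong]: "sets unit_lborel = sets (restrict_space borel {0..1})"
  by (simp add: sets_restrict_space)

lemma cm_norm_sq_eq: "cm_norm_sq h = (\<integral>s. (norm (h s))\<^sup>2 \<partial>unit_lborel)"
  by (simp add: cm_norm_sq_def set_lebesgue_integral_def integral_restrict_space)

text \<open>Consecutive points may coincide. A step of length zero carries no increment but also no
  Gaussian law, hence the case distinctions on \<open>g j < g (Suc j)\<close> below.\<close>

definition grid :: "nat \<Rightarrow> (nat \<Rightarrow> real) \<Rightarrow> bool" where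
  "grid m g \<longleftrightarrow> g 0 = 0 \<and> g m = 1 \<and> (\<forall>j<m. g j \<le> g (Suc j))"

lemma grid_mono:
  assumes "grid m g" "i \<le> j" "j \<le> m"
  shows "g i \<le> g j"
  using assms(2,3)
proof (induction j rule: dec_induct)
  case (step n)
  then have "g i \<le> g n" "g n \<le> g (Suc n)" using assms(1) by (auto simp: grid_def)
  then show ?case by simp
qed simp

lemma grid_range:
  assumes "grid m g" "j \<le> m"
  shows "0 \<le> g j" "g j \<le> 1"
  using grid_mono[OF assms(1), of 0 j] grid_mono[OF assms(1), of j m] assms by (auto simp: grid_def)

lemma grid_exists:
  assumes "finite S" "S \<subseteq> {0..1}"
  obtains m g where "grid m g" "S \<subseteq> g ` {..m}"
proof -
  define T where "T = insert 0 (insert 1 S)"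
  define xs where "xs = sorted_list_of_set T"
  have "finite T" using assms by (simp add: T_def)
  then have xs: "set xs = insert 0 (insert 1 S)" "sorted xs" by (auto simp: xs_def T_def[symmetric])
  have len: "length xs > 0" using xs(1) by auto
  let ?m = "length xs - 1"
  have in01: "xs ! j \<in> {0..1}" if "j < length xs" for j
    using nth_mem[OF that] xs(1) assms(2) by auto
  obtain i0 where i0: "i0 < length xs" "xs ! i0 = 0" using xs(1) by (metis in_set_conv_nth insertI1)
  obtain i1 where i1: "i1 < length xs" "xs ! i1 = 1" using xs(1) by (metis in_set_conv_nth insertI1 insertI2)
  have "xs ! 0 \<le> xs ! i0" "xs ! i1 \<le> xs ! ?m" 
    using sorted_nth_mono[OF xs(2), of 0 i0] sorted_nth_mono[OF xs(2), of i1 ?m] i0 i1 by auto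
  then have "xs ! 0 = 0" "xs ! ?m = 1" using in01[of 0] in01[of ?m] len i0 i1 by auto
  moreover have "xs ! j \<le> xs ! Suc j" if "j < ?m" for j
    using that xs(2) by (intro sorted_nth_mono) auto
  ultimately have "grid ?m ((!) xs)" by (simp add: grid_def)
  moreover have "S \<subseteq> (!) xs ` {..?m}"
  proof
    fix s assume "s \<in> S"
    then obtain j where "j < length xs" "xs ! j = s" using xs(1) by (metis in_set_conv_nth insertI2)
    then show "s \<in> (!) xs ` {..?m}" by (intro image_eqI[of _ _ j]) auto
  qed
  ultimately show ?thesis by (rule that)
qed

text \<open>By monotonicity no grid point lies strictly inside a step. This is what makes indicators
  with end points on the grid constant along each step.\<close>

lemma grid_le_pred:
  assumes "grid m g" "a \<in> g ` {..m}" "j < m" "a < g (Suc j)"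
  shows "a \<le> g j"
proof -
  obtain p where p: "p \<le> m" "a = g p" using assms(2) by auto
  have "p \<le> j"
    using grid_mono[OF assms(1), of "Suc j" p] p assms(4) by (cases "Suc j \<le> p") auto
  then show ?thesis using grid_mono[OF assms(1), of p j] p assms(3) by simp
qed

text \<open>Clipping to \<open>{a..b}\<close> turns the indicator into an increment.\<close>

lemma grid_telescope:
  fixes f :: "real \<Rightarrow> 'v::real_vector"
  assumes "grid m g" "a \<le> b" "a \<in> g ` {..m}" "b \<in> g ` {..m}"
  shows "(\<Sum>j<m. indicator {a<..b} (g (Suc j)) *\<^sub>R (f (g (Suc j)) - f (g j))) = f b - f a"
proof -
  define c where "c t = min b (max a t)" for t
  have "(\<Sum>j<m. indicator {a<..b} (g (Suc j)) *\<^sub>R (f (g (Suc j)) - f (g j))) =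
        (\<Sum>j<m. f (c (g (Suc j))) - f (c (g j)))"
  proof (intro sum.cong refl)
    fix j assume "j \<in> {..<m}"
    then have j: "j < m" by simp
    have le: "g j \<le> g (Suc j)" using assms(1) j by (simp add: grid_def)
    consider "g (Suc j) \<le> a" | "a < g (Suc j)" "g (Suc j) \<le> b" "a \<le> g j" | "b < g (Suc j)" "b \<le> g j"
      using grid_le_pred[OF assms(1,3) j] grid_le_pred[OF assms(1,4) j] by linarith
    then show "indicator {a<..b} (g (Suc j)) *\<^sub>R (f (g (Suc j)) - f (g j)) = f (c (g (Suc j))) - f (c (g j))"
      using le assms(2) by cases (auto simp: c_def)
  qed
  also have "\<dots> = f (c (g m)) - f (c (g 0))"
    by (rule sum_lessThan_telescope)
  also have "\<dots> = f b - f a"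
    using assms grid_range[OF assms(1)] by (auto simp: c_def grid_def)
  finally show ?thesis .
qed

text \<open>The half-open steps tile \<open>{0<..1}\<close>: the indicator of each is a difference
  of indicators of rays, and the sum telescopes. The point 0 lies in no step, hence the condition
  \<open>\<phi> 0 = 0\<close>.\<close>

lemma grid_partition:
  fixes \<phi> :: "real \<Rightarrow> 'v::real_vector"
  assumes g: "grid m g" and c: "\<And>j s. j < m \<Longrightarrow> s \<in> {g j<..g (Suc j)} \<Longrightarrow> \<phi> s = \<phi> (g (Suc j))"
    and s: "s \<in> {0..1}" "\<phi> 0 = 0"
  shows "\<phi> s = (\<Sum>j<m. indicator {g j<..g (Suc j)} s *\<^sub>R \<phi> (g (Suc j)))"
proof -
  have "(\<Sum>j<m. indicator {g j<..g (Suc j)} s *\<^sub>R \<phi> (g (Suc j))) = (\<Sum>j<m. (indicator {g j<..g (Suc j)} s :: real) *\<^sub>R \<phi> s)"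
  proof (intro sum.cong refl)
    fix j assume "j \<in> {..<m}"
    show "indicator {g j<..g (Suc j)} s *\<^sub>R \<phi> (g (Suc j)) = (indicator {g j<..g (Suc j)} s :: real) *\<^sub>R \<phi> s"
    proof (cases "s \<in> {g j<..g (Suc j)}")
      case True
      then show ?thesis using c[of j s] \<open>j \<in> {..<m}\<close> by (metis lessThan_iff)
    next
      case False
      then show ?thesis by (metis indicator_simps(2) scaleR_zero_left)
    qed
  qed
  also have "\<dots> = (\<Sum>j<m. indicator {g j<..g (Suc j)} s :: real) *\<^sub>R \<phi> s"
    by (simp add: scaleR_sum_left)
  also have "(\<Sum>j<m. indicator {g j<..g (Suc j)} s :: real) = (\<Sum>j<m. indicator {g j<..} s - indicator {g (Suc j)<..} s)"
    using g by (intro sum.cong refl) (auto simp: indicator_def grid_def; fastforce)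
  also have "\<dots> = indicator {g 0<..} s - indicator {g m<..} s"
    by (rule sum_lessThan_telescope')
  also have "\<dots> *\<^sub>R \<phi> s = \<phi> s"
    using g s by (auto simp: grid_def indicator_def)
  finally show ?thesis ..
qed

lemma grid_integral:
  fixes \<phi> :: "real \<Rightarrow> 'v::{banach, second_countable_topology}"
  assumes g: "grid m g" and c: "\<And>j s. j < m \<Longrightarrow> s \<in> {g j<..g (Suc j)} \<Longrightarrow> \<phi> s = \<phi> (g (Suc j))"
    and s: "\<phi> 0 = 0"
  shows "integrable unit_lborel \<phi>" "(\<integral>s. \<phi> s \<partial>unit_lborel) = (\<Sum>j<m. (g (Suc j) - g j) *\<^sub>R \<phi> (g (Suc j)))"
proof -
  let ?f = "\<lambda>s. \<Sum>j<m. indicator {g j<..g (Suc j)} s *\<^sub>R \<phi> (g (Suc j))"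
  have *: "{g j<..g (Suc j)} \<inter> {0..1} = {g j<..g (Suc j)}" "g j \<le> g (Suc j)" if "j < m" for j
    using that grid_range[OF g, of j] grid_range[OF g, of "Suc j"] g by (auto simp: grid_def)
  have ii: "has_bochner_integral unit_lborel (indicator {g j<..g (Suc j)}) (g (Suc j) - g j)" if "j < m" for j
  proof -
    have "{g j<..g (Suc j)} \<in> sets unit_lborel"
      using *[OF that] by (auto simp: sets_restrict_space intro!: image_eqI[of _ _ "{g j<..g (Suc j)}"])
    moreover have "emeasure unit_lborel {g j<..g (Suc j)} = ennreal (g (Suc j) - g j)"
      using *[OF that] by (subst emeasure_restrict_space) auto
    ultimately show ?thesis
      using *[OF that] has_bochner_integral_real_indicator[of "{g j<..g (Suc j)}" unit_lborel] by (simp add: measure_def)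
  qed
  have f: "has_bochner_integral unit_lborel ?f (\<Sum>j<m. (g (Suc j) - g j) *\<^sub>R \<phi> (g (Suc j)))"
    by (intro has_bochner_integral_sum has_bochner_integral_scaleR_left) (use ii in auto)
  have "has_bochner_integral unit_lborel \<phi> (\<Sum>j<m. (g (Suc j) - g j) *\<^sub>R \<phi> (g (Suc j)))"
    by (rule iffD2[OF has_bochner_integral_cong[OF refl _ refl] f]) (intro grid_partition[OF g c _ s], auto)
  then show "integrable unit_lborel \<phi>" "(\<integral>s. \<phi> s \<partial>unit_lborel) = (\<Sum>j<m. (g (Suc j) - g j) *\<^sub>R \<phi> (g (Suc j)))"
    by (auto simp: has_bochner_integral_iff)
qed

section \<open>Step integrands and their integrals\<close>

text \<open>\<open>null_F\<close> makes almost sure limits of \<open>F t\<close>-measurable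
  variables again \<open>F t\<close>-measurable. It is provided at the end by augmenting the given
  filtration.\<close>

locale brownian = prob_space M for M :: "'a measure" +
  fixes F :: "real \<Rightarrow> 'a measure" and B :: "real \<Rightarrow> 'a \<Rightarrow> real^'d"
  assumes bm: "brownian_motion M F B"
    and null_F: "null_sets M \<subseteq> sets (F t)"
begin

lemma subalg: "subalgebra M (F t)"
  using bm by (auto simp: brownian_motion_def filtration_of_def filtration_def subalgebra_def)

lemma space_F [simp]: "space (F t) = space M"
  using subalg by (simp add: subalgebra_def)

lemma sets_F_subset: "sets (F t) \<subseteq> sets M"
  using subalg by (simp add: subalgebra_def)

lemma sets_F_mono: "s \<le> t \<Longrightarrow> sets (F s) \<subseteq> sets (F t)"
  using bm by (auto simp: brownian_motion_def filtration_of_def filtration_def)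

lemma F_mono: "f \<in> borel_measurable (F s) \<Longrightarrow> s \<le> t \<Longrightarrow> f \<in> borel_measurable (F t)"
  using sets_F_mono[of s t] by (auto simp: measurable_def)

lemma F_M: "f \<in> borel_measurable (F s) \<Longrightarrow> f \<in> borel_measurable M"
  using sets_F_subset[of s] by (auto simp: measurable_def)

lemma B_F: "t \<in> {0..1} \<Longrightarrow> B t \<in> borel_measurable (F t)"
  using bm by (auto simp: brownian_motion_def)

lemma B_M [measurable]: "t \<in> {0..1} \<Longrightarrow> B t \<in> borel_measurable M"
  using B_F F_M by blast

text \<open>Predictable step processes, described without a grid: on an interval
  \<open>{p<..q}\<close> with no point of \<open>S\<close> strictly inside, the process is constant
  and already known at time \<open>p\<close>. The finite set \<open>S\<close> may be enlarged within
  the unit interval, which makes sums and common refinements easy.\<close>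

definition step :: "real set \<Rightarrow> (real \<Rightarrow> 'a \<Rightarrow> real^'d) \<Rightarrow> bool" where
  "step S h \<longleftrightarrow> finite S \<and> S \<subseteq> {0..1} \<and> h 0 = (\<lambda>_. 0) \<and>
     (\<forall>p q. 0 \<le> p \<and> p < q \<and> q \<le> 1 \<and> S \<inter> {p<..<q} = {} \<longrightarrow>
        h q \<in> borel_measurable (F p) \<and> (\<forall>s\<in>{p<..q}. h s = h q)) \<and>
     (\<exists>K. \<forall>s\<in>{0..1}. \<forall>\<omega>\<in>space M. norm (h s \<omega>) \<le> K)"

definition grid_int :: "nat \<Rightarrow> (nat \<Rightarrow> real) \<Rightarrow> (real \<Rightarrow> 'a \<Rightarrow> real^'d) \<Rightarrow> 'a \<Rightarrow> real" where
  "grid_int m g h \<omega> = (\<Sum>j<m. h (g (Suc j)) \<omega> \<bullet> (B (g (Suc j)) \<omega> - B (g j) \<omega>))"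

text \<open>Some grid through \<open>S\<close> is chosen; \<open>step_int_eq\<close> shows that the
  value does not depend on it.\<close>

definition step_int :: "real set \<Rightarrow> (real \<Rightarrow> 'a \<Rightarrow> real^'d) \<Rightarrow> 'a \<Rightarrow> real" where
  "step_int S h = (let p = SOME p. grid (fst p) (snd p) \<and> S \<subseteq> snd p ` {..fst p} in grid_int (fst p) (snd p) h)"

lemma step_interval:
  assumes "step S h" "0 \<le> p" "p < q" "q \<le> 1" "S \<inter> {p<..<q} = {}"
  shows "h q \<in> borel_measurable (F p)" "s \<in> {p<..q} \<Longrightarrow> h s = h q"
  using assms(1)[unfolded step_def] assms(2-) by blast+

lemma step_basic:
  assumes "step S h"
  shows "finite S" "S \<subseteq> {0..1}" "h 0 \<omega> = 0"
  using assms by (auto simp: step_def)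

lemma stepD:
  assumes "step S h" "grid m g" "S \<subseteq> g ` {..m}" "j < m"
  shows "g j < g (Suc j) \<Longrightarrow> h (g (Suc j)) \<in> borel_measurable (F (g j))"
    and "s \<in> {g j<..g (Suc j)} \<Longrightarrow> h s = h (g (Suc j))"
proof -
  have "s \<le> g j" if "s \<in> S" "s < g (Suc j)" for s
    using grid_le_pred[OF assms(2) _ assms(4) that(2)] that(1) assms(3) by auto
  then have "S \<inter> {g j<..<g (Suc j)} = {}" by force
  note * = step_interval[OF assms(1) grid_range(1)[OF assms(2)] _ grid_range(2)[OF assms(2)] this]
  show "g j < g (Suc j) \<Longrightarrow> h (g (Suc j)) \<in> borel_measurable (F (g j))"
    using *(1) assms(4) by simp
  show "s \<in> {g j<..g (Suc j)} \<Longrightarrow> h s = h (g (Suc j))"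
    using assms(4) by (intro *(2)) auto
qed

lemma step_partition:
  assumes "step S h" "grid m g" "S \<subseteq> g ` {..m}" "s \<in> {0..1}"
  shows "h s \<omega> = (\<Sum>j<m. indicator {g j<..g (Suc j)} s *\<^sub>R h (g (Suc j)) \<omega>)"
proof (rule grid_partition[where \<phi>="\<lambda>s. h s \<omega>", OF assms(2) _ assms(4)])
  show "h s \<omega> = h (g (Suc j)) \<omega>" if "j < m" "s \<in> {g j<..g (Suc j)}" for j s
    using stepD(2)[OF assms(1-3) that] by metis
qed (rule step_basic(3)[OF assms(1)])

text \<open>Expanding \<open>h\<close> over the coarse steps and exchanging the sums leaves, for
  each coarse step, the fine increments inside it, which telescope.\<close>

lemma grid_int_refine:
  assumes "step S h" "grid m g" "S \<subseteq> g ` {..m}" and g': "grid m' g'" "g ` {..m} \<subseteq> g' ` {..m'}"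
  shows "grid_int m' g' h \<omega> = grid_int m g h \<omega>"
proof -
  let ?D = "\<lambda>i. B (g' (Suc i)) \<omega> - B (g' i) \<omega>"
  have "grid_int m' g' h \<omega> = (\<Sum>i<m'. \<Sum>j<m. indicator {g j<..g (Suc j)} (g' (Suc i)) * (h (g (Suc j)) \<omega> \<bullet> ?D i))"
    unfolding grid_int_def
  proof (intro sum.cong refl)
    fix i assume "i \<in> {..<m'}"
    then have "g' (Suc i) \<in> {0..1}" using grid_range[OF g'(1), of "Suc i"] by auto
    from step_partition[OF assms(1-3) this, of \<omega>]
    show "h (g' (Suc i)) \<omega> \<bullet> ?D i = (\<Sum>j<m. indicator {g j<..g (Suc j)} (g' (Suc i)) * (h (g (Suc j)) \<omega> \<bullet> ?D i))"
      by (simp add: inner_sum_left)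
  qed
  also have "\<dots> = (\<Sum>j<m. \<Sum>i<m'. indicator {g j<..g (Suc j)} (g' (Suc i)) * (h (g (Suc j)) \<omega> \<bullet> ?D i))"
    by (rule sum.swap)
  also have "\<dots> = (\<Sum>j<m. h (g (Suc j)) \<omega> \<bullet> (\<Sum>i<m'. indicator {g j<..g (Suc j)} (g' (Suc i)) *\<^sub>R ?D i))"
    by (simp add: inner_sum_right)
  also have "\<dots> = grid_int m g h \<omega>"
    unfolding grid_int_def
  proof (intro sum.cong refl arg_cong2[where f="(\<bullet>)"])
    fix j assume "j \<in> {..<m}"
    then show "(\<Sum>i<m'. indicator {g j<..g (Suc j)} (g' (Suc i)) *\<^sub>R ?D i) = B (g (Suc j)) \<omega> - B (g j) \<omega>"
      using assms(2) g' by (intro grid_telescope[where f="\<lambda>t. B t \<omega>"]) (auto simp: grid_def subset_iff)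
  qed
  finally show ?thesis .
qed

text \<open>Two grids through \<open>S\<close> are compared by passing to a common
  refinement.\<close>

lemma step_int_eq:
  assumes "step S h" "grid m g" "S \<subseteq> g ` {..m}"
  shows "step_int S h \<omega> = grid_int m g h \<omega>"
proof -
  define p where "p = (SOME p. grid (fst p) (snd p) \<and> S \<subseteq> snd p ` {..fst p})"
  define m1 g1 where "m1 = fst p" and "g1 = snd p"
  have "grid (fst p) (snd p) \<and> S \<subseteq> snd p ` {..fst p}"
    unfolding p_def by (rule someI[of _ "(m, g)"]) (use assms in simp)
  then have 1: "grid m1 g1" "S \<subseteq> g1 ` {..m1}" by (auto simp: m1_def g1_def)
  obtain m2 g2 where 2: "grid m2 g2" "g ` {..m} \<union> g1 ` {..m1} \<subseteq> g2 ` {..m2}"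
  proof (rule grid_exists)
    show "g ` {..m} \<union> g1 ` {..m1} \<subseteq> {0..1}" using grid_range[OF assms(2)] grid_range[OF 1(1)] by auto
  qed auto
  have "grid_int m1 g1 h \<omega> = grid_int m g h \<omega>"
    using grid_int_refine[OF assms(1) 1 2(1), of \<omega>] grid_int_refine[OF assms 2(1), of \<omega>] 2(2) by auto
  then show ?thesis by (simp add: step_int_def p_def[symmetric] m1_def g1_def Let_def)
qed

lemma step_bounded:
  assumes "step S h"
  obtains K where "\<And>s \<omega>. s \<in> {0..1} \<Longrightarrow> \<omega> \<in> space M \<Longrightarrow> norm (h s \<omega>) \<le> K"
  using assms unfolding step_def by blast

lemma stepI:
  assumes "finite S" "S \<subseteq> {0..1}" "\<And>\<omega>. h 0 \<omega> = 0"
    and "\<And>p q. 0 \<le> p \<Longrightarrow> p < q \<Longrightarrow> q \<le> 1 \<Longrightarrow> S \<inter> {p<..<q} = {} \<Longrightarrow> h q \<in> borel_measurable (F p)"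
    and "\<And>p q s \<omega>. 0 \<le> p \<Longrightarrow> p < q \<Longrightarrow> q \<le> 1 \<Longrightarrow> S \<inter> {p<..<q} = {} \<Longrightarrow> s \<in> {p<..q} \<Longrightarrow> h s \<omega> = h q \<omega>"
    and "\<And>s \<omega>. s \<in> {0..1} \<Longrightarrow> \<omega> \<in> space M \<Longrightarrow> norm (h s \<omega>) \<le> K"
  shows "step S h"
  unfolding step_def using assms(1-4,6)
  by (intro conjI allI impI exI[of _ K] ballI ext assms(5)) auto

lemma step_joint:
  assumes "step S h"
  shows "(\<lambda>(s, \<omega>). h s \<omega>) \<in> borel_measurable (unit_lborel \<Otimes>\<^sub>M M)"
proof -
  obtain m g where g: "grid m g" "S \<subseteq> g ` {..m}" using grid_exists assms by (metis step_def)
  have h: "h (g (Suc j)) \<in> borel_measurable M" if "j < m" "g j < g (Suc j)" for j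
    using stepD(1)[OF assms g that] F_M by blast
  have m: "(\<lambda>(s, \<omega>). indicator {g j<..g (Suc j)} s *\<^sub>R h (g (Suc j)) \<omega>) \<in> borel_measurable (unit_lborel \<Otimes>\<^sub>M M)" if "j < m" for j
  proof (cases "g j < g (Suc j)")
    case True
    have [measurable]: "h (g (Suc j)) \<in> borel_measurable M" using h that True by auto
    have [measurable]: "(\<lambda>s. indicator {g j<..g (Suc j)} s :: real) \<in> borel_measurable unit_lborel"
      by (intro measurable_restrict_space1) simp
    show ?thesis by measurable
  qed (simp add: greaterThanAtMost_empty split_beta')
  have "(\<lambda>(s, \<omega>). h s \<omega>) \<in> borel_measurable (unit_lborel \<Otimes>\<^sub>M M) \<longleftrightarrow>
     (\<lambda>x. \<Sum>j<m. (\<lambda>(s, \<omega>). indicator {g j<..g (Suc j)} s *\<^sub>R h (g (Suc j)) \<omega>) x) \<in> borel_measurable (unit_lborel \<Otimes>\<^sub>M M)"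
    using step_partition[OF assms g] by (intro measurable_cong) (auto simp: space_pair_measure)
  then show ?thesis using m by (auto intro!: borel_measurable_sum)
qed

lemma step_int_measurable:
  assumes "step S h"
  shows "step_int S h \<in> borel_measurable M"
proof -
  obtain m g where g: "grid m g" "S \<subseteq> g ` {..m}" using grid_exists assms by (metis step_def)
  have "(\<lambda>\<omega>. h (g (Suc j)) \<omega> \<bullet> (B (g (Suc j)) \<omega> - B (g j) \<omega>)) \<in> borel_measurable M" if "j < m" for j
  proof (cases "g j < g (Suc j)")
    case True
    have [measurable]: "h (g (Suc j)) \<in> borel_measurable M" using F_M[OF stepD(1)[OF assms g that True]] .
    have [measurable]: "B (g (Suc j)) \<in> borel_measurable M" "B (g j) \<in> borel_measurable M"
      using grid_range[OF g(1), of j] grid_range[OF g(1), of "Suc j"] that by (auto intro!: B_M)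
    show ?thesis by measurable
  next
    case False
    then have "g j = g (Suc j)" using g(1) that by (auto simp: grid_def not_less intro!: antisym)
    then show ?thesis by simp
  qed
  then have "grid_int m g h \<in> borel_measurable M"
    unfolding grid_int_def[abs_def] by (intro borel_measurable_sum) auto
  moreover have "step_int S h = grid_int m g h" using step_int_eq[OF assms g] by (simp add: fun_eq_iff)
  ultimately show ?thesis by simp
qed

lemma step_lin:
  assumes "step S h" "step S' h'"
  shows "step (S \<union> S') (\<lambda>s \<omega>. c *\<^sub>R h s \<omega> + d *\<^sub>R h' s \<omega>)"
    and "step_int (S \<union> S') (\<lambda>s \<omega>. c *\<^sub>R h s \<omega> + d *\<^sub>R h' s \<omega>) \<omega> = c * step_int S h \<omega> + d * step_int S' h' \<omega>"
proof -
  let ?k = "\<lambda>s \<omega>. c *\<^sub>R h s \<omega> + d *\<^sub>R h' s \<omega>"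
  obtain K where K: "\<And>s \<omega>. s \<in> {0..1} \<Longrightarrow> \<omega> \<in> space M \<Longrightarrow> norm (h s \<omega>) \<le> K"
    using step_bounded[OF assms(1)] by blast
  obtain K' where K': "\<And>s \<omega>. s \<in> {0..1} \<Longrightarrow> \<omega> \<in> space M \<Longrightarrow> norm (h' s \<omega>) \<le> K'"
    using step_bounded[OF assms(2)] by blast
  show st: "step (S \<union> S') ?k"
  proof (rule stepI)
    fix s \<omega> assume "s \<in> {0..1::real}" "\<omega> \<in> space M"
    from K[OF this] K'[OF this] show "norm (?k s \<omega>) \<le> \<bar>c\<bar> * K + \<bar>d\<bar> * K'"
      by (intro norm_triangle_le add_mono) (auto intro!: mult_left_mono)
  next
    fix p q s :: real and \<omega> assume a: "0 \<le> p" "p < q" "q \<le> 1" "(S \<union> S') \<inter> {p<..<q} = {}"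
    then have "S \<inter> {p<..<q} = {}" "S' \<inter> {p<..<q} = {}" by auto
    note i = step_interval[OF assms(1) a(1-3) this(1)] step_interval[OF assms(2) a(1-3) this(2)]
    show "?k q \<in> borel_measurable (F p)" using i(1,3) by measurable
    show "?k s \<omega> = ?k q \<omega>" if "s \<in> {p<..q}" using i(2,4)[OF that] by metis
  qed (use step_basic[OF assms(1)] step_basic[OF assms(2)] in auto)
  obtain m g where g: "grid m g" "S \<union> S' \<subseteq> g ` {..m}"
    using grid_exists[of "S \<union> S'"] assms by (auto simp: step_def)
  show "step_int (S \<union> S') ?k \<omega> = c * step_int S h \<omega> + d * step_int S' h' \<omega>"
    using step_int_eq[OF st g, of \<omega>] step_int_eq[OF assms(1) g(1), of \<omega>] step_int_eq[OF assms(2) g(1), of \<omega>] g(2)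
    by (simp add: grid_int_def inner_add_left sum.distrib sum_distrib_left)
qed

lemma step_comp:
  assumes "step S h" "T \<in> borel_measurable borel" "T 0 = 0" "\<And>x. norm (T x) \<le> C"
  shows "step S (\<lambda>s \<omega>. T (h s \<omega>))"
proof (rule stepI)
  fix p q s \<omega> assume "0 \<le> p" "p < q" "q \<le> 1" "S \<inter> {p<..<q} = {}"
  note i = step_interval[OF assms(1) this]
  show "(\<lambda>\<omega>. T (h q \<omega>)) \<in> borel_measurable (F p)" using i(1) assms(2) by measurable
  show "T (h s \<omega>) = T (h q \<omega>)" if "s \<in> {p<..q}" using i(2)[OF that] by metis
qed (use step_basic[OF assms(1)] assms in auto)

text \<open>Multiplying by an event of \<open>F a\<close> could spoil predictability before time
  \<open>a\<close>; the factor \<open>indicator {a<..b} s\<close> removes that part. With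
  \<open>a\<close> and \<open>b\<close> among the jump times, this factor is constant on the
  intervals tested in \<open>step\<close>.\<close>

lemma step_restrict:
  assumes "step S h" "a \<in> {0..1}" "b \<in> {0..1}" "A \<in> sets (F a)"
  shows "step (S \<union> {a, b}) (\<lambda>s \<omega>. indicator {a<..b} s *\<^sub>R indicator A \<omega> *\<^sub>R h s \<omega>)" (is "step _ ?k")
proof -
  obtain K where K: "\<And>s \<omega>. s \<in> {0..1} \<Longrightarrow> \<omega> \<in> space M \<Longrightarrow> norm (h s \<omega>) \<le> K"
    using step_bounded[OF assms(1)] by blast
  show ?thesis
  proof (rule stepI)
    show "norm (?k s \<omega>) \<le> K" if "s \<in> {0..1}" "\<omega> \<in> space M" for s \<omega>
      using K[OF that] order_trans[OF norm_ge_zero K[OF that]] by (auto simp: indicator_def)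
    fix p q s :: real and \<omega> assume a: "0 \<le> p" "p < q" "q \<le> 1" "(S \<union> {a, b}) \<inter> {p<..<q} = {}"
    then have "S \<inter> {p<..<q} = {}" by auto
    note i = step_interval[OF assms(1) a(1-3) this]
    have ab: "a \<le> p \<or> q \<le> a" "b \<le> p \<or> q \<le> b" using a(4) by auto
    show "?k q \<in> borel_measurable (F p)"
    proof (cases "a < q \<and> q \<le> b")
      case True
      then have "A \<in> sets (F p)" using ab assms(4) sets_F_mono[of a p] by auto
      then show ?thesis using i(1) by measurable
    next
      case False
      then have "indicator {a<..b} q = (0::real)" by auto
      then show ?thesis by simp
    qed
    show "?k s \<omega> = ?k q \<omega>" if "s \<in> {p<..q}"
    proof -
      have "indicator {a<..b} s = (indicator {a<..b} q :: real)"
        using that ab by (auto simp: indicator_def)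
      then show ?thesis using i(2)[OF that] by metis
    qed
  qed (use assms step_basic[OF assms(1)] in auto)
qed

text \<open>Connects the simple processes in the definition of the Ito integral with
  \<open>step\<close>. Restricting the integrand to \<open>{a<..b}\<close> corresponds to the
  difference of the integrals stopped at \<open>b\<close> and at \<open>a\<close>, and it makes the
  value at time 0 vanish.\<close>

lemma simple_step:
  assumes simp: "simple_process M F k \<tau> \<xi>" and ab: "0 \<le> a" "a \<le> b" "b \<le> 1"
  defines "S \<equiv> (\<Union>i<k. {\<tau> i, \<tau> (Suc i)}) \<union> {a, b}"
  defines "h \<equiv> \<lambda>s \<omega>. indicator {a<..b} s *\<^sub>R simple_value k \<tau> \<xi> s \<omega>"
  shows "step S h" "step_int S h \<omega> = simple_integral B k \<tau> \<xi> b \<omega> - simple_integral B k \<tau> \<xi> a \<omega>"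
proof -
  have \<tau>: "0 \<le> \<tau> i" "\<tau> i \<le> \<tau> (Suc i)" "\<tau> (Suc i) \<le> 1" "\<xi> i \<in> borel_measurable (F (\<tau> i))" "bounded (\<xi> i ` space M)" if "i < k" for i
    using simp that by (auto simp: simple_process_def)
  have S: "finite S" "S \<subseteq> {0..1}"
    using \<tau> ab by (auto simp: S_def) (force intro: order_trans)+
  have "\<forall>i<k. \<exists>K. \<forall>\<omega>\<in>space M. norm (\<xi> i \<omega>) \<le> K" using \<tau>(5) by (auto simp: bounded_iff)
  then obtain K where K: "\<And>i \<omega>. i < k \<Longrightarrow> \<omega> \<in> space M \<Longrightarrow> norm (\<xi> i \<omega>) \<le> K i" by metis
  have bd: "norm (h s \<omega>) \<le> (\<Sum>i<k. \<bar>K i\<bar>)" if "\<omega> \<in> space M" for s \<omega>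
  proof -
    have "norm (h s \<omega>) \<le> norm (simple_value k \<tau> \<xi> s \<omega>)" by (auto simp: h_def indicator_def)
    also have "\<dots> \<le> (\<Sum>i<k. \<bar>K i\<bar>)" unfolding simple_value_def
      using order_trans[OF K[OF _ that] abs_ge_self]
      by (intro order_trans[OF norm_sum] sum_mono) (auto simp: indicator_def)
    finally show ?thesis .
  qed
  show st: "step S h"
  proof (rule stepI[OF S])
    show "h 0 \<omega> = 0" for \<omega> using ab by (auto simp: h_def)
    show "norm (h s \<omega>) \<le> (\<Sum>i<k. \<bar>K i\<bar>)" if "\<omega> \<in> space M" for s \<omega> using bd that by blast
    fix p q :: real assume a: "0 \<le> p" "p < q" "q \<le> 1" "S \<inter> {p<..<q} = {}"
    have iv: "s \<in> {u<..v} \<longleftrightarrow> q \<in> {u<..v}" if "u \<in> S" "v \<in> S" "s \<in> {p<..q}" for u v s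
    proof -
      have "u \<notin> {p<..<q}" "v \<notin> {p<..<q}" using that a by auto
      then show ?thesis using that(3) by auto
    qed
    have SS: "a \<in> S" "b \<in> S" "\<And>i. i < k \<Longrightarrow> \<tau> i \<in> S" "\<And>i. i < k \<Longrightarrow> \<tau> (Suc i) \<in> S" by (auto simp: S_def)
    show "h s \<omega> = h q \<omega>" if s: "s \<in> {p<..q}" for s \<omega>
    proof -
      have "simple_value k \<tau> \<xi> s \<omega> = simple_value k \<tau> \<xi> q \<omega>"
        unfolding simple_value_def using iv[OF _ _ s] SS
        by (intro sum.cong refl arg_cong2[where f="(*\<^sub>R)"]) (auto simp only: indicator_def lessThan_iff)
      then show ?thesis using iv[OF SS(1,2) s] by (simp add: h_def indicator_def)
    qed
    have "(\<lambda>\<omega>. indicator {\<tau> i<..\<tau> (Suc i)} q *\<^sub>R \<xi> i \<omega>) \<in> borel_measurable (F p)" if i: "i < k" for i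
    proof (cases "q \<in> {\<tau> i<..\<tau> (Suc i)}")
      case True
      have "\<tau> i \<notin> {p<..<q}" using SS(3)[OF i] a by auto
      then have "\<xi> i \<in> borel_measurable (F p)" using True F_mono[OF \<tau>(4)[OF i]] by auto
      then show ?thesis by measurable
    qed simp
    then have "simple_value k \<tau> \<xi> q \<in> borel_measurable (F p)"
      unfolding simple_value_def[abs_def] by (intro borel_measurable_sum) simp
    then show "h q \<in> borel_measurable (F p)"
      unfolding h_def by (intro borel_measurable_scaleR borel_measurable_const)
  qed
  define S' where "S' = S \<union> {0}"
  have S': "finite S'" "S' \<subseteq> {0..1}" "S \<subseteq> S'" using S by (auto simp: S'_def)
  \<comment> \<open>The product of the indicators of \<open>{a<..b}\<close> and of
    \<open>{\<tau> i<..\<tau> (Suc i)}\<close> is the indicator of the latter interval stopped at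
    \<open>b\<close> minus that of the same interval stopped at \<open>a\<close>; each of the two
    telescopes over the grid.\<close>
  have clip: "(\<Sum>j<m. indicator {a<..b} (g (Suc j)) *\<^sub>R indicator {\<tau> i<..\<tau> (Suc i)} (g (Suc j)) *\<^sub>R (B (g (Suc j)) \<omega> - B (g j) \<omega>))
     = (B (min (\<tau> (Suc i)) b) \<omega> - B (min (\<tau> i) b) \<omega>) - (B (min (\<tau> (Suc i)) a) \<omega> - B (min (\<tau> i) a) \<omega>)"
    if g: "grid m g" "S' \<subseteq> g ` {..m}" and i: "i < k" for m g i
  proof -
    have ge: "v \<in> g ` {..m}" if "v \<in> {a, b, \<tau> i, \<tau> (Suc i)}" for v
      using g(2) i that by (auto simp: S'_def S_def)
    let ?I = "\<lambda>u v j. indicator {u<..v} (g (Suc j)) *\<^sub>R (B (g (Suc j)) \<omega> - B (g j) \<omega>)"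
    have t: "(\<Sum>j<m. ?I u v j) = B v \<omega> - B u \<omega>" if "u \<le> v" "u \<in> g ` {..m}" "v \<in> g ` {..m}" for u v
      using grid_telescope[OF g(1) that, of "\<lambda>t. B t \<omega>"] .
    have "(\<Sum>j<m. indicator {a<..b} (g (Suc j)) *\<^sub>R indicator {\<tau> i<..\<tau> (Suc i)} (g (Suc j)) *\<^sub>R (B (g (Suc j)) \<omega> - B (g j) \<omega>)) =
       (\<Sum>j<m. ?I (min (\<tau> i) b) (min (\<tau> (Suc i)) b) j - ?I (min (\<tau> i) a) (min (\<tau> (Suc i)) a) j)"
      using \<tau>(2)[OF i] ab by (intro sum.cong refl) (auto simp: indicator_def min_def)
    also have "\<dots> = (B (min (\<tau> (Suc i)) b) \<omega> - B (min (\<tau> i) b) \<omega>) - (B (min (\<tau> (Suc i)) a) \<omega> - B (min (\<tau> i) a) \<omega>)"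
      using \<tau>(2)[OF i] ge unfolding sum_subtractf by (subst (1 2) t) (auto simp: min_def)
    finally show ?thesis .
  qed
  obtain m g where g: "grid m g" "S' \<subseteq> g ` {..m}" using grid_exists S' by metis
  have "step_int S h \<omega> = grid_int m g h \<omega>" using step_int_eq[OF st g(1)] g(2) S'(3) by blast
  also have "\<dots> = (\<Sum>j<m. \<Sum>i<k. \<xi> i \<omega> \<bullet> (indicator {a<..b} (g (Suc j)) *\<^sub>R indicator {\<tau> i<..\<tau> (Suc i)} (g (Suc j)) *\<^sub>R (B (g (Suc j)) \<omega> - B (g j) \<omega>)))"
    unfolding grid_int_def h_def simple_value_def scaleR_sum_right inner_sum_left
    by (intro sum.cong refl) simp
  also have "\<dots> = (\<Sum>i<k. \<xi> i \<omega> \<bullet> (\<Sum>j<m. indicator {a<..b} (g (Suc j)) *\<^sub>R indicator {\<tau> i<..\<tau> (Suc i)} (g (Suc j)) *\<^sub>R (B (g (Suc j)) \<omega> - B (g j) \<omega>)))"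
    by (subst sum.swap) (simp add: inner_sum_right)
  also have "\<dots> = simple_integral B k \<tau> \<xi> b \<omega> - simple_integral B k \<tau> \<xi> a \<omega>"
    unfolding simple_integral_def sum_subtractf[symmetric]
    by (intro sum.cong refl) (simp only: lessThan_iff clip[OF g] inner_diff_right)
  finally show "step_int S h \<omega> = simple_integral B k \<tau> \<xi> b \<omega> - simple_integral B k \<tau> \<xi> a \<omega>" .
qed

end

section \<open>Exponentials of step integrals\<close>

lemma prod_tilt:
  "(\<Prod>j<m. tilt (\<delta> j) (x j) (l j) (y j)) =
     of_real (exp ((\<Sum>j<m. x j \<bullet> y j) - (\<Sum>j<m. \<delta> j * (norm (x j))\<^sup>2) / 2 + (\<Sum>j<m. \<delta> j * (norm (l j))\<^sup>2) / 2)) *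
     cis ((\<Sum>j<m. l j \<bullet> y j) - (\<Sum>j<m. \<delta> j * (l j \<bullet> x j)))" for m :: nat
proof (induction m)
  case (Suc m)
  have e: "exp (a + a') * exp (c - d * e / 2 + d * f / 2) = exp (a + a' + (c - e * d / 2 + f * d / 2))" for a a' c d e f :: real
    by (simp add: mult_exp_exp mult.commute)
  have "tilt (\<delta> m) (x m) (l m) (y m) =
     of_real (exp (x m \<bullet> y m - \<delta> m * (norm (x m))\<^sup>2 / 2 + \<delta> m * (norm (l m))\<^sup>2 / 2)) * cis (l m \<bullet> y m - \<delta> m * (l m \<bullet> x m))"
    by (simp add: tilt_def mult.commute)
  moreover have m: "(of_real (exp u) * cis v) * (of_real (exp u') * cis v') = of_real (exp (u + u')) * cis (v + v')" for u u' v v'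
    by (simp add: exp_add cis_mult[symmetric])
  ultimately show ?case
    unfolding prod.lessThan_Suc Suc.IH sum.lessThan_Suc
    by (simp only: m) (simp add: add_divide_distrib algebra_simps)
qed simp

section \<open>Expectations of step exponentials\<close>

context brownian begin

lemma increment:
  assumes "0 \<le> s" "s < t" "t \<le> 1"
  shows "indep_set (sets (F s)) {(\<lambda>\<omega>. B t \<omega> - B s \<omega>) -` A \<inter> space M | A. A \<in> sets borel}"
    and "distr M borel (\<lambda>\<omega>. B t \<omega> - B s \<omega>) = gauss (t - s)"
  using bm assms unfolding brownian_motion_def gauss_def by blast+

text \<open>Peeling off the last step: the product up to \<open>n\<close> is known at time
  \<open>g n\<close>, and the next factor has conditional mean 1 given that time. Over a step of
  length zero the factor equals 1. Starting at an index \<open>p\<close>, with a weight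
  \<open>W\<close> known at time \<open>g p\<close>, leaves room for events of the past.\<close>

lemma tilt_chain_expectation:
  fixes W :: "'a \<Rightarrow> complex" and l :: "nat \<Rightarrow> real^'d"
  assumes h: "step S h" "grid m g" "S \<subseteq> g ` {..m}"
    and pq: "p \<le> q" "q \<le> m" and W: "W \<in> borel_measurable (F (g p))" "integrable M W"
  defines "\<Phi> \<equiv> \<lambda>j \<omega>. tilt (g (Suc j) - g j) (h (g (Suc j)) \<omega>) (l j) (B (g (Suc j)) \<omega> - B (g j) \<omega>)"
  shows "(\<lambda>\<omega>. W \<omega> * (\<Prod>j\<in>{p..<q}. \<Phi> j \<omega>)) \<in> borel_measurable (F (g q)) \<and>
    integrable M (\<lambda>\<omega>. W \<omega> * (\<Prod>j\<in>{p..<q}. \<Phi> j \<omega>)) \<and>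
    (\<integral>\<omega>. W \<omega> * (\<Prod>j\<in>{p..<q}. \<Phi> j \<omega>) \<partial>M) = (\<integral>\<omega>. W \<omega> \<partial>M)"
  using pq
proof (induction q rule: dec_induct)
  case (step n)
  let ?W = "\<lambda>\<omega>. W \<omega> * (\<Prod>j\<in>{p..<n}. \<Phi> j \<omega>)"
  have IH: "?W \<in> borel_measurable (F (g n))" "integrable M ?W" "(\<integral>\<omega>. ?W \<omega> \<partial>M) = (\<integral>\<omega>. W \<omega> \<partial>M)"
    using step by auto
  have n: "n < m" using step by simp
  have gn: "g n \<in> {0..1}" "g (Suc n) \<in> {0..1}" "g n \<le> g (Suc n)"
    using grid_range[OF h(2)] n h(2) by (auto simp: grid_def)
  have eq: "W \<omega> * (\<Prod>j\<in>{p..<Suc n}. \<Phi> j \<omega>) = ?W \<omega> * \<Phi> n \<omega>" for \<omega>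
    using step(1) by (simp add: mult.assoc)
  show ?case
  proof (cases "g n < g (Suc n)")
    case True
    have hm: "h (g (Suc n)) \<in> borel_measurable (F (g n))" by (rule stepD(1)[OF h n True])
    have m1: "?W \<in> borel_measurable (F (g (Suc n)))" "h (g (Suc n)) \<in> borel_measurable (F (g (Suc n)))"
      "B (g (Suc n)) \<in> borel_measurable (F (g (Suc n)))" "B (g n) \<in> borel_measurable (F (g (Suc n)))"
      using F_mono[OF IH(1) gn(3)] F_mono[OF hm gn(3)] B_F[OF gn(2)] F_mono[OF B_F[OF gn(1)] gn(3)] by auto
    have m2: "(\<lambda>\<omega>. ?W \<omega> * \<Phi> n \<omega>) \<in> borel_measurable (F (g (Suc n)))"
    proof (rule borel_measurable_times[OF m1(1)])
      show "\<Phi> n \<in> borel_measurable (F (g (Suc n)))"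
        unfolding \<Phi>_def using m1(2-4) by (intro measurable_tilt borel_measurable_diff)
    qed
    have dm: "(\<lambda>\<omega>. B (g (Suc n)) \<omega> - B (g n) \<omega>) \<in> borel_measurable M"
      using gn by (intro borel_measurable_diff B_M)
    note os = tilt_increment_expectation[OF subalg dm increment(1) increment(2) _ hm IH(1,2), of "l n"]
    show ?thesis
      unfolding eq using m2 os gn True IH(3) by (simp add: \<Phi>_def)
  next
    case False
    then have "g (Suc n) = g n" using gn by simp
    then show ?thesis unfolding eq using IH by (simp add: \<Phi>_def tilt_def)
  qed
qed (use W in simp)

lemma step_sq_integral:
  assumes "step S h" "grid m g" "S \<subseteq> g ` {..m}"
  shows "cm_norm_sq (\<lambda>s. h s \<omega>) = (\<Sum>j<m. (g (Suc j) - g j) * (norm (h (g (Suc j)) \<omega>))\<^sup>2)"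
proof -
  have "(norm (h s \<omega>))\<^sup>2 = (norm (h (g (Suc j)) \<omega>))\<^sup>2" if "j < m" "s \<in> {g j<..g (Suc j)}" for j s
    using stepD(2)[OF assms that] by metis
  from grid_integral(2)[where \<phi>="\<lambda>s. (norm (h s \<omega>))\<^sup>2", OF assms(2) this]
  show ?thesis
    unfolding cm_norm_sq_eq by (simp add: step_basic(3)[OF assms(1)])
qed

text \<open>The Girsanov density of \<open>h\<close>, times the Fourier exponential of the increment
  over \<open>{a<..b}\<close> of Brownian motion minus the drift of \<open>h\<close>, normalised by
  \<open>exp ((norm l)\<^sup>2 * (b - a) / 2)\<close>.\<close>

definition exp_tilt where
  "exp_tilt S h a b l \<omega> = of_real (exp (step_int S h \<omega> - cm_norm_sq (\<lambda>s. h s \<omega>) / 2 + (norm l)\<^sup>2 * (b - a) / 2)) *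
     cis (l \<bullet> (B b \<omega> - B a \<omega>) - (\<integral>s. indicator {a<..b} s * (l \<bullet> h s \<omega>) \<partial>unit_lborel))"

text \<open>On a grid through \<open>a\<close> and \<open>b\<close> each step lies either inside or
  outside \<open>{a<..b}\<close>, and the frequency \<open>l\<close> is switched on only
  inside.\<close>

lemma exp_tilt_grid:
  assumes h: "step S h" and ab: "0 \<le> a" "a \<le> b" "b \<le> 1"
    and g: "grid m g" "S \<union> {a, b} \<subseteq> g ` {..m}"
  shows "exp_tilt S h a b l \<omega> =
    (\<Prod>j<m. tilt (g (Suc j) - g j) (h (g (Suc j)) \<omega>) (indicator {a<..b} (g (Suc j)) *\<^sub>R l) (B (g (Suc j)) \<omega> - B (g j) \<omega>))"
proof -
  have gS: "S \<subseteq> g ` {..m}" "a \<in> g ` {..m}" "b \<in> g ` {..m}" using g(2) by auto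
  have 1: "(\<Sum>j<m. h (g (Suc j)) \<omega> \<bullet> (B (g (Suc j)) \<omega> - B (g j) \<omega>)) = step_int S h \<omega>"
    using step_int_eq[OF h g(1) gS(1)] by (simp add: grid_int_def)
  have 2: "(\<Sum>j<m. (g (Suc j) - g j) * (norm (indicator {a<..b} (g (Suc j)) *\<^sub>R l))\<^sup>2) = (norm l)\<^sup>2 * (b - a)"
  proof -
    have "(\<Sum>j<m. (g (Suc j) - g j) * (norm (indicator {a<..b} (g (Suc j)) *\<^sub>R l))\<^sup>2) =
      (norm l)\<^sup>2 * (\<Sum>j<m. indicator {a<..b} (g (Suc j)) *\<^sub>R (g (Suc j) - g j))"
      unfolding sum_distrib_left by (intro sum.cong refl) (simp add: indicator_def)
    then show ?thesis using grid_telescope[OF g(1) ab(2) gS(2,3), of "\<lambda>x. x"] by simp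
  qed
  have 3: "(\<Sum>j<m. (indicator {a<..b} (g (Suc j)) *\<^sub>R l) \<bullet> (B (g (Suc j)) \<omega> - B (g j) \<omega>)) = l \<bullet> (B b \<omega> - B a \<omega>)"
    using grid_telescope[OF g(1) ab(2) gS(2,3), of "\<lambda>t. B t \<omega>", symmetric] by (simp add: inner_sum_right)
  have 4: "(\<integral>s. indicator {a<..b} s * (l \<bullet> h s \<omega>) \<partial>unit_lborel) =
      (\<Sum>j<m. (g (Suc j) - g j) * ((indicator {a<..b} (g (Suc j)) *\<^sub>R l) \<bullet> h (g (Suc j)) \<omega>))"
  proof -
    have "indicator {a<..b} s * (l \<bullet> h s \<omega>) = indicator {a<..b} (g (Suc j)) * (l \<bullet> h (g (Suc j)) \<omega>)"
      if j: "j < m" "s \<in> {g j<..g (Suc j)}" for j s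
    proof -
      have "indicator {a<..b} s = (indicator {a<..b} (g (Suc j)) :: real)"
        using grid_le_pred[OF g(1) gS(2) j(1)] grid_le_pred[OF g(1) gS(3) j(1)] j(2)
        by (cases "a < g (Suc j)"; cases "b < g (Suc j)") (auto simp: indicator_def)
      then show ?thesis using stepD(2)[OF h g(1) gS(1) j] by metis
    qed
    from grid_integral(2)[where \<phi>="\<lambda>s. indicator {a<..b} s * (l \<bullet> h s \<omega>)", OF g(1) this]
    show ?thesis by (simp add: step_basic(3)[OF h])
  qed
  show ?thesis
    unfolding prod_tilt exp_tilt_def 1 2 3 4 step_sq_integral[OF h g(1) gS(1)] ..
qed

text \<open>Girsanov's theorem for step processes, in Fourier form. The product is split at the grid
  index \<open>p\<close> of time \<open>a\<close>: the earlier factors carry frequency 0 and form,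
  together with \<open>A\<close>, the weight \<open>W\<close>; the later ones have conditional mean
  1. The value is the mean of \<open>W\<close> for every \<open>l\<close>, in particular for
  0.\<close>

lemma exp_tilt_expectation:
  assumes h: "step S h" and ab: "0 \<le> a" "a \<le> b" "b \<le> 1" and A: "A \<in> sets (F a)"
  shows "integrable M (\<lambda>\<omega>. indicator A \<omega> * exp_tilt S h a b l \<omega>)"
    and "(\<integral>\<omega>. indicator A \<omega> * exp_tilt S h a b l \<omega> \<partial>M) = (\<integral>\<omega>. indicator A \<omega> * exp_tilt S h a b 0 \<omega> \<partial>M)"
    and "integrable M (exp_tilt S h a b l)" "(\<integral>\<omega>. exp_tilt S h a b l \<omega> \<partial>M) = 1"
proof -
  have SS: "finite (S \<union> {a, b})" "S \<union> {a, b} \<subseteq> {0..1}" using step_basic[OF h] ab by auto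
  obtain m g where g: "grid m g" "S \<union> {a, b} \<subseteq> g ` {..m}"
    using grid_exists[OF SS] by blast
  then have gS: "S \<subseteq> g ` {..m}" by auto
  obtain p where p: "p \<le> m" "a = g p" using g(2) by auto
  define \<Phi> where "\<Phi> l j \<omega> = tilt (g (Suc j) - g j) (h (g (Suc j)) \<omega>) (indicator {a<..b} (g (Suc j)) *\<^sub>R l) (B (g (Suc j)) \<omega> - B (g j) \<omega>)" for l j \<omega>
  have E: "exp_tilt S h a b l \<omega> = (\<Prod>j\<in>{0..<m}. \<Phi> l j \<omega>)" for l \<omega>
    using exp_tilt_grid[OF h ab g] by (simp add: \<Phi>_def atLeast0LessThan)
  note ch = tilt_chain_expectation[OF h g(1) gS, where l="\<lambda>j. indicator {a<..b} (g (Suc j)) *\<^sub>R l" for l, folded \<Phi>_def]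
  have c1: "(\<lambda>_. 1 :: complex) \<in> borel_measurable (F (g 0))" "integrable M (\<lambda>_. 1 :: complex)" by auto
  show "integrable M (exp_tilt S h a b l)" "(\<integral>\<omega>. exp_tilt S h a b l \<omega> \<partial>M) = 1"
    using ch[OF _ _ c1, of m] by (simp_all add: E[abs_def] prob_space)
  define W where "W \<omega> = indicator A \<omega> * (\<Prod>j\<in>{0..<p}. \<Phi> 0 j \<omega>)" for \<omega>
  have \<Phi>0: "\<Phi> l j \<omega> = \<Phi> 0 j \<omega>" if "j < p" for l j \<omega>
    using grid_mono[OF g(1), of "Suc j" p] that p by (simp add: \<Phi>_def)
  have W: "W \<in> borel_measurable (F (g p))" "integrable M W"
  proof -
    have pm: "(\<lambda>\<omega>. \<Prod>j\<in>{0..<p}. \<Phi> 0 j \<omega>) \<in> borel_measurable (F (g p))" "integrable M (\<lambda>\<omega>. \<Prod>j\<in>{0..<p}. \<Phi> 0 j \<omega>)"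
      using ch[OF _ _ c1, of p] p by simp_all
    have [measurable]: "A \<in> sets (F (g p))" "A \<in> sets M" using A p sets_F_subset[of a] by auto
    show "W \<in> borel_measurable (F (g p))"
      unfolding W_def[abs_def] using pm(1) by measurable
    show "integrable M W"
      unfolding W_def[abs_def] by (rule integrable_mult_bounded(2)[OF pm(2), where K=1]) (auto simp: indicator_def)
  qed
  have WE: "indicator A \<omega> * exp_tilt S h a b l \<omega> = W \<omega> * (\<Prod>j\<in>{p..<m}. \<Phi> l j \<omega>)" for l \<omega>
  proof -
    have "(\<Prod>j\<in>{0..<m}. \<Phi> l j \<omega>) = (\<Prod>j\<in>{0..<p}. \<Phi> l j \<omega>) * (\<Prod>j\<in>{p..<m}. \<Phi> l j \<omega>)"
      using p by (simp add: prod.atLeastLessThan_concat)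
    also have "(\<Prod>j\<in>{0..<p}. \<Phi> l j \<omega>) = (\<Prod>j\<in>{0..<p}. \<Phi> 0 j \<omega>)"
      by (intro prod.cong refl \<Phi>0) auto
    finally show ?thesis by (simp add: E W_def mult.assoc)
  qed
  have c2: "integrable M (\<lambda>\<omega>. indicator A \<omega> * exp_tilt S h a b l \<omega>)"
     "(\<integral>\<omega>. indicator A \<omega> * exp_tilt S h a b l \<omega> \<partial>M) = (\<integral>\<omega>. W \<omega> \<partial>M)" for l
    unfolding WE using ch[OF p(1) order_refl W] by simp_all
  show "integrable M (\<lambda>\<omega>. indicator A \<omega> * exp_tilt S h a b l \<omega>)"
    "(\<integral>\<omega>. indicator A \<omega> * exp_tilt S h a b l \<omega> \<partial>M) = (\<integral>\<omega>. indicator A \<omega> * exp_tilt S h a b 0 \<omega> \<partial>M)"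
    using c2 by simp_all
qed

text \<open>The stochastic exponential at time 1. The integral is a separate argument
  \<open>I\<close>, because it is determined by \<open>H\<close> only through a limit in
  probability.\<close>

definition dexp :: "('a \<Rightarrow> real) \<Rightarrow> (real \<Rightarrow> 'a \<Rightarrow> real^'d) \<Rightarrow> 'a \<Rightarrow> real" where
  "dexp I H \<omega> = exp (I \<omega> - cm_norm_sq (\<lambda>s. H s \<omega>) / 2)"

lemma step_exp_expectation:
  assumes "step S h"
  shows "integrable M (dexp (step_int S h) h)" "(\<integral>\<omega>. dexp (step_int S h) h \<omega> \<partial>M) = 1"
proof -
  have e: "exp_tilt S h 0 0 0 = (\<lambda>\<omega>. of_real (dexp (step_int S h) h \<omega>))"
    by (simp add: exp_tilt_def fun_eq_iff dexp_def)
  note t = exp_tilt_expectation(3,4)[OF assms, of 0 0 "{}" 0, unfolded e]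
  show "integrable M (dexp (step_int S h) h)"
    using t(1) by (simp add: complex_of_real_integrable_eq)
  have "complex_of_real (\<integral>\<omega>. dexp (step_int S h) h \<omega> \<partial>M) = 1"
    using t(2) unfolding integral_complex_of_real by simp
  then show "(\<integral>\<omega>. dexp (step_int S h) h \<omega> \<partial>M) = 1"
    unfolding of_real_eq_1_iff .
qed

end

section \<open>Convergence in probability and in mean square\<close>

text \<open>Pointwise, \<open>2 * u * v \<le> e * u\<^sup>2 + v\<^sup>2 / e\<close> with
  \<open>e = sqrt d\<close>. For fixed \<open>k\<close> the resulting bound tends to 0 with
  \<open>d\<close>.\<close>

lemma inner_integral_bound:
  fixes k g :: "'s \<Rightarrow> 'v::euclidean_space"
  assumes [measurable]: "k \<in> borel_measurable N" "g \<in> borel_measurable N"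
    and k: "integrable N (\<lambda>s. (norm (k s))\<^sup>2)" and g: "integrable N (\<lambda>s. (norm (g s))\<^sup>2)"
    and d: "(\<integral>s. (norm (g s))\<^sup>2 \<partial>N) \<le> d" "d > 0"
  shows "integrable N (\<lambda>s. k s \<bullet> g s)"
    and "\<bar>\<integral>s. k s \<bullet> g s \<partial>N\<bar> \<le> sqrt d * ((\<integral>s. (norm (k s))\<^sup>2 \<partial>N) + 1) / 2"
proof -
  let ?b = "\<lambda>s. sqrt d * (norm (k s))\<^sup>2 / 2 + (norm (g s))\<^sup>2 / (2 * sqrt d)"
  have b: "\<bar>k s \<bullet> g s\<bar> \<le> ?b s" for s
  proof -
    have "0 \<le> (sqrt d * norm (k s) - norm (g s))\<^sup>2" by simp
    then have "2 * (sqrt d * norm (k s) * norm (g s)) \<le> (sqrt d)\<^sup>2 * (norm (k s))\<^sup>2 + (norm (g s))\<^sup>2"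
      by (simp add: power2_diff power_mult_distrib del: real_sqrt_pow2_iff real_sqrt_pow2)
    moreover have "u * v \<le> e * u\<^sup>2 / 2 + v\<^sup>2 / (2 * e)" if "2 * (e * u * v) \<le> e\<^sup>2 * u\<^sup>2 + v\<^sup>2" "e > 0" for e u v :: real
      using that by (simp add: field_simps power2_eq_square)
    ultimately have "norm (k s) * norm (g s) \<le> ?b s"
      using d(2) by simp
    then show ?thesis using Cauchy_Schwarz_ineq2[of "k s" "g s"] by linarith
  qed
  have bi: "integrable N ?b" using k g by simp
  show i: "integrable N (\<lambda>s. k s \<bullet> g s)"
    by (rule Bochner_Integration.integrable_bound[OF bi]) (use b in \<open>auto intro!: AE_I2 order_trans[OF b abs_ge_self]\<close>)
  have "\<bar>\<integral>s. k s \<bullet> g s \<partial>N\<bar> \<le> (\<integral>s. ?b s \<partial>N)"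
    by (rule order_trans[OF integral_abs_bound integral_mono[OF integrable_abs[OF i] bi b]])
  also have "\<dots> = sqrt d * (\<integral>s. (norm (k s))\<^sup>2 \<partial>N) / 2 + (\<integral>s. (norm (g s))\<^sup>2 \<partial>N) / (2 * sqrt d)"
    using k g by simp
  also have "(\<integral>s. (norm (g s))\<^sup>2 \<partial>N) / (2 * sqrt d) \<le> d / (2 * sqrt d)"
    using d by (intro divide_right_mono) auto
  also have "d / (2 * sqrt d) = sqrt d / 2" using d(2) by (simp add: field_simps)
  finally show "\<bar>\<integral>s. k s \<bullet> g s \<partial>N\<bar> \<le> sqrt d * ((\<integral>s. (norm (k s))\<^sup>2 \<partial>N) + 1) / 2"
    by (simp add: field_simps)
qed

lemma norm_add_sq_le: "(norm (x + y))\<^sup>2 \<le> 2 * (norm x)\<^sup>2 + 2 * (norm y)\<^sup>2" for x y :: "'v::real_normed_vector"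
proof -
  have "(norm (x + y))\<^sup>2 \<le> (norm x + norm y)\<^sup>2" by (intro power_mono norm_triangle_ineq) auto
  also have "\<dots> \<le> 2 * (norm x)\<^sup>2 + 2 * (norm y)\<^sup>2"
    using sum_squares_ge_zero[of "norm x - norm y" 0] by (simp add: power2_eq_square algebra_simps)
  finally show ?thesis .
qed

text \<open>The distances are extended integrals, so square integrability of \<open>g\<close> has to
  be recovered first, from one index with distance below 1. The last conclusion is weak convergence;
  convergence of the norms follows from it, with \<open>k = g\<close>, by expanding the
  square.\<close>

lemma L2_limit:
  fixes f :: "nat \<Rightarrow> 's \<Rightarrow> 'v::euclidean_space"
  assumes [measurable]: "\<And>n. f n \<in> borel_measurable N" "g \<in> borel_measurable N"
    and f: "\<And>n. integrable N (\<lambda>s. (norm (f n s))\<^sup>2)"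
    and lim: "(\<lambda>n. \<integral>\<^sup>+s. ennreal ((norm (f n s - g s))\<^sup>2) \<partial>N) \<longlonglongrightarrow> 0"
  shows "integrable N (\<lambda>s. (norm (g s))\<^sup>2)"
    and "\<And>n. integrable N (\<lambda>s. (norm (f n s - g s))\<^sup>2)"
    and "(\<lambda>n. \<integral>s. (norm (f n s - g s))\<^sup>2 \<partial>N) \<longlonglongrightarrow> 0"
    and "(\<lambda>n. \<integral>s. (norm (f n s))\<^sup>2 \<partial>N) \<longlonglongrightarrow> (\<integral>s. (norm (g s))\<^sup>2 \<partial>N)"
    and "\<And>k. k \<in> borel_measurable N \<Longrightarrow> integrable N (\<lambda>s. (norm (k s))\<^sup>2) \<Longrightarrow>
       (\<lambda>n. \<integral>s. k s \<bullet> f n s \<partial>N) \<longlonglongrightarrow> (\<integral>s. k s \<bullet> g s \<partial>N)"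
proof -
  have "eventually (\<lambda>n. (\<integral>\<^sup>+s. ennreal ((norm (f n s - g s))\<^sup>2) \<partial>N) < 1) sequentially"
    by (rule order_tendstoD(2)[OF lim]) simp
  then obtain n0 where "(\<integral>\<^sup>+s. ennreal ((norm (f n0 s - g s))\<^sup>2) \<partial>N) < 1" by (auto simp: eventually_sequentially)
  then have i0: "integrable N (\<lambda>s. (norm (f n0 s - g s))\<^sup>2)"
    by (intro integrableI_nonneg) (auto intro: less_trans)
  show ig: "integrable N (\<lambda>s. (norm (g s))\<^sup>2)"
  proof (rule Bochner_Integration.integrable_bound)
    show "integrable N (\<lambda>s. 2 * (norm (f n0 s))\<^sup>2 + 2 * (norm (f n0 s - g s))\<^sup>2)" using i0 f by simp
    show "AE s in N. norm ((norm (g s))\<^sup>2) \<le> norm (2 * (norm (f n0 s))\<^sup>2 + 2 * (norm (f n0 s - g s))\<^sup>2)"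
      using norm_add_sq_le[of "f n0 s" "- (f n0 s - g s)" for s] by (intro AE_I2) (simp add: norm_minus_commute)
  qed simp
  show id: "integrable N (\<lambda>s. (norm (f n s - g s))\<^sup>2)" for n
  proof (rule Bochner_Integration.integrable_bound)
    show "integrable N (\<lambda>s. 2 * (norm (f n s))\<^sup>2 + 2 * (norm (g s))\<^sup>2)" using ig f by simp
    show "AE s in N. norm ((norm (f n s - g s))\<^sup>2) \<le> norm (2 * (norm (f n s))\<^sup>2 + 2 * (norm (g s))\<^sup>2)"
      using norm_add_sq_le[of "f n s" "- g s" for s] by (intro AE_I2) simp
  qed simp
  let ?D = "\<lambda>n. \<integral>s. (norm (f n s - g s))\<^sup>2 \<partial>N"
  have D0: "0 \<le> ?D n" for n by simp
  have "(\<lambda>n. ennreal (?D n)) \<longlonglongrightarrow> ennreal 0"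
    using lim by (subst (asm) nn_integral_eq_integral[OF id]) auto
  then show D: "?D \<longlonglongrightarrow> 0" by (subst (asm) tendsto_ennreal_iff) auto
  show K: "(\<lambda>n. \<integral>s. k s \<bullet> f n s \<partial>N) \<longlonglongrightarrow> (\<integral>s. k s \<bullet> g s \<partial>N)"
    if [measurable]: "k \<in> borel_measurable N" and k: "integrable N (\<lambda>s. (norm (k s))\<^sup>2)" for k
  proof -
    let ?d = "\<lambda>n. ?D n + inverse (real (Suc n))"
    have dpos: "?d n > 0" for n using D0[of n] by (intro add_nonneg_pos) auto
    have kf: "integrable N (\<lambda>s. k s \<bullet> f n s)" for n
      by (rule inner_integral_bound(1)[OF _ _ k f[of n], of "(\<integral>s. (norm (f n s))\<^sup>2 \<partial>N) + 1"]) (auto simp: add_nonneg_pos)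
    have kg: "integrable N (\<lambda>s. k s \<bullet> g s)"
      by (rule inner_integral_bound(1)[OF _ _ k ig, of "(\<integral>s. (norm (g s))\<^sup>2 \<partial>N) + 1"]) (auto simp: add_nonneg_pos)
    have bd: "norm ((\<integral>s. k s \<bullet> f n s \<partial>N) - (\<integral>s. k s \<bullet> g s \<partial>N)) \<le> sqrt (?d n) * ((\<integral>s. (norm (k s))\<^sup>2 \<partial>N) + 1) / 2" for n
      using inner_integral_bound(2)[OF _ _ k id[of n], of "?d n"] dpos[of n] kf[of n] kg
      by (simp add: inner_diff_right)
    have "(\<lambda>n. sqrt (?d n) * ((\<integral>s. (norm (k s))\<^sup>2 \<partial>N) + 1) / 2) \<longlonglongrightarrow> sqrt (0 + 0) * ((\<integral>s. (norm (k s))\<^sup>2 \<partial>N) + 1) / 2"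
      by (intro tendsto_intros D LIMSEQ_inverse_real_of_nat) auto
    then have z: "(\<lambda>n. sqrt (?d n) * ((\<integral>s. (norm (k s))\<^sup>2 \<partial>N) + 1) / 2) \<longlonglongrightarrow> 0" by simp
    have "(\<lambda>n. (\<integral>s. k s \<bullet> f n s \<partial>N) - (\<integral>s. k s \<bullet> g s \<partial>N)) \<longlonglongrightarrow> 0"
      by (rule Lim_null_comparison[OF always_eventually z]) (intro allI bd)
    then show ?thesis by (rule LIM_zero_cancel)
  qed
  have gf: "integrable N (\<lambda>s. g s \<bullet> f n s)" for n
    by (rule inner_integral_bound(1)[OF _ _ ig f[of n], of "(\<integral>s. (norm (f n s))\<^sup>2 \<partial>N) + 1"]) (auto simp: add_nonneg_pos)
  have "(\<integral>s. (norm (f n s))\<^sup>2 \<partial>N) = ?D n + 2 * (\<integral>s. g s \<bullet> f n s \<partial>N) - (\<integral>s. (norm (g s))\<^sup>2 \<partial>N)" for n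
  proof -
    have "(norm (f n s))\<^sup>2 = (norm (f n s - g s))\<^sup>2 + 2 * (g s \<bullet> f n s) - (norm (g s))\<^sup>2" for s
      by (simp add: power2_norm_eq_inner inner_diff_left inner_diff_right inner_commute)
    then show ?thesis using id[of n] ig gf[of n] by simp
  qed
  moreover have "(\<lambda>n. ?D n + 2 * (\<integral>s. g s \<bullet> f n s \<partial>N) - (\<integral>s. (norm (g s))\<^sup>2 \<partial>N)) \<longlonglongrightarrow>
     0 + 2 * (\<integral>s. g s \<bullet> g s \<partial>N) - (\<integral>s. (norm (g s))\<^sup>2 \<partial>N)"
    by (intro tendsto_intros D K ig) simp
  ultimately show "(\<lambda>n. \<integral>s. (norm (f n s))\<^sup>2 \<partial>N) \<longlonglongrightarrow> (\<integral>s. (norm (g s))\<^sup>2 \<partial>N)"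
    by (simp add: power2_norm_eq_inner)
qed

section \<open>Almost surely convergent subsequences\<close>

lemma fast_subseq:
  assumes "\<And>i. \<exists>N. \<forall>n\<ge>N. P i n"
  obtains r :: "nat \<Rightarrow> nat" where "strict_mono r" "\<And>i n. n \<ge> r i \<Longrightarrow> P i n"
proof -
  obtain N where N: "\<And>i n. n \<ge> N i \<Longrightarrow> P i n" using assms by metis
  define r where "r i = i + (\<Sum>j\<le>i. N j)" for i
  have "strict_mono r" by (auto simp: strict_mono_Suc_iff r_def)
  moreover have "N i \<le> r i" for i unfolding r_def by (intro trans_le_add2 member_le_sum) auto
  ultimately show ?thesis using that N by (meson order_trans)
qed

context prob_space begin

lemma borel_cantelli_half:
  assumes "\<And>i::nat. E i \<in> events" "\<And>i. prob (E i) \<le> (1/2)^i"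
  shows "AE \<omega> in M. eventually (\<lambda>i. \<omega> \<notin> E i) sequentially"
proof -
  have "summable (\<lambda>i. prob (E i))"
    by (rule summable_comparison_test'[OF summable_geometric[of "1/2::real"]]) (use assms in auto)
  then have "AE \<omega> in M. eventually (\<lambda>i. \<omega> \<in> space M - E i) sequentially"
    using assms by (intro borel_cantelli_AE1) (auto simp: emeasure_eq_measure)
  then show ?thesis by (auto elim!: eventually_mono)
qed

text \<open>Borel-Cantelli, with \<open>(1/2)^i\<close> both as threshold and as bound for the
  probability.\<close>

lemma null_in_prob_subseq:
  assumes [measurable]: "\<And>n. D n \<in> borel_measurable M" and "null_in_prob M D"
  obtains r :: "nat \<Rightarrow> nat" where "strict_mono r" "AE \<omega> in M. (\<lambda>n. D (r n) \<omega>) \<longlonglongrightarrow> 0"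
proof -
  have "\<exists>N. \<forall>n\<ge>N. prob {\<omega>\<in>space M. ennreal ((1/2)^i) < D n \<omega>} \<le> (1/2)^i" for i :: nat
  proof -
    have "(\<lambda>n. prob {\<omega>\<in>space M. ennreal ((1/2)^i) < D n \<omega>}) \<longlonglongrightarrow> 0"
      using assms(2) by (simp add: null_in_prob_def)
    then have "eventually (\<lambda>n. prob {\<omega>\<in>space M. ennreal ((1/2)^i) < D n \<omega>} < (1/2)^i) sequentially"
      by (rule order_tendstoD) simp
    then show ?thesis unfolding eventually_sequentially by (meson less_imp_le)
  qed
  then obtain r :: "nat \<Rightarrow> nat" where r: "strict_mono r" "\<And>i n. n \<ge> r i \<Longrightarrow> prob {\<omega>\<in>space M. ennreal ((1/2)^i) < D n \<omega>} \<le> (1/2)^i"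
    using fast_subseq[of "\<lambda>i n. prob {\<omega>\<in>space M. ennreal ((1/2)^i) < D n \<omega>} \<le> (1/2)^i"] by blast
  have "AE \<omega> in M. eventually (\<lambda>i. \<omega> \<notin> {\<omega>\<in>space M. ennreal ((1/2)^i) < D (r i) \<omega>}) sequentially"
    by (rule borel_cantelli_half) (use r(2) in auto)
  then have "AE \<omega> in M. (\<lambda>n. D (r n) \<omega>) \<longlonglongrightarrow> 0"
    using AE_space
  proof eventually_elim
    case (elim \<omega>)
    have g: "(\<lambda>i. ennreal ((1/2)^i)) \<longlonglongrightarrow> 0"
      using tendsto_ennrealI[OF LIMSEQ_power_zero[of "1/2::real"]] by simp
    have "eventually (\<lambda>i. D (r i) \<omega> \<le> ennreal ((1/2)^i)) sequentially"
      using elim(1) by eventually_elim (use elim(2) in \<open>auto simp: not_less\<close>)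
    then show ?case
      by (intro tendsto_sandwich[OF _ _ tendsto_const g]) auto
  qed
  then show ?thesis using r(1) that by blast
qed

lemma null_in_prob_AE:
  assumes [measurable]: "\<And>n. D n \<in> borel_measurable M" and "AE \<omega> in M. (\<lambda>n. D n \<omega>) \<longlonglongrightarrow> 0"
  shows "null_in_prob M D"
  unfolding null_in_prob_def
proof (intro allI impI)
  fix \<epsilon> :: real assume "\<epsilon> > 0"
  have "(\<lambda>n. \<integral>\<omega>. indicator {\<omega>\<in>space M. ennreal \<epsilon> < D n \<omega>} \<omega> \<partial>M) \<longlonglongrightarrow> (\<integral>\<omega>. (0::real) \<partial>M)"
  proof (rule integral_dominated_convergence[where w="\<lambda>_. 1"])
    show "AE \<omega> in M. (\<lambda>n. indicator {\<omega>\<in>space M. ennreal \<epsilon> < D n \<omega>} \<omega> :: real) \<longlonglongrightarrow> 0"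
      using assms(2)
    proof eventually_elim
      case (elim \<omega>)
      then have "eventually (\<lambda>n. D n \<omega> < ennreal \<epsilon>) sequentially"
        by (rule order_tendstoD) (use \<open>\<epsilon> > 0\<close> in simp)
      then have "eventually (\<lambda>n. indicator {\<omega>\<in>space M. ennreal \<epsilon> < D n \<omega>} \<omega> = (0::real)) sequentially"
        by eventually_elim (auto simp: indicator_def)
      then show ?case by (rule tendsto_eventually)
    qed
  qed auto
  then show "(\<lambda>n. prob {\<omega> \<in> space M. ennreal \<epsilon> < D n \<omega>}) \<longlonglongrightarrow> 0" by simp
qed

text \<open>Along a fast subsequence the consecutive differences are eventually below
  \<open>(1/2)^i\<close>, almost surely, so the telescoping series converges absolutely. Defining
  \<open>Y\<close> by \<open>lim\<close> at every point keeps it measurable.\<close>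

lemma cauchy_in_prob_subseq:
  assumes [measurable]: "\<And>n. X n \<in> borel_measurable M"
    and c: "\<And>\<epsilon>. \<epsilon> > 0 \<Longrightarrow> \<exists>N. \<forall>n\<ge>N. \<forall>m\<ge>N. prob {\<omega>\<in>space M. \<epsilon> < \<bar>X n \<omega> - X m \<omega>\<bar>} \<le> \<epsilon>"
  obtains r :: "nat \<Rightarrow> nat" and Y :: "'a \<Rightarrow> real" where "strict_mono r" "Y \<in> borel_measurable M"
    "AE \<omega> in M. (\<lambda>n. X (r n) \<omega>) \<longlonglongrightarrow> Y \<omega>"
proof -
  have "\<exists>N. \<forall>n\<ge>N. \<forall>m\<ge>n. prob {\<omega>\<in>space M. (1/2)^i < \<bar>X n \<omega> - X m \<omega>\<bar>} \<le> (1/2)^i" for i :: nat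
    using c[of "(1/2)^i"] by (meson order_trans zero_less_divide_1_iff zero_less_numeral zero_less_power)
  then obtain r :: "nat \<Rightarrow> nat" where r: "strict_mono r"
      "\<And>i n. n \<ge> r i \<Longrightarrow> \<forall>m\<ge>n. prob {\<omega>\<in>space M. (1/2)^i < \<bar>X n \<omega> - X m \<omega>\<bar>} \<le> (1/2)^i"
    using fast_subseq[of "\<lambda>i n. \<forall>m\<ge>n. prob {\<omega>\<in>space M. (1/2)^i < \<bar>X n \<omega> - X m \<omega>\<bar>} \<le> (1/2)^i"] by blast
  define Y where "Y \<omega> = lim (\<lambda>n. X (r n) \<omega>)" for \<omega>
  have "AE \<omega> in M. eventually (\<lambda>i. \<omega> \<notin> {\<omega>\<in>space M. (1/2)^i < \<bar>X (r i) \<omega> - X (r (Suc i)) \<omega>\<bar>}) sequentially"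
    by (rule borel_cantelli_half) (use r in \<open>auto simp: strict_mono_leD\<close>)
  then have "AE \<omega> in M. (\<lambda>n. X (r n) \<omega>) \<longlonglongrightarrow> Y \<omega>"
    using AE_space
  proof eventually_elim
    case (elim \<omega>)
    have "eventually (\<lambda>i. norm (X (r (Suc i)) \<omega> - X (r i) \<omega>) \<le> (1/2)^i) sequentially"
      using elim(1) by eventually_elim (use elim(2) in \<open>auto simp: not_less abs_minus_commute\<close>)
    then have "summable (\<lambda>i. X (r (Suc i)) \<omega> - X (r i) \<omega>)"
      by (rule summable_comparison_test_ev) (simp add: summable_geometric)
    then have "convergent (\<lambda>n. \<Sum>i<n. X (r (Suc i)) \<omega> - X (r i) \<omega>)" by (simp add: summable_iff_convergent)
    then have "convergent (\<lambda>n. X (r n) \<omega> - X (r 0) \<omega>)" by (simp add: sum_lessThan_telescope[of "\<lambda>i. X (r i) \<omega>"])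
    then have "convergent (\<lambda>n. X (r n) \<omega>)" by (simp add: convergent_diff_const_right_iff)
    then show ?case by (simp add: Y_def convergent_LIMSEQ_iff)
  qed
  moreover have "Y \<in> borel_measurable M" unfolding Y_def[abs_def] by (rule borel_measurable_lim_metric) simp
  ultimately show ?thesis using r(1) that by blast
qed

end

section \<open>Radial truncation and exponential tail bounds\<close>

text \<open>For \<open>K > 0\<close> this is the radial projection onto the ball of radius
  \<open>K\<close>. The result is a scalar multiple of \<open>x\<close>, so truncation keeps values
  in the kernel of a matrix.\<close>

definition trunc :: "real \<Rightarrow> 'v::euclidean_space \<Rightarrow> 'v" where
  "trunc K x = (K / max K (norm x)) *\<^sub>R x"

lemma trunc_measurable [measurable]: "trunc K \<in> borel_measurable borel"
  unfolding trunc_def[abs_def] by measurable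

lemma trunc_0 [simp]: "trunc K 0 = 0"
  by (simp add: trunc_def)

lemma norm_trunc_le: "K > 0 \<Longrightarrow> norm (trunc K x) \<le> K"
  by (auto simp: trunc_def field_simps max_def)

lemma norm_trunc_le_norm: "K > 0 \<Longrightarrow> norm (trunc K x) \<le> norm x"
  by (auto simp: trunc_def field_simps max_def intro: mult_right_mono)

lemma trunc_eq: "K > 0 \<Longrightarrow> norm x \<le> K \<Longrightarrow> trunc K x = x"
  by (simp add: trunc_def max_def)

text \<open>One copy of \<open>norm (x - y)\<close> comes from scaling \<open>x - y\<close> by a
  factor at most 1, the other from the difference of the two scaling factors.\<close>

lemma trunc_lipschitz:
  assumes "K > 0"
  shows "norm (trunc K x - trunc K y) \<le> 2 * norm (x - y)"
proof -
  let ?a = "max K (norm x)" and ?b = "max K (norm y)"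
  have ab: "?a > 0" "?b > 0" "K \<le> ?a" "norm y \<le> ?b" using assms by auto
  have "trunc K x - trunc K y = (K / ?a) *\<^sub>R (x - y) + (K / ?a - K / ?b) *\<^sub>R y"
    by (simp add: trunc_def algebra_simps)
  also have "norm \<dots> \<le> (K / ?a) * norm (x - y) + \<bar>K / ?a - K / ?b\<bar> * norm y"
    using assms ab by (intro norm_triangle_le) (auto simp: abs_of_pos)
  also have "(K / ?a) * norm (x - y) \<le> norm (x - y)"
    using ab assms by (intro mult_left_le_one_le) auto
  also have "K / ?a - K / ?b = (K / ?a) * ((?b - ?a) / ?b)"
    using ab by (simp add: divide_simps right_diff_distrib)
  also have "\<bar>(K / ?a) * ((?b - ?a) / ?b)\<bar> * norm y = (K / ?a) * (norm y / ?b) * \<bar>?b - ?a\<bar>"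
    using ab assms by (simp add: abs_mult)
  also have "\<dots> \<le> 1 * \<bar>?b - ?a\<bar>"
    using ab assms by (intro mult_right_mono mult_le_one) auto
  also have "\<bar>?b - ?a\<bar> \<le> norm (x - y)"
    using norm_triangle_ineq3[of x y] by (auto simp: max_def abs_if split: if_splits)
  finally show ?thesis by simp
qed

lemma tendsto_0_le_ennreal:
  assumes "\<And>n. X n \<le> b n" "b \<longlonglongrightarrow> 0"
  shows "X \<longlonglongrightarrow> (0::ennreal)"
  by (rule tendsto_sandwich[OF _ _ tendsto_const assms(2)]) (use assms(1) in auto)

context prob_space begin

text \<open>The exponential Chebyshev bound at \<open>\<lambda> = \<epsilon> / \<delta>\<close> on the event \<open>V \<le> \<delta>\<close>.\<close>

lemma exp_tail:
  assumes [measurable]: "X \<in> borel_measurable M" "V \<in> borel_measurable M"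
    and e: "\<And>l::real. (\<integral>\<^sup>+\<omega>. ennreal (exp (l * X \<omega> - l\<^sup>2 * V \<omega> / 2)) \<partial>M) \<le> 1"
    and pos: "\<epsilon> > 0" "\<delta> > 0"
  shows "prob {\<omega>\<in>space M. \<epsilon> < \<bar>X \<omega>\<bar>} \<le> prob {\<omega>\<in>space M. \<delta> < V \<omega>} + 2 * exp (- (\<epsilon>\<^sup>2 / (2 * \<delta>)))"
proof -
  let ?c = "exp (- (\<epsilon>\<^sup>2 / (2 * \<delta>)))" and ?Z = "\<lambda>l \<omega>. exp (l * X \<omega> - l\<^sup>2 * V \<omega> / 2)"
  let ?E = "\<lambda>l. {\<omega>\<in>space M. 1 \<le> ennreal ?c * ennreal (?Z l \<omega>)}"
  have mk: "prob (?E l) \<le> ?c" for l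
  proof -
    have "emeasure M (?E l) \<le> ennreal ?c * (\<integral>\<^sup>+\<omega>. ennreal (?Z l \<omega>) * indicator (space M) \<omega> \<partial>M)"
      by (rule nn_integral_Markov_inequality) auto
    also have "\<dots> \<le> ennreal ?c * 1"
      using e[of l] by (intro mult_left_mono) (auto cong: nn_integral_cong)
    finally show ?thesis by (simp add: emeasure_eq_measure)
  qed
  \<comment> \<open>For \<open>l = \<epsilon> / \<delta>\<close> and
    \<open>l = - (\<epsilon> / \<delta>)\<close> the second condition reads
    \<open>\<epsilon> < X \<omega>\<close> and \<open>\<epsilon> < - X \<omega>\<close>.\<close>
  have in_E: "1 \<le> ?c * ?Z l \<omega>" if "V \<omega> \<le> \<delta>" "\<epsilon> < (l * X \<omega>) * \<delta> / \<epsilon>" "l\<^sup>2 = (\<epsilon> / \<delta>)\<^sup>2" for l \<omega>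
  proof -
    have "\<epsilon>\<^sup>2 / \<delta> \<le> l * X \<omega>" using that(2) pos by (simp add: field_simps power2_eq_square)
    moreover have "l\<^sup>2 * V \<omega> / 2 \<le> \<epsilon>\<^sup>2 / (2 * \<delta>)"
    proof -
      have "l\<^sup>2 * V \<omega> \<le> (\<epsilon> / \<delta>)\<^sup>2 * \<delta>" unfolding that(3) using that(1) by (intro mult_left_mono) auto
      also have "\<dots> = \<epsilon>\<^sup>2 / \<delta>" using pos by (simp add: power2_eq_square field_simps)
      finally show ?thesis by simp
    qed
    ultimately have "0 \<le> - (\<epsilon>\<^sup>2 / (2 * \<delta>)) + (l * X \<omega> - l\<^sup>2 * V \<omega> / 2)" by (simp add: field_simps)
    then show ?thesis unfolding mult_exp_exp by simp
  qed
  have "{\<omega>\<in>space M. \<epsilon> < \<bar>X \<omega>\<bar>} \<subseteq> {\<omega>\<in>space M. \<delta> < V \<omega>} \<union> (?E (\<epsilon> / \<delta>) \<union> ?E (- (\<epsilon> / \<delta>)))"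
  proof
    fix \<omega> assume "\<omega> \<in> {\<omega>\<in>space M. \<epsilon> < \<bar>X \<omega>\<bar>}"
    then have w: "\<omega> \<in> space M" "\<epsilon> < X \<omega> \<or> \<epsilon> < - X \<omega>" by auto
    show "\<omega> \<in> {\<omega>\<in>space M. \<delta> < V \<omega>} \<union> (?E (\<epsilon> / \<delta>) \<union> ?E (- (\<epsilon> / \<delta>)))"
      using w in_E[of \<omega> "\<epsilon> / \<delta>"] in_E[of \<omega> "- (\<epsilon> / \<delta>)"] pos
      by (auto simp: not_less power2_minus simp flip: ennreal_mult)
  qed
  then have "prob {\<omega>\<in>space M. \<epsilon> < \<bar>X \<omega>\<bar>} \<le> prob ({\<omega>\<in>space M. \<delta> < V \<omega>} \<union> (?E (\<epsilon> / \<delta>) \<union> ?E (- (\<epsilon> / \<delta>))))"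
    by (intro finite_measure_mono) auto
  also have "\<dots> \<le> prob {\<omega>\<in>space M. \<delta> < V \<omega>} + (prob (?E (\<epsilon> / \<delta>)) + prob (?E (- (\<epsilon> / \<delta>))))"
    by (intro order_trans[OF measure_Un_le] add_left_mono measure_Un_le) auto
  also have "\<dots> \<le> prob {\<omega>\<in>space M. \<delta> < V \<omega>} + (?c + ?c)"
    by (intro add_left_mono add_mono mk)
  finally show ?thesis by simp
qed

lemma small_tail:
  assumes "\<epsilon> > 0" "\<eta> > 0"
  obtains \<delta> :: real where "\<delta> > 0" "2 * exp (- (\<epsilon>\<^sup>2 / (2 * \<delta>))) < \<eta>"
proof -
  have "((\<lambda>\<delta>. 2 * exp (- (\<epsilon>\<^sup>2 / (2 * \<delta>)))) \<longlongrightarrow> 0) (at_right 0)"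
    using assms(1) by real_asymp
  then have "eventually (\<lambda>\<delta>. 2 * exp (- (\<epsilon>\<^sup>2 / (2 * \<delta>))) < \<eta>) (at_right 0)"
    by (rule order_tendstoD) (rule assms(2))
  then have "eventually (\<lambda>\<delta>. \<delta> > 0 \<and> 2 * exp (- (\<epsilon>\<^sup>2 / (2 * \<delta>))) < \<eta>) (at_right 0)"
    using eventually_at_right_less[of "0::real"] by eventually_elim simp
  then show ?thesis using that eventually_happens'[OF trivial_limit_at_right_real] by blast
qed

lemma AE_tendsto_prob:
  fixes V :: "nat \<Rightarrow> 'a \<Rightarrow> real"
  assumes [measurable]: "\<And>n. V n \<in> borel_measurable M" and "AE \<omega> in M. (\<lambda>n. V n \<omega>) \<longlonglongrightarrow> 0" "\<delta> > 0"
  shows "(\<lambda>n. prob {\<omega>\<in>space M. \<delta> < V n \<omega>}) \<longlonglongrightarrow> 0"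
proof -
  have "AE \<omega> in M. (\<lambda>n. ennreal (V n \<omega>)) \<longlonglongrightarrow> 0"
    using assms(2) by eventually_elim (metis ennreal_0 tendsto_ennrealI)
  then have "null_in_prob M (\<lambda>n \<omega>. ennreal (V n \<omega>))"
    by (intro null_in_prob_AE) auto
  then show ?thesis using assms(3) unfolding null_in_prob_def by (auto simp: ennreal_less_iff)
qed

text \<open>Takes the place of the Ito isometry: in the applications \<open>X n\<close> is a
  stochastic integral and \<open>V n\<close> the square norm of its integrand, and \<open>e\<close>
  holds because exponentials have mean at most 1. Almost sure convergence of \<open>V n\<close>,
  without moment bounds, makes the integrals small.\<close>

lemma exp_tail_null:
  assumes [measurable]: "\<And>n. X n \<in> borel_measurable M" "\<And>n. V n \<in> borel_measurable M"
    and e: "\<And>n l::real. (\<integral>\<^sup>+\<omega>. ennreal (exp (l * X n \<omega> - l\<^sup>2 * V n \<omega> / 2)) \<partial>M) \<le> 1"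
    and V: "AE \<omega> in M. (\<lambda>n. V n \<omega>) \<longlonglongrightarrow> 0"
  shows "null_in_prob M (\<lambda>n \<omega>. ennreal \<bar>X n \<omega>\<bar>)"
  unfolding null_in_prob_def
proof (intro allI impI)
  fix \<epsilon> :: real assume \<epsilon>: "\<epsilon> > 0"
  have "(\<lambda>n. prob {\<omega>\<in>space M. \<epsilon> < \<bar>X n \<omega>\<bar>}) \<longlonglongrightarrow> 0"
  proof (rule LIMSEQ_I)
    fix \<eta> :: real assume \<eta>: "\<eta> > 0"
    obtain \<delta> where \<delta>: "\<delta> > 0" "2 * exp (- (\<epsilon>\<^sup>2 / (2 * \<delta>))) < \<eta> / 2"
      using small_tail[OF \<epsilon>, of "\<eta> / 2"] \<eta> by auto
    have "eventually (\<lambda>n. prob {\<omega>\<in>space M. \<delta> < V n \<omega>} < \<eta> / 2) sequentially"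
      using AE_tendsto_prob[OF _ V \<delta>(1)] \<eta> by (intro order_tendstoD) auto
    then obtain N where N: "\<And>n. n \<ge> N \<Longrightarrow> prob {\<omega>\<in>space M. \<delta> < V n \<omega>} < \<eta> / 2"
      by (auto simp: eventually_sequentially)
    have "norm (prob {\<omega>\<in>space M. \<epsilon> < \<bar>X n \<omega>\<bar>} - 0) < \<eta>" if "n \<ge> N" for n
      using exp_tail[OF _ _ e[of _ n] \<epsilon> \<delta>(1)] N[OF that] \<delta>(2) by simp
    then show "\<exists>N. \<forall>n\<ge>N. norm (prob {\<omega>\<in>space M. \<epsilon> < \<bar>X n \<omega>\<bar>} - 0) < \<eta>" by blast
  qed
  then show "(\<lambda>n. prob {\<omega>\<in>space M. ennreal \<epsilon> < ennreal \<bar>X n \<omega>\<bar>}) \<longlonglongrightarrow> 0"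
    using \<epsilon> by (simp add: ennreal_less_iff)
qed

end

section \<open>Stochastic integrals as limits of step integrals\<close>

context brownian begin

abbreviation sq :: "(real \<Rightarrow> 'a \<Rightarrow> real^'d) \<Rightarrow> 'a \<Rightarrow> real" where
  "sq H \<omega> \<equiv> cm_norm_sq (\<lambda>s. H s \<omega>)"

definition joint :: "(real \<Rightarrow> 'a \<Rightarrow> real^'d) \<Rightarrow> bool" where
  "joint H \<longleftrightarrow> (\<lambda>(s, \<omega>). H s \<omega>) \<in> borel_measurable (unit_lborel \<Otimes>\<^sub>M M)"

text \<open>Extended-valued, since square integrability of \<open>H\<close> along a path is a
  consequence of the approximation and not known beforehand.\<close>

definition sq_dist :: "(real \<Rightarrow> 'a \<Rightarrow> real^'d) \<Rightarrow> (real \<Rightarrow> 'a \<Rightarrow> real^'d) \<Rightarrow> 'a \<Rightarrow> ennreal" where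
  "sq_dist h H \<omega> = (\<integral>\<^sup>+s. ennreal ((norm (h s \<omega> - H s \<omega>))\<^sup>2) \<partial>unit_lborel)"

text \<open>\<open>I\<close> is the stochastic integral of \<open>H\<close> over the unit interval.
  Both convergences are almost sure, which is reached along subsequences, so that limits can be
  taken path by path. Other time intervals are handled by indicators in the integrand.\<close>

definition approx where
  "approx S h H I \<longleftrightarrow> joint H \<and> I \<in> borel_measurable M \<and> (\<forall>n::nat. step (S n) (h n)) \<and>
     (AE \<omega> in M. (\<lambda>n. sq_dist (h n) H \<omega>) \<longlonglongrightarrow> 0) \<and> (AE \<omega> in M. (\<lambda>n. step_int (S n) (h n) \<omega>) \<longlonglongrightarrow> I \<omega>)"

lemma step_joint': "step S h \<Longrightarrow> joint h"
  using step_joint by (simp add: joint_def)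

lemma joint_swap:
  assumes "joint H"
  shows "(\<lambda>(\<omega>, s). H s \<omega>) \<in> borel_measurable (M \<Otimes>\<^sub>M unit_lborel)"
proof -
  have "(\<lambda>x. (\<lambda>(s, \<omega>). H s \<omega>) (snd x, fst x)) \<in> borel_measurable (M \<Otimes>\<^sub>M unit_lborel)"
    by (rule measurable_compose[OF _ assms[unfolded joint_def]]) simp
  then show ?thesis by (simp add: split_beta')
qed

lemma joint_section: "joint H \<Longrightarrow> \<omega> \<in> space M \<Longrightarrow> (\<lambda>s. H s \<omega>) \<in> borel_measurable unit_lborel"
  using measurable_compose[OF measurable_Pair1'[of \<omega> M unit_lborel] joint_swap[of H]] by simp

lemma joint_lin:
  assumes "joint H" "joint H'"
  shows "joint (\<lambda>s \<omega>. c *\<^sub>R H s \<omega> + d *\<^sub>R H' s \<omega>)"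
proof -
  note [measurable] = assms[unfolded joint_def]
  have "(\<lambda>x. c *\<^sub>R (case x of (s, \<omega>) \<Rightarrow> H s \<omega>) + d *\<^sub>R (case x of (s, \<omega>) \<Rightarrow> H' s \<omega>)) \<in> borel_measurable (unit_lborel \<Otimes>\<^sub>M M)"
    by measurable
  then show ?thesis by (simp add: joint_def split_beta')
qed

lemma joint_comp:
  assumes "joint H" "T \<in> borel_measurable borel"
  shows "joint (\<lambda>s \<omega>. T (H s \<omega>))"
  using measurable_compose[OF assms(1)[unfolded joint_def] assms(2)] by (simp add: joint_def split_beta')

lemma sq_measurable:
  assumes "joint H"
  shows "sq H \<in> borel_measurable M"
proof -
  note [measurable] = joint_swap[OF assms]
  have "(\<lambda>(\<omega>, s). (norm (H s \<omega>))\<^sup>2) \<in> borel_measurable (M \<Otimes>\<^sub>M unit_lborel)"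
    using measurable_compose[OF joint_swap[OF assms], of "\<lambda>x. (norm x)\<^sup>2" borel] by (simp add: split_beta')
  then show ?thesis
    unfolding cm_norm_sq_eq by (intro unit_lborel.borel_measurable_lebesgue_integral) (simp add: split_beta')
qed

lemma sq_dist_measurable:
  assumes "joint h" "joint H"
  shows "sq_dist h H \<in> borel_measurable M"
proof -
  have "(\<lambda>(\<omega>, s). ennreal ((norm (h s \<omega> - H s \<omega>))\<^sup>2)) \<in> borel_measurable (M \<Otimes>\<^sub>M unit_lborel)"
    using measurable_compose[OF joint_swap[OF joint_lin[OF assms, of 1 "-1"]], of "\<lambda>x. ennreal ((norm x)\<^sup>2)" borel]
    by (simp add: split_beta')
  then show ?thesis
    unfolding sq_dist_def by (intro unit_lborel.borel_measurable_nn_integral) (simp add: split_beta')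
qed

lemma step_sq_integrable:
  assumes "step S h" "\<omega> \<in> space M"
  shows "integrable unit_lborel (\<lambda>s. (norm (h s \<omega>))\<^sup>2)"
proof -
  obtain K where K: "\<And>s \<omega>. s \<in> {0..1} \<Longrightarrow> \<omega> \<in> space M \<Longrightarrow> norm (h s \<omega>) \<le> K"
    using step_bounded[OF assms(1)] by blast
  have "(norm (h s \<omega>))\<^sup>2 \<le> K\<^sup>2" if "s \<in> {0..1}" for s
    using K[OF that assms(2)] by (intro power_mono) auto
  then show ?thesis
    using joint_section[OF step_joint'[OF assms(1)] assms(2)]
    by (intro unit_lborel.integrable_const_bound[where B="K\<^sup>2"] AE_I2) auto
qed

lemma approxD:
  assumes "approx S h H I"
  shows "joint H" "I \<in> borel_measurable M" "step (S n) (h n)"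
    "AE \<omega> in M. (\<lambda>n. sq_dist (h n) H \<omega>) \<longlonglongrightarrow> 0"
    "AE \<omega> in M. (\<lambda>n. step_int (S n) (h n) \<omega>) \<longlonglongrightarrow> I \<omega>"
  using assms by (auto simp: approx_def)

lemma approx_L2:
  assumes "approx S h H I"
  shows "AE \<omega> in M. integrable unit_lborel (\<lambda>s. (norm (H s \<omega>))\<^sup>2) \<and>
     (\<lambda>n. sq (h n) \<omega>) \<longlonglongrightarrow> sq H \<omega> \<and>
     (\<forall>k. k \<in> borel_measurable unit_lborel \<longrightarrow> integrable unit_lborel (\<lambda>s. (norm (k s))\<^sup>2) \<longrightarrow>
        (\<lambda>n. \<integral>s. k s \<bullet> h n s \<omega> \<partial>unit_lborel) \<longlonglongrightarrow> (\<integral>s. k s \<bullet> H s \<omega> \<partial>unit_lborel))"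
  using approxD(4)[OF assms] AE_space
proof eventually_elim
  case (elim \<omega>)
  have m: "(\<lambda>s. h n s \<omega>) \<in> borel_measurable unit_lborel" for n
    using joint_section[OF step_joint'[OF approxD(3)[OF assms]] elim(2)] .
  note L = L2_limit[where f="\<lambda>n s. h n s \<omega>" and g="\<lambda>s. H s \<omega>", OF m joint_section[OF approxD(1)[OF assms] elim(2)]
     step_sq_integrable[OF approxD(3)[OF assms] elim(2)] elim(1)[unfolded sq_dist_def]]
  show ?case using L(1,4,5) unfolding cm_norm_sq_eq by blast
qed

lemma dexp_measurable:
  assumes "joint H" "I \<in> borel_measurable M"
  shows "dexp I H \<in> borel_measurable M"
  unfolding dexp_def[abs_def] using sq_measurable[OF assms(1)] assms(2) by measurable

lemma dexp_nonneg [simp]: "0 < dexp I H \<omega>" "0 \<le> dexp I H \<omega>"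
  by (auto simp: dexp_def)

lemma approx_dexp_tendsto:
  assumes "approx S h H I"
  shows "AE \<omega> in M. (\<lambda>n. dexp (step_int (S n) (h n)) (h n) \<omega>) \<longlonglongrightarrow> dexp I H \<omega>"
  using approxD(5)[OF assms] approx_L2[OF assms]
  unfolding dexp_def by eventually_elim (auto intro!: tendsto_intros)

text \<open>Fatou's lemma along the step exponentials, which have mean 1 and converge almost
  surely.\<close>

lemma approx_dexp_le_1:
  assumes "approx S h H I"
  shows "(\<integral>\<^sup>+\<omega>. ennreal (dexp I H \<omega>) \<partial>M) \<le> 1"
proof -
  let ?L = "\<lambda>n. dexp (step_int (S n) (h n)) (h n)"
  have m: "?L n \<in> borel_measurable M" for n
    using step_exp_expectation(1)[OF approxD(3)[OF assms]] by blast
  have "AE \<omega> in M. ennreal (dexp I H \<omega>) = liminf (\<lambda>n. ennreal (?L n \<omega>))"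
    using approx_dexp_tendsto[OF assms]
    by eventually_elim (intro lim_imp_Liminf[symmetric] tendsto_ennrealI; simp)
  then have "(\<integral>\<^sup>+\<omega>. ennreal (dexp I H \<omega>) \<partial>M) = (\<integral>\<^sup>+\<omega>. liminf (\<lambda>n. ennreal (?L n \<omega>)) \<partial>M)"
    by (rule nn_integral_cong_AE)
  also have "\<dots> \<le> liminf (\<lambda>n. \<integral>\<^sup>+\<omega>. ennreal (?L n \<omega>) \<partial>M)"
    using m by (intro nn_integral_liminf) simp
  also have "(\<lambda>n. \<integral>\<^sup>+\<omega>. ennreal (?L n \<omega>) \<partial>M) = (\<lambda>n. 1)"
    using step_exp_expectation[OF approxD(3)[OF assms]] by (subst nn_integral_eq_integral) auto
  finally show ?thesis by (simp add: Liminf_const)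
qed

lemma sq_scale: "sq (\<lambda>s \<omega>. c *\<^sub>R H s \<omega>) \<omega> = c\<^sup>2 * sq H \<omega>"
  by (simp add: cm_norm_sq_eq power_mult_distrib)

lemma approx_lin:
  assumes "approx S h H I" "approx S' h' H' I'"
  shows "approx (\<lambda>n. S n \<union> S' n) (\<lambda>n s \<omega>. c *\<^sub>R h n s \<omega> + d *\<^sub>R h' n s \<omega>)
     (\<lambda>s \<omega>. c *\<^sub>R H s \<omega> + d *\<^sub>R H' s \<omega>) (\<lambda>\<omega>. c * I \<omega> + d * I' \<omega>)"
  unfolding approx_def
proof (intro conjI allI)
  note A = approxD[OF assms(1)] and A' = approxD[OF assms(2)]
  show "joint (\<lambda>s \<omega>. c *\<^sub>R H s \<omega> + d *\<^sub>R H' s \<omega>)" by (rule joint_lin[OF A(1) A'(1)])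
  show "(\<lambda>\<omega>. c * I \<omega> + d * I' \<omega>) \<in> borel_measurable M" using A(2) A'(2) by measurable
  show "step (S n \<union> S' n) (\<lambda>s \<omega>. c *\<^sub>R h n s \<omega> + d *\<^sub>R h' n s \<omega>)" for n by (rule step_lin[OF A(3) A'(3)])
  show "AE \<omega> in M. (\<lambda>n. step_int (S n \<union> S' n) (\<lambda>s \<omega>. c *\<^sub>R h n s \<omega> + d *\<^sub>R h' n s \<omega>) \<omega>) \<longlonglongrightarrow> c * I \<omega> + d * I' \<omega>"
    unfolding step_lin(2)[OF A(3) A'(3)] using A(5) A'(5) by eventually_elim (intro tendsto_intros)
  show "AE \<omega> in M. (\<lambda>n. sq_dist (\<lambda>s \<omega>. c *\<^sub>R h n s \<omega> + d *\<^sub>R h' n s \<omega>) (\<lambda>s \<omega>. c *\<^sub>R H s \<omega> + d *\<^sub>R H' s \<omega>) \<omega>) \<longlonglongrightarrow> 0"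
    using A(4) A'(4) AE_space
  proof eventually_elim
    case (elim \<omega>)
    let ?k = "\<lambda>n s \<omega>. c *\<^sub>R h n s \<omega> + d *\<^sub>R h' n s \<omega>" and ?K = "\<lambda>s \<omega>. c *\<^sub>R H s \<omega> + d *\<^sub>R H' s \<omega>"
    let ?b = "\<lambda>n. ennreal (2 * c\<^sup>2) * sq_dist (h n) H \<omega> + ennreal (2 * d\<^sup>2) * sq_dist (h' n) H' \<omega>"
    have b: "sq_dist (?k n) ?K \<omega> \<le> ?b n" for n
    proof -
      note [measurable] = joint_section[OF step_joint'[OF A(3)] elim(3)] joint_section[OF step_joint'[OF A'(3)] elim(3)]
        joint_section[OF A(1) elim(3)] joint_section[OF A'(1) elim(3)]
      have "(norm (?k n s \<omega> - ?K s \<omega>))\<^sup>2 \<le> 2 * c\<^sup>2 * (norm (h n s \<omega> - H s \<omega>))\<^sup>2 + 2 * d\<^sup>2 * (norm (h' n s \<omega> - H' s \<omega>))\<^sup>2" for s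
      proof -
        have "?k n s \<omega> - ?K s \<omega> = c *\<^sub>R (h n s \<omega> - H s \<omega>) + d *\<^sub>R (h' n s \<omega> - H' s \<omega>)"
          by (simp add: algebra_simps)
        then show ?thesis
          using norm_add_sq_le[of "c *\<^sub>R (h n s \<omega> - H s \<omega>)" "d *\<^sub>R (h' n s \<omega> - H' s \<omega>)"]
          by (simp only: norm_scaleR power_mult_distrib power2_abs mult.assoc)
      qed
      then have "sq_dist (?k n) ?K \<omega> \<le>
        (\<integral>\<^sup>+s. ennreal (2 * c\<^sup>2) * ennreal ((norm (h n s \<omega> - H s \<omega>))\<^sup>2) + ennreal (2 * d\<^sup>2) * ennreal ((norm (h' n s \<omega> - H' s \<omega>))\<^sup>2) \<partial>unit_lborel)"
        unfolding sq_dist_def by (intro nn_integral_mono) (simp flip: ennreal_mult ennreal_plus)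
      also have "\<dots> = ?b n"
        unfolding sq_dist_def by (simp add: nn_integral_add nn_integral_cmult)
      finally show ?thesis .
    qed
    have "?b \<longlonglongrightarrow> ennreal (2 * c\<^sup>2) * 0 + ennreal (2 * d\<^sup>2) * 0"
      by (rule tendsto_add[OF ennreal_tendsto_cmult[OF _ elim(1)] ennreal_tendsto_cmult[OF _ elim(2)]]) auto
    then have z: "?b \<longlonglongrightarrow> 0" unfolding mult_zero_right add_0_right .
    show ?case by (rule tendsto_0_le_ennreal[OF b z])
  qed
qed

lemma approx_scale:
  assumes "approx S h H I"
  shows "approx S (\<lambda>n s \<omega>. c *\<^sub>R h n s \<omega>) (\<lambda>s \<omega>. c *\<^sub>R H s \<omega>) (\<lambda>\<omega>. c * I \<omega>)"
  using approx_lin[OF assms assms, of c 0] by simp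

text \<open>This is the exponential of the scaled integrand \<open>l *\<^sub>R H s \<omega>\<close>,
  and it is the hypothesis under which the tail bound \<open>exp_tail\<close> applies to
  \<open>I\<close> and \<open>sq H\<close>.\<close>

lemma approx_exp_scaled:
  assumes "approx S h H I"
  shows "(\<integral>\<^sup>+\<omega>. ennreal (exp (l * I \<omega> - l\<^sup>2 * sq H \<omega> / 2)) \<partial>M) \<le> 1"
  using approx_dexp_le_1[OF approx_scale[OF assms, of l]] by (simp add: dexp_def sq_scale)

lemma approx_const:
  assumes "step S h"
  shows "approx (\<lambda>_. S) (\<lambda>_. h) h (step_int S h)"
  using assms step_int_measurable step_joint' by (simp add: approx_def sq_dist_def)

lemma approx_cong:
  assumes "approx S h H I" and H': "joint H'" and I': "I' \<in> borel_measurable M"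
    and "AE \<omega> in M. AE s in unit_lborel. H s \<omega> = H' s \<omega>" "AE \<omega> in M. I \<omega> = I' \<omega>"
  shows "approx S h H' I'"
  unfolding approx_def
proof (intro conjI allI H' I' approxD(3)[OF assms(1)])
  show "AE \<omega> in M. (\<lambda>n. sq_dist (h n) H' \<omega>) \<longlonglongrightarrow> 0"
    using approxD(4)[OF assms(1)] assms(4)
  proof eventually_elim
    case (elim \<omega>)
    have "sq_dist (h n) H' \<omega> = sq_dist (h n) H \<omega>" for n
      unfolding sq_dist_def using elim(2) by (intro nn_integral_cong_AE) (auto elim!: eventually_mono)
    then show ?case using elim(1) by simp
  qed
  show "AE \<omega> in M. (\<lambda>n. step_int (S n) (h n) \<omega>) \<longlonglongrightarrow> I' \<omega>"
    using approxD(5)[OF assms(1)] assms(5) by eventually_elim simp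
qed

lemma sq_eq_sq_dist:
  assumes "step S k" "\<omega> \<in> space M"
  shows "ennreal (sq k \<omega>) = sq_dist k (\<lambda>_ _. 0) \<omega>"
  unfolding cm_norm_sq_eq sq_dist_def using step_sq_integrable[OF assms]
  by (subst nn_integral_eq_integral) auto

lemma sq_diff_le:
  assumes "step S h" "step S' h'" "joint H" "\<omega> \<in> space M"
  shows "ennreal (sq (\<lambda>s \<omega>. 1 *\<^sub>R h s \<omega> + (-1) *\<^sub>R h' s \<omega>) \<omega>) \<le> 2 * sq_dist h H \<omega> + 2 * sq_dist h' H \<omega>"
proof -
  note [measurable] = joint_section[OF step_joint'[OF assms(1)] assms(4)] joint_section[OF step_joint'[OF assms(2)] assms(4)]
    joint_section[OF assms(3,4)]
  have p: "(norm (h s \<omega> - h' s \<omega>))\<^sup>2 \<le> 2 * (norm (h s \<omega> - H s \<omega>))\<^sup>2 + 2 * (norm (h' s \<omega> - H s \<omega>))\<^sup>2" for s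
    using norm_add_sq_le[of "h s \<omega> - H s \<omega>" "- (h' s \<omega> - H s \<omega>)"] unfolding norm_minus_cancel by simp
  have e: "2 * ennreal (a\<^sup>2) + 2 * ennreal (b\<^sup>2) = ennreal (2 * a\<^sup>2 + 2 * b\<^sup>2)" for a b :: real
    by (simp add: ennreal_mult')
  have "ennreal ((norm (h s \<omega> - h' s \<omega>))\<^sup>2) \<le> 2 * ennreal ((norm (h s \<omega> - H s \<omega>))\<^sup>2) + 2 * ennreal ((norm (h' s \<omega> - H s \<omega>))\<^sup>2)" for s
    unfolding e by (rule ennreal_leI[OF p])
  then have "sq_dist (\<lambda>s \<omega>. 1 *\<^sub>R h s \<omega> + (-1) *\<^sub>R h' s \<omega>) (\<lambda>_ _. 0) \<omega> \<le>
     (\<integral>\<^sup>+s. 2 * ennreal ((norm (h s \<omega> - H s \<omega>))\<^sup>2) + 2 * ennreal ((norm (h' s \<omega> - H s \<omega>))\<^sup>2) \<partial>unit_lborel)"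
    unfolding sq_dist_def by (intro nn_integral_mono) simp
  also have "\<dots> = 2 * sq_dist h H \<omega> + 2 * sq_dist h' H \<omega>"
    unfolding sq_dist_def by (simp add: nn_integral_add nn_integral_cmult)
  finally show ?thesis
    unfolding sq_eq_sq_dist[OF step_lin(1)[OF assms(1,2)] assms(4)] .
qed

text \<open>The difference of two approximations is again a step process. Its square norm is at most
  twice the sum of the two distances to \<open>H\<close>, so the exponential tail bound applies to
  its integral.\<close>

lemma step_diff_null:
  assumes "\<And>n. step (S n) (h n)" "\<And>n. step (S' n) (h' n)" "joint H"
    and "AE \<omega> in M. (\<lambda>n::nat. sq_dist (h n) H \<omega>) \<longlonglongrightarrow> 0" "AE \<omega> in M. (\<lambda>n. sq_dist (h' n) H \<omega>) \<longlonglongrightarrow> 0"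
  shows "null_in_prob M (\<lambda>n \<omega>. ennreal \<bar>step_int (S n) (h n) \<omega> - step_int (S' n) (h' n) \<omega>\<bar>)"
proof -
  let ?k = "\<lambda>n s \<omega>. 1 *\<^sub>R h n s \<omega> + (-1) *\<^sub>R h' n s \<omega>"
  note st = step_lin[OF assms(1,2), of _ _ 1 "-1"]
  have "AE \<omega> in M. (\<lambda>n. sq (?k n) \<omega>) \<longlonglongrightarrow> 0"
    using assms(4,5) AE_space
  proof eventually_elim
    case (elim \<omega>)
    have "(\<lambda>n. 2 * sq_dist (h n) H \<omega> + 2 * sq_dist (h' n) H \<omega>) \<longlonglongrightarrow> 2 * 0 + 2 * 0"
      by (rule tendsto_add[OF ennreal_tendsto_cmult[OF _ elim(1)] ennreal_tendsto_cmult[OF _ elim(2)]]) auto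
    then have "(\<lambda>n. 2 * sq_dist (h n) H \<omega> + 2 * sq_dist (h' n) H \<omega>) \<longlonglongrightarrow> 0" unfolding mult_zero_right add_0_right .
    from tendsto_0_le_ennreal[OF sq_diff_le[OF assms(1-3) elim(3)] this]
    have "(\<lambda>n. ennreal (sq (?k n) \<omega>)) \<longlonglongrightarrow> ennreal 0" unfolding ennreal_0 .
    then show ?case by (subst (asm) tendsto_ennreal_iff) (auto simp: cm_norm_sq_eq)
  qed
  then have "null_in_prob M (\<lambda>n \<omega>. ennreal \<bar>step_int (S n \<union> S' n) (?k n) \<omega>\<bar>)"
    using approx_exp_scaled[OF approx_const[OF st(1)]]
    by (intro exp_tail_null[where V="\<lambda>n. sq (?k n)"] step_int_measurable[OF st(1)] sq_measurable step_joint'[OF st(1)])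
  then show ?thesis unfolding st(2) by simp
qed

text \<open>The integral does not depend on the approximating steps, so these may be replaced, along
  a subsequence, by steps with better properties: bounded ones, or ones that vanish up to a given
  time.\<close>

lemma approx_change:
  assumes a: "approx S h H I" and st: "\<And>n. step (S' n) (h' n)"
    and lim: "AE \<omega> in M. (\<lambda>n. sq_dist (h' n) H \<omega>) \<longlonglongrightarrow> 0"
  obtains r :: "nat \<Rightarrow> nat" where "strict_mono r" "approx (\<lambda>n. S' (r n)) (\<lambda>n. h' (r n)) H I"
proof -
  note A = approxD[OF a]
  have m: "(\<lambda>\<omega>. ennreal \<bar>step_int (S n) (h n) \<omega> - step_int (S' n) (h' n) \<omega>\<bar>) \<in> borel_measurable M" for n
    using step_int_measurable[OF A(3)] step_int_measurable[OF st] by measurable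
  obtain r where r: "strict_mono r"
    "AE \<omega> in M. (\<lambda>n. ennreal \<bar>step_int (S (r n)) (h (r n)) \<omega> - step_int (S' (r n)) (h' (r n)) \<omega>\<bar>) \<longlonglongrightarrow> 0"
    using null_in_prob_subseq[OF m step_diff_null[OF A(3) st A(1,4) lim]] by blast
  have "approx (\<lambda>n. S' (r n)) (\<lambda>n. h' (r n)) H I"
    unfolding approx_def
  proof (intro conjI allI A(1,2) st)
    show "AE \<omega> in M. (\<lambda>n. sq_dist (h' (r n)) H \<omega>) \<longlonglongrightarrow> 0"
      using lim by eventually_elim (rule LIMSEQ_subseq_LIMSEQ[OF _ r(1), unfolded comp_def])
    show "AE \<omega> in M. (\<lambda>n. step_int (S' (r n)) (h' (r n)) \<omega>) \<longlonglongrightarrow> I \<omega>"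
      using r(2) A(5)
    proof eventually_elim
      case (elim \<omega>)
      have "(\<lambda>n. \<bar>step_int (S (r n)) (h (r n)) \<omega> - step_int (S' (r n)) (h' (r n)) \<omega>\<bar>) \<longlonglongrightarrow> 0"
        using elim(1) unfolding ennreal_0[symmetric] by (subst (asm) tendsto_ennreal_iff) auto
      then have "(\<lambda>n. step_int (S (r n)) (h (r n)) \<omega> - step_int (S' (r n)) (h' (r n)) \<omega>) \<longlonglongrightarrow> 0"
        by (rule tendsto_rabs_zero_cancel)
      from tendsto_diff[OF LIMSEQ_subseq_LIMSEQ[OF elim(2) r(1), unfolded comp_def] this]
      show ?case by simp
    qed
  qed
  then show ?thesis using r(1) that by blast
qed

lemma sq_dist_lipschitz:
  assumes "joint h" "joint H" "\<omega> \<in> space M" "T \<in> borel_measurable borel"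
    and "\<And>x y. norm (T x - T y) \<le> 2 * norm (x - y)"
  shows "sq_dist (\<lambda>s \<omega>. T (h s \<omega>)) (\<lambda>s \<omega>. T (H s \<omega>)) \<omega> \<le> 4 * sq_dist h H \<omega>"
proof -
  note [measurable] = joint_section[OF assms(1,3)] joint_section[OF assms(2,3)]
  have "(norm (T x - T y))\<^sup>2 \<le> 4 * (norm (x - y))\<^sup>2" for x y
    using power_mono[OF assms(5)[of x y], of 2] by (simp add: power_mult_distrib)
  then have "ennreal ((norm (T x - T y))\<^sup>2) \<le> 4 * ennreal ((norm (x - y))\<^sup>2)" for x y
    using ennreal_leI[of "(norm (T x - T y))\<^sup>2" "4 * (norm (x - y))\<^sup>2"] by (simp add: ennreal_mult')
  then have "sq_dist (\<lambda>s \<omega>. T (h s \<omega>)) (\<lambda>s \<omega>. T (H s \<omega>)) \<omega> \<le> (\<integral>\<^sup>+s. 4 * ennreal ((norm (h s \<omega> - H s \<omega>))\<^sup>2) \<partial>unit_lborel)"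
    unfolding sq_dist_def by (rule nn_integral_mono)
  also have "\<dots> = 4 * sq_dist h H \<omega>" unfolding sq_dist_def by (rule nn_integral_cmult) measurable
  finally show ?thesis .
qed

lemma sq_dist_lipschitz_null:
  assumes "approx S h H I" "T \<in> borel_measurable borel" "\<And>x y. norm (T x - T y) \<le> 2 * norm (x - y)"
  shows "AE \<omega> in M. (\<lambda>n. sq_dist (\<lambda>s \<omega>. T (h n s \<omega>)) (\<lambda>s \<omega>. T (H s \<omega>)) \<omega>) \<longlonglongrightarrow> 0"
  using approxD(4)[OF assms(1)] AE_space
proof eventually_elim
  case (elim \<omega>)
  have "(\<lambda>n. 4 * sq_dist (h n) H \<omega>) \<longlonglongrightarrow> 4 * 0" by (rule ennreal_tendsto_cmult[OF _ elim(1)]) simp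
  then have "(\<lambda>n. 4 * sq_dist (h n) H \<omega>) \<longlonglongrightarrow> 0" unfolding mult_zero_right .
  from tendsto_0_le_ennreal[OF sq_dist_lipschitz[OF step_joint'[OF approxD(3)[OF assms(1)]] approxD(1)[OF assms(1)] elim(2) assms(2,3)] this]
  show ?case .
qed

text \<open>The truncated steps approximate the truncated integrand, but an integral of the latter
  has yet to be found: the step integrals are shown to be Cauchy in probability, and the limit along
  a subsequence is taken.\<close>

lemma approx_trunc:
  assumes a: "approx S h H I" and K: "K > 0"
  obtains S' h' I' where "approx S' h' (\<lambda>s \<omega>. trunc K (H s \<omega>)) I'"
proof -
  let ?H = "\<lambda>s \<omega>. trunc K (H s \<omega>)" and ?k = "\<lambda>n s \<omega>. trunc K (h n s \<omega>)"
  have st: "step (S n) (?k n)" for n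
    by (rule step_comp[OF approxD(3)[OF a] trunc_measurable trunc_0 norm_trunc_le[OF K]])
  have jH: "joint ?H" by (rule joint_comp[OF approxD(1)[OF a] trunc_measurable])
  have lim: "AE \<omega> in M. (\<lambda>n. sq_dist (?k n) ?H \<omega>) \<longlonglongrightarrow> 0"
    by (rule sq_dist_lipschitz_null[OF a trunc_measurable trunc_lipschitz[OF K]])
  let ?X = "\<lambda>n. step_int (S n) (?k n)"
  have cau: "\<exists>N. \<forall>n\<ge>N. \<forall>m\<ge>N. prob {\<omega>\<in>space M. \<epsilon> < \<bar>?X n \<omega> - ?X m \<omega>\<bar>} \<le> \<epsilon>" if \<epsilon>: "\<epsilon> > 0" for \<epsilon>
  proof -
    obtain \<delta> where \<delta>: "\<delta> > 0" "2 * exp (- (\<epsilon>\<^sup>2 / (2 * \<delta>))) < \<epsilon> / 2"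
      using small_tail[OF \<epsilon>, of "\<epsilon> / 2"] \<epsilon> by auto
    have m: "sq_dist (?k n) ?H \<in> borel_measurable M" for n by (rule sq_dist_measurable[OF step_joint'[OF st] jH])
    \<comment> \<open>The square norm of a difference is at most twice the sum of the distances, so
      distances up to \<open>\<delta>/4\<close> give at most \<open>\<delta>\<close>. The two
      exceptional events take \<open>\<epsilon>/4\<close> each and the exponential tail takes
      \<open>\<epsilon>/2\<close>.\<close>
    have "(\<lambda>n. prob {\<omega>\<in>space M. ennreal (\<delta>/4) < sq_dist (?k n) ?H \<omega>}) \<longlonglongrightarrow> 0"
      using null_in_prob_AE[OF m lim] \<delta>(1) unfolding null_in_prob_def by simp
    then have "eventually (\<lambda>n. prob {\<omega>\<in>space M. ennreal (\<delta>/4) < sq_dist (?k n) ?H \<omega>} < \<epsilon>/4) sequentially"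
      using \<epsilon> by (intro order_tendstoD) auto
    then obtain N where N: "\<And>n. n \<ge> N \<Longrightarrow> prob {\<omega>\<in>space M. ennreal (\<delta>/4) < sq_dist (?k n) ?H \<omega>} < \<epsilon>/4"
      by (auto simp: eventually_sequentially)
    have "prob {\<omega>\<in>space M. \<epsilon> < \<bar>?X n \<omega> - ?X m \<omega>\<bar>} \<le> \<epsilon>" if "n \<ge> N" "m \<ge> N" for n m
    proof -
      let ?d = "\<lambda>s \<omega>. 1 *\<^sub>R ?k n s \<omega> + (-1) *\<^sub>R ?k m s \<omega>"
      let ?B = "\<lambda>n. {\<omega>\<in>space M. ennreal (\<delta>/4) < sq_dist (?k n) ?H \<omega>}"
      note sd = step_lin[OF st[of n] st[of m], of 1 "-1"]
      have Bm: "?B n \<in> events" for n using m[of n] by measurable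
      have "{\<omega>\<in>space M. \<delta> < sq ?d \<omega>} \<subseteq> ?B n \<union> ?B m"
      proof
        fix \<omega> assume w: "\<omega> \<in> {\<omega>\<in>space M. \<delta> < sq ?d \<omega>}"
        show "\<omega> \<in> ?B n \<union> ?B m"
        proof (rule ccontr)
          assume "\<omega> \<notin> ?B n \<union> ?B m"
          then have "sq_dist (?k n) ?H \<omega> \<le> ennreal (\<delta>/4)" "sq_dist (?k m) ?H \<omega> \<le> ennreal (\<delta>/4)"
            using w by (auto simp: not_less)
          then have "2 * sq_dist (?k n) ?H \<omega> + 2 * sq_dist (?k m) ?H \<omega> \<le> 2 * ennreal (\<delta>/4) + 2 * ennreal (\<delta>/4)"
            by (intro add_mono mult_left_mono) auto
          also have "\<dots> = ennreal \<delta>" using \<delta>(1) by (simp add: ennreal_mult'[symmetric] ennreal_plus[symmetric] del: ennreal_plus flip: ennreal_numeral)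
          finally have "ennreal (sq ?d \<omega>) \<le> ennreal \<delta>"
            using w by (intro order_trans[OF sq_diff_le[OF st st jH]]) auto
          then show False using w \<delta>(1) by (simp add: ennreal_le_iff)
        qed
      qed
      then have "prob {\<omega>\<in>space M. \<delta> < sq ?d \<omega>} \<le> prob (?B n) + prob (?B m)"
        using Bm by (intro order_trans[OF finite_measure_mono measure_Un_le]) auto
      moreover have "prob {\<omega>\<in>space M. \<epsilon> < \<bar>?X n \<omega> - ?X m \<omega>\<bar>} \<le> prob {\<omega>\<in>space M. \<delta> < sq ?d \<omega>} + 2 * exp (- (\<epsilon>\<^sup>2 / (2 * \<delta>)))"
        using exp_tail[OF step_int_measurable[OF sd(1)] sq_measurable[OF step_joint'[OF sd(1)]] approx_exp_scaled[OF approx_const[OF sd(1)]] \<epsilon> \<delta>(1)]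
        unfolding sd(2) by simp
      ultimately show ?thesis using N[OF that(1)] N[OF that(2)] \<delta>(2) by linarith
    qed
    then show ?thesis by blast
  qed
  obtain r I' where r: "strict_mono (r :: nat \<Rightarrow> nat)" "I' \<in> borel_measurable M" "AE \<omega> in M. (\<lambda>n. ?X (r n) \<omega>) \<longlonglongrightarrow> I' \<omega>"
    using cauchy_in_prob_subseq[OF step_int_measurable[OF st] cau] by blast
  have "approx (\<lambda>n. S (r n)) (\<lambda>n. ?k (r n)) ?H I'"
    unfolding approx_def
  proof (intro conjI allI st jH r(2,3))
    show "AE \<omega> in M. (\<lambda>n. sq_dist (?k (r n)) ?H \<omega>) \<longlonglongrightarrow> 0"
      using lim by eventually_elim (rule LIMSEQ_subseq_LIMSEQ[OF _ r(1), unfolded comp_def])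
  qed
  then show ?thesis by (rule that)
qed

text \<open>Truncation at \<open>K\<close> changes \<open>H\<close> only on null sets, so the
  truncated steps still approximate \<open>H\<close>, and \<open>approx_change\<close> keeps the
  integral \<open>I\<close>.\<close>

lemma approx_bounded_steps:
  assumes a: "approx S h H I" and K: "K > 0" "AE \<omega> in M. AE s in unit_lborel. norm (H s \<omega>) \<le> K"
  obtains S' h' where "approx S' h' H I" "\<And>n s \<omega>. norm (h' n s \<omega>) \<le> K"
proof -
  let ?H = "\<lambda>s \<omega>. trunc K (H s \<omega>)" and ?k = "\<lambda>n s \<omega>. trunc K (h n s \<omega>)"
  have st: "step (S n) (?k n)" for n
    by (rule step_comp[OF approxD(3)[OF a] trunc_measurable trunc_0 norm_trunc_le[OF K(1)]])
  have lim: "AE \<omega> in M. (\<lambda>n. sq_dist (?k n) ?H \<omega>) \<longlonglongrightarrow> 0"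
    by (rule sq_dist_lipschitz_null[OF a trunc_measurable trunc_lipschitz[OF K(1)]])
  have "AE \<omega> in M. (\<lambda>n. sq_dist (?k n) H \<omega>) \<longlonglongrightarrow> 0"
    using lim K(2)
  proof eventually_elim
    case (elim \<omega>)
    have "sq_dist (?k n) H \<omega> = sq_dist (?k n) ?H \<omega>" for n
      unfolding sq_dist_def using elim(2) by (intro nn_integral_cong_AE) (auto elim!: eventually_mono simp: trunc_eq[OF K(1)])
    then show ?case using elim(1) by simp
  qed
  from approx_change[OF a st this] obtain r where "approx (\<lambda>n. S (r n)) (\<lambda>n. ?k (r n)) H I" by blast
  then show ?thesis by (rule that) (rule norm_trunc_le[OF K(1)])
qed

section \<open>Integrability and mean of the stochastic exponential\<close>

lemma approx_dexp_integrable: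
  assumes "approx S h H I"
  shows "integrable M (dexp I H)" "(\<integral>\<omega>. dexp I H \<omega> \<partial>M) \<le> 1"
proof -
  have m: "dexp I H \<in> borel_measurable M" by (rule dexp_measurable[OF approxD(1,2)[OF assms]])
  show i: "integrable M (dexp I H)"
    using approx_dexp_le_1[OF assms] m by (intro integrableI_nonneg) (auto intro: le_less_trans)
  show "(\<integral>\<omega>. dexp I H \<omega> \<partial>M) \<le> 1"
    using approx_dexp_le_1[OF assms] by (subst (asm) nn_integral_eq_integral[OF i]) auto
qed

text \<open>For bounded integrands the step exponentials are bounded in mean square, hence uniformly integrable.\<close>

lemma bounded_dexp_expectation:
  assumes a: "approx S h H I" and K: "AE \<omega> in M. AE s in unit_lborel. norm (H s \<omega>) \<le> K"
  shows "(\<integral>\<omega>. dexp I H \<omega> \<partial>M) = 1"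
proof -
  \<comment> \<open>Truncation of the steps asks for a positive level.\<close>
  define K' where "K' = max K 1"
  have KA: "AE \<omega> in M. AE s in unit_lborel. norm (H s \<omega>) \<le> K'"
    using K by eventually_elim (auto elim!: eventually_mono simp: K'_def)
  have Kp: "K' > 0" by (simp add: K'_def)
  obtain S' h' where a': "approx S' h' H I" and bd: "\<And>n s \<omega>. norm (h' n s \<omega>) \<le> K'"
    using approx_bounded_steps[OF a Kp KA] by blast
  define C where "C = exp (K'\<^sup>2)"
  let ?L = "\<lambda>n. dexp (step_int (S' n) (h' n)) (h' n)" and ?R = "dexp I H"
  have st: "step (S' n) (h' n)" for n by (rule approxD(3)[OF a'])
  note L = step_exp_expectation[OF st] and R = approx_dexp_integrable[OF a]
  have sqb: "sq (h' n) \<omega> \<le> K'\<^sup>2" if "\<omega> \<in> space M" for n \<omega>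
  proof -
    have "sq (h' n) \<omega> \<le> (\<integral>s. K'\<^sup>2 \<partial>unit_lborel)"
      unfolding cm_norm_sq_eq using step_sq_integrable[OF st that] bd
      by (intro integral_mono) (auto intro!: power_mono)
    then show ?thesis using unit_lborel.prob_space by simp
  qed
  \<comment> \<open>The square of the exponential of \<open>h' n\<close> is
    \<open>exp (sq (h' n) \<omega>)\<close> times the exponential of twice the integrand, whose mean
    is at most 1; hence the constant \<open>C = exp (K'\<^sup>2)\<close>.\<close>
  have sq: "ennreal ((?L n \<omega>)\<^sup>2) \<le> ennreal C * ennreal (exp (2 * step_int (S' n) (h' n) \<omega> - 2\<^sup>2 * sq (h' n) \<omega> / 2))"
    if "\<omega> \<in> space M" for n \<omega>
  proof -
    have "(?L n \<omega>)\<^sup>2 = exp (sq (h' n) \<omega>) * exp (2 * step_int (S' n) (h' n) \<omega> - 2\<^sup>2 * sq (h' n) \<omega> / 2)"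
      by (simp add: dexp_def power2_eq_square mult_exp_exp)
    also have "\<dots> \<le> C * exp (2 * step_int (S' n) (h' n) \<omega> - 2\<^sup>2 * sq (h' n) \<omega> / 2)"
      unfolding C_def using sqb[OF that] by (intro mult_right_mono) auto
    finally show ?thesis by (simp add: C_def ennreal_mult'[symmetric] ennreal_leI)
  qed
  have L2: "(\<integral>\<^sup>+\<omega>. ennreal ((?L n \<omega>)\<^sup>2) \<partial>M) \<le> ennreal C" for n
  proof -
    have m: "(\<lambda>\<omega>. ennreal (exp (2 * step_int (S' n) (h' n) \<omega> - 2\<^sup>2 * sq (h' n) \<omega> / 2))) \<in> borel_measurable M"
      using step_int_measurable[OF st[of n]] sq_measurable[OF step_joint'[OF st[of n]]] by measurable
    have "(\<integral>\<^sup>+\<omega>. ennreal ((?L n \<omega>)\<^sup>2) \<partial>M) \<le>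
        (\<integral>\<^sup>+\<omega>. ennreal C * ennreal (exp (2 * step_int (S' n) (h' n) \<omega> - 2\<^sup>2 * sq (h' n) \<omega> / 2)) \<partial>M)"
      using sq by (rule nn_integral_mono)
    also have "\<dots> = ennreal C * (\<integral>\<^sup>+\<omega>. ennreal (exp (2 * step_int (S' n) (h' n) \<omega> - 2\<^sup>2 * sq (h' n) \<omega> / 2)) \<partial>M)"
      by (rule nn_integral_cmult[OF m])
    also have "\<dots> \<le> ennreal C * 1"
      using approx_exp_scaled[OF approx_const[OF st]] by (rule mult_left_mono) simp
    finally show ?thesis by simp
  qed
  have Lm: "?L n \<in> borel_measurable M" for n using L(1) by blast
  have i2: "integrable M (\<lambda>\<omega>. (?L n \<omega>)\<^sup>2)" for n
    using L2[of n] Lm[of n] by (intro integrableI_nonneg) (auto intro: le_less_trans)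
  have E2: "(\<integral>\<omega>. (?L n \<omega>)\<^sup>2 \<partial>M) \<le> C" for n
    using L2[of n] by (subst (asm) nn_integral_eq_integral[OF i2]) (auto simp: C_def)
  \<comment> \<open>Cutting off at \<open>c\<close> loses at most \<open>x\<^sup>2 / c\<close>,
    hence at most \<open>C / c\<close> in mean, uniformly in \<open>n\<close>. The cut-off
    exponentials pass to the limit by dominated convergence, and afterwards \<open>c\<close> tends
    to infinity.\<close>
  have key: "1 \<le> (\<integral>\<omega>. ?R \<omega> \<partial>M) + C / c" if c: "c > 0" for c :: real
  proof -
    have mi: "integrable M (\<lambda>\<omega>. min (?L n \<omega>) c)" for n
      using Lm[of n] c by (intro integrable_const_bound[where B=c] AE_I2) (auto simp: abs_of_nonneg)
    have Ln: "1 \<le> (\<integral>\<omega>. min (?L n \<omega>) c \<partial>M) + C / c" for n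
    proof -
      have "x \<le> min x c + x\<^sup>2 / c" if "0 \<le> x" for x
      proof (cases "x \<le> c")
        case False
        then have "x * c \<le> x\<^sup>2" using that by (simp add: power2_eq_square mult_left_mono)
        then have "x \<le> x\<^sup>2 / c" using c by (simp add: pos_le_divide_eq)
        then show ?thesis using c False by simp
      qed (use c in simp)
      then have "(\<integral>\<omega>. ?L n \<omega> \<partial>M) \<le> (\<integral>\<omega>. min (?L n \<omega>) c + (?L n \<omega>)\<^sup>2 / c \<partial>M)"
        using L(1) mi i2 by (intro integral_mono) auto
      also have "\<dots> = (\<integral>\<omega>. min (?L n \<omega>) c \<partial>M) + (\<integral>\<omega>. (?L n \<omega>)\<^sup>2 \<partial>M) / c"
        using mi i2 by simp
      also have "\<dots> \<le> (\<integral>\<omega>. min (?L n \<omega>) c \<partial>M) + C / c"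
        using E2[of n] c by (intro add_left_mono divide_right_mono) auto
      finally show ?thesis using L(2)[of n] by simp
    qed
    have "(\<lambda>n. \<integral>\<omega>. min (?L n \<omega>) c \<partial>M) \<longlonglongrightarrow> (\<integral>\<omega>. min (?R \<omega>) c \<partial>M)"
    proof (rule integral_dominated_convergence[where w="\<lambda>_. c"])
      show "AE \<omega> in M. (\<lambda>n. min (?L n \<omega>) c) \<longlonglongrightarrow> min (?R \<omega>) c"
        using approx_dexp_tendsto[OF a'] by eventually_elim (intro tendsto_intros)
      show "AE \<omega> in M. norm (min (?L n \<omega>) c) \<le> c" for n
        using c by (intro AE_I2) (auto simp: abs_of_nonneg)
    qed (use R(1) Lm in \<open>auto intro!: borel_measurable_min\<close>)
    from tendsto_add[OF this tendsto_const[of "C / c"]]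
    have "1 \<le> (\<integral>\<omega>. min (?R \<omega>) c \<partial>M) + C / c"
      by (rule LIMSEQ_le_const) (use Ln in blast)
    also have "(\<integral>\<omega>. min (?R \<omega>) c \<partial>M) \<le> (\<integral>\<omega>. ?R \<omega> \<partial>M)"
    proof (rule integral_mono[OF _ R(1)])
      show "integrable M (\<lambda>\<omega>. min (?R \<omega>) c)"
        using borel_measurable_integrable[OF R(1)] c
        by (intro integrable_const_bound[where B=c] AE_I2) (auto simp: abs_of_nonneg)
    qed simp
    finally show ?thesis by simp
  qed
  have "((\<lambda>c. (\<integral>\<omega>. ?R \<omega> \<partial>M) + C / c) \<longlongrightarrow> (\<integral>\<omega>. ?R \<omega> \<partial>M) + 0) at_top"
    by (intro tendsto_intros tendsto_divide_0[OF tendsto_const] filterlim_at_top_imp_at_infinity filterlim_ident)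
  moreover have "eventually (\<lambda>c. 1 \<le> (\<integral>\<omega>. ?R \<omega> \<partial>M) + C / c) at_top"
    using eventually_gt_at_top[of 0] by eventually_elim (rule key)
  ultimately have "1 \<le> (\<integral>\<omega>. ?R \<omega> \<partial>M) + 0"
    by (rule tendsto_lowerbound) simp
  then show ?thesis using R(2) by simp
qed

lemma step_int_indicator:
  assumes "step S k" "step S (\<lambda>s \<omega>. c \<omega> *\<^sub>R k s \<omega>)"
  shows "step_int S (\<lambda>s \<omega>. c \<omega> *\<^sub>R k s \<omega>) \<omega> = c \<omega> * step_int S k \<omega>"
proof -
  obtain m g where g: "grid m g" "S \<subseteq> g ` {..m}" using grid_exists[OF step_basic(1,2)[OF assms(1)]] by blast
  show ?thesis
    unfolding step_int_eq[OF assms(1) g] step_int_eq[OF assms(2) g] grid_int_def by (simp add: sum_distrib_left)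
qed

text \<open>Since \<open>H\<close> vanishes up to time \<open>a\<close>, the steps may be cut off to
  \<open>{a<..1}\<close> without changing the limit. After that, multiplication by the indicator of
  an event of \<open>F a\<close> keeps them predictable and factors out of the step
  integrals.\<close>

lemma approx_restrict:
  assumes a: "approx S h H I" and "0 \<le> a" "a \<le> 1" and A: "A \<in> sets (F a)"
    and H0: "AE \<omega> in M. AE s in unit_lborel. s \<le> a \<longrightarrow> H s \<omega> = 0"
  obtains S' h' where "approx S' h' (\<lambda>s \<omega>. indicator A \<omega> *\<^sub>R H s \<omega>) (\<lambda>\<omega>. indicator A \<omega> * I \<omega>)"
proof -
  have A_M [measurable]: "A \<in> events" using A sets_F_subset by blast
  let ?k = "\<lambda>A n s \<omega>. indicator {a<..1} s *\<^sub>R indicator A \<omega> *\<^sub>R h n s \<omega> :: real^'d"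
  have spF: "space M \<in> sets (F a)" using sets.top[of "F a"] by simp
  have st: "step (S n \<union> {a, 1}) (?k A n)" if "A \<in> sets (F a)" for A n
    using step_restrict[OF approxD(3)[OF a] _ _ that, of 1] assms by auto
  have bd: "AE \<omega> in M. (\<lambda>n. sq_dist (?k A n) (\<lambda>s \<omega>. indicator A \<omega> *\<^sub>R H s \<omega>) \<omega>) \<longlonglongrightarrow> 0" for A
    using approxD(4)[OF a] H0
  proof eventually_elim
    case (elim \<omega>)
    have "sq_dist (?k A n) (\<lambda>s \<omega>. indicator A \<omega> *\<^sub>R H s \<omega>) \<omega> \<le> sq_dist (h n) H \<omega>" for n
      unfolding sq_dist_def
    proof (rule nn_integral_mono_AE)
      have "AE s in unit_lborel. s \<in> {0..1}" using AE_space[of unit_lborel] by simp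
      then show "AE s in unit_lborel. ennreal ((norm (?k A n s \<omega> - indicator A \<omega> *\<^sub>R H s \<omega>))\<^sup>2) \<le> ennreal ((norm (h n s \<omega> - H s \<omega>))\<^sup>2)"
        using elim(2) by eventually_elim (auto intro!: ennreal_leI simp: indicator_def split: if_splits)
    qed
    then show ?case using elim(1) by (rule tendsto_0_le_ennreal)
  qed
  have "AE \<omega> in M. (\<lambda>n. sq_dist (?k (space M) n) H \<omega>) \<longlonglongrightarrow> 0"
    using bd[of "space M"] AE_space
  proof eventually_elim
    case (elim \<omega>)
    have "sq_dist (?k (space M) n) H \<omega> = sq_dist (?k (space M) n) (\<lambda>s \<omega>. indicator (space M) \<omega> *\<^sub>R H s \<omega>) \<omega>" for n
      using elim(2) by (simp add: sq_dist_def)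
    then show ?case using elim(1) by simp
  qed
  from approx_change[OF a st[OF spF] this] obtain r where r: "strict_mono r"
    "approx (\<lambda>n. S (r n) \<union> {a, 1}) (\<lambda>n. ?k (space M) (r n)) H I" by blast
  have si: "step_int (S n \<union> {a, 1}) (?k A n) \<omega> = indicator A \<omega> * step_int (S n \<union> {a, 1}) (?k (space M) n) \<omega>" for n \<omega>
  proof -
    have e: "?k A n = (\<lambda>s \<omega>. indicator A \<omega> *\<^sub>R ?k (space M) n s \<omega>)"
      using sets.sets_into_space[OF A_M] by (auto simp: fun_eq_iff indicator_def)
    show ?thesis using step_int_indicator[OF st[OF spF], of n "indicator A" \<omega>] st[OF A, of n] unfolding e by simp
  qed
  have "approx (\<lambda>n. S (r n) \<union> {a, 1}) (\<lambda>n. ?k A (r n)) (\<lambda>s \<omega>. indicator A \<omega> *\<^sub>R H s \<omega>) (\<lambda>\<omega>. indicator A \<omega> * I \<omega>)"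
    unfolding approx_def
  proof (intro conjI allI st[OF A])
    show "joint (\<lambda>s \<omega>. indicator A \<omega> *\<^sub>R H s \<omega>)"
    proof -
      note [measurable] = approxD(1)[OF a, unfolded joint_def]
      have "(\<lambda>x. indicator A (snd x) *\<^sub>R (case x of (s, \<omega>) \<Rightarrow> H s \<omega>)) \<in> borel_measurable (unit_lborel \<Otimes>\<^sub>M M)" by measurable
      then show ?thesis by (simp add: joint_def split_beta')
    qed
    show "(\<lambda>\<omega>. indicator A \<omega> * I \<omega>) \<in> borel_measurable M" using approxD(2)[OF a] by measurable
    show "AE \<omega> in M. (\<lambda>n. sq_dist (?k A (r n)) (\<lambda>s \<omega>. indicator A \<omega> *\<^sub>R H s \<omega>) \<omega>) \<longlonglongrightarrow> 0"
      using bd[of A] by eventually_elim (rule LIMSEQ_subseq_LIMSEQ[OF _ r(1), unfolded comp_def])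
    show "AE \<omega> in M. (\<lambda>n. step_int (S (r n) \<union> {a, 1}) (?k A (r n)) \<omega>) \<longlonglongrightarrow> indicator A \<omega> * I \<omega>"
      using approxD(5)[OF r(2)] unfolding si by eventually_elim (intro tendsto_intros)
  qed
  then show ?thesis by (rule that)
qed

section \<open>Ito integrals as almost sure limits of step integrals\<close>

lemma nn_integral_unit: "(\<integral>\<^sup>+s\<in>{0..1}. f s \<partial>lborel) = (\<integral>\<^sup>+s. f s \<partial>unit_lborel)"
  by (simp add: nn_integral_restrict_space)

text \<open>The definition of the Ito integral gives convergence in probability of the distances
  and, for each time, of the integrals. Three nested subsequences make the convergence almost sure
  for the distances, for time \<open>a\<close> and for time \<open>b\<close>.\<close>

lemma ito_approx:
  assumes ito: "ito_integral M F B H Z" and ab: "0 \<le> a" "a \<le> b" "b \<le> 1"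
  obtains S h where "approx S h (\<lambda>s \<omega>. indicator {a<..b} s *\<^sub>R H s \<omega>) (\<lambda>\<omega>. Z b \<omega> - Z a \<omega>)"
proof -
  have Z: "Z t \<in> borel_measurable M" if "t \<in> {0..1}" for t using ito that by (simp add: ito_integral_def)
  have jH: "joint H"
    using ito unfolding ito_integral_def joint_def measurable_cong_sets[OF sets_pair_measure_cong[OF sets_unit_lborel refl] refl] by blast
  have jab: "joint (\<lambda>s \<omega>. indicator {a<..b} s *\<^sub>R H s \<omega>)"
  proof -
    note [measurable] = jH[unfolded joint_def]
    have [measurable]: "(\<lambda>s. indicator {a<..b} s :: real) \<in> borel_measurable unit_lborel"
      by (intro measurable_restrict_space1) simp
    have "(\<lambda>x. indicator {a<..b} (fst x) *\<^sub>R (case x of (s, \<omega>) \<Rightarrow> H s \<omega>)) \<in> borel_measurable (unit_lborel \<Otimes>\<^sub>M M)"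
      by (intro borel_measurable_scaleR) measurable
    then show ?thesis by (simp add: joint_def split_beta')
  qed
  obtain k \<tau> \<xi> where s: "\<And>n. simple_process M F (k n) (\<tau> n) (\<xi> n)"
    and d: "null_in_prob M (\<lambda>n \<omega>. \<integral>\<^sup>+s\<in>{0..1}. ennreal ((norm (simple_value (k n) (\<tau> n) (\<xi> n) s \<omega> - H s \<omega>))\<^sup>2) \<partial>lborel)"
    and i: "\<And>t. t \<in> {0..1} \<Longrightarrow> null_in_prob M (\<lambda>n \<omega>. ennreal \<bar>simple_integral B (k n) (\<tau> n) (\<xi> n) t \<omega> - Z t \<omega>\<bar>)"
    using ito unfolding ito_integral_def by blast
  \<comment> \<open>The factor \<open>indicator {0<..1} s\<close> puts the simple process into the
    form of \<open>simple_step\<close>; measurability of the distance \<open>?D n\<close> then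
    follows from that of step processes.\<close>
  define h01 where "h01 n s \<omega> = indicator {0<..1} s *\<^sub>R simple_value (k n) (\<tau> n) (\<xi> n) s \<omega>" for n s \<omega>
  have h01: "joint (h01 n)" for n
    unfolding h01_def[abs_def] by (rule step_joint'[OF simple_step(1)[OF s]]) auto
  let ?D = "\<lambda>n \<omega>. \<integral>\<^sup>+s\<in>{0..1}. ennreal ((norm (simple_value (k n) (\<tau> n) (\<xi> n) s \<omega> - H s \<omega>))\<^sup>2) \<partial>lborel"
  have ne0: "AE s in unit_lborel. s \<noteq> 0 \<and> s \<in> {0..1}"
  proof -
    have "AE s in lborel. s \<noteq> (0::real)" by (rule AE_lborel_singleton)
    then show ?thesis by (subst AE_restrict_space_iff) auto
  qed
  have Deq: "?D n = sq_dist (h01 n) H" for n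
    unfolding nn_integral_unit sq_dist_def
    by (intro ext nn_integral_cong_AE) (use ne0 in \<open>eventually_elim, auto simp: h01_def\<close>)
  have Dm: "?D n \<in> borel_measurable M" for n unfolding Deq by (rule sq_dist_measurable[OF h01 jH])
  have sint: "simple_integral B (k n) (\<tau> n) (\<xi> n) t \<in> borel_measurable M" if t: "t \<in> {0..1}" for n t
  proof -
    have sp: "0 \<le> \<tau> n i" "\<tau> n i \<le> \<tau> n (Suc i)" "\<xi> n i \<in> borel_measurable M" if "i < k n" for i
      using s[of n] that F_M unfolding simple_process_def by auto
    have "(\<lambda>\<omega>. \<xi> n i \<omega> \<bullet> (B (min (\<tau> n (Suc i)) t) \<omega> - B (min (\<tau> n i) t) \<omega>)) \<in> borel_measurable M" if "i < k n" for i
      using sp[OF that] t by (intro borel_measurable_inner borel_measurable_diff B_M) auto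
    then show ?thesis unfolding simple_integral_def[abs_def] by (intro borel_measurable_sum) auto
  qed
  have im: "(\<lambda>\<omega>. ennreal \<bar>simple_integral B (k n) (\<tau> n) (\<xi> n) t \<omega> - Z t \<omega>\<bar>) \<in> borel_measurable M" if "t \<in> {0..1}" for n t
    using sint[OF that, of n] Z[OF that] by measurable
  obtain r1 where r1: "strict_mono r1" "AE \<omega> in M. (\<lambda>n. ?D (r1 n) \<omega>) \<longlonglongrightarrow> 0"
    using null_in_prob_subseq[OF Dm d] by blast
  have nip: "null_in_prob M (\<lambda>n. X (r n))" if "null_in_prob M X" "strict_mono r" for X r
    using that LIMSEQ_subseq_LIMSEQ[OF _ that(2)] unfolding null_in_prob_def comp_def by blast
  have ab01: "a \<in> {0..1}" "b \<in> {0..1}" using ab by auto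
  obtain r2 where r2: "strict_mono r2"
    "AE \<omega> in M. (\<lambda>n. ennreal \<bar>simple_integral B (k (r1 (r2 n))) (\<tau> (r1 (r2 n))) (\<xi> (r1 (r2 n))) a \<omega> - Z a \<omega>\<bar>) \<longlonglongrightarrow> 0"
    using null_in_prob_subseq[OF im[OF ab01(1)] nip[OF i[OF ab01(1)] r1(1)]] by blast
  have r12: "strict_mono (\<lambda>n. r1 (r2 n))" using strict_mono_o[OF r1(1) r2(1)] by (simp add: comp_def)
  obtain r3 where r3: "strict_mono r3"
    "AE \<omega> in M. (\<lambda>n. ennreal \<bar>simple_integral B (k (r1 (r2 (r3 n)))) (\<tau> (r1 (r2 (r3 n)))) (\<xi> (r1 (r2 (r3 n)))) b \<omega> - Z b \<omega>\<bar>) \<longlonglongrightarrow> 0"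
    using null_in_prob_subseq[OF im[OF ab01(2)] nip[OF i[OF ab01(2)] r12]] by blast
  define r where "r n = r1 (r2 (r3 n))" for n
  let ?S = "\<lambda>n. (\<Union>i<k n. {\<tau> n i, \<tau> n (Suc i)}) \<union> {a, b}"
  let ?h = "\<lambda>n s \<omega>. indicator {a<..b} s *\<^sub>R simple_value (k n) (\<tau> n) (\<xi> n) s \<omega>"
  note st = simple_step[OF s ab]
  have cv: "X \<longlonglongrightarrow> z" if "(\<lambda>n. ennreal \<bar>X n - z\<bar>) \<longlonglongrightarrow> 0" for X :: "nat \<Rightarrow> real" and z
  proof -
    have "(\<lambda>n. \<bar>X n - z\<bar>) \<longlonglongrightarrow> 0" using that unfolding ennreal_0[symmetric] by (subst (asm) tendsto_ennreal_iff) auto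
    then show ?thesis by (intro LIM_zero_cancel[where l=z]) (rule tendsto_rabs_zero_cancel)
  qed
  have "approx (\<lambda>n. ?S (r n)) (\<lambda>n. ?h (r n)) (\<lambda>s \<omega>. indicator {a<..b} s *\<^sub>R H s \<omega>) (\<lambda>\<omega>. Z b \<omega> - Z a \<omega>)"
    unfolding approx_def
  proof (intro conjI allI st(1) jab)
    show "(\<lambda>\<omega>. Z b \<omega> - Z a \<omega>) \<in> borel_measurable M" using Z[OF ab01(1)] Z[OF ab01(2)] by measurable
    show "AE \<omega> in M. (\<lambda>n. sq_dist (?h (r n)) (\<lambda>s \<omega>. indicator {a<..b} s *\<^sub>R H s \<omega>) \<omega>) \<longlonglongrightarrow> 0"
      using r1(2)
    proof eventually_elim
      case (elim \<omega>)
      have b: "sq_dist (?h n) (\<lambda>s \<omega>. indicator {a<..b} s *\<^sub>R H s \<omega>) \<omega> \<le> ?D n \<omega>" for n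
        unfolding nn_integral_unit sq_dist_def by (intro nn_integral_mono ennreal_leI) (auto simp: indicator_def)
      have "(\<lambda>n. ?D (r n) \<omega>) \<longlonglongrightarrow> 0"
        using LIMSEQ_subseq_LIMSEQ[OF elim strict_mono_o[OF r2(1) r3(1)]] by (simp add: comp_def r_def)
      then show ?case by (rule tendsto_0_le_ennreal[OF b])
    qed
    show "AE \<omega> in M. (\<lambda>n. step_int (?S (r n)) (?h (r n)) \<omega>) \<longlonglongrightarrow> Z b \<omega> - Z a \<omega>"
      unfolding st(2) using r2(2) r3(2)
    proof eventually_elim
      case (elim \<omega>)
      show ?case
        using LIMSEQ_subseq_LIMSEQ[OF cv[OF elim(1)] r3(1)] cv[OF elim(2)]
        unfolding comp_def r_def by (intro tendsto_diff)
    qed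
  qed
  then show ?thesis by (rule that)
qed

lemma ito_zero:
  assumes "ito_integral M F B H Z"
  shows "AE \<omega> in M. Z 0 \<omega> = 0"
proof -
  obtain k \<tau> \<xi> where s: "\<And>n. simple_process M F (k n) (\<tau> n) (\<xi> n)"
    and i: "\<And>t. t \<in> {0..1} \<Longrightarrow> null_in_prob M (\<lambda>n \<omega>. ennreal \<bar>simple_integral B (k n) (\<tau> n) (\<xi> n) t \<omega> - Z t \<omega>\<bar>)"
    using assms unfolding ito_integral_def by blast
  have "simple_integral B (k n) (\<tau> n) (\<xi> n) 0 \<omega> = 0" for n \<omega>
    unfolding simple_integral_def
  proof (intro sum.neutral ballI)
    fix i assume "i \<in> {..<k n}"
    then have "0 \<le> \<tau> n i" "\<tau> n i \<le> \<tau> n (Suc i)" using s[of n] by (auto simp: simple_process_def)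
    then show "\<xi> n i \<omega> \<bullet> (B (min (\<tau> n (Suc i)) 0) \<omega> - B (min (\<tau> n i) 0) \<omega>) = 0" by simp
  qed
  then have z: "null_in_prob M (\<lambda>n::nat. \<lambda>\<omega>. ennreal \<bar>Z 0 \<omega>\<bar>)" using i[of 0] by simp
  have "Z 0 \<in> borel_measurable M" using assms by (simp add: ito_integral_def)
  then have "(\<lambda>\<omega>. ennreal \<bar>Z 0 \<omega>\<bar>) \<in> borel_measurable M" by measurable
  from null_in_prob_subseq[OF this z] show ?thesis by (auto simp: LIMSEQ_const_iff)
qed

lemma ito_approx_0:
  assumes "ito_integral M F B H Z" "0 \<le> t" "t \<le> 1"
  obtains S h where "approx S h (\<lambda>s \<omega>. indicator {0<..t} s *\<^sub>R H s \<omega>) (Z t)"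
proof -
  obtain S h where a: "approx S h (\<lambda>s \<omega>. indicator {0<..t} s *\<^sub>R H s \<omega>) (\<lambda>\<omega>. Z t \<omega> - Z 0 \<omega>)"
    using ito_approx[OF assms(1) order_refl assms(2,3)] by blast
  have "approx S h (\<lambda>s \<omega>. indicator {0<..t} s *\<^sub>R H s \<omega>) (Z t)"
    using assms ito_zero[OF assms(1)]
    by (intro approx_cong[OF a approxD(1)[OF a]]) (auto simp: ito_integral_def elim!: eventually_mono)
  then show ?thesis by (rule that)
qed

end

section \<open>Girsanov's theorem\<close>

lemma gauss_char:
  assumes "\<delta> > 0"
  shows "(\<integral>y. cis (l \<bullet> y) \<partial>gauss \<delta>) = of_real (exp (- ((norm l)\<^sup>2 * \<delta> / 2)))"
proof -
  have "of_real (exp ((norm l)\<^sup>2 * \<delta> / 2)) * (\<integral>y. cis (l \<bullet> y) \<partial>gauss \<delta>) = 1"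
    using tilt_gauss(2)[OF assms, of 0 l] by (simp add: tilt_def)
  then have "of_real (exp (- ((norm l)\<^sup>2 * \<delta> / 2))) * (of_real (exp ((norm l)\<^sup>2 * \<delta> / 2)) * (\<integral>y. cis (l \<bullet> y) \<partial>gauss \<delta>)) =
      complex_of_real (exp (- ((norm l)\<^sup>2 * \<delta> / 2)))" by simp
  then show ?thesis
    unfolding mult.assoc[symmetric] of_real_mult[symmetric] mult_exp_exp by simp
qed

text \<open>Scheffe's lemma makes the densities converge in mean, because the limit has integral 1
  as well. Almost sure convergence of the bounded factors then suffices: against \<open>R\<close> by
  dominated convergence, against \<open>L n - R\<close> by their bound.\<close>

lemma (in prob_space) L1_bounded_limit:
  fixes c :: "nat \<Rightarrow> 'a \<Rightarrow> complex" and L :: "nat \<Rightarrow> 'a \<Rightarrow> real"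
  assumes L: "\<And>n. integrable M (L n)" "\<And>n \<omega>. 0 \<le> L n \<omega>" "\<And>n. (\<integral>\<omega>. L n \<omega> \<partial>M) = 1"
    and R: "integrable M R" "\<And>\<omega>. 0 \<le> R \<omega>" "(\<integral>\<omega>. R \<omega> \<partial>M) = 1" "AE \<omega> in M. (\<lambda>n. L n \<omega>) \<longlonglongrightarrow> R \<omega>"
    and c: "\<And>n. c n \<in> borel_measurable M" "\<And>n \<omega>. norm (c n \<omega>) \<le> 1"
      "c' \<in> borel_measurable M" "\<And>\<omega>. norm (c' \<omega>) \<le> 1" "AE \<omega> in M. (\<lambda>n. c n \<omega>) \<longlonglongrightarrow> c' \<omega>"
  shows "(\<lambda>n. \<integral>\<omega>. of_real (L n \<omega>) * c n \<omega> \<partial>M) \<longlonglongrightarrow> (\<integral>\<omega>. of_real (R \<omega>) * c' \<omega> \<partial>M)"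
proof -
  have "(\<lambda>n. \<integral>\<^sup>+\<omega>. norm (L n \<omega> - R \<omega>) \<partial>M) \<longlonglongrightarrow> 0"
    using L R by (intro Scheffe_lemma2) (auto simp: nn_integral_eq_integral)
  moreover have "(\<integral>\<^sup>+\<omega>. norm (L n \<omega> - R \<omega>) \<partial>M) = ennreal (\<integral>\<omega>. \<bar>L n \<omega> - R \<omega>\<bar> \<partial>M)" for n
    using L(1)[of n] R(1) by (subst nn_integral_eq_integral) auto
  ultimately have "(\<lambda>n. ennreal (\<integral>\<omega>. \<bar>L n \<omega> - R \<omega>\<bar> \<partial>M)) \<longlonglongrightarrow> ennreal 0" by simp
  then have l1: "(\<lambda>n. \<integral>\<omega>. \<bar>L n \<omega> - R \<omega>\<bar> \<partial>M) \<longlonglongrightarrow> 0"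
    by (subst (asm) tendsto_ennreal_iff) auto
  have iR: "integrable M (\<lambda>\<omega>. complex_of_real (R \<omega>))" "integrable M (\<lambda>\<omega>. complex_of_real (L n \<omega>))" for n
    using R(1) L(1) by (simp_all add: complex_of_real_integrable_eq)
  note b = integrable_mult_bounded(1)[where K=1]
  have i: "integrable M (\<lambda>\<omega>. of_real (L n \<omega>) * c n \<omega>)" "integrable M (\<lambda>\<omega>. of_real (R \<omega>) * c n \<omega>)"
    "integrable M (\<lambda>\<omega>. of_real (R \<omega>) * c' \<omega>)" for n
    using iR c by (auto intro!: b)
  have "(\<lambda>n. \<integral>\<omega>. of_real (R \<omega>) * c n \<omega> \<partial>M) \<longlonglongrightarrow> (\<integral>\<omega>. of_real (R \<omega>) * c' \<omega> \<partial>M)"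
  proof (rule integral_dominated_convergence[where w=R])
    show "AE \<omega> in M. (\<lambda>n. complex_of_real (R \<omega>) * c n \<omega>) \<longlonglongrightarrow> of_real (R \<omega>) * c' \<omega>"
      using c(5) by eventually_elim (intro tendsto_intros)
    show "AE \<omega> in M. norm (complex_of_real (R \<omega>) * c n \<omega>) \<le> R \<omega>" for n
      using R(2) c(2) by (intro AE_I2) (simp add: norm_mult mult_left_le)
  qed (use R(1) i in auto)
  moreover have "(\<lambda>n. \<integral>\<omega>. of_real (L n \<omega> - R \<omega>) * c n \<omega> \<partial>M) \<longlonglongrightarrow> 0"
  proof (rule Lim_null_comparison[OF always_eventually l1], intro allI)
    fix n
    have "norm (\<integral>\<omega>. of_real (L n \<omega> - R \<omega>) * c n \<omega> \<partial>M) \<le> (\<integral>\<omega>. norm (of_real (L n \<omega> - R \<omega>) * c n \<omega>) \<partial>M)"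
      by (rule integral_norm_bound)
    also have "\<dots> \<le> (\<integral>\<omega>. \<bar>L n \<omega> - R \<omega>\<bar> \<partial>M)"
    proof (rule integral_mono)
      show "integrable M (\<lambda>\<omega>. norm (of_real (L n \<omega> - R \<omega>) * c n \<omega>))"
        using i(1,2)[of n] by (simp add: left_diff_distrib)
      show "norm (of_real (L n \<omega> - R \<omega>) * c n \<omega>) \<le> \<bar>L n \<omega> - R \<omega>\<bar>" for \<omega>
        unfolding norm_mult norm_of_real using c(2)[of n \<omega>] by (simp add: mult_left_le)
    qed (use L(1)[of n] R(1) in auto)
    finally show "norm (\<integral>\<omega>. of_real (L n \<omega> - R \<omega>) * c n \<omega> \<partial>M) \<le> (\<integral>\<omega>. \<bar>L n \<omega> - R \<omega>\<bar> \<partial>M)" .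
  qed
  moreover have "(\<integral>\<omega>. of_real (L n \<omega>) * c n \<omega> \<partial>M) = (\<integral>\<omega>. of_real (R \<omega>) * c n \<omega> \<partial>M) + (\<integral>\<omega>. of_real (L n \<omega> - R \<omega>) * c n \<omega> \<partial>M)" for n
    using i(1,2)[of n] by (simp add: left_diff_distrib)
  ultimately show ?thesis using tendsto_add by fastforce
qed

context brownian begin

text \<open>The preimages of a set under \<open>f\<close> and under \<open>g\<close> differ by null
  sets, which belong to \<open>F t\<close> by \<open>null_F\<close>.\<close>

lemma F_AE:
  fixes f g :: "'a \<Rightarrow> real"
  assumes f: "f \<in> borel_measurable M" and g: "g \<in> borel_measurable (F t)" and eq: "AE \<omega> in M. f \<omega> = g \<omega>"
  shows "f \<in> borel_measurable (F t)"
proof (rule measurableI)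
  fix A :: "real set" assume A: "A \<in> sets borel"
  have [measurable]: "g \<in> borel_measurable M" by (rule F_M[OF g])
  note f [measurable]
  let ?a = "f -` A \<inter> space M" and ?b = "g -` A \<inter> space M"
  have sets: "?a \<in> events" "?b \<in> events" using A by measurable
  have AE: "AE \<omega> in M. \<omega> \<notin> (?a - ?b)" "AE \<omega> in M. \<omega> \<notin> (?b - ?a)"
    using eq by (eventually_elim, auto)+
  have "?a - ?b \<in> null_sets M" "?b - ?a \<in> null_sets M"
    using AE sets by (auto intro!: AE_iff_null_sets[THEN iffD2])
  then have "?a - ?b \<in> sets (F t)" "?b - ?a \<in> sets (F t)" using null_F by auto
  moreover have "?b \<in> sets (F t)" using measurable_sets[OF g A] by simp
  moreover have "?a = (?b \<union> (?a - ?b)) - (?b - ?a)" by auto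
  ultimately show "f -` A \<inter> space (F t) \<in> sets (F t)"
    unfolding space_F by (metis sets.Diff sets.Un)
qed simp

lemma F_AE_lim:
  fixes f :: "'a \<Rightarrow> real"
  assumes f: "f \<in> borel_measurable M" and g: "\<And>n. g n \<in> borel_measurable (F t)"
    and lim: "AE \<omega> in M. (\<lambda>n. g n \<omega>) \<longlonglongrightarrow> f \<omega>"
  shows "f \<in> borel_measurable (F t)"
proof (rule F_AE[OF f])
  show "(\<lambda>\<omega>. lim (\<lambda>n. g n \<omega>)) \<in> borel_measurable (F t)"
    by (rule borel_measurable_lim_metric[OF g])
  show "AE \<omega> in M. f \<omega> = lim (\<lambda>n. g n \<omega>)"
    using lim by eventually_elim (simp add: limI)
qed

definition drift :: "(real \<Rightarrow> 'a \<Rightarrow> real^'d) \<Rightarrow> real \<Rightarrow> 'a \<Rightarrow> real^'d" where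
  "drift H t \<omega> = (\<integral>s. indicator {0..t} s *\<^sub>R H s \<omega> \<partial>unit_lborel)"

lemma ind_meas_unit [measurable]: "A \<in> sets borel \<Longrightarrow> (\<lambda>s. indicator A s :: real) \<in> borel_measurable unit_lborel"
  by (intro measurable_restrict_space1) simp

lemma ind_sq_integrable:
  assumes "A \<in> sets borel"
  shows "integrable unit_lborel (\<lambda>s. (norm (indicator A s *\<^sub>R l))\<^sup>2)"
proof -
  note [measurable] = ind_meas_unit[OF assms]
  have e: "(norm (indicator A s *\<^sub>R l))\<^sup>2 = indicator A s * (norm l)\<^sup>2" for s by (simp add: indicator_def)
  show ?thesis
    unfolding e
  proof (rule unit_lborel.integrable_const_bound[where B="(norm l)\<^sup>2"])
    show "(\<lambda>s. indicator A s * (norm l)\<^sup>2) \<in> borel_measurable unit_lborel"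
      by (intro borel_measurable_times ind_meas_unit assms borel_measurable_const)
  qed (simp add: indicator_def)
qed

lemma unit_integrable_indicator:
  fixes f :: "real \<Rightarrow> 'v::euclidean_space"
  assumes "integrable unit_lborel f" "A \<in> sets borel"
  shows "integrable unit_lborel (\<lambda>s. indicator A s *\<^sub>R f s)"
  by (rule Bochner_Integration.integrable_bound[OF assms(1)])
     (use borel_measurable_scaleR[OF ind_meas_unit[OF assms(2)] borel_measurable_integrable[OF assms(1)]] in \<open>auto simp: indicator_def\<close>)

lemma sq_integrable_imp:
  fixes f :: "real \<Rightarrow> 'v::euclidean_space"
  assumes "f \<in> borel_measurable unit_lborel" "integrable unit_lborel (\<lambda>s. (norm (f s))\<^sup>2)"
  shows "integrable unit_lborel f"
proof (rule Bochner_Integration.integrable_bound)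
  show "integrable unit_lborel (\<lambda>s. 1 + (norm (f s))\<^sup>2)" using assms(2) by simp
  have "x \<le> 1 + x\<^sup>2" for x :: real
    using sum_squares_ge_zero[of "x - 1/2" 0] by (simp add: power2_eq_square algebra_simps)
  then show "AE s in unit_lborel. norm (f s) \<le> norm (1 + (norm (f s))\<^sup>2)"
    by (intro AE_I2) simp
qed (rule assms(1))

lemma drift_measurable:
  assumes "joint H"
  shows "drift H t \<in> borel_measurable M"
proof -
  note [measurable] = joint_swap[OF assms]
  have "(\<lambda>x. indicator {0..t} (snd x) *\<^sub>R (case x of (\<omega>, s) \<Rightarrow> H s \<omega>)) \<in> borel_measurable (M \<Otimes>\<^sub>M unit_lborel)"
    by measurable
  then show ?thesis
    unfolding drift_def by (intro unit_lborel.borel_measurable_lebesgue_integral) (simp add: split_beta')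
qed

lemma step_drift_measurable:
  assumes "step S h" "0 \<le> t" "t \<le> 1"
  shows "(\<lambda>\<omega>. \<integral>s. (indicator {0..t} s *\<^sub>R l) \<bullet> h s \<omega> \<partial>unit_lborel) \<in> borel_measurable (F t)"
proof -
  \<comment> \<open>Stopping the integrand at \<open>t\<close> places \<open>t\<close> on the grid,
    so a step of positive length lies either before \<open>t\<close>, where its value is known at
    time \<open>t\<close>, or after it, where the value vanishes.\<close>
  let ?k = "\<lambda>s \<omega>. indicator {0<..t} s *\<^sub>R indicator (space M) \<omega> *\<^sub>R h s \<omega>"
  have st: "step (S \<union> {0, t}) ?k" using assms sets.top[of "F 0"] by (intro step_restrict) auto
  obtain m g where g: "grid m g" "S \<union> {0, t} \<subseteq> g ` {..m}" using grid_exists[OF step_basic(1,2)[OF st]] by blast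
  have tg: "t \<in> g ` {..m}" using g by auto
  have e: "(\<integral>s. (indicator {0..t} s *\<^sub>R l) \<bullet> h s \<omega> \<partial>unit_lborel) = (\<Sum>j<m. (g (Suc j) - g j) *\<^sub>R (l \<bullet> ?k (g (Suc j)) \<omega>))"
    if w: "\<omega> \<in> space M" for \<omega>
  proof -
    have "(indicator {0..t} s *\<^sub>R l) \<bullet> h s \<omega> = l \<bullet> ?k s \<omega>" if "s \<in> {0..1}" for s
      using that step_basic(3)[OF assms(1)] w by (cases "s = 0") (auto simp: indicator_def)
    then have "(\<integral>s. (indicator {0..t} s *\<^sub>R l) \<bullet> h s \<omega> \<partial>unit_lborel) = (\<integral>s. l \<bullet> ?k s \<omega> \<partial>unit_lborel)"
      by (intro Bochner_Integration.integral_cong) auto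
    also have "\<dots> = (\<Sum>j<m. (g (Suc j) - g j) *\<^sub>R (l \<bullet> ?k (g (Suc j)) \<omega>))"
    proof (rule grid_integral(2)[OF g(1)])
      show "l \<bullet> ?k s \<omega> = l \<bullet> ?k (g (Suc j)) \<omega>" if "j < m" "s \<in> {g j<..g (Suc j)}" for j s
        using stepD(2)[OF st g that] by metis
    qed simp
    finally show ?thesis .
  qed
  have m: "(\<lambda>\<omega>. (g (Suc j) - g j) *\<^sub>R (l \<bullet> ?k (g (Suc j)) \<omega>)) \<in> borel_measurable (F t)" if j: "j < m" for j
  proof (cases "g j < g (Suc j) \<and> g (Suc j) \<le> t")
    case True
    then have "?k (g (Suc j)) \<in> borel_measurable (F t)"
      using F_mono[OF stepD(1)[OF st g j]] by auto
    then show ?thesis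
      by (rule borel_measurable_scaleR[OF borel_measurable_const borel_measurable_inner[OF borel_measurable_const]])
  next
    case False
    then have "g (Suc j) = g j \<or> indicator {0<..t} (g (Suc j)) = (0::real)"
      using g(1) j by (auto simp: grid_def not_less intro: antisym)
    then have "(\<lambda>\<omega>. (g (Suc j) - g j) *\<^sub>R (l \<bullet> ?k (g (Suc j)) \<omega>)) = (\<lambda>_. 0)" by auto
    then show ?thesis by simp
  qed
  have "(\<lambda>\<omega>. \<Sum>j<m. (g (Suc j) - g j) *\<^sub>R (l \<bullet> ?k (g (Suc j)) \<omega>)) \<in> borel_measurable (F t)"
    by (rule borel_measurable_sum) (rule m, simp)
  then show ?thesis by (subst measurable_cong[OF e]) simp_all
qed

lemma drift_inner:
  assumes "integrable unit_lborel (\<lambda>s. H s \<omega>)"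
  shows "l \<bullet> drift H t \<omega> = (\<integral>s. (indicator {0..t} s *\<^sub>R l) \<bullet> H s \<omega> \<partial>unit_lborel)"
proof -
  have "integrable unit_lborel (\<lambda>s. indicator {0..t} s *\<^sub>R H s \<omega>)"
    by (rule unit_integrable_indicator[OF assms]) simp
  then show ?thesis unfolding drift_def by (subst integral_inner_right[symmetric]) auto
qed

lemma drift_diff:
  assumes i: "integrable unit_lborel (\<lambda>s. H s \<omega>)" and "0 \<le> a" "a \<le> b"
  shows "drift H b \<omega> - drift H a \<omega> = (\<integral>s. indicator {a<..b} s *\<^sub>R H s \<omega> \<partial>unit_lborel)"
proof -
  have "integrable unit_lborel (\<lambda>s. indicator {0..t} s *\<^sub>R H s \<omega>)" for t
    by (rule unit_integrable_indicator[OF i]) simp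
  then have "drift H b \<omega> - drift H a \<omega> = (\<integral>s. indicator {0..b} s *\<^sub>R H s \<omega> - indicator {0..a} s *\<^sub>R H s \<omega> \<partial>unit_lborel)"
    unfolding drift_def by simp
  also have "\<dots> = (\<integral>s. indicator {a<..b} s *\<^sub>R H s \<omega> \<partial>unit_lborel)"
    using assms(2,3) by (intro Bochner_Integration.integral_cong refl) (auto simp: indicator_def)
  finally show ?thesis .
qed

text \<open>Adaptedness is inherited from the steps: their drifts are sums of values known at time
  \<open>t\<close>, and converge almost surely when tested against a vector
  \<open>l\<close>.\<close>

lemma drift_F:
  assumes a: "approx S h H I" and t: "0 \<le> t" "t \<le> 1"
  shows "drift H t \<in> borel_measurable (F t)"
  unfolding borel_measurable_euclidean_space[of "drift H t"]
proof
  fix l :: "real^'d"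
  let ?g = "\<lambda>n \<omega>. \<integral>s. (indicator {0..t} s *\<^sub>R l) \<bullet> h n s \<omega> \<partial>unit_lborel"
  show "(\<lambda>\<omega>. drift H t \<omega> \<bullet> l) \<in> borel_measurable (F t)"
  proof (rule F_AE_lim[where g="?g"])
    show "(\<lambda>\<omega>. drift H t \<omega> \<bullet> l) \<in> borel_measurable M"
      using drift_measurable[OF approxD(1)[OF a], of t] by measurable
    show "?g n \<in> borel_measurable (F t)" for n
      by (rule step_drift_measurable[OF approxD(3)[OF a] t])
    show "AE \<omega> in M. (\<lambda>n. ?g n \<omega>) \<longlonglongrightarrow> drift H t \<omega> \<bullet> l"
      using approx_L2[OF a] AE_space
    proof eventually_elim
      case (elim \<omega>)
      have k: "(\<lambda>s. indicator {0..t} s *\<^sub>R l) \<in> borel_measurable unit_lborel" by measurable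
      have k2: "integrable unit_lborel (\<lambda>s. (norm (indicator {0..t} s *\<^sub>R l))\<^sup>2)"
        by (rule ind_sq_integrable) simp
      have "integrable unit_lborel (\<lambda>s. H s \<omega>)"
        by (rule sq_integrable_imp[OF joint_section[OF approxD(1)[OF a] elim(2)] conjunct1[OF elim(1)]])
      note d = drift_inner[where H=H and \<omega>=\<omega>, OF this, of l t]
      have "(\<lambda>n. ?g n \<omega>) \<longlonglongrightarrow> (\<integral>s. (indicator {0..t} s *\<^sub>R l) \<bullet> H s \<omega> \<partial>unit_lborel)"
        using elim(1) k k2 by blast
      then show ?case unfolding d[symmetric] inner_commute[of l] .
    qed
  qed
qed

lemma drift_continuous:
  assumes "joint H" "AE \<omega> in M. integrable unit_lborel (\<lambda>s. H s \<omega>)"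
  shows "AE \<omega> in M. continuous_on {0..1} (\<lambda>t. drift H t \<omega>)"
  using assms(2)
proof eventually_elim
  case (elim \<omega>)
  then have "set_integrable lborel {0..1} (\<lambda>s. H s \<omega>)"
    by (simp add: integrable_restrict_space set_integrable_def)
  from set_borel_integral_eq_integral(1)[OF this] have c: "continuous_on {0..1} (\<lambda>t. integral {0..t} (\<lambda>s. H s \<omega>))"
    by (rule indefinite_integral_continuous_1)
  have "drift H t \<omega> = integral {0..t} (\<lambda>s. H s \<omega>)" if "t \<in> {0..1}" for t
  proof -
    have si: "set_integrable lborel {0..t} (\<lambda>s. H s \<omega>)"
      using \<open>set_integrable lborel {0..1} (\<lambda>s. H s \<omega>)\<close> by (rule set_integrable_subset) (use that in auto)
    have "drift H t \<omega> = (LINT s:{0..t}|lborel. H s \<omega>)"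
      unfolding drift_def set_lebesgue_integral_def using that
      by (subst integral_restrict_space) (auto intro!: Bochner_Integration.integral_cong simp: indicator_def)
    then show ?thesis using set_borel_integral_eq_integral(2)[OF si] by simp
  qed
  then show ?case using c by (subst continuous_on_cong[OF refl]) auto
qed

definition girsanov :: "('a \<Rightarrow> real) \<Rightarrow> (real \<Rightarrow> 'a \<Rightarrow> real^'d) \<Rightarrow> 'a measure" where
  "girsanov I H = density M (\<lambda>\<omega>. ennreal (dexp I H \<omega>))"

lemma approx_integrable:
  assumes "approx S h H I"
  shows "AE \<omega> in M. integrable unit_lborel (\<lambda>s. H s \<omega>)"
  using approx_L2[OF assms] AE_space
proof eventually_elim
  case (elim \<omega>)
  show ?case
    by (rule sq_integrable_imp[OF joint_section[OF approxD(1)[OF assms] elim(2)] conjunct1[OF elim(1)]])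
qed

text \<open>Passes the step identity between frequency \<open>l\<close> and frequency 0 to the
  limit. The assumption \<open>E\<close> is what makes the step densities converge in mean.\<close>

lemma girsanov_char:
  assumes a: "approx S h H I" and E: "(\<integral>\<omega>. dexp I H \<omega> \<partial>M) = 1"
    and ab: "0 \<le> a" "a \<le> b" "b \<le> 1" and A: "A \<in> sets (F a)"
  shows "of_real (exp ((norm l)\<^sup>2 * (b - a) / 2)) *
     (\<integral>\<omega>. of_real (dexp I H \<omega>) * (indicator A \<omega> * cis (l \<bullet> ((B b \<omega> - drift H b \<omega>) - (B a \<omega> - drift H a \<omega>)))) \<partial>M) =
     (\<integral>\<omega>. of_real (dexp I H \<omega>) * indicator A \<omega> \<partial>M)"
proof -
  have AM [measurable]: "A \<in> events" using A sets_F_subset by blast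
  let ?L = "\<lambda>n. dexp (step_int (S n) (h n)) (h n)"
  let ?k = "\<lambda>s. indicator {a<..b} s *\<^sub>R l"
  let ?c = "\<lambda>n \<omega>. indicator A \<omega> * cis (l \<bullet> (B b \<omega> - B a \<omega>) - (\<integral>s. ?k s \<bullet> h n s \<omega> \<partial>unit_lborel))"
  let ?c' = "\<lambda>\<omega>. indicator A \<omega> * cis (l \<bullet> ((B b \<omega> - drift H b \<omega>) - (B a \<omega> - drift H a \<omega>)))"
  have st: "step (S n) (h n)" for n by (rule approxD(3)[OF a])
  note L = step_exp_expectation[OF st] and R = approx_dexp_integrable(1)[OF a]
  have [measurable]: "B a \<in> borel_measurable M" "B b \<in> borel_measurable M" using ab by (auto intro!: B_M)
  note [measurable] = drift_measurable[OF approxD(1)[OF a]]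
  have k: "?k \<in> borel_measurable unit_lborel" by measurable
  have k2: "integrable unit_lborel (\<lambda>s. (norm (?k s))\<^sup>2)"
    by (rule ind_sq_integrable) simp
  have hm: "(\<lambda>\<omega>. \<integral>s. ?k s \<bullet> h n s \<omega> \<partial>unit_lborel) \<in> borel_measurable M" for n
  proof -
    note [measurable] = joint_swap[OF step_joint'[OF st[of n]]]
    have "(\<lambda>x. ?k (snd x) \<bullet> (case x of (\<omega>, s) \<Rightarrow> h n s \<omega>)) \<in> borel_measurable (M \<Otimes>\<^sub>M unit_lborel)" by measurable
    then show ?thesis by (intro unit_lborel.borel_measurable_lebesgue_integral) (simp add: split_beta')
  qed
  have lim: "(\<lambda>n. \<integral>\<omega>. of_real (?L n \<omega>) * ?c n \<omega> \<partial>M) \<longlonglongrightarrow> (\<integral>\<omega>. of_real (dexp I H \<omega>) * ?c' \<omega> \<partial>M)"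
  proof (rule L1_bounded_limit[OF L(1) _ L(2) R _ E approx_dexp_tendsto[OF a]])
    show "?c n \<in> borel_measurable M" for n using hm[of n] by measurable
    show "?c' \<in> borel_measurable M" by measurable
    show "AE \<omega> in M. (\<lambda>n. ?c n \<omega>) \<longlonglongrightarrow> ?c' \<omega>"
      using approx_L2[OF a] approx_integrable[OF a]
    proof eventually_elim
      case (elim \<omega>)
      have "(\<lambda>n. \<integral>s. ?k s \<bullet> h n s \<omega> \<partial>unit_lborel) \<longlonglongrightarrow> (\<integral>s. ?k s \<bullet> H s \<omega> \<partial>unit_lborel)"
        using elim(1) k k2 by blast
      moreover have "(\<integral>s. ?k s \<bullet> H s \<omega> \<partial>unit_lborel) = l \<bullet> (drift H b \<omega> - drift H a \<omega>)"
      proof -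
        have "integrable unit_lborel (\<lambda>s. indicator {a<..b} s *\<^sub>R H s \<omega>)"
          by (rule unit_integrable_indicator[OF elim(2)]) simp
        then show ?thesis unfolding drift_diff[where H=H and \<omega>=\<omega>, OF elim(2) ab(1,2)]
          by (subst integral_inner_right[symmetric]) auto
      qed
      ultimately have "(\<lambda>n. ?c n \<omega>) \<longlonglongrightarrow> indicator A \<omega> * cis (l \<bullet> (B b \<omega> - B a \<omega>) - l \<bullet> (drift H b \<omega> - drift H a \<omega>))"
        unfolding cis_conv_exp by (intro tendsto_intros) auto
      then show ?case by (simp add: inner_diff_right algebra_simps)
    qed
  qed (auto simp: norm_mult indicator_def)
  have lim0: "(\<lambda>n. \<integral>\<omega>. complex_of_real (?L n \<omega>) * indicator A \<omega> \<partial>M) \<longlonglongrightarrow> (\<integral>\<omega>. of_real (dexp I H \<omega>) * indicator A \<omega> \<partial>M)"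
    by (rule L1_bounded_limit[OF L(1) _ L(2) R _ E approx_dexp_tendsto[OF a]]) (auto simp: indicator_def)
  have eq: "of_real (exp ((norm l)\<^sup>2 * (b - a) / 2)) * (\<integral>\<omega>. of_real (?L n \<omega>) * ?c n \<omega> \<partial>M) = (\<integral>\<omega>. of_real (?L n \<omega>) * indicator A \<omega> \<partial>M)" for n
  proof -
    have e1: "indicator A \<omega> * exp_tilt (S n) (h n) a b l \<omega> = of_real (exp ((norm l)\<^sup>2 * (b - a) / 2)) * (of_real (?L n \<omega>) * ?c n \<omega>)" for \<omega>
      by (simp add: exp_tilt_def dexp_def exp_add)
    have e2: "indicator A \<omega> * exp_tilt (S n) (h n) a b 0 \<omega> = of_real (?L n \<omega>) * indicator A \<omega>" for \<omega>
      by (simp add: exp_tilt_def dexp_def)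
    show ?thesis
      using exp_tilt_expectation(2)[OF st[of n] ab A, of l] unfolding e1 e2 integral_mult_right_zero .
  qed
  show ?thesis
    by (rule LIMSEQ_unique[OF tendsto_mult[OF tendsto_const lim] lim0[folded eq]])
qed

text \<open>The Fourier transform of the shifted increment with weight \<open>?w\<close> is
  \<open>q\<close> times that of the Gaussian law, where \<open>q\<close> is the mass of
  \<open>A\<close> under the new measure. The law of the increment and its independence from
  \<open>F a\<close> are both contained in this.\<close>

lemma girsanov_increment:
  assumes a: "approx S h H I" and E: "(\<integral>\<omega>. dexp I H \<omega> \<partial>M) = 1"
    and ab: "0 \<le> a" "a < b" "b \<le> 1" and A: "A \<in> sets (F a)" and C: "C \<in> sets borel"
  defines "Y \<equiv> \<lambda>\<omega>. (B b \<omega> - drift H b \<omega>) - (B a \<omega> - drift H a \<omega>)"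
  shows "(\<integral>\<omega>. dexp I H \<omega> * indicator A \<omega> * indicator C (Y \<omega>) \<partial>M) =
    (\<integral>\<omega>. dexp I H \<omega> * indicator A \<omega> \<partial>M) * measure (gauss (b - a)) C"
proof -
  interpret g: prob_space "gauss (b - a) :: (real^'d) measure" using ab by (intro prob_space_gauss) simp
  have AM [measurable]: "A \<in> events" using A sets_F_subset by blast
  let ?w = "\<lambda>\<omega>. dexp I H \<omega> * indicator A \<omega>"
  define q where "q = (\<integral>\<omega>. ?w \<omega> \<partial>M)"
  have [measurable]: "B a \<in> borel_measurable M" "B b \<in> borel_measurable M" using ab by (auto intro!: B_M)
  note [measurable] = drift_measurable[OF approxD(1)[OF a]]
  have wi: "integrable M ?w"
    by (rule integrable_mult_bounded(1)[OF approx_dexp_integrable(1)[OF a], where K=1]) (auto simp: indicator_def)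
  have q0: "0 \<le> q" unfolding q_def by (rule Bochner_Integration.integral_nonneg) simp
  have "(\<integral>\<omega>. ?w \<omega> * indicator C (Y \<omega>) \<partial>M) = (\<integral>y. q * indicator C y \<partial>gauss (b - a))"
  proof (rule integral_eqI_char[where Y'="\<lambda>y. y"])
    show "Y \<in> borel_measurable M" unfolding Y_def by measurable
    fix l :: "real^'d"
    have "of_real (exp ((norm l)\<^sup>2 * (b - a) / 2)) * (\<integral>\<omega>. of_real (?w \<omega>) * cis (l \<bullet> Y \<omega>) \<partial>M) = of_real q"
    proof -
      have 1: "of_real (?w \<omega>) * cis (l \<bullet> Y \<omega>) = of_real (dexp I H \<omega>) * (indicator A \<omega> * cis (l \<bullet> Y \<omega>))" for \<omega>
        by (simp add: indicator_def)
      have 2: "(\<integral>\<omega>. of_real (dexp I H \<omega>) * indicator A \<omega> \<partial>M) = complex_of_real q"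
        unfolding q_def integral_complex_of_real[symmetric] by (simp add: of_real_indicator)
      show ?thesis
        unfolding Y_def 1[unfolded Y_def] 2[symmetric] using ab by (intro girsanov_char[OF a E _ _ _ A]) auto
    qed
    then have "of_real (exp (- ((norm l)\<^sup>2 * (b - a) / 2))) * (of_real (exp ((norm l)\<^sup>2 * (b - a) / 2)) * (\<integral>\<omega>. of_real (?w \<omega>) * cis (l \<bullet> Y \<omega>) \<partial>M)) =
        of_real (exp (- ((norm l)\<^sup>2 * (b - a) / 2))) * complex_of_real q" by simp
    then have "(\<integral>\<omega>. of_real (?w \<omega>) * cis (l \<bullet> Y \<omega>) \<partial>M) = of_real q * of_real (exp (- ((norm l)\<^sup>2 * (b - a) / 2)))"
      unfolding mult.assoc[symmetric] of_real_mult[symmetric] mult_exp_exp by (simp add: mult.commute)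
    also have "\<dots> = (\<integral>y. of_real q * cis (l \<bullet> y) \<partial>gauss (b - a))"
      using ab gauss_char[of "b - a" l] by simp
    finally show "(\<integral>\<omega>. of_real (?w \<omega>) * cis (l \<bullet> Y \<omega>) \<partial>M) = (\<integral>y. of_real q * cis (l \<bullet> y) \<partial>gauss (b - a))" .
  qed (use wi q0 C in auto)
  also have "\<dots> = q * measure (gauss (b - a)) C" using C by simp
  finally show ?thesis by (simp add: q_def)
qed

lemma girsanov_measure:
  assumes a: "approx S h H I" and "A \<in> events"
  shows "emeasure (girsanov I H) A = ennreal (\<integral>\<omega>. dexp I H \<omega> * indicator A \<omega> \<partial>M)"
proof -
  note R = approx_dexp_integrable(1)[OF a]
  have i: "integrable M (\<lambda>\<omega>. dexp I H \<omega> * indicator A \<omega>)"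
    by (rule integrable_mult_bounded(1)[OF R, where K=1]) (use assms(2) in \<open>auto simp: indicator_def\<close>)
  have "emeasure (girsanov I H) A = (\<integral>\<^sup>+\<omega>. ennreal (dexp I H \<omega> * indicator A \<omega>) \<partial>M)"
    unfolding girsanov_def using assms(2) R
    by (subst emeasure_density) (auto intro!: nn_integral_cong simp: indicator_def)
  also have "\<dots> = ennreal (\<integral>\<omega>. dexp I H \<omega> * indicator A \<omega> \<partial>M)"
    by (rule nn_integral_eq_integral[OF i]) simp
  finally show ?thesis .
qed

text \<open>Initial value and continuity survive because the new measure is absolutely continuous,
  and the drift is adapted by \<open>drift_F\<close>. Law and independence of the increments come
  from \<open>girsanov_increment\<close>.\<close>

theorem girsanov_brownian:
  assumes a: "approx S h H I" and E: "(\<integral>\<omega>. dexp I H \<omega> \<partial>M) = 1"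
  shows "brownian_motion (girsanov I H) F (\<lambda>t \<omega>. B t \<omega> - drift H t \<omega>)"
proof -
  let ?Q = "girsanov I H"
  have dm: "dexp I H \<in> borel_measurable M" using approx_dexp_integrable(1)[OF a] by auto
  have spQ [simp]: "space ?Q = space M" and setsQ [simp]: "sets ?Q = events" by (auto simp: girsanov_def)
  have mQ: "borel_measurable ?Q = borel_measurable M" by (rule measurable_cong_sets) auto
  have AEQ: "AE \<omega> in ?Q. R \<omega>" if "AE \<omega> in M. R \<omega>" for R
    unfolding girsanov_def using dm that by (subst AE_density) (auto elim!: eventually_mono)
  have measQ: "measure ?Q A = (\<integral>\<omega>. dexp I H \<omega> * indicator A \<omega> \<partial>M)" if "A \<in> events" for A
    unfolding measure_def girsanov_measure[OF a that] by (simp add: Bochner_Integration.integral_nonneg)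
  have QP: "prob_space ?Q"
    by (rule prob_spaceI) (use girsanov_measure[OF a, of "space M"] E in \<open>simp cong: Bochner_Integration.integral_cong\<close>)
  interpret Q: prob_space ?Q by (rule QP)
  note [measurable] = drift_measurable[OF approxD(1)[OF a]]
  show ?thesis
    unfolding brownian_motion_def
  proof (intro conjI allI impI ballI QP)
    show "filtration_of ?Q F" using bm by (simp add: brownian_motion_def filtration_of_def)
    show "(\<lambda>\<omega>. B t \<omega> - drift H t \<omega>) \<in> borel_measurable (F t)" if "t \<in> {0..1}" for t
      using B_F[OF that] drift_F[OF a, of t] that by auto
    have "AE \<omega> in M. drift H 0 \<omega> = 0"
    proof (intro AE_I2)
      fix \<omega> assume "\<omega> \<in> space M"
      have "AE s in unit_lborel. s \<noteq> 0"
        using AE_lborel_singleton[of "0::real"] by (subst AE_restrict_space_iff) auto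
      then have "AE s in unit_lborel. indicator {0..0} s *\<^sub>R H s \<omega> = 0" by eventually_elim simp
      then show "drift H 0 \<omega> = 0" unfolding drift_def by (rule integral_eq_zero_AE)
    qed
    moreover have "AE \<omega> in M. B 0 \<omega> = 0" using bm by (simp add: brownian_motion_def)
    ultimately have "AE \<omega> in M. B 0 \<omega> - drift H 0 \<omega> = 0" by eventually_elim simp
    then show "AE \<omega> in ?Q. B 0 \<omega> - drift H 0 \<omega> = 0" by (rule AEQ)
    have "AE \<omega> in M. continuous_on {0..1} (\<lambda>t. B t \<omega>)" using bm by (simp add: brownian_motion_def)
    then have "AE \<omega> in M. continuous_on {0..1} (\<lambda>t. B t \<omega> - drift H t \<omega>)"
      using drift_continuous[OF approxD(1)[OF a] approx_integrable[OF a]]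
      by eventually_elim (intro continuous_intros)
    then show "AE \<omega> in ?Q. continuous_on {0..1} (\<lambda>t. B t \<omega> - drift H t \<omega>)" by (rule AEQ)
    fix s t :: real assume st: "0 \<le> s \<and> s < t \<and> t \<le> 1"
    let ?Y = "\<lambda>\<omega>. (B t \<omega> - drift H t \<omega>) - (B s \<omega> - drift H s \<omega>)"
    have [measurable]: "B s \<in> borel_measurable M" "B t \<in> borel_measurable M" using st by (auto intro!: B_M)
    have Ym: "?Y \<in> borel_measurable M" by measurable
    \<comment> \<open>For \<open>A\<close> the whole space this is the law of the increment;
      inserted back, it gives independence from \<open>F s\<close>.\<close>
    have inc: "measure ?Q (A \<inter> (?Y -` C \<inter> space M)) = measure ?Q A * measure (gauss (t - s)) C"
      if A: "A \<in> sets (F s)" and C: "C \<in> sets borel" for A C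
    proof -
      have AM: "A \<in> events" using A sets_F_subset by blast
      have "measure ?Q (A \<inter> (?Y -` C \<inter> space M)) = (\<integral>\<omega>. dexp I H \<omega> * indicator A \<omega> * indicator C (?Y \<omega>) \<partial>M)"
        using AM measurable_sets[OF Ym C]
        by (subst measQ) (auto intro!: Bochner_Integration.integral_cong simp: indicator_def)
      also have "\<dots> = measure ?Q A * measure (gauss (t - s)) C"
        using girsanov_increment[OF a E _ _ _ A C, of t] st measQ[OF AM] by simp
      finally show ?thesis .
    qed
    have law: "measure ?Q (?Y -` C \<inter> space M) = measure (gauss (t - s)) C" if "C \<in> sets borel" for C
      using inc[OF sets.top that] Q.prob_space by (simp add: Int_absorb2 inf.absorb2)
    show "distr ?Q borel ?Y = density lborel (\<lambda>y. ennreal (\<Prod>i\<in>UNIV. normal_density 0 (sqrt (t - s)) (y $ i)))"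
      unfolding gauss_def[symmetric]
    proof (rule measure_eqI)
      interpret g: prob_space "gauss (t - s) :: (real^'d) measure" using st by (intro prob_space_gauss) simp
      fix C assume "C \<in> sets (distr ?Q borel ?Y)"
      then have C: "C \<in> sets borel" by simp
      show "emeasure (distr ?Q borel ?Y) C = emeasure (gauss (t - s)) C"
        using C Ym law[OF C] by (simp add: emeasure_distr mQ Q.emeasure_eq_measure g.emeasure_eq_measure)
    qed simp
    show "Q.indep_set (sets (F s)) {?Y -` A \<inter> space ?Q | A. A \<in> sets borel}"
    proof (rule Q.indep_setI)
      show "sets (F s) \<subseteq> Q.events" using sets_F_subset by simp
      show "{?Y -` A \<inter> space ?Q | A. A \<in> sets borel} \<subseteq> Q.events" using measurable_sets[OF Ym] by auto
      fix A D assume "A \<in> sets (F s)" "D \<in> {?Y -` A \<inter> space ?Q | A. A \<in> sets borel}"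
      then show "Q.prob (A \<inter> D) = Q.prob A * Q.prob D" using inc law by auto
    qed
  qed
qed

end

section \<open>Convergence in probability and Ito integrals under a change of measure\<close>

context prob_space begin

text \<open>Absolute continuity, quantitatively: the part of the density above a level
  \<open>c\<close> has small integral, and the part below it contributes at most \<open>c\<close>
  times the original probability.\<close>

lemma null_in_prob_density:
  assumes R: "integrable M R" "\<And>\<omega>. 0 \<le> R \<omega>" and D [measurable]: "\<And>n. D n \<in> borel_measurable M"
    and n: "null_in_prob M D"
  shows "null_in_prob (density M (\<lambda>\<omega>. ennreal (R \<omega>))) D"
  unfolding null_in_prob_def
proof (intro allI impI)
  fix \<epsilon> :: real assume "\<epsilon> > 0"
  have [measurable]: "R \<in> borel_measurable M" using R(1) by auto
  let ?A = "\<lambda>n. {\<omega>\<in>space M. ennreal \<epsilon> < D n \<omega>}"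
  have p: "(\<lambda>n. prob (?A n)) \<longlonglongrightarrow> 0" using n \<open>\<epsilon> > 0\<close> by (simp add: null_in_prob_def)
  have m: "measure (density M (\<lambda>\<omega>. ennreal (R \<omega>))) (?A n) = (\<integral>\<omega>. R \<omega> * indicator (?A n) \<omega> \<partial>M)" for n
  proof -
    have i: "integrable M (\<lambda>\<omega>. R \<omega> * indicator (?A n) \<omega>)"
      by (rule integrable_mult_bounded(1)[OF R(1), where K=1]) (auto simp: indicator_def)
    have "emeasure (density M (\<lambda>\<omega>. ennreal (R \<omega>))) (?A n) = (\<integral>\<^sup>+\<omega>. ennreal (R \<omega> * indicator (?A n) \<omega>) \<partial>M)"
      by (subst emeasure_density) (auto intro!: nn_integral_cong simp: indicator_def)
    then show ?thesis
      using R(2) by (simp add: measure_def nn_integral_eq_integral[OF i] Bochner_Integration.integral_nonneg)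
  qed
  have r: "(\<lambda>c. \<integral>\<omega>. R \<omega> - min (R \<omega>) (real c) \<partial>M) \<longlonglongrightarrow> (\<integral>\<omega>. 0 \<partial>M)"
  proof (rule integral_dominated_convergence[where w=R])
    show "AE \<omega> in M. (\<lambda>c. R \<omega> - min (R \<omega>) (real c)) \<longlonglongrightarrow> 0"
    proof (intro AE_I2 tendsto_eventually)
      fix \<omega>
      have "eventually (\<lambda>c. R \<omega> \<le> real c) sequentially"
        using filterlim_real_sequentially by (simp add: filterlim_at_top)
      then show "eventually (\<lambda>c. R \<omega> - min (R \<omega>) (real c) = 0) sequentially" by eventually_elim simp
    qed
    show "AE \<omega> in M. norm (R \<omega> - min (R \<omega>) (real c)) \<le> R \<omega>" for c
      using R(2) by (intro AE_I2) (auto simp: min_def)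
  qed (use R in auto)
  show "(\<lambda>n. measure (density M (\<lambda>\<omega>. ennreal (R \<omega>))) {\<omega> \<in> space (density M (\<lambda>\<omega>. ennreal (R \<omega>))). ennreal \<epsilon> < D n \<omega>}) \<longlonglongrightarrow> 0"
    unfolding space_density m
  proof (rule LIMSEQ_I)
    fix e :: real assume e: "e > 0"
    have "eventually (\<lambda>c. (\<integral>\<omega>. R \<omega> - min (R \<omega>) (real c) \<partial>M) < e / 2) sequentially"
      using r e by (intro order_tendstoD(2)[where a="e/2"]) auto
    then obtain c where c: "(\<integral>\<omega>. R \<omega> - min (R \<omega>) (real c) \<partial>M) < e / 2" by (auto simp: eventually_sequentially)
    have "eventually (\<lambda>n. prob (?A n) < e / (2 * (real c + 1))) sequentially"
      using p e by (intro order_tendstoD(2)[OF p]) auto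
    then obtain N where N: "\<And>n. n \<ge> N \<Longrightarrow> prob (?A n) < e / (2 * (real c + 1))" by (auto simp: eventually_sequentially)
    have "norm ((\<integral>\<omega>. R \<omega> * indicator (?A n) \<omega> \<partial>M) - 0) < e" if n: "n \<ge> N" for n
    proof -
      have i: "integrable M (\<lambda>\<omega>. R \<omega> * indicator (?A n) \<omega>)"
        by (rule integrable_mult_bounded(1)[OF R(1), where K=1]) (auto simp: indicator_def)
      have i2: "integrable M (\<lambda>\<omega>. R \<omega> - min (R \<omega>) (real c))"
        using R by (intro Bochner_Integration.integrable_diff R integrable_const_bound[where B="real c"] AE_I2) auto
      have ci: "integrable M (\<lambda>\<omega>. real c * indicator (?A n) \<omega>)"
        by (rule integrable_const_bound[where B="real c"]) (auto simp: indicator_def)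
      have "(\<integral>\<omega>. R \<omega> * indicator (?A n) \<omega> \<partial>M) \<le> (\<integral>\<omega>. (R \<omega> - min (R \<omega>) (real c)) + real c * indicator (?A n) \<omega> \<partial>M)"
      proof (rule integral_mono[OF i Bochner_Integration.integrable_add[OF i2]])
        show "integrable M (\<lambda>\<omega>. real c * indicator (?A n) \<omega>)" by (rule ci)
        show "R \<omega> * indicator (?A n) \<omega> \<le> R \<omega> - min (R \<omega>) (real c) + real c * indicator (?A n) \<omega>" for \<omega>
          using R(2)[of \<omega>] by (auto simp: indicator_def min_def)
      qed
      also have "\<dots> = (\<integral>\<omega>. R \<omega> - min (R \<omega>) (real c) \<partial>M) + real c * prob (?A n)"
        unfolding Bochner_Integration.integral_add[OF i2 ci] by simp
      also have "real c * prob (?A n) \<le> (real c + 1) * prob (?A n)" by (intro mult_right_mono) auto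
      also have "(real c + 1) * prob (?A n) < e / 2"
        using N[OF n] by (simp add: field_simps)
      finally have "(\<integral>\<omega>. R \<omega> * indicator (?A n) \<omega> \<partial>M) < e" using c by simp
      moreover have "0 \<le> (\<integral>\<omega>. R \<omega> * indicator (?A n) \<omega> \<partial>M)" using R(2) by (intro Bochner_Integration.integral_nonneg) simp
      ultimately show ?thesis by simp
    qed
    then show "\<exists>N. \<forall>n\<ge>N. norm ((\<integral>\<omega>. R \<omega> * indicator (?A n) \<omega> \<partial>M) - 0) < e" by blast
  qed
qed

lemma null_in_prob_add:
  fixes X Y :: "nat \<Rightarrow> 'a \<Rightarrow> real"
  assumes [measurable]: "\<And>n. X n \<in> borel_measurable M" "\<And>n. Y n \<in> borel_measurable M"
    and "null_in_prob M (\<lambda>n \<omega>. ennreal \<bar>X n \<omega>\<bar>)" "null_in_prob M (\<lambda>n \<omega>. ennreal \<bar>Y n \<omega>\<bar>)"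
  shows "null_in_prob M (\<lambda>n \<omega>. ennreal \<bar>X n \<omega> + Y n \<omega>\<bar>)"
  unfolding null_in_prob_def
proof (intro allI impI)
  fix e :: real assume e: "e > 0"
  let ?A = "\<lambda>X n. {\<omega>\<in>space M. ennreal (e/2) < ennreal \<bar>X n \<omega>\<bar>}"
  have "(\<lambda>n. prob (?A X n)) \<longlonglongrightarrow> 0" "(\<lambda>n. prob (?A Y n)) \<longlonglongrightarrow> 0"
    using assms(3,4) e by (auto simp: null_in_prob_def)
  from tendsto_add[OF this] have l: "(\<lambda>n. prob (?A X n) + prob (?A Y n)) \<longlonglongrightarrow> 0" by simp
  have "prob {\<omega>\<in>space M. ennreal e < ennreal \<bar>X n \<omega> + Y n \<omega>\<bar>} \<le> prob (?A X n) + prob (?A Y n)" for n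
  proof -
    have "{\<omega>\<in>space M. ennreal e < ennreal \<bar>X n \<omega> + Y n \<omega>\<bar>} \<subseteq> ?A X n \<union> ?A Y n"
      using e by (auto simp: ennreal_less_iff)
    then show ?thesis by (intro order_trans[OF finite_measure_mono measure_Un_le]) auto
  qed
  then show "(\<lambda>n. prob {\<omega>\<in>space M. ennreal e < ennreal \<bar>X n \<omega> + Y n \<omega>\<bar>}) \<longlonglongrightarrow> 0"
    by (intro tendsto_sandwich[OF _ _ tendsto_const l]) auto
qed

end

context brownian begin

lemma simple_drift:
  assumes i: "integrable unit_lborel (\<lambda>s. H s \<omega>)" and sp: "simple_process M F k \<tau> \<xi>" and t: "0 \<le> t" "t \<le> 1"
  shows "simple_integral (\<lambda>t \<omega>. B t \<omega> - drift H t \<omega>) k \<tau> \<xi> t \<omega> =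
    simple_integral B k \<tau> \<xi> t \<omega> - (\<integral>s. (indicator {0<..t} s *\<^sub>R H s \<omega>) \<bullet> simple_value k \<tau> \<xi> s \<omega> \<partial>unit_lborel)"
proof -
  have \<tau>: "0 \<le> \<tau> j" "\<tau> j \<le> \<tau> (Suc j)" if "j < k" for j using sp that by (auto simp: simple_process_def)
  have int: "integrable unit_lborel (\<lambda>s. indicator {u<..v} s *\<^sub>R H s \<omega>)" for u v
    by (rule unit_integrable_indicator[OF i]) simp
  have d: "\<xi> j \<omega> \<bullet> (drift H (min (\<tau> (Suc j)) t) \<omega> - drift H (min (\<tau> j) t) \<omega>) =
     (\<integral>s. \<xi> j \<omega> \<bullet> (indicator {min (\<tau> j) t<..min (\<tau> (Suc j)) t} s *\<^sub>R H s \<omega>) \<partial>unit_lborel)" if "j < k" for j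
  proof -
    have "drift H (min (\<tau> (Suc j)) t) \<omega> - drift H (min (\<tau> j) t) \<omega> =
        (\<integral>s. indicator {min (\<tau> j) t<..min (\<tau> (Suc j)) t} s *\<^sub>R H s \<omega> \<partial>unit_lborel)"
      using \<tau>[OF that] t by (intro drift_diff[where H=H and \<omega>=\<omega>, OF i]) auto
    then show ?thesis using integral_inner_right[OF int] by metis
  qed
  have e: "(indicator {0<..t} s *\<^sub>R H s \<omega>) \<bullet> simple_value k \<tau> \<xi> s \<omega> =
     (\<Sum>j<k. \<xi> j \<omega> \<bullet> (indicator {min (\<tau> j) t<..min (\<tau> (Suc j)) t} s *\<^sub>R H s \<omega>))" for s
  proof -
    have "indicator {min (\<tau> j) t<..min (\<tau> (Suc j)) t} s = indicator {0<..t} s * (indicator {\<tau> j<..\<tau> (Suc j)} s :: real)" if "j < k" for j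
      using \<tau>[OF that] t by (auto simp: indicator_def)
    then show ?thesis
      unfolding simple_value_def inner_sum_right by (intro sum.cong refl) (simp add: inner_commute)
  qed
  have "(\<integral>s. (indicator {0<..t} s *\<^sub>R H s \<omega>) \<bullet> simple_value k \<tau> \<xi> s \<omega> \<partial>unit_lborel) =
     (\<Sum>j<k. \<xi> j \<omega> \<bullet> (drift H (min (\<tau> (Suc j)) t) \<omega> - drift H (min (\<tau> j) t) \<omega>))"
  proof -
    have "integrable unit_lborel (\<lambda>s. \<xi> j \<omega> \<bullet> (indicator {min (\<tau> j) t<..min (\<tau> (Suc j)) t} s *\<^sub>R H s \<omega>))" for j
      by (rule integrable_inner_right) (rule int)
    from Bochner_Integration.integral_sum[OF this]
    have "(\<integral>s. (\<Sum>j<k. \<xi> j \<omega> \<bullet> (indicator {min (\<tau> j) t<..min (\<tau> (Suc j)) t} s *\<^sub>R H s \<omega>)) \<partial>unit_lborel) =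
      (\<Sum>j<k. \<integral>s. \<xi> j \<omega> \<bullet> (indicator {min (\<tau> j) t<..min (\<tau> (Suc j)) t} s *\<^sub>R H s \<omega>) \<partial>unit_lborel)" .
    also have "\<dots> = (\<Sum>j<k. \<xi> j \<omega> \<bullet> (drift H (min (\<tau> (Suc j)) t) \<omega> - drift H (min (\<tau> j) t) \<omega>))"
      by (rule sum.cong[OF refl]) (rule d[symmetric], simp)
    finally show ?thesis unfolding e .
  qed
  then show ?thesis
    unfolding simple_integral_def sum_subtractf[symmetric] by (simp add: inner_diff_right sum_subtractf sum.distrib algebra_simps)
qed

lemma simple_value_section:
  "(\<lambda>s. simple_value k \<tau> \<xi> s \<omega>) \<in> borel_measurable unit_lborel"
  "integrable unit_lborel (\<lambda>s. (norm (simple_value k \<tau> \<xi> s \<omega>))\<^sup>2)"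
proof -
  show m: "(\<lambda>s. simple_value k \<tau> \<xi> s \<omega>) \<in> borel_measurable unit_lborel"
    unfolding simple_value_def by (intro borel_measurable_sum borel_measurable_scaleR ind_meas_unit borel_measurable_const) auto
  have "norm (simple_value k \<tau> \<xi> s \<omega>) \<le> (\<Sum>i<k. norm (\<xi> i \<omega>))" for s
    unfolding simple_value_def by (intro order_trans[OF norm_sum] sum_mono) (auto simp: indicator_def)
  then have "(norm (simple_value k \<tau> \<xi> s \<omega>))\<^sup>2 \<le> (\<Sum>i<k. norm (\<xi> i \<omega>))\<^sup>2" for s
    by (intro power_mono) auto
  then show "integrable unit_lborel (\<lambda>s. (norm (simple_value k \<tau> \<xi> s \<omega>))\<^sup>2)"
    using m by (intro unit_lborel.integrable_const_bound[where B="(\<Sum>i<k. norm (\<xi> i \<omega>))\<^sup>2"] AE_I2) auto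
qed

lemma simple_integral_measurable:
  assumes "simple_process M F k \<tau> \<xi>" "t \<in> {0..1}"
  shows "simple_integral B k \<tau> \<xi> t \<in> borel_measurable M"
proof -
  have sp: "0 \<le> \<tau> i" "\<tau> i \<le> \<tau> (Suc i)" "\<xi> i \<in> borel_measurable M" if "i < k" for i
    using assms(1) that F_M unfolding simple_process_def by auto
  have "(\<lambda>\<omega>. \<xi> i \<omega> \<bullet> (B (min (\<tau> (Suc i)) t) \<omega> - B (min (\<tau> i) t) \<omega>)) \<in> borel_measurable M" if "i < k" for i
    using sp[OF that] assms(2) by (intro borel_measurable_inner borel_measurable_diff B_M) auto
  then show ?thesis unfolding simple_integral_def[abs_def] by (intro borel_measurable_sum) auto
qed

lemma null_in_prob_subseq': "null_in_prob M X \<Longrightarrow> strict_mono r \<Longrightarrow> null_in_prob M (\<lambda>n. X (r n))"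
  using LIMSEQ_subseq_LIMSEQ[of _ _ r] unfolding null_in_prob_def comp_def by blast

text \<open>The same simple processes serve for the shifted motion. Their integrals change by the
  integral of \<open>H\<close> against the simple values, which tends to the integral of
  \<open>H s \<omega> \<bullet> K s \<omega>\<close>, and this is 0 by \<open>orth\<close>. So the
  same \<open>Z\<close> is the integral of \<open>K\<close> in both settings.\<close>

lemma girsanov_ito:
  assumes a: "approx S h H I"
    and ito: "ito_integral M F B K Z" and orth: "AE \<omega> in M. AE s in unit_lborel. H s \<omega> \<bullet> K s \<omega> = 0"
  shows "ito_integral (girsanov I H) F (\<lambda>t \<omega>. B t \<omega> - drift H t \<omega>) K Z"
proof -
  let ?Q = "girsanov I H" and ?B = "\<lambda>t \<omega>. B t \<omega> - drift H t \<omega>"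
  have spQ [simp]: "space ?Q = space M" and setsQ [simp]: "sets ?Q = events" by (auto simp: girsanov_def)
  have mQ: "borel_measurable ?Q = borel_measurable M" by (rule measurable_cong_sets) auto
  note R = approx_dexp_integrable(1)[OF a]
  have nQ: "null_in_prob ?Q D" if "\<And>n. D n \<in> borel_measurable M" "null_in_prob M D" for D
    unfolding girsanov_def using R that by (intro null_in_prob_density) auto
  have Z: "Z t \<in> borel_measurable M" if "t \<in> {0..1}" for t using ito that by (simp add: ito_integral_def)
  have jK: "joint K"
    using ito unfolding ito_integral_def joint_def measurable_cong_sets[OF sets_pair_measure_cong[OF sets_unit_lborel refl] refl] by blast
  obtain k \<tau> \<xi> where s: "\<And>n. simple_process M F (k n) (\<tau> n) (\<xi> n)"
    and d: "null_in_prob M (\<lambda>n \<omega>. \<integral>\<^sup>+s\<in>{0..1}. ennreal ((norm (simple_value (k n) (\<tau> n) (\<xi> n) s \<omega> - K s \<omega>))\<^sup>2) \<partial>lborel)"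
    and i: "\<And>t. t \<in> {0..1} \<Longrightarrow> null_in_prob M (\<lambda>n \<omega>. ennreal \<bar>simple_integral B (k n) (\<tau> n) (\<xi> n) t \<omega> - Z t \<omega>\<bar>)"
    using ito unfolding ito_integral_def by blast
  let ?v = "\<lambda>n. simple_value (k n) (\<tau> n) (\<xi> n)"
  let ?D = "\<lambda>n \<omega>. \<integral>\<^sup>+s\<in>{0..1}. ennreal ((norm (?v n s \<omega> - K s \<omega>))\<^sup>2) \<partial>lborel"
  have jv: "joint (\<lambda>s \<omega>. indicator {0<..1} s *\<^sub>R ?v n s \<omega>)" for n
    by (rule step_joint'[OF simple_step(1)[OF s]]) auto
  have ne0: "AE s in unit_lborel. s \<noteq> 0 \<and> s \<in> {0..1}"
  proof -
    have "AE s in lborel. s \<noteq> (0::real)" by (rule AE_lborel_singleton)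
    then show ?thesis by (subst AE_restrict_space_iff) auto
  qed
  have Deq: "?D n = sq_dist (\<lambda>s \<omega>. indicator {0<..1} s *\<^sub>R ?v n s \<omega>) K" for n
    unfolding nn_integral_unit sq_dist_def
    by (intro ext nn_integral_cong_AE) (use ne0 in \<open>eventually_elim, auto\<close>)
  have Dm: "?D n \<in> borel_measurable M" for n unfolding Deq by (rule sq_dist_measurable[OF jv jK])
  obtain r where r: "strict_mono r" "AE \<omega> in M. (\<lambda>n. ?D (r n) \<omega>) \<longlonglongrightarrow> 0"
    using null_in_prob_subseq[OF Dm d] by blast
  let ?e = "\<lambda>t n \<omega>. \<integral>s. (indicator {0<..t} s *\<^sub>R H s \<omega>) \<bullet> ?v n s \<omega> \<partial>unit_lborel"
  have em: "?e t n \<in> borel_measurable M" if "t \<in> {0..1}" for t n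
  proof -
    note [measurable] = joint_swap[OF jv[of n]] joint_swap[OF approxD(1)[OF a]]
    have "(\<lambda>x. (indicator {0<..t} (snd x) *\<^sub>R (case x of (\<omega>, s) \<Rightarrow> H s \<omega>)) \<bullet> (case x of (\<omega>, s) \<Rightarrow> indicator {0<..1} s *\<^sub>R ?v n s \<omega>))
        \<in> borel_measurable (M \<Otimes>\<^sub>M unit_lborel)" by measurable
    then have "(\<lambda>\<omega>. \<integral>s. (indicator {0<..t} s *\<^sub>R H s \<omega>) \<bullet> (indicator {0<..1} s *\<^sub>R ?v n s \<omega>) \<partial>unit_lborel) \<in> borel_measurable M"
      by (intro unit_lborel.borel_measurable_lebesgue_integral) (simp add: split_beta')
    moreover have "(\<integral>s. (indicator {0<..t} s *\<^sub>R H s \<omega>) \<bullet> (indicator {0<..1} s *\<^sub>R ?v n s \<omega>) \<partial>unit_lborel) = ?e t n \<omega>" for \<omega>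
      using that by (intro Bochner_Integration.integral_cong refl) (auto simp: indicator_def)
    ultimately show ?thesis by simp
  qed
  have e0: "AE \<omega> in M. (\<lambda>n. ?e t (r n) \<omega>) \<longlonglongrightarrow> 0" if t: "t \<in> {0..1}" for t
    using r(2) approx_L2[OF a] orth AE_space
  proof eventually_elim
    case (elim \<omega>)
    have Hm: "(\<lambda>s. indicator {0<..t} s *\<^sub>R H s \<omega>) \<in> borel_measurable unit_lborel"
      by (intro borel_measurable_scaleR ind_meas_unit joint_section[OF approxD(1)[OF a] elim(4)]) simp
    have eq: "(norm (indicator {0<..t} s *\<^sub>R H s \<omega>))\<^sup>2 = indicator {0<..t} s *\<^sub>R (norm (H s \<omega>))\<^sup>2" for s
      by (simp add: indicator_def)
    have H2: "integrable unit_lborel (\<lambda>s. (norm (indicator {0<..t} s *\<^sub>R H s \<omega>))\<^sup>2)"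
      unfolding eq by (rule unit_integrable_indicator[OF conjunct1[OF elim(2)]]) simp
    have "(\<lambda>n. ?e t (r n) \<omega>) \<longlonglongrightarrow> (\<integral>s. (indicator {0<..t} s *\<^sub>R H s \<omega>) \<bullet> K s \<omega> \<partial>unit_lborel)"
      using elim(1) unfolding nn_integral_unit
      by (intro L2_limit(5)[OF simple_value_section(1) joint_section[OF jK elim(4)] simple_value_section(2) _ Hm H2])
    also have "(\<integral>s. (indicator {0<..t} s *\<^sub>R H s \<omega>) \<bullet> K s \<omega> \<partial>unit_lborel) = 0"
      using elim(3) by (intro integral_eq_zero_AE) (auto elim!: eventually_mono)
    finally show ?case .
  qed
  show ?thesis
    unfolding ito_integral_def
  proof (intro conjI ballI exI[of _ "\<lambda>n. k (r n)"] exI[of _ "\<lambda>n. \<tau> (r n)"] exI[of _ "\<lambda>n. \<xi> (r n)"] allI)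
    show "(\<lambda>(s, \<omega>). K s \<omega>) \<in> borel_measurable (restrict_space borel {0..1} \<Otimes>\<^sub>M ?Q)"
      using ito unfolding ito_integral_def measurable_cong_sets[OF sets_pair_measure_cong[OF refl setsQ] refl] by blast
    show "Z t \<in> borel_measurable ?Q" if "t \<in> {0..1}" for t using Z[OF that] by (simp add: mQ)
    show "continuous_on {0..1} (\<lambda>t. Z t \<omega>)" if "\<omega> \<in> space ?Q" for \<omega>
      using ito that by (simp add: ito_integral_def)
    show "simple_process ?Q F (k (r n)) (\<tau> (r n)) (\<xi> (r n))" for n
      using s[of "r n"] by (simp add: simple_process_def)
    show "null_in_prob ?Q (\<lambda>n. ?D (r n))"
      by (rule nQ[OF Dm null_in_prob_subseq'[OF d r(1)]])
    fix t :: real assume t: "t \<in> {0..1}"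
    let ?J = "\<lambda>n. simple_integral B (k (r n)) (\<tau> (r n)) (\<xi> (r n)) t"
    let ?J' = "\<lambda>n. simple_integral ?B (k (r n)) (\<tau> (r n)) (\<xi> (r n)) t"
    have Jm: "?J n \<in> borel_measurable M" for n by (rule simple_integral_measurable[OF s t])
    have m1: "(\<lambda>\<omega>. ?J n \<omega> - Z t \<omega>) \<in> borel_measurable M" "(\<lambda>\<omega>. - ?e t (r n) \<omega>) \<in> borel_measurable M" for n
      using Jm[of n] Z[OF t] em[OF t, of "r n"] by measurable
    have "null_in_prob M (\<lambda>n \<omega>. ennreal \<bar>- ?e t (r n) \<omega>\<bar>)"
    proof (rule null_in_prob_AE)
      show "(\<lambda>\<omega>. ennreal \<bar>- ?e t (r n) \<omega>\<bar>) \<in> borel_measurable M" for n using m1(2)[of n] by measurable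
      show "AE \<omega> in M. (\<lambda>n. ennreal \<bar>- ?e t (r n) \<omega>\<bar>) \<longlonglongrightarrow> 0"
        using e0[OF t]
      proof eventually_elim
        case (elim \<omega>)
        from tendsto_ennrealI[OF tendsto_rabs_zero[OF elim]] show ?case by simp
      qed
    qed
    from null_in_prob_add[OF m1 null_in_prob_subseq'[OF i[OF t] r(1)] this]
    have "null_in_prob M (\<lambda>n \<omega>. ennreal \<bar>(?J n \<omega> - Z t \<omega>) + - ?e t (r n) \<omega>\<bar>)" .
    then have q: "null_in_prob ?Q (\<lambda>n \<omega>. ennreal \<bar>(?J n \<omega> - Z t \<omega>) + - ?e t (r n) \<omega>\<bar>)"
      by (rule nQ[rotated]) (use m1 in measurable)
    show "null_in_prob ?Q (\<lambda>n \<omega>. ennreal \<bar>?J' n \<omega> - Z t \<omega>\<bar>)"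
      unfolding null_in_prob_def
    proof (intro allI impI)
      fix \<epsilon> :: real assume "\<epsilon> > 0"
      have dm: "dexp I H \<in> borel_measurable M" using R by auto
      have AEQ: "AE \<omega> in ?Q. integrable unit_lborel (\<lambda>s. H s \<omega>)"
        unfolding girsanov_def using dm approx_integrable[OF a] by (subst AE_density) (auto elim!: eventually_mono)
      \<comment> \<open>The formula for the shifted simple integral relies on integrability of
        \<open>H\<close> along the path, which holds almost surely, so the two events are compared
        up to a null set.\<close>
      have "measure ?Q {\<omega> \<in> space ?Q. ennreal \<epsilon> < ennreal \<bar>?J' n \<omega> - Z t \<omega>\<bar>} =
          measure ?Q {\<omega> \<in> space ?Q. ennreal \<epsilon> < ennreal \<bar>(?J n \<omega> - Z t \<omega>) + - ?e t (r n) \<omega>\<bar>}" for n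
      proof (rule measure_eq_AE)
        show "AE \<omega> in ?Q. (\<omega> \<in> {\<omega> \<in> space ?Q. ennreal \<epsilon> < ennreal \<bar>?J' n \<omega> - Z t \<omega>\<bar>}) =
           (\<omega> \<in> {\<omega> \<in> space ?Q. ennreal \<epsilon> < ennreal \<bar>(?J n \<omega> - Z t \<omega>) + - ?e t (r n) \<omega>\<bar>})"
          using AEQ
        proof eventually_elim
          case (elim \<omega>)
          have eq: "?J' n \<omega> - Z t \<omega> = (?J n \<omega> - Z t \<omega>) + - ?e t (r n) \<omega>"
            using t by (subst simple_drift[where H=H, OF elim s]) auto
          show ?case unfolding mem_Collect_eq eq ..
        qed
        have "(\<lambda>\<omega>. simple_integral (\<lambda>t \<omega>. B t \<omega> - drift H t \<omega>) (k (r n)) (\<tau> (r n)) (\<xi> (r n)) t \<omega>) \<in> borel_measurable M"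
        proof -
          have sp: "0 \<le> \<tau> (r n) i" "\<tau> (r n) i \<le> \<tau> (r n) (Suc i)" "\<xi> (r n) i \<in> borel_measurable M" if "i < k (r n)" for i
            using s[of "r n"] that F_M unfolding simple_process_def by auto
          have "(\<lambda>\<omega>. \<xi> (r n) i \<omega> \<bullet> (?B (min (\<tau> (r n) (Suc i)) t) \<omega> - ?B (min (\<tau> (r n) i) t) \<omega>)) \<in> borel_measurable M" if "i < k (r n)" for i
            using sp[OF that] t
            by (intro borel_measurable_inner borel_measurable_diff B_M drift_measurable[OF approxD(1)[OF a]]) auto
          then show ?thesis unfolding simple_integral_def[abs_def] by (intro borel_measurable_sum) auto
        qed
        note [measurable] = this Z[OF t] em[OF t, of "r n"] Jm[of n]
        show "{\<omega> \<in> space ?Q. ennreal \<epsilon> < ennreal \<bar>?J' n \<omega> - Z t \<omega>\<bar>} \<in> sets ?Q"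
          "{\<omega> \<in> space ?Q. ennreal \<epsilon> < ennreal \<bar>(?J n \<omega> - Z t \<omega>) + - ?e t (r n) \<omega>\<bar>} \<in> sets ?Q"
          unfolding spQ setsQ by measurable
      qed
      then show "(\<lambda>n. measure ?Q {\<omega> \<in> space ?Q. ennreal \<epsilon> < ennreal \<bar>?J' n \<omega> - Z t \<omega>\<bar>}) \<longlonglongrightarrow> 0"
        using q \<open>\<epsilon> > 0\<close> unfolding null_in_prob_def by simp
    qed
  qed
qed

end

section \<open>Invariance of the law of the solution\<close>

locale weak_solution = brownian M F B for M :: "'a measure" and F and B :: "real \<Rightarrow> 'a \<Rightarrow> real^'d" +
  fixes X :: "real \<Rightarrow> 'a \<Rightarrow> real^'n" and x :: "real^'n"
    and b :: "real \<Rightarrow> (real \<Rightarrow> real^'n) \<Rightarrow> real^'n" and \<sigma> :: "real \<Rightarrow> (real \<Rightarrow> real^'n) \<Rightarrow> real^'d^'n"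
  assumes sol: "sde_solution M F B X x b \<sigma>" and weak: "weak_uniqueness TYPE('a) x b \<sigma>"
begin

abbreviation G where "G \<equiv> natural_filtration M X 1"

definition kernel :: "(real \<Rightarrow> 'a \<Rightarrow> real^'d) \<Rightarrow> bool" where
  "kernel H \<longleftrightarrow> (AE \<omega> in M. AE s in unit_lborel. \<sigma> s (path_of X \<omega>) *v H s \<omega> = 0)"

lemma X_M [measurable]: "t \<in> {0..1} \<Longrightarrow> X t \<in> borel_measurable M"
  using sol F_M[of "X t" t] by (auto simp: sde_solution_def)

lemma path_Pi: "path_of X \<in> space M \<rightarrow> space (\<Pi>\<^sub>M t\<in>{0..1}. borel)"
  by (auto simp: path_of_def space_PiM)

lemma path_eq: "path_of X = (\<lambda>\<omega>. \<lambda>s\<in>{0..1}. X s \<omega>)"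
  by (simp add: path_of_def fun_eq_iff)

lemma path_cont: "\<omega> \<in> space M \<Longrightarrow> continuous_on {0..1} (path_of X \<omega>)"
  using sol by (subst continuous_on_cong[OF refl, of _ _ "\<lambda>t. X t \<omega>"]) (auto simp: path_of_def sde_solution_def)

lemma space_G [simp]: "space G = space M"
  by (simp add: natural_filtration_def)

lemma path_measurable: "path_of X \<in> M \<rightarrow>\<^sub>M path_space" "path_of X \<in> G \<rightarrow>\<^sub>M path_space"
proof -
  have "path_of X \<in> M \<rightarrow>\<^sub>M (\<Pi>\<^sub>M t\<in>{0..1}. borel)"
    unfolding path_eq by (rule measurable_restrict) simp
  then show "path_of X \<in> M \<rightarrow>\<^sub>M path_space"
    unfolding path_space_def using path_cont by (intro measurable_restrict_space2) auto
  have "path_of X \<in> G \<rightarrow>\<^sub>M (\<Pi>\<^sub>M t\<in>{0..1}. borel)"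
    unfolding natural_filtration_def path_eq[symmetric] by (rule measurable_vimage_algebra1[OF path_Pi])
  then show "path_of X \<in> G \<rightarrow>\<^sub>M path_space"
    unfolding path_space_def using path_cont by (intro measurable_restrict_space2) auto
qed

text \<open>Events of \<open>G\<close> are statements about the whole path, so equality of the laws
  of \<open>X\<close> on \<open>path_space\<close> yields equality of probabilities on all of
  \<open>G\<close>.\<close>

lemma sets_G: "D \<in> sets G \<longleftrightarrow> (\<exists>E\<in>sets path_space. D = path_of X -` E \<inter> space M)"
proof
  assume "D \<in> sets G"
  then obtain E where E: "E \<in> sets (\<Pi>\<^sub>M t\<in>{0..1}. borel :: (real^'n) measure)" "D = path_of X -` E \<inter> space M"
    unfolding natural_filtration_def path_eq[symmetric] using sets_vimage_algebra2[OF path_Pi] by auto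
  have "E \<inter> {w. continuous_on {0..1} w} \<in> sets path_space"
    using E(1) unfolding path_space_def by (auto simp: sets_restrict_space)
  moreover have "D = path_of X -` (E \<inter> {w. continuous_on {0..1} w}) \<inter> space M" using E(2) path_cont by auto
  ultimately show "\<exists>E\<in>sets path_space. D = path_of X -` E \<inter> space M" by blast
next
  assume "\<exists>E\<in>sets path_space. D = path_of X -` E \<inter> space M"
  then show "D \<in> sets G" using measurable_sets[OF path_measurable(2)] by auto
qed

lemma subalg_G: "subalgebra M G"
  unfolding subalgebra_def using measurable_sets[OF path_measurable(1)] by (auto simp: sets_G)

text \<open>
  Since \<open>\<sigma> H = 0\<close>, the same process \<open>X\<close> solves the equation under the Girsanov measure, driven by
  the shifted Brownian motion; weak uniqueness then identifies the two laws of \<open>X\<close>.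
\<close>

theorem dexp_invariance:
  assumes a: "approx S h H I" and E: "(\<integral>\<omega>. dexp I H \<omega> \<partial>M) = 1" and ker: "kernel H" and D: "D \<in> sets G"
  shows "(\<integral>\<omega>. dexp I H \<omega> * indicator D \<omega> \<partial>M) = prob D"
proof -
  let ?Q = "girsanov I H" and ?B = "\<lambda>t \<omega>. B t \<omega> - drift H t \<omega>"
  have dm: "dexp I H \<in> borel_measurable M" using approx_dexp_integrable(1)[OF a] by auto
  have spQ [simp]: "space ?Q = space M" and setsQ [simp]: "sets ?Q = events" by (auto simp: girsanov_def)
  have AEQ: "AE \<omega> in ?Q. R \<omega>" if "AE \<omega> in M. R \<omega>" for R
    unfolding girsanov_def using dm that by (subst AE_density) (auto elim!: eventually_mono)
  obtain Z where Z: "ito_integral_matrix M F B (\<lambda>s \<omega>. \<sigma> s (path_of X \<omega>)) Z"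
    "\<And>t. t \<in> {0..1} \<Longrightarrow> AE \<omega> in M. X t \<omega> = x + (LINT s:{0..t}|lborel. b s (path_of X \<omega>)) + Z t \<omega>"
    using sol unfolding sde_solution_def by blast
  have "ito_integral_matrix ?Q F ?B (\<lambda>s \<omega>. \<sigma> s (path_of X \<omega>)) Z"
    unfolding ito_integral_matrix_def
  proof
    fix i
    have "AE \<omega> in M. AE s in unit_lborel. H s \<omega> \<bullet> \<sigma> s (path_of X \<omega>) $ i = 0"
      using ker unfolding kernel_def
    proof eventually_elim
      case (elim \<omega>)
      then show ?case
      proof eventually_elim
        case (elim s)
        have "\<sigma> s (path_of X \<omega>) $ i \<bullet> H s \<omega> = (\<sigma> s (path_of X \<omega>) *v H s \<omega>) $ i"
          by (rule matrix_vector_mul_component[symmetric])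
        then show ?case using elim by (simp add: inner_commute)
      qed
    qed
    then show "ito_integral ?Q F ?B (\<lambda>s \<omega>. \<sigma> s (path_of X \<omega>) $ i) (\<lambda>t \<omega>. Z t \<omega> $ i)"
      using Z(1) by (intro girsanov_ito[OF a]) (auto simp: ito_integral_matrix_def)
  qed
  \<comment> \<open>Both solutions live on the same type, with the same filtration, the same
    \<open>X\<close> and the same Ito term \<open>Z\<close>. The term with \<open>b\<close> is a
    pathwise integral and unaffected by the change of measure.\<close>
  then have "sde_solution ?Q F ?B X x b \<sigma>"
    unfolding sde_solution_def
  proof (intro conjI exI[of _ Z] girsanov_brownian[OF a E])
    show "\<forall>t\<in>{0..1}. AE \<omega> in ?Q. X t \<omega> = x + (LINT s:{0..t}|lborel. b s (path_of X \<omega>)) + Z t \<omega>"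
      using Z(2) AEQ by blast
    show "AE \<omega> in ?Q. X 0 \<omega> = x" using sol by (intro AEQ) (simp add: sde_solution_def)
  qed (use sol in \<open>simp_all add: sde_solution_def\<close>)
  then have law: "distr ?Q path_space (path_of X) = distr M path_space (path_of X)"
    using weak sol unfolding weak_uniqueness_def by blast
  obtain C where C: "C \<in> sets path_space" "D = path_of X -` C \<inter> space M" using D sets_G by auto
  have pQ: "path_of X \<in> ?Q \<rightarrow>\<^sub>M path_space"
    using path_measurable(1) by (simp add: measurable_cong_sets[OF setsQ refl])
  have "emeasure ?Q D = emeasure (distr ?Q path_space (path_of X)) C"
    using C pQ by (simp add: emeasure_distr)
  also have "\<dots> = emeasure M D"
    unfolding law using C path_measurable(1) by (simp add: emeasure_distr)
  finally have "ennreal (\<integral>\<omega>. dexp I H \<omega> * indicator D \<omega> \<partial>M) = ennreal (prob D)"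
    using girsanov_measure[OF a, of D] C measurable_sets[OF path_measurable(1) C(1)] by (simp add: emeasure_eq_measure)
  then show ?thesis
    by (subst (asm) ennreal_inj) (auto intro!: Bochner_Integration.integral_nonneg)
qed

end

section \<open>From real to imaginary exponentials\<close>

context prob_space begin

text \<open>The exponential series is integrated term by term: the partial sums of the norms are
  dominated by \<open>exp (cmod z * Y \<omega>) + exp (- cmod z * Y \<omega>)\<close>, which is
  integrable by assumption. The result is a power series in \<open>z\<close>.\<close>

lemma exp_moments_holomorphic:
  assumes [measurable]: "Y \<in> borel_measurable M" "W \<in> borel_measurable M"
    and W: "\<And>\<omega>. \<bar>W \<omega>\<bar> \<le> 1" and e: "\<And>r::real. integrable M (\<lambda>\<omega>. exp (r * Y \<omega>))"
  shows "(\<lambda>z. \<integral>\<omega>. of_real (W \<omega>) * exp (z * of_real (Y \<omega>)) \<partial>M) holomorphic_on ball 0 R"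
proof -
  define a where "a n = (\<integral>\<omega>. of_real (W \<omega>) * (of_real (Y \<omega>) ^ n / fact n) \<partial>M :: complex)" for n
  have "(\<lambda>n. a n * (z - 0) ^ n) sums (\<integral>\<omega>. of_real (W \<omega>) * exp (z * of_real (Y \<omega>)) \<partial>M)" for z :: complex
  proof -
    let ?f = "\<lambda>n \<omega>. of_real (W \<omega>) * ((z * of_real (Y \<omega>)) ^ n / fact n) :: complex"
    let ?E = "\<lambda>\<omega>. exp (cmod z * Y \<omega>) + exp (- cmod z * Y \<omega>)"
    have iE: "integrable M ?E" using e[of "cmod z"] e[of "- cmod z"] by simp
    have nf: "norm (?f n \<omega>) = \<bar>W \<omega>\<bar> * ((cmod z * \<bar>Y \<omega>\<bar>) ^ n / fact n)" for n \<omega>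
      by (simp add: norm_mult norm_divide norm_power)
    have ex: "(\<lambda>n. (cmod z * \<bar>Y \<omega>\<bar>) ^ n / fact n) sums exp (cmod z * \<bar>Y \<omega>\<bar>)" for \<omega>
      using exp_converges[of "cmod z * \<bar>Y \<omega>\<bar>"] by (simp add: field_simps)
    have sumb: "(\<Sum>i<N. norm (?f i \<omega>)) \<le> ?E \<omega>" for N \<omega>
    proof -
      have "(\<Sum>i<N. norm (?f i \<omega>)) = \<bar>W \<omega>\<bar> * (\<Sum>i<N. (cmod z * \<bar>Y \<omega>\<bar>) ^ i / fact i)"
        unfolding nf by (simp add: sum_distrib_left)
      also have "\<dots> \<le> 1 * exp (cmod z * \<bar>Y \<omega>\<bar>)"
      proof (intro mult_mono W)
        show "(\<Sum>i<N. (cmod z * \<bar>Y \<omega>\<bar>) ^ i / fact i) \<le> exp (cmod z * \<bar>Y \<omega>\<bar>)"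
          unfolding sums_unique[OF ex] by (rule sum_le_suminf[OF sums_summable[OF ex]]) auto
      qed (auto intro!: sum_nonneg)
      also have "\<dots> \<le> ?E \<omega>" by (cases "Y \<omega> \<ge> 0") (auto simp: add_increasing add_increasing2)
      finally show ?thesis .
    qed
    have fi: "integrable M (?f n)" for n
    proof (rule Bochner_Integration.integrable_bound[OF iE])
      have "norm (?f n \<omega>) \<le> ?E \<omega>" for \<omega>
        by (rule order_trans[OF member_le_sum[of n "{..<Suc n}" "\<lambda>i. norm (?f i \<omega>)"] sumb]) auto
      then show "AE \<omega> in M. norm (?f n \<omega>) \<le> norm (?E \<omega>)"
        by (intro AE_I2) (smt (verit) norm_ge_zero real_norm_def)
    qed measurable
    have "(\<lambda>n. \<integral>\<omega>. ?f n \<omega> \<partial>M) sums (\<integral>\<omega>. (\<Sum>n. ?f n \<omega>) \<partial>M)"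
    proof (rule sums_integral[OF fi])
      show "AE \<omega> in M. summable (\<lambda>n. norm (?f n \<omega>))"
        unfolding nf using ex by (intro AE_I2 summable_mult sums_summable) 
      show "summable (\<lambda>n. \<integral>\<omega>. norm (?f n \<omega>) \<partial>M)"
      proof (rule summableI_nonneg_bounded)
        fix N
        have "(\<Sum>i<N. \<integral>\<omega>. norm (?f i \<omega>) \<partial>M) = (\<integral>\<omega>. (\<Sum>i<N. norm (?f i \<omega>)) \<partial>M)"
          using fi by (intro Bochner_Integration.integral_sum[symmetric] integrable_norm)
        also have "\<dots> \<le> (\<integral>\<omega>. ?E \<omega> \<partial>M)"
          using fi iE sumb by (intro integral_mono Bochner_Integration.integrable_sum integrable_norm) auto
        finally show "(\<Sum>i<N. \<integral>\<omega>. norm (?f i \<omega>) \<partial>M) \<le> (\<integral>\<omega>. ?E \<omega> \<partial>M)" .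
      qed auto
    qed
    moreover have "(\<integral>\<omega>. ?f n \<omega> \<partial>M) = a n * (z - 0) ^ n" for n
    proof -
      have e: "?f n \<omega> = (of_real (W \<omega>) * (of_real (Y \<omega>) ^ n / fact n)) * z ^ n" for \<omega>
        by (simp add: power_mult_distrib)
      show ?thesis unfolding e a_def diff_zero by (rule integral_mult_left_zero)
    qed
    moreover have "(\<Sum>n. ?f n \<omega>) = of_real (W \<omega>) * exp (z * of_real (Y \<omega>))" for \<omega>
    proof -
      have "(\<lambda>n. (z * of_real (Y \<omega>)) ^ n / fact n) sums exp (z * of_real (Y \<omega>))"
        using exp_converges[of "z * of_real (Y \<omega>)"] by (simp add: scaleR_conv_of_real field_simps)
      from sums_mult[OF this] show ?thesis by (rule sums_unique[symmetric])
    qed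
    ultimately show ?thesis by simp
  qed
  then show ?thesis by (rule power_series_holomorphic)
qed

text \<open>Both sides of \<open>eq\<close> extend to holomorphic functions of \<open>z\<close> in
  place of \<open>r\<close>, and they agree on the real interval \<open>{0<..<R}\<close>, which
  accumulates at 0. At \<open>\<i> * of_real l\<close> the factor \<open>z\<^sup>2 / 2\<close>
  becomes \<open>- l\<^sup>2 / 2\<close>; the radius \<open>\<bar>l\<bar> + 1\<close> makes room for
  that point.\<close>

lemma imaginary_exponential:
  assumes m [measurable]: "Y \<in> borel_measurable M" "V \<in> borel_measurable M" "W \<in> borel_measurable M"
    and W: "\<And>\<omega>. \<bar>W \<omega>\<bar> \<le> 1"
    and eY: "\<And>r::real. integrable M (\<lambda>\<omega>. exp (r * Y \<omega>))" and eV: "\<And>r::real. integrable M (\<lambda>\<omega>. exp (r * V \<omega>))"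
    and eq: "\<And>r::real. (\<integral>\<omega>. W \<omega> * exp (r * Y \<omega>) \<partial>M) = (\<integral>\<omega>. W \<omega> * exp (r\<^sup>2 * V \<omega> / 2) \<partial>M)"
  shows "(\<integral>\<omega>. of_real (W \<omega>) * cis (l * Y \<omega>) \<partial>M) = (\<integral>\<omega>. of_real (W \<omega> * exp (- (l\<^sup>2 * V \<omega> / 2))) \<partial>M)"
proof -
  let ?F = "\<lambda>U z. \<integral>\<omega>. of_real (W \<omega>) * exp (z * of_real (U \<omega>)) \<partial>M :: complex"
  define R where "R = \<bar>l\<bar> + 1"
  have hF: "?F Y holomorphic_on ball 0 R" by (rule exp_moments_holomorphic[OF m(1,3) W eY])
  have "(?F V \<circ> (\<lambda>z. z\<^sup>2 / 2)) holomorphic_on ball 0 R"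
  proof (rule holomorphic_on_compose)
    show "(\<lambda>z. z\<^sup>2 / 2) holomorphic_on ball 0 R" by (intro holomorphic_intros) simp
    have "(\<lambda>z::complex. z\<^sup>2 / 2) ` ball 0 R \<subseteq> ball 0 (R\<^sup>2 :: real)"
    proof
      fix y :: complex assume "y \<in> (\<lambda>z. z\<^sup>2 / 2) ` ball 0 R"
      then obtain z where z: "y = z\<^sup>2 / 2" "cmod z < R" by auto
      have "(cmod z)\<^sup>2 < R\<^sup>2" using z(2) by (intro power_strict_mono) auto
      moreover have "cmod y = (cmod z)\<^sup>2 / 2" unfolding z(1) by (simp add: norm_divide norm_power)
      ultimately have "cmod y < R\<^sup>2" using zero_le_power2[of "cmod z"] by linarith
      then show "y \<in> ball 0 (R\<^sup>2)" by simp
    qed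
    then show "?F V holomorphic_on (\<lambda>z. z\<^sup>2 / 2) ` ball 0 R"
      by (rule holomorphic_on_subset[OF exp_moments_holomorphic[OF m(2,3) W eV]])
  qed
  then have hG: "(\<lambda>z. ?F Y z - ?F V (z\<^sup>2 / 2)) holomorphic_on ball 0 R"
    using hF by (intro holomorphic_on_diff) (simp_all add: comp_def)
  have fin: "?F Y (\<i> * of_real l) - ?F V ((\<i> * of_real l)\<^sup>2 / 2) = 0"
  proof (rule analytic_continuation[OF hG open_ball connected_ball, of "of_real ` {0<..<R}" 0])
    show "complex_of_real ` {0<..<R} \<subseteq> ball 0 R" by auto
    show "(0::complex) \<in> ball 0 R" by (simp add: R_def)
    show "(0::complex) islimpt complex_of_real ` {0<..<R}"
      unfolding islimpt_approachable
    proof (intro allI impI)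
      fix e :: real assume "e > 0"
      then obtain u where u: "0 < u" "u < R" "u < e"
        by (metis R_def abs_ge_zero add_nonneg_pos field_lbound_gt_zero zero_less_one)
      then have "complex_of_real u \<in> complex_of_real ` {0<..<R}" "complex_of_real u \<noteq> 0" "dist (complex_of_real u) 0 < e"
        by auto
      then show "\<exists>x'\<in>complex_of_real ` {0<..<R}. x' \<noteq> 0 \<and> dist x' 0 < e" by blast
    qed
    show "?F Y z - ?F V (z\<^sup>2 / 2) = 0" if z: "z \<in> complex_of_real ` {0<..<R}" for z
    proof -
      obtain r where r: "z = of_real r" using z by auto
      have 1: "of_real (W \<omega>) * exp (of_real r * complex_of_real (Y \<omega>)) = of_real (W \<omega> * exp (r * Y \<omega>))" for \<omega>
        by (simp add: exp_of_real[symmetric])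
      have 2: "of_real (W \<omega>) * exp ((of_real r)\<^sup>2 / 2 * complex_of_real (V \<omega>)) = of_real (W \<omega> * exp (r\<^sup>2 * V \<omega> / 2))" for \<omega>
        by (simp add: exp_of_real[symmetric])
      show ?thesis unfolding r 1 2 integral_complex_of_real eq by simp
    qed
    show "\<i> * of_real l \<in> ball 0 R" by (simp add: norm_mult R_def)
  qed
  have e1: "exp (\<i> * of_real l * complex_of_real (Y \<omega>)) = cis (l * Y \<omega>)" for \<omega>
    by (simp add: cis_conv_exp mult.assoc)
  have e2: "of_real (W \<omega>) * exp ((\<i> * of_real l)\<^sup>2 / 2 * complex_of_real (V \<omega>)) = of_real (W \<omega> * exp (- (l\<^sup>2 * V \<omega> / 2)))" for \<omega>
    by (simp add: exp_of_real[symmetric] power_mult_distrib)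
  show ?thesis using fin unfolding e1 e2 by (simp only: right_minus_eq)
qed

end

section \<open>Conditional characteristic functions\<close>

context weak_solution begin

lemma sigma_finite_G: "sigma_finite_subalgebra M G"
proof -
  interpret finite_measure_subalgebra M G by unfold_locales (rule subalg_G)
  show ?thesis by (rule finite_measure_subalgebra_is_sigma_finite) unfold_locales
qed

sublocale sG: sigma_finite_subalgebra M G by (rule sigma_finite_G)

lemma G_M: "f \<in> borel_measurable G \<Longrightarrow> f \<in> borel_measurable M" for f :: "'a \<Rightarrow> 'v::topological_space"
  by (rule measurable_from_subalg[OF subalg_G])

lemma sets_G_M: "sets G \<subseteq> events"
  using subalg_G by (simp add: subalgebra_def)

text \<open>Invariance on the events of \<open>G\<close> says that the conditional expectation of
  the exponential is 1. This extends to weights measurable for \<open>G\<close>, such as the inverse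
  of the compensator.\<close>

lemma dexp_weighted:
  assumes a: "approx S h H I" and E: "(\<integral>\<omega>. dexp I H \<omega> \<partial>M) = 1" and ker: "kernel H"
    and g: "g \<in> borel_measurable G" "integrable M (\<lambda>\<omega>. g \<omega> * dexp I H \<omega>)"
  shows "(\<integral>\<omega>. g \<omega> * dexp I H \<omega> \<partial>M) = (\<integral>\<omega>. g \<omega> \<partial>M)"
proof -
  note R = approx_dexp_integrable(1)[OF a]
  have "AE \<omega> in M. real_cond_exp M G (dexp I H) \<omega> = 1"
  proof (rule sG.real_cond_exp_charact[OF _ R])
    fix A assume A: "A \<in> sets G"
    then have "A \<in> events" using sets_G_M by auto
    then show "(\<integral>\<omega>\<in>A. dexp I H \<omega> \<partial>M) = (\<integral>\<omega>\<in>A. 1 \<partial>M)"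
      using dexp_invariance[OF a E ker A] by (simp add: set_lebesgue_integral_def mult.commute)
  qed auto
  then have "(\<integral>\<omega>. g \<omega> * real_cond_exp M G (dexp I H) \<omega> \<partial>M) = (\<integral>\<omega>. g \<omega> \<partial>M)"
    by (intro integral_cong_AE) (use G_M[OF g(1)] in \<open>auto elim!: eventually_mono\<close>)
  then show ?thesis using sG.real_cond_exp_intg(2)[OF g(2,1)] R by simp
qed

lemma sq_bounded:
  assumes j: "joint H" and K: "K \<ge> 0" "AE \<omega> in M. AE s in unit_lborel. norm (H s \<omega>) \<le> K"
  shows "AE \<omega> in M. sq H \<omega> \<le> K\<^sup>2"
  using K(2) AE_space
proof eventually_elim
  case (elim \<omega>)
  have b: "AE s in unit_lborel. (norm (H s \<omega>))\<^sup>2 \<le> K\<^sup>2"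
    using elim(1) by eventually_elim (auto intro: power_mono)
  have "integrable unit_lborel (\<lambda>s. (norm (H s \<omega>))\<^sup>2)"
    using b joint_section[OF j elim(2)] by (intro unit_lborel.integrable_const_bound[where B="K\<^sup>2"]) auto
  then have "sq H \<omega> \<le> (\<integral>s. K\<^sup>2 \<partial>unit_lborel)"
    unfolding cm_norm_sq_eq using b by (intro integral_mono_AE) auto
  then show ?case using unit_lborel.prob_space by simp
qed

lemma sq_nonneg [simp]: "0 \<le> cm_norm_sq k"
  unfolding cm_norm_sq_eq by (rule Bochner_Integration.integral_nonneg) simp

text \<open>Invariance is applied to
  \<open>r *\<^sub>R indicator A \<omega> *\<^sub>R H s \<omega>\<close>, which is a legitimate
  integrand because \<open>H\<close> vanishes up to time \<open>a\<close>. With the weight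
  \<open>indicator D \<omega> * exp (r\<^sup>2 * v \<omega> / 2)\<close>, measurable for
  \<open>G\<close>, it yields the real exponential moments of \<open>I\<close> on \<open>A\<close>
  and \<open>D\<close> for all \<open>r\<close>. Admitting \<open>A\<close> from \<open>F a\<close>
  is what later gives independence from the past.\<close>

lemma conditional_char_bounded:
  assumes a: "approx S h H I" and K: "K \<ge> 0" "AE \<omega> in M. AE s in unit_lborel. norm (H s \<omega>) \<le> K"
    and ker: "kernel H" and v: "v \<in> borel_measurable G" "AE \<omega> in M. sq H \<omega> = v \<omega>"
    and a01: "0 \<le> a" "a \<le> 1" and A: "A \<in> sets (F a)"
    and H0: "AE \<omega> in M. AE s in unit_lborel. s \<le> a \<longrightarrow> H s \<omega> = 0" and D: "D \<in> sets G"
  shows "(\<integral>\<omega>. of_real (indicator A \<omega> * indicator D \<omega>) * cis (l * I \<omega>) \<partial>M) =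
    (\<integral>\<omega>. of_real (indicator A \<omega> * indicator D \<omega> * exp (- (l\<^sup>2 * v \<omega> / 2))) \<partial>M)"
    and "\<And>r. integrable M (\<lambda>\<omega>. exp (r * I \<omega>))"
proof -
  have AM [measurable]: "A \<in> events" and DM [measurable]: "D \<in> events" using A D sets_F_subset sets_G_M by auto
  have Im [measurable]: "I \<in> borel_measurable M" by (rule approxD(2)[OF a])
  have vm [measurable]: "v \<in> borel_measurable M" by (rule G_M[OF v(1)])
  have vb: "AE \<omega> in M. 0 \<le> v \<omega> \<and> v \<omega> \<le> K\<^sup>2"
    using sq_bounded[OF approxD(1)[OF a] K] v(2) by eventually_elim (metis sq_nonneg)
  have ev: "integrable M (\<lambda>\<omega>. exp (r * v \<omega>))" for r
  proof (rule integrable_const_bound[where B="exp (\<bar>r\<bar> * K\<^sup>2)"])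
    show "AE \<omega> in M. norm (exp (r * v \<omega>)) \<le> exp (\<bar>r\<bar> * K\<^sup>2)"
      using vb
    proof eventually_elim
      case (elim \<omega>)
      have "r * v \<omega> \<le> \<bar>r\<bar> * v \<omega>" using elim by (intro mult_right_mono) auto
      also have "\<dots> \<le> \<bar>r\<bar> * K\<^sup>2" using elim by (intro mult_left_mono) auto
      finally show ?case by simp
    qed
  qed measurable
  \<comment> \<open>\<open>exp (r * I \<omega>)\<close> is the exponential of the scaled integrand,
    which is integrable, times a compensator bounded by
    \<open>exp (r\<^sup>2 * K\<^sup>2 / 2)\<close>.\<close>
  show eI: "integrable M (\<lambda>\<omega>. exp (r * I \<omega>))" for r
  proof (rule Bochner_Integration.integrable_bound)
    let ?d = "dexp (\<lambda>\<omega>. r * I \<omega>) (\<lambda>s \<omega>. r *\<^sub>R H s \<omega>)"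
    show "integrable M (\<lambda>\<omega>. exp (r\<^sup>2 * K\<^sup>2 / 2) * ?d \<omega>)"
      using approx_dexp_integrable(1)[OF approx_scale[OF a, of r]] by simp
    show "AE \<omega> in M. norm (exp (r * I \<omega>)) \<le> norm (exp (r\<^sup>2 * K\<^sup>2 / 2) * ?d \<omega>)"
      using vb v(2)
    proof eventually_elim
      case (elim \<omega>)
      have "r\<^sup>2 * sq H \<omega> \<le> r\<^sup>2 * K\<^sup>2" using elim by (intro mult_left_mono) auto
      then show ?case by (simp add: dexp_def sq_scale mult_exp_exp)
    qed
  qed measurable
  let ?W = "\<lambda>\<omega>. indicator A \<omega> * indicator D \<omega> :: real"
  obtain S' h' where a': "approx S' h' (\<lambda>s \<omega>. indicator A \<omega> *\<^sub>R H s \<omega>) (\<lambda>\<omega>. indicator A \<omega> * I \<omega>)"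
    using approx_restrict[OF a a01 A H0] by blast
  have real: "(\<integral>\<omega>. ?W \<omega> * exp (r * I \<omega>) \<partial>M) = (\<integral>\<omega>. ?W \<omega> * exp (r\<^sup>2 * v \<omega> / 2) \<partial>M)" for r
  proof -
    let ?H = "\<lambda>s \<omega>. r *\<^sub>R indicator A \<omega> *\<^sub>R H s \<omega>" and ?I = "\<lambda>\<omega>. r * (indicator A \<omega> * I \<omega>)"
    note ar = approx_scale[OF a', of r]
    have sqr: "sq ?H \<omega> = r\<^sup>2 * indicator A \<omega> * sq H \<omega>" for \<omega>
      by (simp add: cm_norm_sq_eq power_mult_distrib indicator_def)
    have E: "(\<integral>\<omega>. dexp ?I ?H \<omega> \<partial>M) = 1"
    proof (rule bounded_dexp_expectation[OF ar])
      show "AE \<omega> in M. AE s in unit_lborel. norm (?H s \<omega>) \<le> \<bar>r\<bar> * K"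
        using K(2)
      proof eventually_elim
        case (elim \<omega>)
        then show ?case
        proof eventually_elim
          case (elim s)
          then show ?case using K(1) by (auto simp: indicator_def intro!: mult_left_mono)
        qed
      qed
    qed
    have kr: "kernel ?H"
      using ker unfolding kernel_def
    proof eventually_elim
      case (elim \<omega>)
      then show ?case by eventually_elim (simp add: indicator_def matrix_vector_mult_scaleR)
    qed
    let ?g = "\<lambda>\<omega>. indicator D \<omega> * exp (r\<^sup>2 * v \<omega> / 2)"
    have gG: "?g \<in> borel_measurable G" using v(1) D by measurable
    \<comment> \<open>On \<open>A\<close> the weight cancels the compensator and leaves
      \<open>exp (r * I \<omega>)\<close>; outside \<open>A\<close> the exponential is 1 and the
      weight itself remains. The mean of \<open>?g\<close> then occurs on both sides and
      cancels.\<close>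
    have split: "AE \<omega> in M. ?g \<omega> * dexp ?I ?H \<omega> = ?W \<omega> * exp (r * I \<omega>) + (?g \<omega> - ?W \<omega> * exp (r\<^sup>2 * v \<omega> / 2))"
      using v(2)
    proof eventually_elim
      case (elim \<omega>)
      have "dexp ?I ?H \<omega> = exp (r * (indicator A \<omega> * I \<omega>) - r\<^sup>2 * indicator A \<omega> * v \<omega> / 2)"
        unfolding dexp_def sqr elim ..
      then show ?case by (cases "\<omega> \<in> A"; cases "\<omega> \<in> D") (simp_all add: mult_exp_exp)
    qed
    have i1: "integrable M (\<lambda>\<omega>. ?W \<omega> * exp (r * I \<omega>))"
      by (rule integrable_mult_bounded(2)[OF eI, where K=1]) (auto simp: indicator_def)
    have ev2: "integrable M (\<lambda>\<omega>. exp (r\<^sup>2 * v \<omega> / 2))" using ev[of "r\<^sup>2 / 2"] by simp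
    have i2: "integrable M ?g"
      by (rule integrable_mult_bounded(2)[OF ev2, where K=1]) (auto simp: indicator_def)
    have i3: "integrable M (\<lambda>\<omega>. ?W \<omega> * exp (r\<^sup>2 * v \<omega> / 2))"
      by (rule integrable_mult_bounded(2)[OF ev2, where K=1]) (auto simp: indicator_def)
    have dm: "dexp ?I ?H \<in> borel_measurable M" by (rule dexp_measurable[OF approxD(1,2)[OF ar]])
    have ig: "integrable M (\<lambda>\<omega>. ?g \<omega> * dexp ?I ?H \<omega>)"
      using i1 i2 i3 by (subst integrable_cong_AE[OF _ _ split]) (use dm in auto)
    have "(\<integral>\<omega>. ?g \<omega> \<partial>M) = (\<integral>\<omega>. ?g \<omega> * dexp ?I ?H \<omega> \<partial>M)"
      by (rule dexp_weighted[OF ar E kr gG ig, symmetric])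
    also have "\<dots> = (\<integral>\<omega>. ?W \<omega> * exp (r * I \<omega>) + (?g \<omega> - ?W \<omega> * exp (r\<^sup>2 * v \<omega> / 2)) \<partial>M)"
      by (rule integral_cong_AE[OF _ _ split]) (use dm in measurable)
    also have "\<dots> = (\<integral>\<omega>. ?W \<omega> * exp (r * I \<omega>) \<partial>M) + ((\<integral>\<omega>. ?g \<omega> \<partial>M) - (\<integral>\<omega>. ?W \<omega> * exp (r\<^sup>2 * v \<omega> / 2) \<partial>M))"
      using i1 i2 i3 by simp
    finally show ?thesis by simp
  qed
  show "(\<integral>\<omega>. of_real (?W \<omega>) * cis (l * I \<omega>) \<partial>M) = (\<integral>\<omega>. of_real (?W \<omega> * exp (- (l\<^sup>2 * v \<omega> / 2))) \<partial>M)"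
    by (rule imaginary_exponential[OF _ _ _ _ eI ev real]) (auto simp: indicator_def)
qed

end

lemma trunc_tendsto: "(\<lambda>n. trunc (real (Suc n)) x) \<longlonglongrightarrow> x"
proof (rule tendsto_eventually)
  obtain N where "norm x \<le> real N" using real_arch_simple by blast
  then have "trunc (real (Suc n)) x = x" if "n \<ge> N" for n
    using that by (intro trunc_eq) auto
  then show "eventually (\<lambda>n. trunc (real (Suc n)) x = x) sequentially"
    by (auto simp: eventually_sequentially)
qed

lemma norm_trunc_diff_le: "K > 0 \<Longrightarrow> norm (x - trunc K x) \<le> norm x"
proof -
  assume K: "K > 0"
  define c where "c = K / max K (norm x)"
  have "0 \<le> c" "c \<le> 1" using K by (auto simp: c_def)
  moreover have "x - trunc K x = (1 - c) *\<^sub>R x" by (simp add: trunc_def c_def algebra_simps)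
  ultimately show ?thesis by (simp add: mult_left_le_one_le)
qed

context weak_solution begin

text \<open>Joint measurability in time and in the path of \<open>X\<close>. It makes
  \<open>sq H\<close> measurable for \<open>G\<close>, so that the conditional variance can be used
  as a weight.\<close>

definition jointG :: "(real \<Rightarrow> 'a \<Rightarrow> real^'d) \<Rightarrow> bool" where
  "jointG H \<longleftrightarrow> (\<lambda>(s, \<omega>). H s \<omega>) \<in> borel_measurable (unit_lborel \<Otimes>\<^sub>M G)"

lemma jointG_sq:
  assumes "jointG H"
  shows "sq H \<in> borel_measurable G"
proof -
  have "(\<lambda>x. (\<lambda>(s, \<omega>). H s \<omega>) (snd x, fst x)) \<in> borel_measurable (G \<Otimes>\<^sub>M unit_lborel)"
    by (rule measurable_compose[OF _ assms[unfolded jointG_def]]) simp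
  then have [measurable]: "(\<lambda>x. H (snd x) (fst x)) \<in> borel_measurable (G \<Otimes>\<^sub>M unit_lborel)" by (simp add: split_beta')
  have "(\<lambda>(\<omega>, s). (norm (H s \<omega>))\<^sup>2) \<in> borel_measurable (G \<Otimes>\<^sub>M unit_lborel)"
    unfolding split_beta' by measurable
  then show ?thesis
    unfolding cm_norm_sq_eq by (intro unit_lborel.borel_measurable_lebesgue_integral) (simp add: split_beta')
qed

lemma jointG_comp:
  assumes "jointG H" "T \<in> borel_measurable borel"
  shows "jointG (\<lambda>s \<omega>. T (H s \<omega>))"
  using measurable_compose[OF assms(1)[unfolded jointG_def] assms(2)] by (simp add: jointG_def split_beta')

lemma jointG_joint:
  assumes "jointG H"
  shows "joint H"
proof -
  have "(\<lambda>x. x) \<in> unit_lborel \<Otimes>\<^sub>M M \<rightarrow>\<^sub>M unit_lborel \<Otimes>\<^sub>M G"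
  proof -
    have "(\<lambda>\<omega>. \<omega>) \<in> M \<rightarrow>\<^sub>M G" using subalg_G by (auto simp: measurable_def subalgebra_def sets.Int_space_eq2 dest: sets.sets_into_space)
    then have "(\<lambda>x. (fst x, snd x)) \<in> unit_lborel \<Otimes>\<^sub>M M \<rightarrow>\<^sub>M unit_lborel \<Otimes>\<^sub>M G"
      by (intro measurable_Pair measurable_fst measurable_compose[OF measurable_snd])
    then show ?thesis by simp
  qed
  from measurable_compose[OF this assms[unfolded jointG_def]] show ?thesis by (simp add: joint_def)
qed

text \<open>The truncations \<open>?T n\<close> are bounded, stay in the kernel and stay measurable
  for \<open>G\<close>, so the bounded case applies with \<open>A\<close> the whole space and
  \<open>a = 0\<close>. Their integrals tend to \<open>I\<close> in probability, since the square
  norms of the differences from \<open>H\<close> tend to 0, and both sides are integrals of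
  functions bounded by 1.\<close>

lemma conditional_char:
  assumes a: "approx S h H I" and ker: "kernel H" and jG: "jointG H" and D: "D \<in> sets G"
  shows "(\<integral>\<omega>. of_real (indicator D \<omega>) * cis (l * I \<omega>) \<partial>M) =
    (\<integral>\<omega>. of_real (indicator D \<omega> * exp (- (l\<^sup>2 * sq H \<omega> / 2))) \<partial>M)"
proof -
  have DM [measurable]: "D \<in> events" using D sets_G_M by auto
  let ?T = "\<lambda>n s \<omega>. trunc (real (Suc n)) (H s \<omega>)"
  have "\<forall>n. \<exists>S' h' I'. approx S' h' (?T n) I'" using approx_trunc[OF a] by (metis of_nat_0_less_iff zero_less_Suc)
  then obtain S' h' J where J: "\<And>n. approx (S' n) (h' n) (?T n) (J n)" by metis
  have jT: "jointG (?T n)" for n by (rule jointG_comp[OF jG trunc_measurable])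
  have kT: "kernel (?T n)" for n
    using ker unfolding kernel_def
  proof eventually_elim
    case (elim \<omega>)
    then show ?case by eventually_elim (simp add: trunc_def matrix_vector_mult_scaleR)
  qed
  have eq: "(\<integral>\<omega>. of_real (indicator D \<omega>) * cis (l * J n \<omega>) \<partial>M) =
      (\<integral>\<omega>. of_real (indicator D \<omega> * exp (- (l\<^sup>2 * sq (?T n) \<omega> / 2))) \<partial>M)" for n
  proof -
    have sp: "space M \<in> sets (F 0)" using sets.top[of "F 0"] by simp
    have ae0: "AE s in unit_lborel. s \<le> 0 \<longrightarrow> ?T n s \<omega> = 0" for \<omega>
    proof -
      have "AE s in lborel. s \<noteq> (0::real)" by (rule AE_lborel_singleton)
      then have "AE s in unit_lborel. s \<noteq> 0 \<and> s \<in> {0..1}" by (subst AE_restrict_space_iff) auto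
      then show ?thesis by eventually_elim auto
    qed
    have e: "indicator (space M) \<omega> * indicator D \<omega> = (indicator D \<omega> :: real)" for \<omega>
      using sets.sets_into_space[OF DM] by (auto simp: indicator_def)
    have "AE \<omega> in M. AE s in unit_lborel. norm (?T n s \<omega>) \<le> real (Suc n)"
      by (intro AE_I2 norm_trunc_le) simp
    from conditional_char_bounded(1)[where l=l, OF J _ this kT jointG_sq[OF jT] _ _ _ sp _ D, unfolded e]
    show ?thesis using ae0 by simp
  qed
  have jd: "approx (\<lambda>m. S m \<union> S' n m) (\<lambda>m s \<omega>. 1 *\<^sub>R h m s \<omega> + (-1) *\<^sub>R h' n m s \<omega>) (\<lambda>s \<omega>. 1 *\<^sub>R H s \<omega> + (-1) *\<^sub>R ?T n s \<omega>)
       (\<lambda>\<omega>. 1 * I \<omega> + (-1) * J n \<omega>)" for n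
    by (rule approx_lin[OF a J])
  have lims: "AE \<omega> in M. (\<lambda>n. sq (?T n) \<omega>) \<longlonglongrightarrow> sq H \<omega> \<and> (\<lambda>n. sq (\<lambda>s \<omega>. 1 *\<^sub>R H s \<omega> + (-1) *\<^sub>R ?T n s \<omega>) \<omega>) \<longlonglongrightarrow> 0"
    using approx_L2[OF a] AE_space
  proof eventually_elim
    case (elim \<omega>)
    have i: "integrable unit_lborel (\<lambda>s. (norm (H s \<omega>))\<^sup>2)" using elim(1) by blast
    have Hm: "(\<lambda>s. H s \<omega>) \<in> borel_measurable unit_lborel" by (rule joint_section[OF approxD(1)[OF a] elim(2)])
    have Tm: "(\<lambda>s. ?T n s \<omega>) \<in> borel_measurable unit_lborel" for n
      by (rule joint_section[OF approxD(1)[OF J] elim(2)])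
    have 1: "(\<lambda>n. \<integral>s. (norm (?T n s \<omega>))\<^sup>2 \<partial>unit_lborel) \<longlonglongrightarrow> (\<integral>s. (norm (H s \<omega>))\<^sup>2 \<partial>unit_lborel)"
    proof (rule integral_dominated_convergence[OF _ _ i])
      show "AE s in unit_lborel. (\<lambda>n. (norm (?T n s \<omega>))\<^sup>2) \<longlonglongrightarrow> (norm (H s \<omega>))\<^sup>2"
        by (intro AE_I2 tendsto_power tendsto_norm trunc_tendsto)
      show "AE s in unit_lborel. norm ((norm (?T n s \<omega>))\<^sup>2) \<le> (norm (H s \<omega>))\<^sup>2" for n
        by (intro AE_I2) (simp add: power_mono norm_trunc_le_norm)
    qed (use Hm Tm in measurable)
    have 2: "(\<lambda>n. \<integral>s. (norm (1 *\<^sub>R H s \<omega> + (-1) *\<^sub>R ?T n s \<omega>))\<^sup>2 \<partial>unit_lborel) \<longlonglongrightarrow> (\<integral>s. 0 \<partial>unit_lborel)"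
    proof (rule integral_dominated_convergence[OF _ _ i])
      have "(\<lambda>n. (norm (1 *\<^sub>R x + (-1) *\<^sub>R trunc (real (Suc n)) x))\<^sup>2) \<longlonglongrightarrow> (norm (1 *\<^sub>R x + (-1) *\<^sub>R x))\<^sup>2" for x :: "real^'d"
        by (intro tendsto_power tendsto_norm tendsto_add tendsto_scaleR tendsto_const trunc_tendsto)
      then show "AE s in unit_lborel. (\<lambda>n. (norm (1 *\<^sub>R H s \<omega> + (-1) *\<^sub>R ?T n s \<omega>))\<^sup>2) \<longlonglongrightarrow> 0"
        by (intro AE_I2) simp
      show "AE s in unit_lborel. norm ((norm (1 *\<^sub>R H s \<omega> + (-1) *\<^sub>R ?T n s \<omega>))\<^sup>2) \<le> (norm (H s \<omega>))\<^sup>2" for n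
        by (intro AE_I2) (simp add: power_mono norm_trunc_diff_le)
      show "(\<lambda>s. (norm (1 *\<^sub>R H s \<omega> + (-1) *\<^sub>R ?T n s \<omega>))\<^sup>2) \<in> borel_measurable unit_lborel" for n
        using Hm Tm[of n] by measurable
    qed simp
    show ?case using 1 2 unfolding cm_norm_sq_eq by simp
  qed
  have jdm: "(\<lambda>\<omega>. 1 * I \<omega> + (-1) * J n \<omega>) \<in> borel_measurable M" for n by (rule approxD(2)[OF jd])
  have nm: "(\<lambda>\<omega>. ennreal \<bar>1 * I \<omega> + (-1) * J n \<omega>\<bar>) \<in> borel_measurable M" for n
    using jdm[of n] by measurable
  have nJ: "null_in_prob M (\<lambda>n \<omega>. ennreal \<bar>1 * I \<omega> + (-1) * J n \<omega>\<bar>)"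
  proof (rule exp_tail_null[OF jdm sq_measurable[OF approxD(1)[OF jd]] approx_exp_scaled[OF jd]])
    show "AE \<omega> in M. (\<lambda>n. sq (\<lambda>s \<omega>. 1 *\<^sub>R H s \<omega> + (-1) *\<^sub>R ?T n s \<omega>) \<omega>) \<longlonglongrightarrow> 0"
      using lims by eventually_elim blast
  qed
  obtain r where r: "strict_mono r" "AE \<omega> in M. (\<lambda>n. ennreal \<bar>1 * I \<omega> + (-1) * J (r n) \<omega>\<bar>) \<longlonglongrightarrow> 0"
    using null_in_prob_subseq[OF nm nJ] by blast
  have JI: "AE \<omega> in M. (\<lambda>n. J (r n) \<omega>) \<longlonglongrightarrow> I \<omega>"
    using r(2)
  proof eventually_elim
    case (elim \<omega>)
    have "(\<lambda>n. \<bar>1 * I \<omega> + (-1) * J (r n) \<omega>\<bar>) \<longlonglongrightarrow> 0"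
      using elim unfolding ennreal_0[symmetric] by (subst (asm) tendsto_ennreal_iff) auto
    from tendsto_diff[OF tendsto_const[of "I \<omega>"] tendsto_rabs_zero_cancel[OF this]] show ?case by simp
  qed
  have Im [measurable]: "I \<in> borel_measurable M" and Jm [measurable]: "\<And>n. J n \<in> borel_measurable M"
    using approxD(2)[OF a] approxD(2)[OF J] by auto
  have [measurable]: "sq H \<in> borel_measurable M" "\<And>n. sq (?T n) \<in> borel_measurable M"
    using sq_measurable[OF approxD(1)[OF a]] sq_measurable[OF approxD(1)[OF J]] by auto
  have L: "(\<lambda>n. \<integral>\<omega>. of_real (indicator D \<omega>) * cis (l * J (r n) \<omega>) \<partial>M) \<longlonglongrightarrow> (\<integral>\<omega>. of_real (indicator D \<omega>) * cis (l * I \<omega>) \<partial>M)"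
  proof (rule integral_dominated_convergence[where w="\<lambda>_. 1"])
    show "AE \<omega> in M. (\<lambda>n. complex_of_real (indicator D \<omega>) * cis (l * J (r n) \<omega>)) \<longlonglongrightarrow> of_real (indicator D \<omega>) * cis (l * I \<omega>)"
      using JI unfolding cis_conv_exp by eventually_elim (intro tendsto_intros)
  qed (auto simp: norm_mult indicator_def)
  have Rr: "(\<lambda>n. \<integral>\<omega>. indicator D \<omega> * exp (- (l\<^sup>2 * sq (?T (r n)) \<omega> / 2)) \<partial>M) \<longlonglongrightarrow> (\<integral>\<omega>. indicator D \<omega> * exp (- (l\<^sup>2 * sq H \<omega> / 2)) \<partial>M)"
  proof (rule integral_dominated_convergence[where w="\<lambda>_. 1"])
    show "AE \<omega> in M. (\<lambda>n. indicator D \<omega> * exp (- (l\<^sup>2 * sq (?T (r n)) \<omega> / 2))) \<longlonglongrightarrow> indicator D \<omega> * exp (- (l\<^sup>2 * sq H \<omega> / 2))"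
      using lims
    proof eventually_elim
      case (elim \<omega>)
      from LIMSEQ_subseq_LIMSEQ[OF conjunct1[OF elim] r(1)] show ?case
        unfolding comp_def by (intro tendsto_intros) auto
    qed
    show "AE \<omega> in M. norm (indicator D \<omega> * exp (- (l\<^sup>2 * sq (?T (r n)) \<omega> / 2))) \<le> 1" for n
      by (intro AE_I2) (auto simp: indicator_def)
    show "(\<lambda>\<omega>. indicator D \<omega> * exp (- (l\<^sup>2 * sq (?T (r n)) \<omega> / 2))) \<in> borel_measurable M" for n by measurable
  qed auto
  show ?thesis
    using LIMSEQ_unique[OF L[unfolded eq integral_complex_of_real] tendsto_of_real[OF Rr]]
    unfolding integral_complex_of_real .
qed

section \<open>Conditional Gaussian laws\<close>

lemma gaussian_law_measure:
  assumes "A \<in> sets borel"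
  shows "measure (gaussian_law 0 v) A = (\<integral>z. indicator A (sqrt v * z) \<partial>std_normal_distribution)"
proof -
  interpret std: prob_space std_normal_distribution by (rule prob_space_normal_density) simp
  have "measure (gaussian_law 0 v) A = measure std_normal_distribution ((\<lambda>z. sqrt v * z) -` A)"
    unfolding gaussian_law_def using assms by (subst measure_distr) auto
  also have "\<dots> = (\<integral>z. indicator ((\<lambda>z. sqrt v * z) -` A) z \<partial>std_normal_distribution)"
    using assms by (subst Bochner_Integration.integral_indicator) (auto simp: measure_def)
  finally show ?thesis by (simp add: indicator_def)
qed

text \<open>On the product of \<open>M\<close> with a standard normal variable \<open>z\<close>, the
  variable \<open>sqrt (v \<omega>) * z\<close> has the wanted conditional law by construction.
  Comparing Fourier transforms with weight \<open>w\<close> transfers this to \<open>I\<close>, with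
  the point mass at \<open>v \<omega> = 0\<close> included.\<close>

lemma gaussian_law_conditional:
  assumes I [measurable]: "I \<in> borel_measurable M" and v: "v \<in> borel_measurable G" "\<And>\<omega>. 0 \<le> v \<omega>"
    and w: "integrable M w" "\<And>\<omega>. 0 \<le> w \<omega>"
    and char: "\<And>l. (\<integral>\<omega>. of_real (w \<omega>) * cis (l * I \<omega>) \<partial>M) = (\<integral>\<omega>. of_real (w \<omega> * exp (- (l\<^sup>2 * v \<omega> / 2))) \<partial>M)"
    and A: "A \<in> sets borel"
  shows "(\<integral>\<omega>. w \<omega> * indicator A (I \<omega>) \<partial>M) = (\<integral>\<omega>. w \<omega> * measure (gaussian_law 0 (v \<omega>)) A \<partial>M)"
proof -
  let ?g = "std_normal_distribution"
  interpret std: prob_space ?g by (rule prob_space_normal_density) simp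
  interpret P: pair_sigma_finite M ?g ..
  interpret PP: pair_prob_space M ?g ..
  have [measurable]: "v \<in> borel_measurable M" "w \<in> borel_measurable M" using G_M[OF v(1)] w(1) by auto
  let ?Y = "\<lambda>p. sqrt (v (fst p)) * snd p" and ?w = "\<lambda>p. w (fst p)"
  have wi: "integrable (M \<Otimes>\<^sub>M ?g) ?w"
    using P.Fubini_integrable[of ?w] w(1) by (simp add: w(2))
  have Ym: "?Y \<in> borel_measurable (M \<Otimes>\<^sub>M ?g)" by measurable
  have "(\<integral>\<omega>. w \<omega> * indicator A (I \<omega>) \<partial>M) = (\<integral>p. ?w p * indicator A (?Y p) \<partial>(M \<Otimes>\<^sub>M ?g))"
  proof (rule integral_eqI_char[where Y=I and Y'="?Y"])
    fix l :: real
    have ic: "integrable (M \<Otimes>\<^sub>M ?g) (\<lambda>p. complex_of_real (?w p) * cis (l \<bullet> ?Y p))"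
      by (rule integrable_mult_cis[OF wi]) (use Ym in measurable)
    have "(\<integral>p. complex_of_real (?w p) * cis (l \<bullet> ?Y p) \<partial>(M \<Otimes>\<^sub>M ?g)) = (\<integral>\<omega>. \<integral>z. of_real (w \<omega>) * cis (l * sqrt (v \<omega>) * z) \<partial>?g \<partial>M)"
      using P.integral_fst'[OF ic] by (simp add: mult.assoc)
    also have "\<dots> = (\<integral>\<omega>. of_real (w \<omega>) * char ?g (l * sqrt (v \<omega>)) \<partial>M)"
      by (simp add: char_eq_cis)
    also have "\<dots> = (\<integral>\<omega>. of_real (w \<omega> * exp (- (l\<^sup>2 * v \<omega> / 2))) \<partial>M)"
      using v(2) by (simp add: char_std_normal_distribution power_mult_distrib)
    finally show "(\<integral>\<omega>. of_real (w \<omega>) * cis (l \<bullet> I \<omega>) \<partial>M) = (\<integral>p. of_real (?w p) * cis (l \<bullet> ?Y p) \<partial>(M \<Otimes>\<^sub>M ?g))"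
      using char[of l] by simp
  qed (use wi w A I Ym in auto)
  also have "\<dots> = (\<integral>\<omega>. \<integral>z. w \<omega> * indicator A (sqrt (v \<omega>) * z) \<partial>?g \<partial>M)"
  proof -
    have "integrable (M \<Otimes>\<^sub>M ?g) (\<lambda>p. ?w p * indicator A (?Y p))"
      by (rule integrable_mult_bounded(1)[OF wi, where K=1]) (use Ym A in \<open>auto simp: indicator_def\<close>)
    from P.integral_fst'[OF this] show ?thesis by simp
  qed
  also have "\<dots> = (\<integral>\<omega>. w \<omega> * measure (gaussian_law 0 (v \<omega>)) A \<partial>M)"
    by (simp add: gaussian_law_measure[OF A])
  finally show ?thesis .
qed

text \<open>Two versions of the variance occur because the one in the final statement is computed
  from \<open>u'\<close> and agrees with a function measurable for \<open>G\<close> only almost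
  surely.\<close>

lemma cond_gaussianI:
  assumes I [measurable]: "I \<in> borel_measurable M" and v: "v \<in> borel_measurable G" "\<And>\<omega>. 0 \<le> v \<omega>"
    and char: "\<And>D l. D \<in> sets G \<Longrightarrow> (\<integral>\<omega>. of_real (indicator D \<omega>) * cis (l * I \<omega>) \<partial>M) =
      (\<integral>\<omega>. of_real (indicator D \<omega> * exp (- (l\<^sup>2 * v \<omega> / 2))) \<partial>M)"
    and v': "AE \<omega> in M. v' \<omega> = v \<omega>"
  shows "cond_gaussian M G I (\<lambda>_. 0) v'"
  unfolding cond_gaussian_def
proof (intro conjI ballI)
  show "AE \<omega> in M. 0 \<le> v' \<omega>" using v' by eventually_elim (simp add: v(2))
  fix A :: "real set" assume A: "A \<in> sets borel"
  let ?g = "std_normal_distribution"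
  interpret std: prob_space ?g by (rule prob_space_normal_density) simp
  have gm: "(\<lambda>\<omega>. measure (gaussian_law 0 (v \<omega>)) A) \<in> borel_measurable G"
  proof -
    note [measurable] = v(1) A
    have "(\<lambda>(\<omega>, z). indicator A (sqrt (v \<omega>) * z) :: real) \<in> borel_measurable (G \<Otimes>\<^sub>M ?g)" by measurable
    then have "(\<lambda>\<omega>. \<integral>z. indicator A (sqrt (v \<omega>) * z) \<partial>?g :: real) \<in> borel_measurable G"
      by (rule std.borel_measurable_lebesgue_integral)
    then show ?thesis by (simp add: gaussian_law_measure[OF A])
  qed
  have "prob_space (gaussian_law 0 (v \<omega>))" for \<omega>
    unfolding gaussian_law_def by (rule std.prob_space_distr) simp
  then have b: "measure (gaussian_law 0 (v \<omega>)) A \<le> 1" for \<omega>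
    by (intro prob_space.prob_le_1)
  have gi: "integrable M (\<lambda>\<omega>. measure (gaussian_law 0 (v \<omega>)) A)"
    by (rule integrable_const_bound[where B=1]) (use G_M[OF gm] b in auto)
  have Ai: "I -` A \<inter> space M \<in> events" using A by measurable
  have "AE \<omega> in M. real_cond_exp M G (indicator (I -` A \<inter> space M)) \<omega> = measure (gaussian_law 0 (v \<omega>)) A"
  proof (rule sG.real_cond_exp_charact[OF _ _ gi gm])
    fix D assume D: "D \<in> sets G"
    then have [measurable]: "D \<in> events" using sets_G_M by auto
    have iD: "integrable M (indicator D :: 'a \<Rightarrow> real)"
      by (rule integrable_const_bound[where B=1]) auto
    have "(\<integral>\<omega>\<in>D. indicator (I -` A \<inter> space M) \<omega> \<partial>M) = (\<integral>\<omega>. indicator D \<omega> * indicator A (I \<omega>) \<partial>M :: real)"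
      unfolding set_lebesgue_integral_def by (intro Bochner_Integration.integral_cong) (auto simp: indicator_def)
    also have "\<dots> = (\<integral>\<omega>. indicator D \<omega> * measure (gaussian_law 0 (v \<omega>)) A \<partial>M)"
      by (rule gaussian_law_conditional[OF I v iD _ char[OF D] A]) simp
    finally show "(\<integral>\<omega>\<in>D. indicator (I -` A \<inter> space M) \<omega> \<partial>M) = (\<integral>\<omega>\<in>D. measure (gaussian_law 0 (v \<omega>)) A \<partial>M)"
      by (simp add: set_lebesgue_integral_def)
  qed (use Ai in \<open>simp add: less_top[symmetric]\<close>)
  then show "AE \<omega> in M. cond_prob_of M G (I -` A \<inter> space M) \<omega> = measure (gaussian_law 0 (v' \<omega>)) A"
    using v' unfolding cond_prob_of_def by eventually_elim simp
qed

end

section \<open>Recovering a density from its primitive\<close>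

lemma AE_unit_of_negligible:
  assumes "negligible N"
  shows "AE s in unit_lborel. s \<notin> N"
proof -
  have "N \<in> null_sets lebesgue" using assms by (simp add: negligible_iff_null_sets)
  then obtain N' where N': "N' \<in> null_sets lborel" "N \<subseteq> N'" by (auto simp: null_sets_completion_iff2)
  then have "AE s in lborel. s \<notin> N" by (intro AE_I'[OF N'(1)]) auto
  then show ?thesis by (subst AE_restrict_space_iff) auto
qed

text \<open>Lebesgue's differentiation theorem for difference quotients to the right, of lengths
  \<open>inverse (real (Suc k))\<close>. The cut-off \<open>min 1\<close> keeps the times in the
  unit interval; for \<open>s < 1\<close> it is eventually inactive.\<close>

lemma cm_path_differentiable:
  fixes f :: "real \<Rightarrow> real^'d"
  assumes f: "integrable unit_lborel f"
  shows "continuous_on {0..1} (cm_path f)"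
    and "AE s in unit_lborel. (\<lambda>k. real (Suc k) *\<^sub>R (cm_path f (min 1 (s + inverse (real (Suc k)))) - cm_path f s)) \<longlonglongrightarrow> f s"
proof -
  let ?f = "\<lambda>s. if s \<in> {0..1} then f s else 0"
  have si: "set_integrable lborel {0..1} f"
    using f by (simp add: integrable_restrict_space set_integrable_def)
  have il: "integrable lborel ?f"
    using si unfolding set_integrable_def by (rule Bochner_Integration.integrable_cong[THEN iffD1, rotated 2]) (auto simp: indicator_def)
  have sil: "set_integrable lborel S ?f" if "S \<in> sets borel" for S
    unfolding set_integrable_def using il that by (intro integrable_mult_indicator) auto
  have cm: "cm_path f t = integral {0..t} ?f" if "t \<in> {0..1}" for t
  proof -
    have "cm_path f t = (LINT s:{0..t}|lborel. ?f s)"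
      unfolding cm_path_def set_lebesgue_integral_def using that
      by (intro Bochner_Integration.integral_cong refl) (auto simp: indicator_def)
    also have "\<dots> = integral {0..t} ?f" by (rule set_borel_integral_eq_integral(2)[OF sil]) simp
    finally show ?thesis .
  qed
  have io: "?f integrable_on {a..b}" for a b by (rule set_borel_integral_eq_integral(1)[OF sil]) simp
  have "continuous_on {0..1} (\<lambda>t. integral {0..t} ?f)" by (rule indefinite_integral_continuous_1[OF io])
  then show "continuous_on {0..1} (cm_path f)" using cm by (subst continuous_on_cong[OF refl]) auto
  obtain N where N: "negligible N"
    "\<And>x e. x \<notin> N \<Longrightarrow> 0 < e \<Longrightarrow> \<exists>d>0. \<forall>h. 0 < h \<and> h < d \<longrightarrow>
       norm (integral (cbox x (x + h *\<^sub>R One)) ?f /\<^sub>R h ^ DIM(real) - ?f x) < e"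
  proof (rule integrable_ccontinuous_explicit[of ?f])
    show "?f integrable_on cbox a b" for a b using io[of a b] by simp
  qed blast
  have "negligible (insert 1 N)" using N(1) by simp
  from AE_unit_of_negligible[OF this] AE_space
  show "AE s in unit_lborel. (\<lambda>k. real (Suc k) *\<^sub>R (cm_path f (min 1 (s + inverse (real (Suc k)))) - cm_path f s)) \<longlonglongrightarrow> f s"
  proof eventually_elim
    case (elim s)
    then have s: "0 \<le> s" "s < 1" "s \<notin> N" by auto
    show ?case
    proof (rule LIMSEQ_I)
      fix e :: real assume "e > 0"
      from N(2)[OF s(3) this] obtain d where d: "d > 0"
        "\<And>h. 0 < h \<Longrightarrow> h < d \<Longrightarrow> norm (integral {s..s + h} ?f /\<^sub>R h - ?f s) < e" by auto
      have "eventually (\<lambda>k. inverse (real (Suc k)) < min d (1 - s)) sequentially"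
        using LIMSEQ_inverse_real_of_nat by (rule order_tendstoD) (use d s in simp)
      then obtain K where K: "\<And>k. k \<ge> K \<Longrightarrow> inverse (real (Suc k)) < min d (1 - s)" by (auto simp: eventually_sequentially)
      have "norm (real (Suc k) *\<^sub>R (cm_path f (min 1 (s + inverse (real (Suc k)))) - cm_path f s) - f s) < e" if k: "k \<ge> K" for k
      proof -
        define h where "h = inverse (real (Suc k))"
        have h: "0 < h" "h < d" "s + h < 1" using K[OF k] by (auto simp: h_def)
        have "integral {0..s} ?f + integral {s..s + h} ?f = integral {0..s + h} ?f"
          using s h by (intro Henstock_Kurzweil_Integration.integral_combine io) auto
        then have "cm_path f (min 1 (s + h)) - cm_path f s = integral {s..s + h} ?f"
          using s h cm[of s] cm[of "s + h"] by (simp add: min_def algebra_simps)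
        then have "real (Suc k) *\<^sub>R (cm_path f (min 1 (s + h)) - cm_path f s) = integral {s..s + h} ?f /\<^sub>R h"
          by (simp add: h_def)
        moreover have "?f s = f s" using s by simp
        ultimately show ?thesis using d(2)[OF h(1,2)] by (simp add: h_def)
      qed
      then show "\<exists>K. \<forall>k\<ge>K. norm (real (Suc k) *\<^sub>R (cm_path f (min 1 (s + inverse (real (Suc k)))) - cm_path f s) - f s) < e" by blast
    qed
  qed
qed

lemma dyadic_floor_tendsto: "(\<lambda>n. of_int \<lfloor>2 ^ n * t\<rfloor> / 2 ^ n) \<longlonglongrightarrow> (t :: real)"
proof (rule tendsto_sandwich[of "\<lambda>n. t - (1/2) ^ n" _ _ "\<lambda>_. t"])
  have b: "2 ^ n * t - 1 < of_int \<lfloor>2 ^ n * t\<rfloor>" "of_int \<lfloor>2 ^ n * t\<rfloor> \<le> 2 ^ n * t" for n by linarith+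
  show "\<forall>\<^sub>F n in sequentially. t - (1/2) ^ n \<le> of_int \<lfloor>2 ^ n * t\<rfloor> / 2 ^ n"
  proof (intro always_eventually allI)
    fix n
    have "t - (1/2) ^ n = (2 ^ n * t - 1) / 2 ^ n" by (simp add: diff_divide_distrib power_one_over)
    also have "\<dots> \<le> of_int \<lfloor>2 ^ n * t\<rfloor> / 2 ^ n" using less_imp_le[OF b(1)] by (rule divide_right_mono) simp
    finally show "t - (1/2) ^ n \<le> of_int \<lfloor>2 ^ n * t\<rfloor> / 2 ^ n" .
  qed
  show "\<forall>\<^sub>F n in sequentially. of_int \<lfloor>2 ^ n * t\<rfloor> / 2 ^ n \<le> t"
    using b(2) by (intro always_eventually allI) (simp add: field_simps)
  have "(\<lambda>n. t - (1/2) ^ n) \<longlonglongrightarrow> t - 0" by (intro tendsto_intros LIMSEQ_power_zero) simp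
  then show "(\<lambda>n. t - (1/2) ^ n) \<longlonglongrightarrow> t" by simp
qed simp

context weak_solution begin

text \<open>The density is the almost everywhere derivative of the continuous path.\<close>

lemma cm_measurable_density:
  fixes u :: "real \<Rightarrow> 'a \<Rightarrow> real^'d"
  assumes cm: "cm_measurable M G u" and int: "AE \<omega> in M. integrable unit_lborel (\<lambda>s. u s \<omega>)"
  obtains uG where "jointG uG" "AE \<omega> in M. AE s in unit_lborel. u s \<omega> = uG s \<omega>"
proof -
  obtain v where v: "\<And>t. t \<in> {0..1} \<Longrightarrow> v t \<in> borel_measurable G" "\<And>t. t \<in> {0..1} \<Longrightarrow> AE \<omega> in M. cm_path (\<lambda>s. u s \<omega>) t = v t \<omega>"
    using cm unfolding cm_measurable_def by metis
  \<comment> \<open>Arbitrary integers occur in the rounded times below, so \<open>v\<close> is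
    extended by 0 outside the unit interval.\<close>
  define vv where "vv t = (if t \<in> {0..1} then v t else (\<lambda>_. 0))" for t
  have vv: "vv t \<in> borel_measurable G" for t using v(1)[of t] by (auto simp: vv_def)
  \<comment> \<open>Each time has its own exceptional null set. Rounding down to dyadic times
    involves only countably many of them, makes \<open>C\<close> jointly measurable, and by
    continuity of the path loses nothing in the limit.\<close>
  define q where "q n t = of_int \<lfloor>2 ^ n * t\<rfloor> / (2 ^ n :: real)" for n :: nat and t :: real
  define C where "C t \<omega> = lim (\<lambda>n. vv (q n t) \<omega>)" for t \<omega>
  have "(\<lambda>x. vv (of_int \<lfloor>2 ^ n * fst x\<rfloor> / 2 ^ n) (snd x)) \<in> borel_measurable (unit_lborel \<Otimes>\<^sub>M G)" for n
  proof (rule measurable_compose_countable[where f="\<lambda>k x. vv (of_int k / 2 ^ n) (snd x)" and g="\<lambda>x. \<lfloor>2 ^ n * fst x\<rfloor>"])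
    show "(\<lambda>x. vv (of_int k / 2 ^ n) (snd x)) \<in> borel_measurable (unit_lborel \<Otimes>\<^sub>M G)" for k :: int
      by (rule measurable_compose[OF measurable_snd vv])
    have "(\<lambda>s. s) \<in> borel_measurable unit_lborel" by (intro measurable_restrict_space1) simp
    then have "(\<lambda>x. 2 ^ n * fst x) \<in> borel_measurable (unit_lborel \<Otimes>\<^sub>M G)"
      by (intro borel_measurable_times borel_measurable_const measurable_compose[OF measurable_fst])
    from measurable_compose[OF this measurable_real_floor]
    show "(\<lambda>x. \<lfloor>2 ^ n * fst x\<rfloor>) \<in> unit_lborel \<Otimes>\<^sub>M G \<rightarrow>\<^sub>M count_space UNIV" .
  qed
  then have Cm: "(\<lambda>x. C (fst x) (snd x)) \<in> borel_measurable (unit_lborel \<Otimes>\<^sub>M G)"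
    unfolding C_def q_def by (rule borel_measurable_lim_metric)
  define uG where "uG s \<omega> = lim (\<lambda>k. real (Suc k) *\<^sub>R (C (min 1 (s + inverse (real (Suc k)))) \<omega> - C s \<omega>))" for s \<omega>
  have "(\<lambda>x. uG (fst x) (snd x)) \<in> borel_measurable (unit_lborel \<Otimes>\<^sub>M G)"
    unfolding uG_def
  proof (rule borel_measurable_lim_metric)
    fix k
    have "(\<lambda>s. min 1 (s + inverse (real (Suc k)))) \<in> unit_lborel \<rightarrow>\<^sub>M unit_lborel"
    proof -
      have "(\<lambda>s. min 1 (s + inverse (real (Suc k)))) \<in> unit_lborel \<rightarrow>\<^sub>M lborel"
        by (intro measurable_restrict_space1) simp
      then show ?thesis by (rule measurable_restrict_space2[rotated]) (auto intro!: add_nonneg_nonneg)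
    qed
    then have "(\<lambda>x. (min 1 (fst x + inverse (real (Suc k))), snd x)) \<in> unit_lborel \<Otimes>\<^sub>M G \<rightarrow>\<^sub>M unit_lborel \<Otimes>\<^sub>M G"
      by (intro measurable_Pair measurable_snd measurable_compose[OF measurable_fst])
    from measurable_compose[OF this Cm]
    have "(\<lambda>x. C (min 1 (fst x + inverse (real (Suc k)))) (snd x)) \<in> borel_measurable (unit_lborel \<Otimes>\<^sub>M G)" by simp
    then show "(\<lambda>x. real (Suc k) *\<^sub>R (C (min 1 (fst x + inverse (real (Suc k)))) (snd x) - C (fst x) (snd x))) \<in> borel_measurable (unit_lborel \<Otimes>\<^sub>M G)"
      using Cm by (intro borel_measurable_scaleR borel_measurable_diff borel_measurable_const)
  qed
  then have "jointG uG" by (simp add: jointG_def split_beta')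
  moreover have "AE \<omega> in M. AE s in unit_lborel. u s \<omega> = uG s \<omega>"
  proof -
    have "AE \<omega> in M. \<forall>n::nat. \<forall>k::int. of_int k / 2 ^ n \<in> {0..1::real} \<longrightarrow> cm_path (\<lambda>s. u s \<omega>) (of_int k / 2 ^ n) = v (of_int k / 2 ^ n) \<omega>"
      unfolding AE_all_countable using v(2) by (auto intro!: AE_impI)
    then show ?thesis
      using int
    proof eventually_elim
      case (elim \<omega>)
      let ?c = "cm_path (\<lambda>s. u s \<omega>)"
      note df = cm_path_differentiable[OF elim(2)]
      have Cc: "C t \<omega> = ?c t" if t: "t \<in> {0..1}" for t
      proof -
        have q01: "q n t \<in> {0..1}" for n
        proof -
          have "0 \<le> \<lfloor>2 ^ n * t\<rfloor>" "of_int \<lfloor>2 ^ n * t\<rfloor> \<le> 2 ^ n * t" using t by auto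
          moreover have "2 ^ n * t \<le> 2 ^ n" using t by (simp add: mult_left_le)
          ultimately have f: "real_of_int \<lfloor>2 ^ n * t\<rfloor> \<le> 2 ^ n" "0 \<le> real_of_int \<lfloor>2 ^ n * t\<rfloor>"
            by linarith+
          have "q n t \<le> 2 ^ n / 2 ^ n" "0 \<le> q n t"
            unfolding q_def by (rule divide_right_mono[OF f(1)], simp) (rule divide_nonneg_nonneg[OF f(2)], simp)
          then show ?thesis by simp
        qed
        have "(\<lambda>n. ?c (q n t)) \<longlonglongrightarrow> ?c t"
          using continuous_on_tendsto_compose[OF df(1) dyadic_floor_tendsto t] q01 by (simp add: q_def)
        moreover have "vv (q n t) \<omega> = ?c (q n t)" for n
          using q01[of n] elim(1) by (simp add: vv_def q_def)
        ultimately show ?thesis unfolding C_def by (simp add: limI)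
      qed
      show ?case
        using df(2) AE_space
      proof eventually_elim
        case (elim s)
        have "C (min 1 (s + inverse (real (Suc k)))) \<omega> = ?c (min 1 (s + inverse (real (Suc k))))" "C s \<omega> = ?c s" for k
          using elim(2) by (auto intro!: Cc add_nonneg_nonneg)
        then show ?case unfolding uG_def using limI[OF elim(1)] by simp
      qed
    qed
  qed
  ultimately show ?thesis by (rule that)
qed

end

section \<open>Orthogonal projections\<close>

text \<open>Both \<open>(Q *v v) \<bullet> w\<close> and \<open>v \<bullet> (Q *v w)\<close> equal
  \<open>(Q *v v) \<bullet> (Q *v w)\<close>.\<close>

lemma orthogonal_projection_symmetric:
  assumes "is_orthogonal_projection S Q"
  shows "transpose Q = Q"
proof -
  have *: "(Q *v v) \<bullet> w = v \<bullet> (Q *v w)" for v w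
  proof -
    have "(v - Q *v v) \<bullet> (Q *v w) = 0" "(w - Q *v w) \<bullet> (Q *v v) = 0"
      using assms by (auto simp: is_orthogonal_projection_def orthogonal_def)
    then have "v \<bullet> (Q *v w) = (Q *v v) \<bullet> (Q *v w)" "w \<bullet> (Q *v v) = (Q *v w) \<bullet> (Q *v v)"
      unfolding inner_diff_left by linarith+
    then show ?thesis by (metis inner_commute)
  qed
  have "(transpose Q *v w) \<bullet> v = (Q *v w) \<bullet> v" for v w
    using *[of w v] by (simp add: dot_lmul_matrix)
  then have "transpose Q *v w = Q *v w" for w
    by (metis vector_eq_rdot)
  then show ?thesis by (simp add: matrix_eq)
qed

text \<open>Pythagoras for the orthogonal sum of \<open>v - Q *v v\<close> and
  \<open>Q *v v\<close>.\<close>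

lemma coprojection_norm_le:
  assumes "is_orthogonal_projection S Q"
  shows "norm ((mat 1 - Q) *v v) \<le> norm v"
proof -
  have e: "(mat 1 - Q) *v v = v - Q *v v" by (simp add: matrix_vector_mult_diff_rdistrib)
  have "(v - Q *v v) \<bullet> (Q *v v) = 0"
    using assms by (auto simp: is_orthogonal_projection_def orthogonal_def)
  then have "(norm v)\<^sup>2 = (norm (v - Q *v v))\<^sup>2 + (norm (Q *v v))\<^sup>2"
    by (simp add: power2_norm_eq_inner inner_diff_left inner_diff_right inner_commute)
  then have "(norm (v - Q *v v))\<^sup>2 \<le> (norm v)\<^sup>2" by simp
  then show ?thesis unfolding e by (rule power2_le_imp_le) simp
qed

text \<open>\<open>?z = v - Q *v v\<close> is orthogonal to \<open>transpose A *v (A *v ?z)\<close>,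
  and this inner product is the squared norm of \<open>A *v ?z\<close>.\<close>

lemma coprojection_kernel:
  assumes "is_orthogonal_projection (range (\<lambda>y. transpose A *v y)) Q"
  shows "A *v ((mat 1 - Q) *v v) = 0"
proof -
  let ?z = "(mat 1 - Q) *v v"
  have e: "?z = v - Q *v v" by (simp add: matrix_vector_mult_diff_rdistrib)
  have "?z \<bullet> (transpose A *v (A *v ?z)) = 0"
    using assms unfolding e is_orthogonal_projection_def orthogonal_def by blast
  then have "(A *v ?z) \<bullet> (A *v ?z) = 0" by (simp add: inner_commute[of ?z] dot_lmul_matrix)
  then show ?thesis by simp
qed

lemma borel_measurable_matrix_vector_mult:
  fixes f :: "'x \<Rightarrow> real^'d^'m"
  assumes [measurable]: "f \<in> borel_measurable N" "g \<in> borel_measurable N"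
  shows "(\<lambda>x. f x *v g x) \<in> borel_measurable N"
proof -
  have c: "(\<lambda>A :: real^'d^'m. A $ i) \<in> borel_measurable borel" for i
    by (intro borel_measurable_continuous_onI continuous_intros)
  have "(\<lambda>x. (f x *v g x) \<bullet> b) \<in> borel_measurable N" if bB: "b \<in> Basis" for b :: "real^'m"
  proof -
    obtain i where b: "b = axis i 1" using bB by (auto simp: Basis_vec_def)
    have [measurable]: "(\<lambda>x. f x $ i) \<in> borel_measurable N" by (rule measurable_compose[OF assms(1) c])
    have "(f x *v g x) \<bullet> b = f x $ i \<bullet> g x" for x
      unfolding b by (simp add: inner_axis matrix_vector_mul_component)
    then show ?thesis by simp
  qed
  then show ?thesis by (simp add: borel_measurable_euclidean_space[of "\<lambda>x. f x *v g x"])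
qed

section \<open>The stochastic exponential of the projected integrand\<close>

locale projected_solution = weak_solution M F B X x b \<sigma>
  for M :: "'a measure" and F and B :: "real \<Rightarrow> 'a \<Rightarrow> real^'d" and X :: "real \<Rightarrow> 'a \<Rightarrow> real^'n" and x b \<sigma> +
  fixes P :: "real \<Rightarrow> (real \<Rightarrow> real^'n) \<Rightarrow> real^'d^'d"
  assumes proj: "projection_version M X \<sigma> P"
begin

abbreviation R where "R \<equiv> coprojection P X"

lemma proj_AE:
  "AE \<omega> in M. AE s in unit_lborel. is_orthogonal_projection (range (\<lambda>y. transpose (\<sigma> s (path_of X \<omega>)) *v y)) (P s (path_of X \<omega>))"
proof -
  have "AE \<omega> in M. AE s in lborel. s \<in> {0..1} \<longrightarrow> is_orthogonal_projection (range (\<lambda>y. transpose (\<sigma> s (path_of X \<omega>)) *v y)) (P s (path_of X \<omega>))"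
    using proj by (simp add: projection_version_def)
  then show ?thesis by eventually_elim (subst AE_restrict_space_iff, auto)
qed

lemma kernel_R: "kernel (\<lambda>s \<omega>. R s \<omega> *v u s \<omega>)"
  unfolding kernel_def using proj_AE
proof eventually_elim
  case (elim \<omega>)
  then show ?case by eventually_elim (simp add: coprojection_def coprojection_kernel)
qed

lemma R_measurable: "(\<lambda>(s, \<omega>). R s \<omega>) \<in> borel_measurable (unit_lborel \<Otimes>\<^sub>M G)"
proof -
  have P: "(\<lambda>(s, w). P s w) \<in> borel_measurable (unit_lborel \<Otimes>\<^sub>M path_space)"
    using proj unfolding projection_version_def measurable_cong_sets[OF sets_pair_measure_cong[OF sets_unit_lborel refl] refl] by blast
  have "(\<lambda>x. (fst x, path_of X (snd x))) \<in> unit_lborel \<Otimes>\<^sub>M G \<rightarrow>\<^sub>M unit_lborel \<Otimes>\<^sub>M path_space"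
    by (intro measurable_Pair measurable_fst measurable_compose[OF measurable_snd path_measurable(2)])
  from measurable_compose[OF this P] have "(\<lambda>x. P (fst x) (path_of X (snd x))) \<in> borel_measurable (unit_lborel \<Otimes>\<^sub>M G)" by simp
  then have "(\<lambda>x. mat 1 - P (fst x) (path_of X (snd x))) \<in> borel_measurable (unit_lborel \<Otimes>\<^sub>M G)" by measurable
  then show ?thesis unfolding coprojection_def split_beta' .
qed

lemma jointG_R:
  assumes "jointG u"
  shows "jointG (\<lambda>s \<omega>. R s \<omega> *v u s \<omega>)"
  using borel_measurable_matrix_vector_mult[OF R_measurable assms[unfolded jointG_def]]
  unfolding jointG_def split_beta' .

lemma AE_unit_pos: "AE s in unit_lborel. s \<noteq> 0 \<and> s \<in> {0..1}"
proof -
  have "AE s in lborel. s \<noteq> (0::real)" by (rule AE_lborel_singleton)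
  then show ?thesis by (subst AE_restrict_space_iff) auto
qed

lemma ito_terminal:
  assumes ito: "ito_integral M F B H Z"
  obtains S h where "approx S h H (Z 1)"
proof -
  obtain S h where a: "approx S h (\<lambda>s \<omega>. indicator {0<..1} s *\<^sub>R H s \<omega>) (Z 1)"
    using ito_approx_0[OF ito, of 1] by auto
  have jH: "joint H"
    using ito unfolding ito_integral_def joint_def measurable_cong_sets[OF sets_pair_measure_cong[OF sets_unit_lborel refl] refl] by blast
  have "approx S h H (Z 1)"
  proof (rule approx_cong[OF a jH approxD(2)[OF a]])
    show "AE \<omega> in M. AE s in unit_lborel. indicator {0<..1} s *\<^sub>R H s \<omega> = H s \<omega>"
    proof (rule AE_I2)
      show "AE s in unit_lborel. indicator {0<..1} s *\<^sub>R H s \<omega> = H s \<omega>" for \<omega>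
        using AE_unit_pos by eventually_elim auto
    qed
  qed simp
  then show ?thesis by (rule that)
qed

text \<open>The real conditional expectation is the first claim of the theorem. The nonnegative one
  allows the factor \<open>exp (sq H \<omega> / 2)\<close>, which may fail to be integrable, to be
  taken out of the conditional expectation later.\<close>

lemma cond_exp_dexp:
  assumes ito: "ito_integral M F B (\<lambda>s \<omega>. R s \<omega> *v u s \<omega>) I"
    and E: "(\<integral>\<omega>. dexp (I 1) (\<lambda>s \<omega>. R s \<omega> *v u s \<omega>) \<omega> \<partial>M) = 1"
  shows "AE \<omega> in M. real_cond_exp M G (dexp (I 1) (\<lambda>s \<omega>. R s \<omega> *v u s \<omega>)) \<omega> = 1"
    and "AE \<omega> in M. nn_cond_exp M G (\<lambda>\<omega>. ennreal (dexp (I 1) (\<lambda>s \<omega>. R s \<omega> *v u s \<omega>) \<omega>)) \<omega> = 1"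
proof -
  let ?H = "\<lambda>s \<omega>. R s \<omega> *v u s \<omega>"
  obtain S h where a: "approx S h ?H (I 1)" using ito_terminal[OF ito] by blast
  note Li = approx_dexp_integrable(1)[OF a]
  have inv: "(\<integral>\<omega>. dexp (I 1) ?H \<omega> * indicator A \<omega> \<partial>M) = prob A" if "A \<in> sets G" for A
    by (rule dexp_invariance[OF a E kernel_R that])
  show "AE \<omega> in M. real_cond_exp M G (dexp (I 1) ?H) \<omega> = 1"
  proof (rule sG.real_cond_exp_charact[OF _ Li])
    fix A assume A: "A \<in> sets G"
    then have "A \<in> events" using sets_G_M by auto
    then show "(\<integral>\<omega>\<in>A. dexp (I 1) ?H \<omega> \<partial>M) = (\<integral>\<omega>\<in>A. 1 \<partial>M)"
      using inv[OF A] by (simp add: set_lebesgue_integral_def mult.commute)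
  qed auto
  have "AE \<omega> in M. 1 = nn_cond_exp M G (\<lambda>\<omega>. ennreal (dexp (I 1) ?H \<omega>)) \<omega>"
  proof (rule sG.nn_cond_exp_charact)
    fix A assume A: "A \<in> sets G"
    then have AM: "A \<in> events" using sets_G_M by auto
    have "(\<integral>\<^sup>+\<omega>\<in>A. ennreal (dexp (I 1) ?H \<omega>) \<partial>M) = emeasure (girsanov (I 1) ?H) A"
      unfolding girsanov_def using Li AM by (subst emeasure_density) auto
    also have "\<dots> = emeasure M A"
      using girsanov_measure[OF a AM] inv[OF A] by (simp add: emeasure_eq_measure)
    finally show "(\<integral>\<^sup>+\<omega>\<in>A. ennreal (dexp (I 1) ?H \<omega>) \<partial>M) = (\<integral>\<^sup>+\<omega>\<in>A. 1 \<partial>M)"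
      using AM by simp
  qed (use Li in auto)
  then show "AE \<omega> in M. nn_cond_exp M G (\<lambda>\<omega>. ennreal (dexp (I 1) ?H \<omega>)) \<omega> = 1"
    by eventually_elim simp
qed

text \<open>\<open>cm_measurable\<close> concerns the path of \<open>u\<close>, while the variance
  is formed from the density. The jointly measurable density recovered from the path equals
  \<open>u\<close> almost everywhere, so after applying \<open>R\<close> it has the same integral
  and almost surely the same square norm.\<close>

lemma measurable_integrand:
  assumes L2: "L2_adapted M F u" and ito: "ito_integral M F B (\<lambda>s \<omega>. R s \<omega> *v u s \<omega>) I"
    and cm: "cm_measurable M G u"
  obtains H S h where "approx S h H (I 1)" "kernel H" "jointG H" "AE \<omega> in M. sq (\<lambda>s \<omega>. R s \<omega> *v u s \<omega>) \<omega> = sq H \<omega>"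
proof -
  have ju: "joint u"
    using L2 unfolding L2_adapted_def joint_def measurable_cong_sets[OF sets_pair_measure_cong[OF sets_unit_lborel refl] refl] by blast
  have "AE \<omega> in M. integrable unit_lborel (\<lambda>s. u s \<omega>)"
  proof -
    have fin: "(\<integral>\<^sup>+\<omega>. sq_dist u (\<lambda>_ _. 0) \<omega> \<partial>M) < \<infinity>"
      using L2 unfolding L2_adapted_def nn_integral_unit by (simp add: sq_dist_def)
    have "sq_dist u (\<lambda>_ _. 0) \<in> borel_measurable M"
      by (rule sq_dist_measurable[OF ju]) (simp add: joint_def)
    then have "AE \<omega> in M. sq_dist u (\<lambda>_ _. 0) \<omega> \<noteq> \<infinity>"
      using fin by (intro nn_integral_PInf_AE) auto
    then show ?thesis
      using AE_space
    proof eventually_elim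
      case (elim \<omega>)
      note m = joint_section[OF ju elim(2)]
      have "integrable unit_lborel (\<lambda>s. (norm (u s \<omega>))\<^sup>2)"
        using elim(1) m by (intro integrableI_nonneg) (auto simp: sq_dist_def less_top)
      then show ?case by (rule sq_integrable_imp[OF m])
    qed
  qed
  from cm_measurable_density[OF cm this] obtain uG where uG: "jointG uG" "AE \<omega> in M. AE s in unit_lborel. u s \<omega> = uG s \<omega>" by blast
  let ?H = "\<lambda>s \<omega>. R s \<omega> *v uG s \<omega>" and ?K = "\<lambda>s \<omega>. R s \<omega> *v u s \<omega>"
  have jG: "jointG ?H" by (rule jointG_R[OF uG(1)])
  have eq: "AE \<omega> in M. AE s in unit_lborel. ?K s \<omega> = ?H s \<omega>"
    using uG(2) by eventually_elim (auto elim!: eventually_mono)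
  obtain S h where a: "approx S h ?K (I 1)" using ito_terminal[OF ito] by blast
  have a': "approx S h ?H (I 1)"
    by (rule approx_cong[OF a jointG_joint[OF jG] approxD(2)[OF a] eq]) simp
  have "AE \<omega> in M. sq ?K \<omega> = sq ?H \<omega>"
    using eq AE_space
  proof eventually_elim
    case (elim \<omega>)
    show ?case
      unfolding cm_norm_sq_eq
    proof (rule integral_cong_AE)
      show "(\<lambda>s. (norm (?K s \<omega>))\<^sup>2) \<in> borel_measurable unit_lborel"
        using joint_section[OF approxD(1)[OF a] elim(2)] by measurable
      show "(\<lambda>s. (norm (?H s \<omega>))\<^sup>2) \<in> borel_measurable unit_lborel"
        using joint_section[OF approxD(1)[OF a'] elim(2)] by measurable
      show "AE s in unit_lborel. (norm (?K s \<omega>))\<^sup>2 = (norm (?H s \<omega>))\<^sup>2"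
        using elim(1) by eventually_elim simp
    qed
  qed
  then show ?thesis by (rule that[OF a' kernel_R jG])
qed

text \<open>Almost surely, \<open>exp (I 1 \<omega>)\<close> is the exponential with conditional
  mean 1 times \<open>exp (sq H \<omega> / 2)\<close>, and the latter is measurable for
  \<open>G\<close>.\<close>

lemma conditional_exponential:
  assumes L2: "L2_adapted M F u" and ito: "ito_integral M F B (\<lambda>s \<omega>. R s \<omega> *v u s \<omega>) I"
    and E: "(\<integral>\<omega>. dexp (I 1) (\<lambda>s \<omega>. R s \<omega> *v u s \<omega>) \<omega> \<partial>M) = 1" and cm: "cm_measurable M G u"
  shows "AE \<omega> in M. nn_cond_exp M G (\<lambda>\<omega>. ennreal (exp (I 1 \<omega>))) \<omega> = ennreal (exp (sq (\<lambda>s \<omega>. R s \<omega> *v u s \<omega>) \<omega> / 2))"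
    and "cond_gaussian M G (I 1) (\<lambda>_. 0) (sq (\<lambda>s \<omega>. R s \<omega> *v u s \<omega>))"
proof -
  let ?K = "\<lambda>s \<omega>. R s \<omega> *v u s \<omega>"
  obtain H S h where a: "approx S h H (I 1)" and ker: "kernel H" and jG: "jointG H" and eq: "AE \<omega> in M. sq ?K \<omega> = sq H \<omega>"
    using measurable_integrand[OF L2 ito cm] by blast
  have vG: "sq H \<in> borel_measurable G" by (rule jointG_sq[OF jG])
  show "cond_gaussian M G (I 1) (\<lambda>_. 0) (sq ?K)"
    by (rule cond_gaussianI[OF approxD(2)[OF a] vG _ conditional_char[OF a ker jG] eq]) simp
  obtain S0 h0 where a0: "approx S0 h0 ?K (I 1)" using ito_terminal[OF ito] by blast
  let ?L = "\<lambda>\<omega>. ennreal (dexp (I 1) ?K \<omega>)" and ?e = "\<lambda>\<omega>. ennreal (exp (sq H \<omega> / 2))"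
  have Lm: "?L \<in> borel_measurable M" using approx_dexp_integrable(1)[OF a0] by auto
  have eG: "?e \<in> borel_measurable G" using vG by measurable
  have "AE \<omega> in M. ?e \<omega> * nn_cond_exp M G ?L \<omega> = nn_cond_exp M G (\<lambda>\<omega>. ?e \<omega> * ?L \<omega>) \<omega>"
    by (rule sG.nn_cond_exp_prod[OF eG Lm])
  moreover have "AE \<omega> in M. nn_cond_exp M G (\<lambda>\<omega>. ?e \<omega> * ?L \<omega>) \<omega> = nn_cond_exp M G (\<lambda>\<omega>. ennreal (exp (I 1 \<omega>))) \<omega>"
  proof (rule sG.nn_cond_exp_cong)
    show "AE \<omega> in M. ?e \<omega> * ?L \<omega> = ennreal (exp (I 1 \<omega>))"
      using eq by eventually_elim (simp add: dexp_def ennreal_mult[symmetric] mult_exp_exp)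
    show "(\<lambda>\<omega>. ?e \<omega> * ?L \<omega>) \<in> borel_measurable M" using G_M[OF eG] Lm by measurable
    show "(\<lambda>\<omega>. ennreal (exp (I 1 \<omega>))) \<in> borel_measurable M" using approxD(2)[OF a] by measurable
  qed
  ultimately show "AE \<omega> in M. nn_cond_exp M G (\<lambda>\<omega>. ennreal (exp (I 1 \<omega>))) \<omega> = ennreal (exp (sq ?K \<omega> / 2))"
    using eq cond_exp_dexp(2)[OF ito E] by eventually_elim simp
qed

end

section \<open>Sums and adaptedness of stochastic integrals\<close>

context brownian begin

lemma approx_sum:
  assumes "finite T" "\<And>i. i \<in> T \<Longrightarrow> \<exists>S h. approx S h (H i) (I i)"
  shows "\<exists>S h. approx S h (\<lambda>s \<omega>. \<Sum>i\<in>T. H i s \<omega>) (\<lambda>\<omega>. \<Sum>i\<in>T. I i \<omega>)"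
  using assms
proof (induction T rule: finite_induct)
  case empty
  have st: "step {} (\<lambda>_ _. 0)" by (rule stepI[where K=0]) auto
  obtain m g where g: "grid m g" "{} \<subseteq> g ` {..m}" using grid_exists[of "{}"] by auto
  have "step_int {} (\<lambda>_ _. 0) = (\<lambda>_. 0)"
    using step_int_eq[OF st g] by (simp add: grid_int_def fun_eq_iff)
  then show ?case using approx_const[OF st] by auto
next
  case (insert i T)
  obtain S h where 1: "approx S h (H i) (I i)" using insert.prems by blast
  obtain S' h' where 2: "approx S' h' (\<lambda>s \<omega>. \<Sum>i\<in>T. H i s \<omega>) (\<lambda>\<omega>. \<Sum>i\<in>T. I i \<omega>)" using insert by blast
  show ?case using approx_lin[OF 1 2, of 1 1] insert.hyps by auto
qed

lemma ito_adapted: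
  assumes ito: "ito_integral M F B H Z" and t: "t \<in> {0..1}"
  shows "Z t \<in> borel_measurable (F t)"
proof -
  have Z: "Z t \<in> borel_measurable M" using ito t by (simp add: ito_integral_def)
  obtain k \<tau> \<xi> where s: "\<And>n. simple_process M F (k n) (\<tau> n) (\<xi> n)"
    and i: "null_in_prob M (\<lambda>n \<omega>. ennreal \<bar>simple_integral B (k n) (\<tau> n) (\<xi> n) t \<omega> - Z t \<omega>\<bar>)"
    using ito t unfolding ito_integral_def by blast
  have m: "(\<lambda>\<omega>. ennreal \<bar>simple_integral B (k n) (\<tau> n) (\<xi> n) t \<omega> - Z t \<omega>\<bar>) \<in> borel_measurable M" for n
    using simple_integral_measurable[OF s t, of n] Z by measurable
  obtain r where r: "AE \<omega> in M. (\<lambda>n. ennreal \<bar>simple_integral B (k (r n)) (\<tau> (r n)) (\<xi> (r n)) t \<omega> - Z t \<omega>\<bar>) \<longlonglongrightarrow> 0"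
    using null_in_prob_subseq[OF m i] by blast
  show ?thesis
  proof (rule F_AE_lim[where g="\<lambda>n. simple_integral B (k (r n)) (\<tau> (r n)) (\<xi> (r n)) t", OF Z])
    show "AE \<omega> in M. (\<lambda>n. simple_integral B (k (r n)) (\<tau> (r n)) (\<xi> (r n)) t \<omega>) \<longlonglongrightarrow> Z t \<omega>"
      using r
    proof eventually_elim
      case (elim \<omega>)
      have "(\<lambda>n. \<bar>simple_integral B (k (r n)) (\<tau> (r n)) (\<xi> (r n)) t \<omega> - Z t \<omega>\<bar>) \<longlonglongrightarrow> 0"
        using elim unfolding ennreal_0[symmetric] by (subst (asm) tendsto_ennreal_iff) auto
      then show ?case by (intro LIM_zero_cancel[where l="Z t \<omega>"]) (rule tendsto_rabs_zero_cancel)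
    qed
    fix n
    let ?n = "r n"
    have "(\<lambda>\<omega>. \<xi> ?n i \<omega> \<bullet> (B (min (\<tau> ?n (Suc i)) t) \<omega> - B (min (\<tau> ?n i) t) \<omega>)) \<in> borel_measurable (F t)" if i: "i < k ?n" for i
    proof -
      have sp: "0 \<le> \<tau> ?n i" "\<tau> ?n i \<le> \<tau> ?n (Suc i)" "\<xi> ?n i \<in> borel_measurable (F (\<tau> ?n i))"
        using s[of ?n] i unfolding simple_process_def by auto
      show ?thesis
      \<comment> \<open>If \<open>\<tau> ?n i\<close> exceeds \<open>t\<close>, both stopped times
        equal \<open>t\<close> and the summand vanishes, so values of \<open>\<xi>\<close> from
        later times do not enter.\<close>
      proof (cases "\<tau> ?n i \<le> t")
        case True
        have "B (min (\<tau> ?n (Suc i)) t) \<in> borel_measurable (F t)" "B (min (\<tau> ?n i) t) \<in> borel_measurable (F t)"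
          using sp(1,2) t by (auto intro!: F_mono[OF B_F])
        then show ?thesis using F_mono[OF sp(3) True]
          by (intro borel_measurable_inner borel_measurable_diff)
      qed (use sp in simp)
    qed
    then show "simple_integral B (k ?n) (\<tau> ?n) (\<xi> ?n) t \<in> borel_measurable (F t)"
      unfolding simple_integral_def[abs_def] by (intro borel_measurable_sum) auto
  qed
qed

end

section \<open>The martingale of the complementary noise\<close>

locale noise = projected_solution M F B X x \<beta> \<sigma> P
  for M :: "'a measure" and F and B :: "real \<Rightarrow> 'a \<Rightarrow> real^'d" and X :: "real \<Rightarrow> 'a \<Rightarrow> real^'n" and x \<beta> \<sigma> P +
  fixes N :: "real \<Rightarrow> 'a \<Rightarrow> real^'d"
  assumes N: "ito_integral_matrix M F B (coprojection P X) N"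
begin

lemma N_F: "t \<in> {0..1} \<Longrightarrow> N t \<in> borel_measurable (F t)"
proof -
  assume t: "t \<in> {0..1}"
  have "(\<lambda>\<omega>. N t \<omega> \<bullet> c) \<in> borel_measurable (F t)" if cB: "c \<in> Basis" for c
  proof -
    obtain i where "c = axis i 1" using cB by (auto simp: Basis_vec_def)
    then show ?thesis
      using ito_adapted[of _ "\<lambda>t \<omega>. N t \<omega> $ i", OF _ t] N by (auto simp: ito_integral_matrix_def inner_axis)
  qed
  then show ?thesis by (simp add: borel_measurable_euclidean_space[of "N t"])
qed

lemma N_M [measurable]: "t \<in> {0..1} \<Longrightarrow> N t \<in> borel_measurable M"
  using N_F F_M by blast

text \<open>The deterministic integrand for which \<open>R s \<omega> *v combination k t c s\<close>
  has the stochastic integral \<open>\<Sum>j<k. c j \<bullet> N (t j) \<omega>\<close>.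
  Finite-dimensional laws of \<open>N\<close> are thereby laws of single integrals.\<close>

definition combination :: "nat \<Rightarrow> (nat \<Rightarrow> real) \<Rightarrow> (nat \<Rightarrow> real^'d) \<Rightarrow> real \<Rightarrow> real^'d" where
  "combination k t c s = (\<Sum>j<k. indicator {0<..t j} s *\<^sub>R c j)"

text \<open>The integrand is deterministic before the projection, and \<open>R\<close> is a function
  of time and of the path of \<open>X\<close>.\<close>

lemma combination_jointG: "jointG (\<lambda>s \<omega>. R s \<omega> *v combination k t c s)"
proof (rule jointG_R)
  have "combination k t c \<in> borel_measurable unit_lborel"
    unfolding combination_def by (intro borel_measurable_sum borel_measurable_scaleR ind_meas_unit borel_measurable_const) auto
  from measurable_compose[OF measurable_fst this]
  show "jointG (\<lambda>s \<omega>. combination k t c s)" by (simp add: jointG_def split_beta')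
qed

lemma combination_bounded: "AE \<omega> in M. AE s in unit_lborel. norm (R s \<omega> *v combination k t c s) \<le> (\<Sum>j<k. norm (c j))"
  using proj_AE
proof eventually_elim
  case (elim \<omega>)
  then show ?case
  proof eventually_elim
    case (elim s)
    have "norm (R s \<omega> *v combination k t c s) \<le> norm (combination k t c s)"
      unfolding coprojection_def by (rule coprojection_norm_le[OF elim])
    also have "\<dots> \<le> (\<Sum>j<k. norm (c j))"
      unfolding combination_def by (intro order_trans[OF norm_sum] sum_mono) (auto simp: indicator_def)
    finally show ?case .
  qed
qed

text \<open>The rows of \<open>R\<close> combine to \<open>R\<^sup>T c\<close>, which equals \<open>R c\<close> since orthogonal projections are symmetric.\<close>

lemma combination_approx:
  assumes t: "\<And>j. j < k \<Longrightarrow> t j \<in> {0..1}"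
  shows "\<exists>S h. approx S h (\<lambda>s \<omega>. R s \<omega> *v combination k t c s) (\<lambda>\<omega>. \<Sum>j<k. c j \<bullet> N (t j) \<omega>)"
proof -
  let ?H = "\<lambda>j i s \<omega>. (c j $ i) *\<^sub>R (indicator {0<..t j} s *\<^sub>R R s \<omega> $ i)"
  have 1: "\<exists>S h. approx S h (?H j i) (\<lambda>\<omega>. c j $ i * N (t j) \<omega> $ i)" if j: "j < k" for j i
  proof -
    have "ito_integral M F B (\<lambda>s \<omega>. R s \<omega> $ i) (\<lambda>t \<omega>. N t \<omega> $ i)" using N by (simp add: ito_integral_matrix_def)
    from ito_approx_0[OF this, of "t j"] t[OF j]
    obtain S h where "approx S h (\<lambda>s \<omega>. indicator {0<..t j} s *\<^sub>R R s \<omega> $ i) (\<lambda>\<omega>. N (t j) \<omega> $ i)" by auto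
    from approx_scale[OF this, of "c j $ i"] show ?thesis by blast
  qed
  have 2: "\<exists>S h. approx S h (\<lambda>s \<omega>. \<Sum>i\<in>UNIV. ?H j i s \<omega>) (\<lambda>\<omega>. \<Sum>i\<in>UNIV. c j $ i * N (t j) \<omega> $ i)" if "j < k" for j
    by (rule approx_sum[OF _ 1[OF that]]) simp
  have "\<exists>S h. approx S h (\<lambda>s \<omega>. \<Sum>j<k. \<Sum>i\<in>UNIV. ?H j i s \<omega>) (\<lambda>\<omega>. \<Sum>j<k. \<Sum>i\<in>UNIV. c j $ i * N (t j) \<omega> $ i)"
    by (rule approx_sum) (use 2 in auto)
  then obtain S h where a: "approx S h (\<lambda>s \<omega>. \<Sum>j<k. \<Sum>i\<in>UNIV. ?H j i s \<omega>) (\<lambda>\<omega>. \<Sum>j<k. \<Sum>i\<in>UNIV. c j $ i * N (t j) \<omega> $ i)"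
    by blast
  have row: "(\<Sum>i\<in>UNIV. (v $ i) *\<^sub>R (A $ i)) = transpose A *v v" for A :: "real^'d^'d" and v
    by (simp add: vec_eq_iff vector_matrix_mult_def mult.commute)
  have "(\<Sum>j<k. \<Sum>i\<in>UNIV. ?H j i s \<omega>) = transpose (R s \<omega>) *v combination k t c s" for s \<omega>
  proof -
    have "(\<Sum>i\<in>UNIV. ?H j i s \<omega>) = indicator {0<..t j} s *\<^sub>R (transpose (R s \<omega>) *v c j)" for j
      unfolding row[symmetric] scaleR_sum_right by (intro sum.cong refl) (simp add: mult.commute)
    then show ?thesis
      unfolding combination_def by (simp only: matrix_vector_mult_scaleR[symmetric] linear_sum[OF matrix_vector_mul_linear])
  qed
  then have a': "approx S h (\<lambda>s \<omega>. transpose (R s \<omega>) *v combination k t c s) (\<lambda>\<omega>. \<Sum>j<k. c j \<bullet> N (t j) \<omega>)"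
    using a by (simp only: inner_vec_def inner_real_def)
  have "approx S h (\<lambda>s \<omega>. R s \<omega> *v combination k t c s) (\<lambda>\<omega>. \<Sum>j<k. c j \<bullet> N (t j) \<omega>)"
  proof (rule approx_cong[OF a' jointG_joint[OF combination_jointG] approxD(2)[OF a']])
    show "AE \<omega> in M. AE s in unit_lborel. transpose (R s \<omega>) *v combination k t c s = R s \<omega> *v combination k t c s"
      using proj_AE
    proof eventually_elim
      case (elim \<omega>)
      then show ?case
      proof eventually_elim
        case (elim s)
        have "transpose (mat 1 - P s (path_of X \<omega>)) = transpose (mat 1) - transpose (P s (path_of X \<omega>))"
          by (simp add: transpose_def vec_eq_iff)
        then have "transpose (R s \<omega>) = R s \<omega>"
          using orthogonal_projection_symmetric[OF elim] by (simp add: coprojection_def transpose_mat)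
        then show ?case by metis
      qed
    qed
  qed simp
  then show ?thesis by blast
qed

lemma gaussian_process: "cond_gaussian_process M G N"
  unfolding cond_gaussian_process_def
proof (intro allI impI)
  fix k :: nat and t :: "nat \<Rightarrow> real" and c :: "nat \<Rightarrow> real^'d"
  assume t: "\<forall>j<k. t j \<in> {0..1}"
  let ?H = "\<lambda>s \<omega>. R s \<omega> *v combination k t c s"
  obtain S h where a: "approx S h ?H (\<lambda>\<omega>. \<Sum>j<k. c j \<bullet> N (t j) \<omega>)" using combination_approx t by blast
  have v: "sq ?H \<in> borel_measurable G" by (rule jointG_sq[OF combination_jointG])
  have "cond_gaussian M G (\<lambda>\<omega>. \<Sum>j<k. c j \<bullet> N (t j) \<omega>) (\<lambda>_. 0) (sq ?H)"
    by (rule cond_gaussianI[OF approxD(2)[OF a] v _ conditional_char[OF a kernel_R combination_jointG]]) auto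
  then show "\<exists>m\<in>borel_measurable G. \<exists>v\<in>borel_measurable G. cond_gaussian M G (\<lambda>\<omega>. \<Sum>j<k. c j \<bullet> N (t j) \<omega>) m v"
    using v by (intro bexI[of _ "\<lambda>_. 0"] bexI[of _ "sq ?H"]) auto
qed

section \<open>Increments of the noise and their conditional independence\<close>

text \<open>For \<open>0 \<le> a\<close> and \<open>a \<le> b\<close> this is \<open>c\<close> on
  \<open>{a<..b}\<close> and 0 elsewhere, written as a combination so that the results above
  apply.\<close>

definition increment_comb :: "real \<Rightarrow> real \<Rightarrow> real^'d \<Rightarrow> real \<Rightarrow> real^'d" where
  "increment_comb a b c = combination 2 (\<lambda>j. if j = 0 then b else a) (\<lambda>j. if j = 0 then c else - c)"

definition increment_var :: "real \<Rightarrow> real \<Rightarrow> real^'d \<Rightarrow> 'a \<Rightarrow> real" where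
  "increment_var a b c = sq (\<lambda>s \<omega>. R s \<omega> *v increment_comb a b c s)"

lemma increment_var_measurable: "increment_var a b c \<in> borel_measurable G"
  unfolding increment_var_def increment_comb_def by (rule jointG_sq[OF combination_jointG])

lemma increment_var_nonneg [simp]: "0 \<le> increment_var a b c \<omega>"
  by (simp add: increment_var_def)

lemma increment_char:
  assumes ab: "0 \<le> a" "a \<le> b" "b \<le> 1" and A: "A \<in> sets (F a)" and D: "D \<in> sets G"
  shows "(\<integral>\<omega>. of_real (indicator A \<omega> * indicator D \<omega>) * cis (l * (c \<bullet> (N b \<omega> - N a \<omega>))) \<partial>M) =
    (\<integral>\<omega>. of_real (indicator A \<omega> * indicator D \<omega> * exp (- (l\<^sup>2 * increment_var a b c \<omega> / 2))) \<partial>M)"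
    and "integrable M (\<lambda>\<omega>. exp (r * (c \<bullet> (N b \<omega> - N a \<omega>))))"
proof -
  let ?t = "\<lambda>j::nat. if j = 0 then b else a" and ?c = "\<lambda>j::nat. if j = 0 then c else - c"
  have t: "?t j \<in> {0..1}" for j using ab by auto
  let ?H = "\<lambda>s \<omega>. R s \<omega> *v increment_comb a b c s"
  have eq: "(\<Sum>j<2. ?c j \<bullet> N (?t j) \<omega>) = c \<bullet> (N b \<omega> - N a \<omega>)" for \<omega>
    by (simp add: numeral_2_eq_2 inner_diff_right)
  from combination_approx[of 2 ?t ?c, OF t] obtain S h where a: "approx S h ?H (\<lambda>\<omega>. c \<bullet> (N b \<omega> - N a \<omega>))"
    unfolding eq increment_comb_def by blast
  have z: "increment_comb a b c s = 0" if "s \<le> a" for s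
    using that ab by (auto simp: increment_comb_def combination_def numeral_2_eq_2 indicator_def)
  note cb = conditional_char_bounded[OF a sum_nonneg combination_bounded[of 2 ?t ?c, folded increment_comb_def] kernel_R
    increment_var_measurable _ ab(1) order_trans[OF ab(2,3)] A _ D]
  show "(\<integral>\<omega>. of_real (indicator A \<omega> * indicator D \<omega>) * cis (l * (c \<bullet> (N b \<omega> - N a \<omega>))) \<partial>M) =
    (\<integral>\<omega>. of_real (indicator A \<omega> * indicator D \<omega> * exp (- (l\<^sup>2 * increment_var a b c \<omega> / 2))) \<partial>M)"
    by (rule cb(1)) (auto simp: increment_var_def z)
  show "integrable M (\<lambda>\<omega>. exp (r * (c \<bullet> (N b \<omega> - N a \<omega>))))"
    by (rule cb(2)) (auto simp: increment_var_def z)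
qed

lemma increment_integrable:
  assumes ab: "0 \<le> a" "a \<le> b" "b \<le> 1"
  shows "integrable M (\<lambda>\<omega>. c \<bullet> (N b \<omega> - N a \<omega>))"
proof (rule Bochner_Integration.integrable_bound)
  have [measurable]: "N a \<in> borel_measurable M" "N b \<in> borel_measurable M" using ab by (auto intro!: N_M)
  show "(\<lambda>\<omega>. c \<bullet> (N b \<omega> - N a \<omega>)) \<in> borel_measurable M" by measurable
  show "integrable M (\<lambda>\<omega>. exp (1 * (c \<bullet> (N b \<omega> - N a \<omega>))) + exp (- 1 * (c \<bullet> (N b \<omega> - N a \<omega>))))"
    by (intro Bochner_Integration.integrable_add increment_char(2)[OF ab sets.empty_sets sets.empty_sets])
  have "\<bar>y\<bar> \<le> exp y + exp (- y)" for y :: real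
    using exp_ge_add_one_self[of y] exp_ge_add_one_self[of "- y"] exp_gt_zero[of y] exp_gt_zero[of "- y"] by linarith
  then have "\<bar>y\<bar> \<le> exp (1 * y) + exp (- 1 * y)" for y :: real by simp
  then show "AE \<omega> in M. norm (c \<bullet> (N b \<omega> - N a \<omega>)) \<le> norm (exp (1 * (c \<bullet> (N b \<omega> - N a \<omega>))) + exp (- 1 * (c \<bullet> (N b \<omega> - N a \<omega>))))"
    by (intro AE_I2) (simp add: abs_of_nonneg)
qed

text \<open>The conditional law of an increment, also given the past, is symmetric.\<close>

lemma increment_mean_zero:
  assumes ab: "0 \<le> a" "a \<le> b" "b \<le> 1" and A: "A \<in> sets (F a)" and D: "D \<in> sets G"
  shows "(\<integral>\<omega>. indicator A \<omega> * indicator D \<omega> * (c \<bullet> (N b \<omega> - N a \<omega>)) \<partial>M) = 0"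
proof -
  have [measurable]: "A \<in> events" "D \<in> events" using A D sets_F_subset sets_G_M by auto
  have [measurable]: "N a \<in> borel_measurable M" "N b \<in> borel_measurable M" using ab by (auto intro!: N_M)
  let ?w = "\<lambda>\<omega>. indicator A \<omega> * indicator D \<omega> :: real" and ?Y = "\<lambda>\<omega>. c \<bullet> (N b \<omega> - N a \<omega>)"
  have "(\<integral>\<omega>. ?w \<omega> * ?Y \<omega> \<partial>M) = (\<integral>\<omega>. ?w \<omega> * (- ?Y \<omega>) \<partial>M)"
  proof (rule integral_eqI_char[where f="\<lambda>y. y"])
    show "integrable M ?w" by (rule integrable_const_bound[where B=1]) (auto simp: indicator_def)
    show "integrable M ?w" by (rule integrable_const_bound[where B=1]) (auto simp: indicator_def)
    fix l :: real
    have "(\<integral>\<omega>. of_real (?w \<omega>) * cis (l * ?Y \<omega>) \<partial>M) = (\<integral>\<omega>. of_real (?w \<omega>) * cis (- l * ?Y \<omega>) \<partial>M)"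
      unfolding increment_char(1)[OF ab A D] by simp
    then show "(\<integral>\<omega>. of_real (?w \<omega>) * cis (l \<bullet> ?Y \<omega>) \<partial>M) = (\<integral>\<omega>. of_real (?w \<omega>) * cis (l \<bullet> (- ?Y \<omega>)) \<partial>M)"
      by simp
  qed auto
  then show ?thesis by simp
qed

lemma bounded_integrable:
  fixes f :: "'a \<Rightarrow> real"
  assumes "f \<in> borel_measurable M" "\<And>\<omega>. \<bar>f \<omega>\<bar> \<le> 1"
  shows "integrable M f"
  by (rule integrable_const_bound[where B=1]) (use assms in auto)

text \<open>Real and imaginary part of the conditional characteristic function, with
  \<open>A\<close> the whole space; its value is real, so the sine has conditional mean
  zero.\<close>

lemma increment_cond_exp:
  assumes ab: "0 \<le> a" "a \<le> b" "b \<le> 1"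
  shows "AE \<omega> in M. real_cond_exp M G (\<lambda>\<omega>. cos (c \<bullet> (N b \<omega> - N a \<omega>))) \<omega> = exp (- (increment_var a b c \<omega> / 2))"
    and "AE \<omega> in M. real_cond_exp M G (\<lambda>\<omega>. sin (c \<bullet> (N b \<omega> - N a \<omega>))) \<omega> = 0"
proof -
  have [measurable]: "N a \<in> borel_measurable M" "N b \<in> borel_measurable M" using ab by (auto intro!: N_M)
  let ?Y = "\<lambda>\<omega>. c \<bullet> (N b \<omega> - N a \<omega>)" and ?e = "\<lambda>\<omega>. exp (- (increment_var a b c \<omega> / 2))"
  have eG: "?e \<in> borel_measurable G" using increment_var_measurable[of a b c] by measurable
  have ei: "integrable M ?e" by (rule bounded_integrable[OF G_M[OF eG]]) simp
  have "(\<integral>\<omega>\<in>D. cos (?Y \<omega>) \<partial>M) = (\<integral>\<omega>\<in>D. ?e \<omega> \<partial>M) \<and> (\<integral>\<omega>\<in>D. sin (?Y \<omega>) \<partial>M) = (\<integral>\<omega>\<in>D. 0 \<partial>M)"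
    if D: "D \<in> sets G" for D
  proof -
    have [measurable]: "D \<in> events" using D sets_G_M by auto
    have sp: "space M \<in> sets (F a)" using sets.top[of "F a"] by simp
    have i: "integrable M (\<lambda>\<omega>. of_real (indicator D \<omega>) * cis (?Y \<omega>))"
      by (rule integrable_mult_cis[OF bounded_integrable]) (auto simp: indicator_def)
    have "(\<integral>\<omega>. of_real (indicator (space M) \<omega> * indicator D \<omega>) * cis (1 * ?Y \<omega>) \<partial>M) = (\<integral>\<omega>. of_real (indicator D \<omega>) * cis (?Y \<omega>) \<partial>M)"
      by (intro Bochner_Integration.integral_cong) auto
    moreover have "(\<integral>\<omega>. of_real (indicator (space M) \<omega> * indicator D \<omega> * exp (- (1\<^sup>2 * increment_var a b c \<omega> / 2))) \<partial>M) =
        complex_of_real (\<integral>\<omega>. indicator D \<omega> * ?e \<omega> \<partial>M)"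
      unfolding integral_complex_of_real[symmetric] by (intro Bochner_Integration.integral_cong) auto
    ultimately have *: "(\<integral>\<omega>. of_real (indicator D \<omega>) * cis (?Y \<omega>) \<partial>M) = complex_of_real (\<integral>\<omega>. indicator D \<omega> * ?e \<omega> \<partial>M)"
      using increment_char(1)[OF ab sp D, of 1 c] by metis
    have "(\<integral>\<omega>. indicator D \<omega> * cos (?Y \<omega>) \<partial>M) = (\<integral>\<omega>. indicator D \<omega> * ?e \<omega> \<partial>M)"
      using integral_Re[OF i] unfolding * by simp
    moreover have "(\<integral>\<omega>. indicator D \<omega> * sin (?Y \<omega>) \<partial>M) = 0"
      using integral_Im[OF i] unfolding * by simp
    ultimately show ?thesis by (simp add: set_lebesgue_integral_def)
  qed
  note sets = this[THEN conjunct1] this[THEN conjunct2]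
  show "AE \<omega> in M. real_cond_exp M G (\<lambda>\<omega>. cos (?Y \<omega>)) \<omega> = ?e \<omega>"
  proof (rule sG.real_cond_exp_charact[OF _ _ ei eG])
    show "integrable M (\<lambda>\<omega>. cos (?Y \<omega>))" by (rule bounded_integrable) auto
  qed (rule sets(1))
  show "AE \<omega> in M. real_cond_exp M G (\<lambda>\<omega>. sin (?Y \<omega>)) \<omega> = 0"
  proof (rule sG.real_cond_exp_charact)
    show "integrable M (\<lambda>\<omega>. sin (?Y \<omega>))" by (rule bounded_integrable) auto
  qed (use sets(2) in auto)
qed

text \<open>Extends the formula from indicators of events in \<open>G\<close> to bounded weights
  measurable for \<open>G\<close>; the weight to come is a conditional probability given
  \<open>G\<close>.\<close>

lemma increment_char_weighted:
  assumes ab: "0 \<le> a" "a \<le> b" "b \<le> 1" and g: "g \<in> borel_measurable G" "\<And>\<omega>. \<bar>g \<omega>\<bar> \<le> 1"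
  shows "(\<integral>\<omega>. of_real (g \<omega>) * cis (c \<bullet> (N b \<omega> - N a \<omega>)) \<partial>M) = of_real (\<integral>\<omega>. g \<omega> * exp (- (increment_var a b c \<omega> / 2)) \<partial>M)"
proof -
  have [measurable]: "N a \<in> borel_measurable M" "N b \<in> borel_measurable M" using ab by (auto intro!: N_M)
  have gm [measurable]: "g \<in> borel_measurable M" by (rule G_M[OF g(1)])
  let ?Y = "\<lambda>\<omega>. c \<bullet> (N b \<omega> - N a \<omega>)"
  have i: "integrable M (\<lambda>\<omega>. of_real (g \<omega>) * cis (?Y \<omega>))"
    by (rule integrable_mult_cis[OF bounded_integrable[OF gm g(2)]]) measurable
  have b1: "\<bar>g \<omega> * z\<bar> \<le> 1" if "\<bar>z\<bar> \<le> 1" for \<omega> z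
    using g(2)[of \<omega>] that by (simp add: abs_mult mult_le_one)
  have "(\<integral>\<omega>. g \<omega> * cos (?Y \<omega>) \<partial>M) = (\<integral>\<omega>. g \<omega> * real_cond_exp M G (\<lambda>\<omega>. cos (?Y \<omega>)) \<omega> \<partial>M)"
    by (rule sG.real_cond_exp_intg(2)[symmetric]) (use g b1 in \<open>auto intro!: bounded_integrable\<close>)
  also have "\<dots> = (\<integral>\<omega>. g \<omega> * exp (- (increment_var a b c \<omega> / 2)) \<partial>M)"
    using increment_cond_exp(1)[OF ab, of c] G_M[OF increment_var_measurable[of a b c]]
    by (intro integral_cong_AE) (auto elim!: eventually_mono)
  finally have re: "(\<integral>\<omega>. g \<omega> * cos (?Y \<omega>) \<partial>M) = (\<integral>\<omega>. g \<omega> * exp (- (increment_var a b c \<omega> / 2)) \<partial>M)" .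
  have "(\<integral>\<omega>. g \<omega> * sin (?Y \<omega>) \<partial>M) = (\<integral>\<omega>. g \<omega> * real_cond_exp M G (\<lambda>\<omega>. sin (?Y \<omega>)) \<omega> \<partial>M)"
    by (rule sG.real_cond_exp_intg(2)[symmetric]) (use g b1 in \<open>auto intro!: bounded_integrable\<close>)
  also have "\<dots> = (\<integral>\<omega>. 0 \<partial>M)"
    using increment_cond_exp(2)[OF ab, of c] by (intro integral_cong_AE) (auto elim!: eventually_mono)
  finally have im: "(\<integral>\<omega>. g \<omega> * sin (?Y \<omega>) \<partial>M) = 0" by simp
  show ?thesis
    using integral_Re[OF i] integral_Im[OF i] re im by (simp add: complex_eq_iff)
qed

text \<open>On an event \<open>D\<close> of \<open>G\<close>, the indicator of \<open>A\<close> and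
  its conditional probability \<open>p\<close> are weights that give the increment the same Fourier
  transform, because the increment contributes only the factor \<open>?e\<close>, measurable for
  \<open>G\<close>. So \<open>A\<close> may be exchanged for \<open>p\<close> in integrals over
  \<open>D\<close>.\<close>

lemma increment_conditionally_independent:
  assumes ab: "0 \<le> a" "a \<le> b" "b \<le> 1" and A: "A \<in> sets (F a)" and C: "C \<in> sets borel"
  defines "E \<equiv> {\<omega> \<in> space M. N b \<omega> - N a \<omega> \<in> C}"
  shows "AE \<omega> in M. cond_prob_of M G (A \<inter> E) \<omega> = cond_prob_of M G A \<omega> * cond_prob_of M G E \<omega>"
proof -
  have AM [measurable]: "A \<in> events" using A sets_F_subset by auto
  have [measurable]: "N a \<in> borel_measurable M" "N b \<in> borel_measurable M" using ab by (auto intro!: N_M)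
  have EM [measurable]: "E \<in> events" unfolding E_def using C by measurable
  have iI: "integrable M (indicator S :: 'a \<Rightarrow> real)" if "S \<in> events" for S
    by (rule bounded_integrable) (use that in \<open>auto simp: indicator_def\<close>)
  \<comment> \<open>Clamping gives a version of the conditional probability with values in the unit
    interval everywhere, so that it can serve as a nonnegative bounded weight.\<close>
  define p where "p \<omega> = max 0 (min 1 (real_cond_exp M G (indicator A) \<omega>))" for \<omega>
  have pG [measurable]: "p \<in> borel_measurable G" unfolding p_def by measurable
  have p01: "0 \<le> p \<omega>" "p \<omega> \<le> 1" for \<omega> by (auto simp: p_def)
  have p: "AE \<omega> in M. real_cond_exp M G (indicator A) \<omega> = p \<omega>"
  proof -
    have "AE \<omega> in M. 0 \<le> real_cond_exp M G (indicator A) \<omega>"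
      by (rule sG.real_cond_exp_pos) auto
    moreover have "AE \<omega> in M. real_cond_exp M G (indicator A) \<omega> \<le> 1"
      by (rule sG.real_cond_exp_le_c[OF iI[OF AM]]) (auto simp: indicator_def)
    ultimately show ?thesis by eventually_elim (simp add: p_def)
  qed
  have pM [measurable]: "p \<in> borel_measurable M" by (rule G_M[OF pG])
  have key: "(\<integral>\<omega>. indicator A \<omega> * indicator D \<omega> * indicator C (N b \<omega> - N a \<omega>) \<partial>M) =
      (\<integral>\<omega>. p \<omega> * indicator D \<omega> * indicator C (N b \<omega> - N a \<omega>) \<partial>M)" if D: "D \<in> sets G" for D
  proof -
    have DM [measurable]: "D \<in> events" using D sets_G_M by auto
    have pD: "(\<lambda>\<omega>. p \<omega> * indicator D \<omega>) \<in> borel_measurable G" using D by measurable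
    have pDb: "\<bar>p \<omega> * indicator D \<omega>\<bar> \<le> 1" for \<omega> using p01[of \<omega>] by (simp add: indicator_def)
    show ?thesis
    proof (rule integral_eqI_char[where Y="\<lambda>\<omega>. N b \<omega> - N a \<omega>" and Y'="\<lambda>\<omega>. N b \<omega> - N a \<omega>" and f="indicator C"])
      show "integrable M (\<lambda>\<omega>. indicator A \<omega> * indicator D \<omega> :: real)"
        by (rule bounded_integrable) (auto simp: indicator_def)
      show "integrable M (\<lambda>\<omega>. p \<omega> * indicator D \<omega>)"
        by (rule bounded_integrable[OF G_M[OF pD] pDb])
      show "(indicator C :: real^'d \<Rightarrow> real) \<in> borel_measurable borel" using C by measurable
      fix c :: "real^'d"
      let ?e = "\<lambda>\<omega>. exp (- (increment_var a b c \<omega> / 2))"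
      have eG: "?e \<in> borel_measurable G" using increment_var_measurable[of a b c] by measurable
      have eb: "\<bar>?e \<omega>\<bar> \<le> 1" for \<omega> by simp
      have "(\<integral>\<omega>. of_real (indicator A \<omega> * indicator D \<omega>) * cis (c \<bullet> (N b \<omega> - N a \<omega>)) \<partial>M) =
          complex_of_real (\<integral>\<omega>. (indicator D \<omega> * ?e \<omega>) * indicator A \<omega> \<partial>M)"
        using increment_char(1)[OF ab A D, of 1 c] unfolding integral_complex_of_real[symmetric] by (simp add: mult_ac)
      also have "(\<integral>\<omega>. (indicator D \<omega> * ?e \<omega>) * indicator A \<omega> \<partial>M) = (\<integral>\<omega>. (indicator D \<omega> * ?e \<omega>) * real_cond_exp M G (indicator A) \<omega> \<partial>M)"
      proof (rule sG.real_cond_exp_intg(2)[symmetric])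
        show "(\<lambda>\<omega>. indicator D \<omega> * ?e \<omega>) \<in> borel_measurable G" using D eG by measurable
        show "integrable M (\<lambda>\<omega>. indicator D \<omega> * ?e \<omega> * indicator A \<omega>)"
          using G_M[OF eG] by (intro bounded_integrable) (auto simp: indicator_def)
      qed measurable
      also have "\<dots> = (\<integral>\<omega>. (p \<omega> * indicator D \<omega>) * ?e \<omega> \<partial>M)"
      proof (rule integral_cong_AE)
        show "AE \<omega> in M. indicator D \<omega> * ?e \<omega> * real_cond_exp M G (indicator A) \<omega> = p \<omega> * indicator D \<omega> * ?e \<omega>"
          using p by eventually_elim simp
      qed (use G_M[OF eG] in measurable)
      also have "complex_of_real \<dots> = (\<integral>\<omega>. of_real (p \<omega> * indicator D \<omega>) * cis (c \<bullet> (N b \<omega> - N a \<omega>)) \<partial>M)"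
        by (rule increment_char_weighted[OF ab pD pDb, symmetric])
      finally show "(\<integral>\<omega>. of_real (indicator A \<omega> * indicator D \<omega>) * cis (c \<bullet> (N b \<omega> - N a \<omega>)) \<partial>M) =
          (\<integral>\<omega>. of_real (p \<omega> * indicator D \<omega>) * cis (c \<bullet> (N b \<omega> - N a \<omega>)) \<partial>M)" .
    qed (use p01 in auto)
  qed
  have bE: "integrable M (\<lambda>\<omega>. p \<omega> * indicator E \<omega>)"
    by (rule bounded_integrable) (use p01 in \<open>auto simp: indicator_def\<close>)
  have "AE \<omega> in M. real_cond_exp M G (indicator (A \<inter> E)) \<omega> = p \<omega> * real_cond_exp M G (indicator E) \<omega>"
  proof (rule sG.real_cond_exp_charact)
    fix D assume D: "D \<in> sets G"
    then have DM [measurable]: "D \<in> events" using sets_G_M by auto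
    have iE: "indicator E \<omega> = (indicator C (N b \<omega> - N a \<omega>) :: real)" if "\<omega> \<in> space M" for \<omega>
      using that by (simp add: E_def indicator_def)
    have "(\<integral>\<omega>\<in>D. indicator (A \<inter> E) \<omega> \<partial>M) = (\<integral>\<omega>. indicator A \<omega> * indicator D \<omega> * indicator C (N b \<omega> - N a \<omega>) \<partial>M :: real)"
      unfolding set_lebesgue_integral_def
      by (intro Bochner_Integration.integral_cong refl) (simp add: iE[symmetric] indicator_inter_arith mult_ac)
    also have "\<dots> = (\<integral>\<omega>. (p \<omega> * indicator D \<omega>) * indicator E \<omega> \<partial>M)"
      unfolding key[OF D] by (intro Bochner_Integration.integral_cong refl) (simp add: iE)
    also have "\<dots> = (\<integral>\<omega>. (p \<omega> * indicator D \<omega>) * real_cond_exp M G (indicator E) \<omega> \<partial>M)"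
    proof (rule sG.real_cond_exp_intg(2)[symmetric])
      show "(\<lambda>\<omega>. p \<omega> * indicator D \<omega>) \<in> borel_measurable G" using D by measurable
      show "integrable M (\<lambda>\<omega>. p \<omega> * indicator D \<omega> * indicator E \<omega>)"
        by (rule bounded_integrable) (use p01 in \<open>auto simp: indicator_def\<close>)
    qed measurable
    finally show "(\<integral>\<omega>\<in>D. indicator (A \<inter> E) \<omega> \<partial>M) = (\<integral>\<omega>\<in>D. p \<omega> * real_cond_exp M G (indicator E) \<omega> \<partial>M)"
      by (simp add: set_lebesgue_integral_def mult_ac)
  next
    show "integrable M (indicator (A \<inter> E) :: 'a \<Rightarrow> real)" by (rule iI) simp
    show "integrable M (\<lambda>\<omega>. p \<omega> * real_cond_exp M G (indicator E) \<omega>)"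
      by (rule sG.real_cond_exp_intg(1)[OF bE pG]) measurable
    show "(\<lambda>\<omega>. p \<omega> * real_cond_exp M G (indicator E) \<omega>) \<in> borel_measurable G" by measurable
  qed
  then show ?thesis
    using p unfolding cond_prob_of_def by eventually_elim simp
qed

text \<open>Induction on \<open>k\<close>: the earlier increments form an event of
  \<open>F (t k)\<close>, from which the last increment is conditionally independent. Without
  increments the event is the whole space, of conditional probability 1.\<close>

lemma independent_increments: "cond_indep_increments M G N"
  unfolding cond_indep_increments_def
proof (intro allI impI)
  fix k :: nat and t :: "nat \<Rightarrow> real" and A :: "nat \<Rightarrow> (real^'d) set"
  assume "(\<forall>i\<le>k. t i \<in> {0..1}) \<and> (\<forall>i<k. t i \<le> t (Suc i) \<and> A i \<in> sets borel)"
  then show "AE \<omega> in M. cond_prob_of M G {\<omega> \<in> space M. \<forall>i<k. N (t (Suc i)) \<omega> - N (t i) \<omega> \<in> A i} \<omega> =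
      (\<Prod>i<k. cond_prob_of M G {\<omega> \<in> space M. N (t (Suc i)) \<omega> - N (t i) \<omega> \<in> A i} \<omega>)"
  proof (induction k)
    case 0
    have "AE \<omega> in M. real_cond_exp M G (indicator (space M)) \<omega> = (indicator (space M) \<omega> :: real)"
    proof (rule sG.real_cond_exp_F_meas)
      show "integrable M (indicator (space M) :: 'a \<Rightarrow> real)" by (rule bounded_integrable) (auto simp: indicator_def)
      show "(indicator (space M) :: 'a \<Rightarrow> real) \<in> borel_measurable G"
        using borel_measurable_indicator[OF sets.top[of G]] by simp
    qed
    then show ?case using AE_space unfolding cond_prob_of_def by eventually_elim simp
  next
    case (Suc k)
    let ?E = "\<lambda>i. {\<omega> \<in> space M. N (t (Suc i)) \<omega> - N (t i) \<omega> \<in> A i}"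
    let ?A = "{\<omega> \<in> space M. \<forall>i<k. N (t (Suc i)) \<omega> - N (t i) \<omega> \<in> A i}"
    have tk: "0 \<le> t k" "t k \<le> t (Suc k)" "t (Suc k) \<le> 1" "A k \<in> sets borel" using Suc.prems by auto
    have mono: "t i \<le> t j" if "i \<le> j" "j \<le> k" for i j
      using that by (induction j rule: dec_induct) (use Suc.prems in \<open>auto intro: order_trans\<close>)
    have Ei: "?E i \<in> sets (F (t k))" if "i < k" for i
    proof -
      have "t (Suc i) \<in> {0..1}" "t i \<in> {0..1}" using Suc.prems that by auto
      then have [measurable]: "N (t (Suc i)) \<in> borel_measurable (F (t k))" "N (t i) \<in> borel_measurable (F (t k))"
        using N_F mono[of "Suc i" k] mono[of i k] that by (auto intro!: F_mono[OF N_F])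
      have [measurable]: "A i \<in> sets borel" using Suc.prems that by auto
      have "{\<omega> \<in> space (F (t k)). N (t (Suc i)) \<omega> - N (t i) \<omega> \<in> A i} \<in> sets (F (t k))" by measurable
      then show ?thesis by simp
    qed
    have "?A = space (F (t k)) \<inter> (\<Inter>i\<in>{..<k}. ?E i)" if "k > 0"
      using that by auto
    moreover have "space (F (t k)) \<inter> (\<Inter>i\<in>{..<k}. ?E i) \<in> sets (F (t k))" if "k > 0"
      using that Ei by (intro sets.Int sets.top sets.finite_INT) auto
    moreover have "?A \<in> sets (F (t k))" if "k = 0" using that sets.top[of "F (t k)"] by simp
    ultimately have AF: "?A \<in> sets (F (t k))" by (cases "k = 0") auto
    have split: "{\<omega> \<in> space M. \<forall>i<Suc k. N (t (Suc i)) \<omega> - N (t i) \<omega> \<in> A i} = ?A \<inter> ?E k"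
      by (auto simp: less_Suc_eq)
    have "AE \<omega> in M. cond_prob_of M G ?A \<omega> = (\<Prod>i<k. cond_prob_of M G (?E i) \<omega>)"
      using Suc.prems by (intro Suc.IH) auto
    then show ?case
      unfolding split using increment_conditionally_independent[OF tk(1-3) AF tk(4)]
      by eventually_elim simp
  qed
qed

lemma N_zero: "AE \<omega> in M. N 0 \<omega> = 0"
proof -
  have "AE \<omega> in M. N 0 \<omega> $ i = 0" for i
    using ito_zero[of _ "\<lambda>t \<omega>. N t \<omega> $ i"] N by (auto simp: ito_integral_matrix_def)
  then have "AE \<omega> in M. \<forall>i. N 0 \<omega> $ i = 0" by (simp add: AE_all_countable)
  then show ?thesis by eventually_elim (simp add: vec_eq_iff)
qed

lemma N_component_integrable:
  assumes t: "t \<in> {0..1}"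
  shows "integrable M (\<lambda>\<omega>. N t \<omega> $ i)"
proof (rule integrable_cong_AE_imp)
  show "integrable M (\<lambda>\<omega>. axis i 1 \<bullet> (N t \<omega> - N 0 \<omega>))" using t by (intro increment_integrable) auto
  show "AE \<omega> in M. axis i 1 \<bullet> (N t \<omega> - N 0 \<omega>) = N t \<omega> $ i"
    using N_zero by eventually_elim (simp add: inner_axis')
  have "(\<lambda>\<omega>. N t \<omega> \<bullet> axis i 1) \<in> borel_measurable M" using N_M[OF t] by measurable
  then show "(\<lambda>\<omega>. N t \<omega> $ i) \<in> borel_measurable M" by (simp add: inner_axis)
qed

lemma martingale: "cond_martingale M G F N"
  unfolding cond_martingale_def
proof (intro conjI ballI allI impI)
  show "N t \<in> borel_measurable (F t)" if "t \<in> {0..1}" for t by (rule N_F[OF that])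
  show "AE \<omega> in M. nn_cond_exp M G (\<lambda>\<omega>. ennreal (norm (N t \<omega>))) \<omega> < \<infinity>" if t: "t \<in> {0..1}" for t
  proof -
    have Nm [measurable]: "N t \<in> borel_measurable M" by (rule N_M[OF t])
    have "integrable M (\<lambda>\<omega>. \<Sum>i\<in>UNIV. \<bar>N t \<omega> $ i\<bar>)"
      by (intro Bochner_Integration.integrable_sum integrable_abs N_component_integrable t)
    then have "integrable M (\<lambda>\<omega>. norm (N t \<omega>))"
      by (rule Bochner_Integration.integrable_bound) (auto intro!: AE_I2 order_trans[OF norm_le_l1_cart] simp: sum_nonneg)
    then have "(\<integral>\<^sup>+\<omega>. ennreal (norm (N t \<omega>)) \<partial>M) < \<infinity>"
      by (simp add: nn_integral_eq_integral)
    moreover have "(\<integral>\<^sup>+\<omega>. nn_cond_exp M G (\<lambda>\<omega>. ennreal (norm (N t \<omega>))) \<omega> \<partial>M) = (\<integral>\<^sup>+\<omega>. ennreal (norm (N t \<omega>)) \<partial>M)"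
      using sG.nn_cond_exp_intg[of "\<lambda>_. 1" "\<lambda>\<omega>. ennreal (norm (N t \<omega>))"] by simp
    ultimately have "AE \<omega> in M. nn_cond_exp M G (\<lambda>\<omega>. ennreal (norm (N t \<omega>))) \<omega> \<noteq> \<infinity>"
      by (intro nn_integral_PInf_AE) auto
    then show ?thesis by eventually_elim (simp add: less_top)
  qed
  fix s t :: real and A and i
  assume st: "0 \<le> s \<and> s \<le> t \<and> t \<le> 1 \<and> A \<in> sets (F s)"
  then have A: "A \<in> sets (F s)" and ab: "0 \<le> s" "s \<le> t" "t \<le> 1" by auto
  have [measurable]: "A \<in> events" using A sets_F_subset by auto
  have Ni: "integrable M (\<lambda>\<omega>. indicator A \<omega> * N r \<omega> $ i)" if "r \<in> {0..1}" for r
    by (rule integrable_mult_bounded(2)[OF N_component_integrable[OF that], where K=1]) (auto simp: indicator_def)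
  have It: "integrable M (\<lambda>\<omega>. indicator A \<omega> * N t \<omega> $ i)" and Is: "integrable M (\<lambda>\<omega>. indicator A \<omega> * N s \<omega> $ i)"
    using ab by (auto intro!: Ni)
  show "AE \<omega> in M. real_cond_exp M G (\<lambda>\<omega>. indicator A \<omega> * N t \<omega> $ i) \<omega> = real_cond_exp M G (\<lambda>\<omega>. indicator A \<omega> * N s \<omega> $ i) \<omega>"
  proof (rule sG.real_cond_exp_charact[OF _ It])
    fix D assume D: "D \<in> sets G"
    then have [measurable]: "D \<in> events" using sets_G_M by auto
    have iD: "integrable M (\<lambda>\<omega>. indicator D \<omega> * (indicator A \<omega> * N t \<omega> $ i))" "integrable M (\<lambda>\<omega>. indicator D \<omega> * (indicator A \<omega> * N s \<omega> $ i))"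
      by (rule integrable_mult_bounded(2)[OF It, where K=1] integrable_mult_bounded(2)[OF Is, where K=1]; auto simp: indicator_def)+
    \<comment> \<open>Tested on \<open>D\<close>, the martingale property says that the increment
      has mean zero on the intersection of \<open>A\<close> and \<open>D\<close>.\<close>
    have "(\<integral>\<omega>. indicator A \<omega> * indicator D \<omega> * (axis i 1 \<bullet> (N t \<omega> - N s \<omega>)) \<partial>M) = 0"
      by (rule increment_mean_zero[OF ab A D])
    also have "(\<lambda>\<omega>. indicator A \<omega> * indicator D \<omega> * (axis i 1 \<bullet> (N t \<omega> - N s \<omega>))) =
        (\<lambda>\<omega>. indicator D \<omega> * (indicator A \<omega> * N t \<omega> $ i) - indicator D \<omega> * (indicator A \<omega> * N s \<omega> $ i))"
      by (simp add: fun_eq_iff inner_axis' algebra_simps)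
    finally have "(\<integral>\<omega>. indicator D \<omega> * (indicator A \<omega> * N t \<omega> $ i) \<partial>M) = (\<integral>\<omega>. indicator D \<omega> * (indicator A \<omega> * N s \<omega> $ i) \<partial>M)"
      using iD by simp
    then have "(\<integral>\<omega>\<in>D. indicator A \<omega> * N t \<omega> $ i \<partial>M) = (\<integral>\<omega>\<in>D. indicator A \<omega> * N s \<omega> $ i \<partial>M)"
      by (simp add: set_lebesgue_integral_def)
    also have "\<dots> = (\<integral>\<omega>\<in>D. real_cond_exp M G (\<lambda>\<omega>. indicator A \<omega> * N s \<omega> $ i) \<omega> \<partial>M)"
      by (rule sG.real_cond_exp_intA[OF Is D])
    finally show "(\<integral>\<omega>\<in>D. indicator A \<omega> * N t \<omega> $ i \<partial>M) = (\<integral>\<omega>\<in>D. real_cond_exp M G (\<lambda>\<omega>. indicator A \<omega> * N s \<omega> $ i) \<omega> \<partial>M)" .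
  qed (use sG.real_cond_exp_int(1)[OF Is] in auto)
qed

end

section \<open>Augmentation of the filtration\<close>

text \<open>The last fact, by induction over the generated \<sigma>-algebra, makes every augmented
  event almost surely equal to an original one; this carries independence over to the augmented
  filtration.\<close>

lemma augmented_facts:
  assumes "filtration_of M F"
  shows "space (augmented M F t) = space M" "sets (F t) \<subseteq> sets (augmented M F t)"
    "null_sets M \<subseteq> sets (augmented M F t)" "filtration_of M (augmented M F)"
    and "A \<in> sets (augmented M F t) \<Longrightarrow> \<exists>A0\<in>sets (F t). AE \<omega> in M. \<omega> \<in> A \<longleftrightarrow> \<omega> \<in> A0"
proof -
  have F: "space (F t) = space M" "sets (F t) \<subseteq> sets M" "s \<le> t \<Longrightarrow> sets (F s) \<subseteq> sets (F t)" for s t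
    using assms by (auto simp: filtration_of_def filtration_def)
  have Pow: "sets (F t) \<union> null_sets M \<subseteq> Pow (space M)" for t
    using F(2)[of t] sets.sets_into_space by auto
  have sets: "sets (augmented M F t) = sigma_sets (space M) (sets (F t) \<union> null_sets M)" for t
    unfolding augmented_def using Pow by (rule sets_measure_of)
  show sp: "space (augmented M F t) = space M" for t
    unfolding augmented_def using Pow by (rule space_measure_of)
  show "sets (F t) \<subseteq> sets (augmented M F t)" "null_sets M \<subseteq> sets (augmented M F t)"
    unfolding sets by auto
  show "filtration_of M (augmented M F)"
    unfolding filtration_of_def filtration_def
  proof (intro conjI allI impI)
    show "space (augmented M F i) = space M" for i by (rule sp)
    show "sets (augmented M F i) \<subseteq> sets (augmented M F j)" if "i \<le> j" for i j
      unfolding sets by (rule sigma_sets_mono') (use F(3)[OF that] in auto)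
    show "sets (augmented M F i) \<subseteq> sets M" for i
      unfolding sets using F(2)[of i] by (intro sets.sigma_sets_subset) auto
  qed
  show "\<exists>A0\<in>sets (F t). AE \<omega> in M. \<omega> \<in> A \<longleftrightarrow> \<omega> \<in> A0" if "A \<in> sets (augmented M F t)"
    using that unfolding sets
  proof (induction rule: sigma_sets.induct)
    case (Basic a)
    then show ?case
    proof
      assume "a \<in> null_sets M"
      then have "AE \<omega> in M. \<omega> \<in> a \<longleftrightarrow> \<omega> \<in> {}" using AE_not_in by fastforce
      then show ?thesis by blast
    qed auto
  next
    case Empty
    then show ?case by (intro bexI[of _ "{}"]) auto
  next
    case (Compl a)
    then obtain A0 where A0: "A0 \<in> sets (F t)" "AE \<omega> in M. \<omega> \<in> a \<longleftrightarrow> \<omega> \<in> A0" by blast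
    have "AE \<omega> in M. \<omega> \<in> space M - a \<longleftrightarrow> \<omega> \<in> space M - A0" using A0(2) by eventually_elim simp
    moreover have "space M - A0 \<in> sets (F t)" using sets.compl_sets[OF A0(1)] F(1) by simp
    ultimately show ?case by blast
  next
    case (Union a)
    then obtain A0 where A0: "\<And>i::nat. A0 i \<in> sets (F t)" "\<And>i. AE \<omega> in M. \<omega> \<in> a i \<longleftrightarrow> \<omega> \<in> A0 i" by metis
    have "AE \<omega> in M. \<forall>i. \<omega> \<in> a i \<longleftrightarrow> \<omega> \<in> A0 i" using A0(2) by (simp add: AE_all_countable)
    then have "AE \<omega> in M. \<omega> \<in> (\<Union>i. a i) \<longleftrightarrow> \<omega> \<in> (\<Union>i. A0 i)" by eventually_elim simp
    moreover have "(\<Union>i. A0 i) \<in> sets (F t)" using A0(1) by auto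
    ultimately show ?case by blast
  qed
qed

lemma augmented_measurable:
  assumes "filtration_of M F" "f \<in> borel_measurable (F t)"
  shows "f \<in> borel_measurable (augmented M F t)"
proof -
  have "space (F t) = space M" using assms(1) by (auto simp: filtration_of_def filtration_def)
  then show ?thesis
    using assms(2) augmented_facts(1,2)[OF assms(1), of t] by (auto simp: measurable_def)
qed

lemma augmented_brownian_motion:
  assumes bm: "brownian_motion M F B"
  shows "brownian_motion M (augmented M F) B"
proof -
  have f: "filtration_of M F" and ps: "prob_space M" using bm by (auto simp: brownian_motion_def)
  interpret prob_space M by (rule ps)
  note aug = augmented_facts[OF f]
  have sub: "sets (augmented M F t) \<subseteq> events" for t using aug(4) by (auto simp: filtration_of_def)
  show ?thesis
    unfolding brownian_motion_def
  proof (intro conjI allI impI ballI ps aug(4))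
    show "B t \<in> borel_measurable (augmented M F t)" if "t \<in> {0..1}" for t
      using bm that by (intro augmented_measurable[OF f]) (auto simp: brownian_motion_def)
    fix s t :: real assume st: "0 \<le> s \<and> s < t \<and> t \<le> 1"
    let ?E = "{(\<lambda>\<omega>. B t \<omega> - B s \<omega>) -` A \<inter> space M | A. A \<in> sets borel}"
    have ind: "indep_set (sets (F s)) ?E" using bm st unfolding brownian_motion_def by blast
    have Es: "?E \<subseteq> events" using ind by (rule indep_setD_ev2)
    show "indep_set (sets (augmented M F s)) ?E"
    proof (rule indep_setI[OF sub Es])
      fix A E assume A: "A \<in> sets (augmented M F s)" and E: "E \<in> ?E"
      obtain A0 where A0: "A0 \<in> sets (F s)" "AE \<omega> in M. \<omega> \<in> A \<longleftrightarrow> \<omega> \<in> A0" using aug(5)[OF A] by blast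
      have m: "A \<in> events" "A0 \<in> events" "E \<in> events" using A sub A0(1) aug(2)[of s] E Es by blast+
      have "prob (A \<inter> E) = prob (A0 \<inter> E)"
        by (rule measure_eq_AE) (use A0(2) m in \<open>auto elim!: eventually_mono\<close>)
      also have "\<dots> = prob A0 * prob E" by (rule indep_setD[OF ind A0(1) E])
      also have "prob A0 = prob A"
        by (rule measure_eq_AE) (use A0(2) m in \<open>auto elim!: eventually_mono\<close>)
      finally show "prob (A \<inter> E) = prob A * prob E" .
    qed
    show "distr M borel (\<lambda>\<omega>. B t \<omega> - B s \<omega>) = density lborel (\<lambda>y. ennreal (\<Prod>i\<in>UNIV. normal_density 0 (sqrt (t - s)) (y $ i)))"
      using bm st unfolding brownian_motion_def by blast
  qed (use bm in \<open>auto simp: brownian_motion_def\<close>)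
qed

text \<open>Simple processes remain simple for a larger filtration, so the same approximating
  sequence serves.\<close>

lemma augmented_ito:
  assumes f: "filtration_of M F" and ito: "ito_integral M F B H Z"
  shows "ito_integral M (augmented M F) B H Z"
proof -
  have "simple_process M (augmented M F) k \<tau> \<xi>" if "simple_process M F k \<tau> \<xi>" for k \<tau> and \<xi> :: "nat \<Rightarrow> 'a \<Rightarrow> real^'b"
    using that augmented_measurable[OF f] by (auto simp: simple_process_def)
  then show ?thesis using ito unfolding ito_integral_def by meson
qed

lemma augmented_sde:
  assumes "sde_solution M F B X x b \<sigma>"
  shows "sde_solution M (augmented M F) B X x b \<sigma>"
proof -
  have f: "filtration_of M F" using assms by (auto simp: sde_solution_def brownian_motion_def)
  obtain Z where Z: "ito_integral_matrix M F B (\<lambda>s \<omega>. \<sigma> s (path_of X \<omega>)) Z"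
    "\<forall>t\<in>{0..1}. AE \<omega> in M. X t \<omega> = x + (LINT s:{0..t}|lborel. b s (path_of X \<omega>)) + Z t \<omega>"
    using assms unfolding sde_solution_def by blast
  have "ito_integral_matrix M (augmented M F) B (\<lambda>s \<omega>. \<sigma> s (path_of X \<omega>)) Z"
    using Z(1) augmented_ito[OF f] by (auto simp: ito_integral_matrix_def)
  then show ?thesis
    using assms Z(2) augmented_brownian_motion augmented_measurable[OF f] unfolding sde_solution_def by blast
qed

theorem theorem16:
  fixes M :: "'a measure" and F :: "real \<Rightarrow> 'a measure"
    and B :: "real \<Rightarrow> 'a \<Rightarrow> real^'d" and X :: "real \<Rightarrow> 'a \<Rightarrow> real^'n" and x :: "real^'n"
    and b :: "real \<Rightarrow> (real \<Rightarrow> real^'n) \<Rightarrow> real^'n"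
    and \<sigma> :: "real \<Rightarrow> (real \<Rightarrow> real^'n) \<Rightarrow> real^'d^'n"
    and P :: "real \<Rightarrow> (real \<Rightarrow> real^'n) \<Rightarrow> real^'d^'d"
  assumes "sde_coefficients b \<sigma>"
    and "sde_solution M F B X x b \<sigma>"
    and "weak_uniqueness TYPE('a) x b \<sigma>"
    and "projection_version M X \<sigma> P"
  shows
    "(\<forall>u' I.
        L2_adapted M F u' \<and>
        ito_integral M F B (\<lambda>s \<omega>. coprojection P X s \<omega> *v u' s \<omega>) I \<and>
        (LINT \<omega>|M. exp (I 1 \<omega> - cm_norm_sq (\<lambda>s. coprojection P X s \<omega> *v u' s \<omega>) / 2)) = 1 \<longrightarrow>
        (AE \<omega> in M.
           real_cond_exp M (natural_filtration M X 1)
             (\<lambda>\<omega>. exp (I 1 \<omega> - cm_norm_sq (\<lambda>s. coprojection P X s \<omega> *v u' s \<omega>) / 2)) \<omega> = 1) \<and>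
        (cm_measurable M (natural_filtration M X 1) u' \<longrightarrow>
           (AE \<omega> in M.
              nn_cond_exp M (natural_filtration M X 1) (\<lambda>\<omega>. ennreal (exp (I 1 \<omega>))) \<omega> =
              ennreal (exp (cm_norm_sq (\<lambda>s. coprojection P X s \<omega> *v u' s \<omega>) / 2))) \<and>
           cond_gaussian M (natural_filtration M X 1) (I 1)
             (\<lambda>\<omega>. 0) (\<lambda>\<omega>. cm_norm_sq (\<lambda>s. coprojection P X s \<omega> *v u' s \<omega>)))) \<and>
     (\<forall>N. ito_integral_matrix M F B (coprojection P X) N \<longrightarrow>
        cond_indep_increments M (natural_filtration M X 1) N \<and>
        cond_gaussian_process M (natural_filtration M X 1) N \<and>
        cond_martingale M (natural_filtration M X 1) (augmented M F) N)"
proof -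
  have bm: "brownian_motion M F B" using assms(2) by (simp add: sde_solution_def)
  then have f: "filtration_of M F" and ps: "prob_space M" by (auto simp: brownian_motion_def)
  interpret prob_space M by (rule ps)
  \<comment> \<open>Augmentation changes only the filtration: \<open>weak_uniqueness\<close>
    quantifies over all filtrations, and the conditioning on \<open>X\<close> still refers to
    \<open>natural_filtration M X 1\<close>.\<close>
  have proj_sol: "projected_solution M (augmented M F) B X x b \<sigma> P"
    by unfold_locales
       (use augmented_brownian_motion[OF bm] augmented_facts(3)[OF f] augmented_sde[OF assms(2)] assms(3,4) in auto)
  then interpret projected_solution M "augmented M F" B X x b \<sigma> P .
  show ?thesis
  proof (intro conjI allI impI; (elim conjE)?)
    fix u' :: "real \<Rightarrow> 'a \<Rightarrow> real^'d" and I
    assume u: "L2_adapted M F u'" and I: "ito_integral M F B (\<lambda>s \<omega>. coprojection P X s \<omega> *v u' s \<omega>) I"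
      and E: "(LINT \<omega>|M. exp (I 1 \<omega> - cm_norm_sq (\<lambda>s. coprojection P X s \<omega> *v u' s \<omega>) / 2)) = 1"
    have u': "L2_adapted M (augmented M F) u'" using u augmented_measurable[OF f] by (auto simp: L2_adapted_def)
    note I' = augmented_ito[OF f I]
    have E': "expectation (dexp (I 1) (\<lambda>s \<omega>. coprojection P X s \<omega> *v u' s \<omega>)) = 1" using E unfolding dexp_def[abs_def] .
    show "AE \<omega> in M. real_cond_exp M (natural_filtration M X 1)
        (\<lambda>\<omega>. exp (I 1 \<omega> - cm_norm_sq (\<lambda>s. coprojection P X s \<omega> *v u' s \<omega>) / 2)) \<omega> = 1"
      using cond_exp_dexp(1)[OF I' E'] unfolding dexp_def[abs_def] .
    assume cm: "cm_measurable M (natural_filtration M X 1) u'"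
    show "AE \<omega> in M. nn_cond_exp M (natural_filtration M X 1) (\<lambda>\<omega>. ennreal (exp (I 1 \<omega>))) \<omega> =
        ennreal (exp (cm_norm_sq (\<lambda>s. coprojection P X s \<omega> *v u' s \<omega>) / 2))"
      "cond_gaussian M (natural_filtration M X 1) (I 1) (\<lambda>\<omega>. 0) (\<lambda>\<omega>. cm_norm_sq (\<lambda>s. coprojection P X s \<omega> *v u' s \<omega>))"
      by (rule conditional_exponential[OF u' I' E' cm])+
  next
    fix N assume N: "ito_integral_matrix M F B (coprojection P X) N"
    then have "ito_integral_matrix M (augmented M F) B (coprojection P X) N"
      unfolding ito_integral_matrix_def by (intro allI augmented_ito[OF f]) blast
    then have "noise M (augmented M F) B X x b \<sigma> P N"
      by (intro noise.intro noise_axioms.intro proj_sol)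
    then interpret N: noise M "augmented M F" B X x b \<sigma> P N .
    show "cond_indep_increments M (natural_filtration M X 1) N" by (rule N.independent_increments)
    show "cond_gaussian_process M (natural_filtration M X 1) N" by (rule N.gaussian_process)
    show "cond_martingale M (natural_filtration M X 1) (augmented M F) N" by (rule N.martingale)
  qed
qed

end
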